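(* Let $F:(M^m,g)\to(B^n,g')$ be a Clairaut conformal submersion between Riemannian manifolds with integrable horizontal distribution, dilation $\lambda$ and $r=e^f$. Then every point of $M$ has a neighbourhood $W$ on which $g$ is a warped product metric.
   Context: All manifolds, maps and functions are smooth; $\dim M=m$, $\dim B=n$. For a submersion $F:(M,g)\to(B,g')$, the vertical distribution is $\ker F_\ast$ and the horizontal distribution is its $g$-orthogonal complement. $F$ is a conformal submersion with dilation $\lambda:M\to\mathbb{R}^+$ if $g'(F_\ast X,F_\ast Y)=\lambda^2 g(X,Y)$ for all horizontal $X,Y$. A conformal submersion $F$ is a Clairaut conformal submersion with function $r:M\to\mathbb{R}^+$ if for every geodesic $\alpha$ on $(M,g)$ the function $t\mapsto r(\alpha(t))\sin\omega(t)$ is constant, where $\omega(t)\in[0,\pi/2]$ is the angle between $\dot\alpha(t)$ and the horizontal space at $\alpha(t)$. Writing $r=e^f$ means that $f:M\to\mathbb{R}$ is the function $\log r$. A warped product metric is a metric of the form $\mathrm{pr}_1^\ast g_1+(\phi\circ \mathrm{pr}_1)^2\,\mathrm{pr}_2^\ast g_2$ on a product $M_1\times M_2$ of Riemannian manifolds $(M_1,g_1)$ and $(M_2,g_2)$, where $\mathrm{pr}_1,\mathrm{pr}_2$ are the projections and $\phi:M_1\to\mathbb{R}^+$ is a function. *)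

theory Defs
  imports "HOL-Analysis.Analysis"
begin

section \<open>Calculus on a linear subspace of a Euclidean space\<close>

text \<open>
  The model space of a \<open>k\<close>-dimensional manifold is a \<open>k\<close>-dimensional linear subspace \<open>E\<close> of
  a Euclidean space. Thus every dimension \<open>k\<close>, including 0, is available without changing
  types. Maps on relatively open subsets of \<open>E\<close> are differentiated within \<open>E\<close>; their
  derivative is determined on vectors of \<open>E\<close> and is only ever applied to such vectors.
\<close>

definition deriv_in ::
    "'e::euclidean_space set \<Rightarrow> ('e \<Rightarrow> 'g::real_normed_vector) \<Rightarrow> 'e \<Rightarrow> 'e \<Rightarrow> 'g" where
  "deriv_in E f x = frechet_derivative f (at x within E)"

primrec C_k_on ::
    "nat \<Rightarrow> 'e::euclidean_space set \<Rightarrow> 'e set \<Rightarrow> ('e \<Rightarrow> 'g::real_normed_vector) \<Rightarrow> bool" where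
  "C_k_on 0 E U f \<longleftrightarrow> continuous_on U f"
| "C_k_on (Suc k) E U f \<longleftrightarrow>
     (\<forall>x\<in>U. f differentiable (at x within E)) \<and> (\<forall>v\<in>E. C_k_on k E U (\<lambda>x. deriv_in E f x v))"

definition smooth_on ::
    "'e::euclidean_space set \<Rightarrow> 'e set \<Rightarrow> ('e \<Rightarrow> 'g::real_normed_vector) \<Rightarrow> bool" where
  "smooth_on E U f \<longleftrightarrow> (\<forall>k. C_k_on k E U f)"

section \<open>Smooth manifolds\<close>

text \<open>A chart is its domain together with its coordinate map, which is relevant on the domain only.\<close>

type_synonym ('a, 'e) chart = "'a set \<times> ('a \<Rightarrow> 'e)"

record ('a, 'e) manifold =
  mtop :: "'a topology"
  model :: "'e set"
  atlas :: "('a, 'e) chart set"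

abbreviation points :: "('a, 'e) manifold \<Rightarrow> 'a set" where
  "points M \<equiv> topspace (mtop M)"

definition manifold_dim :: "('a, 'e::euclidean_space) manifold \<Rightarrow> nat" where
  "manifold_dim M = dim (model M)"

definition param :: "('a, 'e) chart \<Rightarrow> 'e \<Rightarrow> 'a" where
  "param c = inv_into (fst c) (snd c)"

text \<open>The atlas need not be maximal.\<close>

definition smooth_manifold :: "('a, 'e::euclidean_space) manifold \<Rightarrow> bool" where
  "smooth_manifold M \<longleftrightarrow>
     Hausdorff_space (mtop M) \<and> second_countable (mtop M) \<and> subspace (model M) \<and>
     (\<Union>c\<in>atlas M. fst c) = points M \<and>
     (\<forall>c\<in>atlas M.
        openin (mtop M) (fst c) \<and>
        openin (top_of_set (model M)) (snd c ` fst c) \<and>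
        homeomorphic_map (subtopology (mtop M) (fst c)) (top_of_set (snd c ` fst c)) (snd c)) \<and>
     (\<forall>c\<in>atlas M. \<forall>d\<in>atlas M.
        smooth_on (model M) (snd c ` (fst c \<inter> fst d)) (snd d \<circ> param c))"

definition smooth_fun :: "('a, 'e::euclidean_space) manifold \<Rightarrow> ('a \<Rightarrow> real) \<Rightarrow> bool" where
  "smooth_fun M h \<longleftrightarrow> (\<forall>c\<in>atlas M. smooth_on (model M) (snd c ` fst c) (h \<circ> param c))"

definition smooth_map ::
    "('a, 'e::euclidean_space) manifold \<Rightarrow> ('b, 'f::euclidean_space) manifold \<Rightarrow> ('a \<Rightarrow> 'b) \<Rightarrow> bool" where
  "smooth_map M N F \<longleftrightarrow>
     continuous_map (mtop M) (mtop N) F \<and>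
     (\<forall>c\<in>atlas M. \<forall>d\<in>atlas N.
        smooth_on (model M) (snd c ` (fst c \<inter> F -` fst d)) (snd d \<circ> F \<circ> param c))"

definition diffeomorphism ::
    "('a, 'e::euclidean_space) manifold \<Rightarrow> ('b, 'f::euclidean_space) manifold \<Rightarrow> ('a \<Rightarrow> 'b) \<Rightarrow> bool" where
  "diffeomorphism M N F \<longleftrightarrow>
     smooth_map M N F \<and>
     (\<exists>G. smooth_map N M G \<and> (\<forall>p\<in>points M. G (F p) = p) \<and> (\<forall>q\<in>points N. F (G q) = q))"

definition open_submanifold ::
    "('a, 'e) manifold \<Rightarrow> 'a set \<Rightarrow> ('a, 'e) manifold" where
  "open_submanifold M W =
     \<lparr>mtop = subtopology (mtop M) W, model = model M, atlas = (\<lambda>(U, x). (U \<inter> W, x)) ` atlas M\<rparr>"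

definition product_manifold ::
    "('a, 'e) manifold \<Rightarrow> ('b, 'f) manifold \<Rightarrow> ('a \<times> 'b, 'e \<times> 'f) manifold" where
  "product_manifold M N =
     \<lparr>mtop = prod_topology (mtop M) (mtop N), model = model M \<times> model N,
      atlas = {(U \<times> V, map_prod x y) | U x V y. (U, x) \<in> atlas M \<and> (V, y) \<in> atlas N}\<rparr>"

section \<open>Tangent vectors and differentials\<close>

text \<open>
  A tangent vector at \<open>p\<close> assigns to every chart around \<open>p\<close> its coordinate vector in that
  chart, subject to the transformation law of contravariant vectors; charts not around \<open>p\<close>
  get the value 0.
\<close>

type_synonym ('a, 'e) tvec = "('a, 'e) chart \<Rightarrow> 'e"

definition charts_at :: "('a, 'e) manifold \<Rightarrow> 'a \<Rightarrow> ('a, 'e) chart set" where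
  "charts_at M p = {c \<in> atlas M. p \<in> fst c}"

definition tangent_space :: "('a, 'e::euclidean_space) manifold \<Rightarrow> 'a \<Rightarrow> ('a, 'e) tvec set" where
  "tangent_space M p =
     {v. (\<forall>c. c \<notin> charts_at M p \<longrightarrow> v c = 0) \<and>
         (\<forall>c\<in>charts_at M p. v c \<in> model M) \<and>
         (\<forall>c\<in>charts_at M p. \<forall>d\<in>charts_at M p.
            v d = deriv_in (model M) (snd d \<circ> param c) (snd c p) (v c))}"

text \<open>The tangent vector at \<open>p\<close> with coordinate vector \<open>u\<close> in the chart \<open>c\<close>.\<close>

definition coord_vec ::
    "('a, 'e::euclidean_space) manifold \<Rightarrow> ('a, 'e) chart \<Rightarrow> 'a \<Rightarrow> 'e \<Rightarrow> ('a, 'e) tvec" where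
  "coord_vec M c p u =
     (\<lambda>d. if d \<in> charts_at M p then deriv_in (model M) (snd d \<circ> param c) (snd c p) u else 0)"

text \<open>By the chain rule the differential does not depend on the chart \<open>c\<close> chosen around \<open>p\<close>.\<close>

definition differential ::
    "('a, 'e::euclidean_space) manifold \<Rightarrow> ('b, 'f::euclidean_space) manifold \<Rightarrow> ('a \<Rightarrow> 'b) \<Rightarrow>
     'a \<Rightarrow> ('a, 'e) tvec \<Rightarrow> ('b, 'f) tvec" where
  "differential M N F p v =
     (\<lambda>d. if d \<in> charts_at N (F p)
          then let c = SOME c. c \<in> charts_at M p
               in deriv_in (model M) (snd d \<circ> F \<circ> param c) (snd c p) (v c)
          else 0)"

definition submersion ::
    "('a, 'e::euclidean_space) manifold \<Rightarrow> ('b, 'f::euclidean_space) manifold \<Rightarrow> ('a \<Rightarrow> 'b) \<Rightarrow> bool" where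
  "submersion M N F \<longleftrightarrow>
     smooth_map M N F \<and>
     (\<forall>p\<in>points M. differential M N F p ` tangent_space M p = tangent_space N (F p))"

definition immersion ::
    "('a, 'e::euclidean_space) manifold \<Rightarrow> ('b, 'f::euclidean_space) manifold \<Rightarrow> ('a \<Rightarrow> 'b) \<Rightarrow> bool" where
  "immersion M N F \<longleftrightarrow>
     smooth_map M N F \<and> (\<forall>p\<in>points M. inj_on (differential M N F p) (tangent_space M p))"

text \<open>
  A distribution is integrable if through every point there passes an integral manifold: an
  immersed submanifold whose tangent spaces are the spaces of the distribution. An immersed
  submanifold is a set of points with its own topology and smooth structure for which the
  inclusion is an immersion; its dimension cannot exceed that of the ambient manifold, so it
  can be modelled on a subspace of the same Euclidean space.
\<close>

definition integral_manifold ::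
    "('a, 'e::euclidean_space) manifold \<Rightarrow> ('a \<Rightarrow> ('a, 'e) tvec set) \<Rightarrow> ('a, 'e) manifold \<Rightarrow> bool" where
  "integral_manifold M D L \<longleftrightarrow>
     smooth_manifold L \<and> points L \<subseteq> points M \<and> immersion L M (\<lambda>q. q) \<and>
     (\<forall>q\<in>points L. differential L M (\<lambda>q. q) q ` tangent_space L q = D q)"

definition integrable_distribution ::
    "('a, 'e::euclidean_space) manifold \<Rightarrow> ('a \<Rightarrow> ('a, 'e) tvec set) \<Rightarrow> bool" where
  "integrable_distribution M D \<longleftrightarrow> (\<forall>p\<in>points M. \<exists>L. integral_manifold M D L \<and> p \<in> points L)"

section \<open>Riemannian metrics\<close>

type_synonym ('a, 'e) metric_field = "'a \<Rightarrow> ('a, 'e) tvec \<Rightarrow> ('a, 'e) tvec \<Rightarrow> real"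

text \<open>
  The components of the metric in the chart \<open>c\<close> at the coordinate point \<open>x\<close>, as a bilinear form
  on the model space.
\<close>

definition metric_coord ::
    "('a, 'e::euclidean_space) manifold \<Rightarrow> ('a, 'e) metric_field \<Rightarrow> ('a, 'e) chart \<Rightarrow>
     'e \<Rightarrow> 'e \<Rightarrow> 'e \<Rightarrow> real" where
  "metric_coord M g c x u w =
     g (param c x) (coord_vec M c (param c x) u) (coord_vec M c (param c x) w)"

definition riemannian_manifold ::
    "('a, 'e::euclidean_space) manifold \<Rightarrow> ('a, 'e) metric_field \<Rightarrow> bool" where
  "riemannian_manifold M g \<longleftrightarrow>
     smooth_manifold M \<and>
     (\<forall>p\<in>points M.
        (\<forall>u\<in>tangent_space M p. \<forall>v\<in>tangent_space M p. \<forall>w\<in>tangent_space M p. \<forall>a b.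
           g p (\<lambda>c. a *\<^sub>R u c + b *\<^sub>R v c) w = a * g p u w + b * g p v w) \<and>
        (\<forall>u\<in>tangent_space M p. \<forall>v\<in>tangent_space M p. g p u v = g p v u) \<and>
        (\<forall>v\<in>tangent_space M p. v \<noteq> (\<lambda>_. 0) \<longrightarrow> g p v v > 0)) \<and>
     (\<forall>c\<in>atlas M. \<forall>u\<in>model M. \<forall>w\<in>model M.
        smooth_on (model M) (snd c ` fst c) (\<lambda>x. metric_coord M g c x u w))"

definition pullback_metric ::
    "('a, 'e::euclidean_space) manifold \<Rightarrow> ('b, 'f::euclidean_space) manifold \<Rightarrow> ('a \<Rightarrow> 'b) \<Rightarrow>
     ('b, 'f) metric_field \<Rightarrow> ('a, 'e) metric_field" where
  "pullback_metric M N F h p v w =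
     h (F p) (differential M N F p v) (differential M N F p w)"

section \<open>Geodesics\<close>

text \<open>
  \<open>christoffel M g c x u v\<close> is the vector with components \<open>\<Gamma>\<^sup>k\<^sub>i\<^sub>j u\<^sup>i v\<^sup>j\<close> at
  the coordinate point \<open>x\<close> of the chart \<open>c\<close>, that is, the Levi-Civita derivative in direction \<open>u\<close>
  of the field with constant coordinates \<open>v\<close>. It is given by the usual formula
  \<open>g\<^sub>k\<^sub>l \<Gamma>\<^sup>k\<^sub>i\<^sub>j = (\<partial>\<^sub>i g\<^sub>j\<^sub>l + \<partial>\<^sub>j g\<^sub>i\<^sub>l - \<partial>\<^sub>l g\<^sub>i\<^sub>j) / 2\<close>.
\<close>

definition christoffel ::
    "('a, 'e::euclidean_space) manifold \<Rightarrow> ('a, 'e) metric_field \<Rightarrow> ('a, 'e) chart \<Rightarrow>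
     'e \<Rightarrow> 'e \<Rightarrow> 'e \<Rightarrow> 'e" where
  "christoffel M g c x u v =
     (THE a. a \<in> model M \<and>
        (\<forall>w\<in>model M.
           metric_coord M g c x a w =
             (deriv_in (model M) (\<lambda>y. metric_coord M g c y v w) x u
              + deriv_in (model M) (\<lambda>y. metric_coord M g c y u w) x v
              - deriv_in (model M) (\<lambda>y. metric_coord M g c y u v) x w) / 2))"

definition velocity :: "('a, 'e::euclidean_space) manifold \<Rightarrow> (real \<Rightarrow> 'a) \<Rightarrow> real \<Rightarrow> ('a, 'e) tvec" where
  "velocity M \<alpha> t =
     (\<lambda>c. if c \<in> charts_at M (\<alpha> t) then vector_derivative (snd c \<circ> \<alpha>) (at t) else 0)"

definition geodesic ::
    "('a, 'e::euclidean_space) manifold \<Rightarrow> ('a, 'e) metric_field \<Rightarrow> real set \<Rightarrow> (real \<Rightarrow> 'a) \<Rightarrow> bool" where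
  "geodesic M g I \<alpha> \<longleftrightarrow>
     open I \<and> is_interval I \<and> continuous_map (top_of_set I) (mtop M) \<alpha> \<and>
     (\<forall>c\<in>atlas M.
        smooth_on UNIV {t \<in> I. \<alpha> t \<in> fst c} (snd c \<circ> \<alpha>) \<and>
        (\<forall>t\<in>I. \<alpha> t \<in> fst c \<longrightarrow>
           vector_derivative (\<lambda>s. velocity M \<alpha> s c) (at t)
           + christoffel M g c (snd c (\<alpha> t)) (velocity M \<alpha> t c) (velocity M \<alpha> t c) = 0))"

section \<open>Clairaut conformal submersions\<close>

definition vertical_space ::
    "('a, 'e::euclidean_space) manifold \<Rightarrow> ('b, 'f::euclidean_space) manifold \<Rightarrow> ('a \<Rightarrow> 'b) \<Rightarrow>
     'a \<Rightarrow> ('a, 'e) tvec set" where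
  "vertical_space M B F p = {v \<in> tangent_space M p. differential M B F p v = (\<lambda>_. 0)}"

definition horizontal_space ::
    "('a, 'e::euclidean_space) manifold \<Rightarrow> ('a, 'e) metric_field \<Rightarrow>
     ('b, 'f::euclidean_space) manifold \<Rightarrow> ('a \<Rightarrow> 'b) \<Rightarrow> 'a \<Rightarrow> ('a, 'e) tvec set" where
  "horizontal_space M g B F p =
     {v \<in> tangent_space M p. \<forall>w\<in>vertical_space M B F p. g p v w = 0}"

definition conformal_submersion ::
    "('a, 'e::euclidean_space) manifold \<Rightarrow> ('a, 'e) metric_field \<Rightarrow>
     ('b, 'f::euclidean_space) manifold \<Rightarrow> ('b, 'f) metric_field \<Rightarrow>
     ('a \<Rightarrow> 'b) \<Rightarrow> ('a \<Rightarrow> real) \<Rightarrow> bool" where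
  "conformal_submersion M g B g' F lam \<longleftrightarrow>
     submersion M B F \<and> smooth_fun M lam \<and> (\<forall>p\<in>points M. lam p > 0) \<and>
     (\<forall>p\<in>points M. \<forall>X\<in>horizontal_space M g B F p. \<forall>Y\<in>horizontal_space M g B F p.
        g' (F p) (differential M B F p X) (differential M B F p Y) = (lam p)\<^sup>2 * g p X Y)"

definition horizontal_part ::
    "('a, 'e::euclidean_space) manifold \<Rightarrow> ('a, 'e) metric_field \<Rightarrow>
     ('b, 'f::euclidean_space) manifold \<Rightarrow> ('a \<Rightarrow> 'b) \<Rightarrow> 'a \<Rightarrow> ('a, 'e) tvec \<Rightarrow> ('a, 'e) tvec" where
  "horizontal_part M g B F p v =
     (THE h. h \<in> horizontal_space M g B F p \<and> (\<lambda>c. v c - h c) \<in> vertical_space M B F p)"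

text \<open>
  The angle in \<open>[0, \<pi>/2]\<close> between a nonzero vector and the horizontal space is the angle between
  the vector and its orthogonal projection, with cosine the quotient of their lengths.
\<close>

definition horizontal_angle ::
    "('a, 'e::euclidean_space) manifold \<Rightarrow> ('a, 'e) metric_field \<Rightarrow>
     ('b, 'f::euclidean_space) manifold \<Rightarrow> ('a \<Rightarrow> 'b) \<Rightarrow> 'a \<Rightarrow> ('a, 'e) tvec \<Rightarrow> real" where
  "horizontal_angle M g B F p v =
     (let h = horizontal_part M g B F p v in arccos (sqrt (g p h h) / sqrt (g p v v)))"

text \<open>The angle is undefined along constant geodesics, so these are excluded.\<close>

definition clairaut_conformal_submersion ::
    "('a, 'e::euclidean_space) manifold \<Rightarrow> ('a, 'e) metric_field \<Rightarrow>
     ('b, 'f::euclidean_space) manifold \<Rightarrow> ('b, 'f) metric_field \<Rightarrow>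
     ('a \<Rightarrow> 'b) \<Rightarrow> ('a \<Rightarrow> real) \<Rightarrow> ('a \<Rightarrow> real) \<Rightarrow> bool" where
  "clairaut_conformal_submersion M g B g' F lam r \<longleftrightarrow>
     conformal_submersion M g B g' F lam \<and> smooth_fun M r \<and> (\<forall>p\<in>points M. r p > 0) \<and>
     (\<forall>I \<alpha>. geodesic M g I \<alpha> \<and> (\<forall>t\<in>I. velocity M \<alpha> t \<noteq> (\<lambda>_. 0)) \<longrightarrow>
        (\<exists>C. \<forall>t\<in>I. r (\<alpha> t) * sin (horizontal_angle M g B F (\<alpha> t) (velocity M \<alpha> t)) = C))"

section \<open>Warped products\<close>

definition warped_metric ::
    "('a, 'e::euclidean_space) manifold \<Rightarrow> ('a, 'e) metric_field \<Rightarrow>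
     ('b, 'f::euclidean_space) manifold \<Rightarrow> ('b, 'f) metric_field \<Rightarrow> ('a \<Rightarrow> real) \<Rightarrow>
     ('a \<times> 'b, 'e \<times> 'f) metric_field" where
  "warped_metric M1 g1 M2 g2 \<phi> p v w =
     pullback_metric (product_manifold M1 M2) M1 fst g1 p v w
     + (\<phi> (fst p))\<^sup>2 * pullback_metric (product_manifold M1 M2) M2 snd g2 p v w"

text \<open>
  \<open>is_warped_product M g k l\<close>: \<open>(M, g)\<close> is isometric to a warped product of a \<open>k\<close>-dimensional
  base and an \<open>l\<close>-dimensional fibre. The dimensions are part of the notion because every
  Riemannian manifold is a warped product with a one-point factor. Taking the factors over the
  same types as \<open>M\<close> loses no generality for nonempty \<open>M\<close>, as both factors occur as slices in \<open>M\<close>.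
\<close>

definition is_warped_product ::
    "('a, 'e::euclidean_space) manifold \<Rightarrow> ('a, 'e) metric_field \<Rightarrow> nat \<Rightarrow> nat \<Rightarrow> bool" where
  "is_warped_product M g k l \<longleftrightarrow>
     (\<exists>(M1 :: ('a, 'e) manifold) g1 (M2 :: ('a, 'e) manifold) g2 \<phi> \<Phi>.
        riemannian_manifold M1 g1 \<and> manifold_dim M1 = k \<and>
        riemannian_manifold M2 g2 \<and> manifold_dim M2 = l \<and>
        smooth_fun M1 \<phi> \<and> (\<forall>q\<in>points M1. \<phi> q > 0) \<and>
        diffeomorphism M (product_manifold M1 M2) \<Phi> \<and>
        (\<forall>p\<in>points M. \<forall>v\<in>tangent_space M p. \<forall>w\<in>tangent_space M p.
           g p v w =
             pullback_metric M (product_manifold M1 M2) \<Phi> (warped_metric M1 g1 M2 g2 \<phi>) p v w))"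

definition restrict_metric ::
    "('a, 'e::euclidean_space) manifold \<Rightarrow> ('a, 'e) metric_field \<Rightarrow> 'a set \<Rightarrow> ('a, 'e) metric_field" where
  "restrict_metric M g W = pullback_metric (open_submanifold M W) M (\<lambda>p. p) g"

end

theory Submission
  imports Defs
begin

text \<open>
  The Clairaut condition says that \<open>r\<^sup>2 |v\<^sub>V|\<^sup>2 / |v|\<^sup>2\<close> is constant along every geodesic, where
  \<open>v\<^sub>V\<close> is the vertical part of the velocity \<open>v\<close>. Since the horizontal distribution is integrable,
  there are local coordinates \<open>(x, y)\<close> in which the fibres of \<open>F\<close> are given by constant \<open>x\<close> and the
  horizontal leaves by constant \<open>y\<close>, so that \<open>g = g\<^sub>H(x, y) + g\<^sub>V(x, y)\<close> is block diagonal.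
  Differentiating the conserved quantity at the initial time of a geodesic with velocity \<open>(a, b)\<close> gives
  \<open>dr\<^sup>2(a + b) g\<^sub>V(b, b) + r\<^sup>2 (\<partial>\<^sub>b g\<^sub>H(a, a) - \<partial>\<^sub>a g\<^sub>V(b, b)) = 0\<close> for all \<open>a\<close> and \<open>b\<close>. Hence
  \<open>\<partial>\<^sub>b r = 0\<close>, \<open>\<partial>\<^sub>b g\<^sub>H = 0\<close> and \<open>\<partial>\<^sub>a (g\<^sub>V / r\<^sup>2) = 0\<close>, which is \<open>g = g\<^sub>1(x) + r(x)\<^sup>2 g\<^sub>2(y)\<close>. The
  coordinates come from the flow of horizontal lifts of radial lines, whose smoothness and linearisation
  are obtained from a fixed point argument in a Banach space of curves.
\<close>

section \<open>Calculus on relatively open sets\<close>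

text \<open>Integrability provides a leaf through each point, with a topology of its own, but says
  nothing about how leaves depend on the point. It is therefore used infinitesimally: a leaf through
  a point shows that, at this point, the horizontal lifts of constant fields commute. This identity
  holds on an open set, so a smooth family of leaves can be rebuilt by integrating the lifts. That
  these surfaces are tangent to the horizontal spaces is a statement about the derivative of a flow
  in its initial value, which must be known exactly; hence the weight put on the variational
  equation. The Clairaut relation is evaluated at time 0 only. The resulting identities are
  infinitesimal and are integrated along straight segments in the two coordinate directions
  separately, so the neighbourhood is a product of two balls. Geodesics are treated in weak form,
  tested against all vectors, since this form passes through coordinate changes directly.\<close>

definition rel_open :: "'e::euclidean_space set \<Rightarrow> 'e set \<Rightarrow> bool" where
  "rel_open E U \<longleftrightarrow> subspace E \<and> openin (top_of_set E) U"

lemma rel_open_subspace: "rel_open E U \<Longrightarrow> subspace E"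
  by (simp add: rel_open_def)

lemma rel_open_subset: "rel_open E U \<Longrightarrow> U \<subseteq> E"
  by (auto simp: rel_open_def dest: openin_imp_subset)

lemma rel_open_self: "subspace E \<Longrightarrow> rel_open E E"
  by (simp add: rel_open_def)

lemma rel_open_Int_open: "rel_open E U \<Longrightarrow> open T \<Longrightarrow> rel_open E (U \<inter> T)"
  by (auto simp: rel_open_def openin_Int_open)

lemma rel_open_ball:
  assumes "rel_open E U" "x \<in> U"
  obtains d where "d > 0" "E \<inter> ball x d \<subseteq> U"
  using assms unfolding rel_open_def openin_contains_ball by (auto simp: Int_commute)

lemma rel_open_at_within:
  assumes "rel_open E U" "x \<in> U"
  shows "at x within U = at x within E"
proof -
  obtain T where "open T" "U = E \<inter> T"
    using assms unfolding rel_open_def openin_open by auto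
  then show ?thesis
    using assms(2) by (intro at_within_nhd[of x T]) auto
qed

lemma rel_open_vimage:
  assumes "rel_open E U" "rel_open E' U'" "continuous_on U f" "f ` U \<subseteq> E'"
  shows "rel_open E {x\<in>U. f x \<in> U'}"
proof -
  obtain T where T: "open T" "U' = E' \<inter> T"
    using assms unfolding rel_open_def openin_open by auto
  have "openin (top_of_set U) (U \<inter> f -` T)"
    using assms(3) T(1) continuous_openin_preimage_gen by blast
  moreover have "U \<inter> f -` T = {x\<in>U. f x \<in> U'}" using T assms by auto
  ultimately show ?thesis using assms(1) unfolding rel_open_def
    by (metis openin_trans)
qed

lemma rel_open_Times: "rel_open E U \<Longrightarrow> rel_open E' U' \<Longrightarrow> rel_open (E \<times> E') (U \<times> U')"
  by (auto simp: rel_open_def subspace_Times openin_Times)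

section \<open>Orthonormal bases and orthogonal projections of subspaces\<close>

definition onb :: "'e::euclidean_space set \<Rightarrow> 'e set" where
  "onb E = (SOME B. B \<subseteq> E \<and> pairwise orthogonal B \<and> (\<forall>x\<in>B. norm x = 1) \<and> finite B \<and> card B = dim E \<and> span B = E)"

lemma onb:
  assumes "subspace E"
  shows "onb E \<subseteq> E" "finite (onb E)" "card (onb E) = dim E" "span (onb E) = E"
    "pairwise orthogonal (onb E)" "\<forall>x\<in>onb E. norm x = 1"
proof -
  have "\<exists>B. B \<subseteq> E \<and> pairwise orthogonal B \<and> (\<forall>x\<in>B. norm x = 1) \<and> finite B \<and> card B = dim E \<and> span B = E"
    using orthonormal_basis_subspace[OF assms] independent_imp_finite by metis
  from someI_ex[OF this] show "onb E \<subseteq> E" "finite (onb E)" "card (onb E) = dim E" "span (onb E) = E"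
    "pairwise orthogonal (onb E)" "\<forall>x\<in>onb E. norm x = 1" unfolding onb_def by auto
qed

lemma onb_expand:
  assumes "subspace E" "v \<in> E"
  shows "(\<Sum>b\<in>onb E. (v \<bullet> b) *\<^sub>R b) = v"
  by (rule orthonormal_basis_expand) (use onb[OF assms(1)] assms(2) in auto)

text \<open>Applied later to a fixed subspace \<open>E1\<close> of a model space:
  \<open>proj E1 p\<close> and \<open>p - proj E1 p\<close> are then the two coordinates of
  \<open>p\<close> in a product decomposition.\<close>

definition proj :: "'e::euclidean_space set \<Rightarrow> 'e \<Rightarrow> 'e" where
  "proj E v = (\<Sum>b\<in>onb E. (v \<bullet> b) *\<^sub>R b)"

lemma bounded_linear_proj: "bounded_linear (proj E)"
  unfolding proj_def by (intro bounded_linear_intros)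

lemma linear_proj: "linear (proj E)"
  using bounded_linear_proj bounded_linear.linear by blast

lemma proj_in: "subspace E \<Longrightarrow> proj E v \<in> E"
  unfolding proj_def using onb(1)[of E] by (intro subspace_sum subspace_scale) auto

lemma proj_id: "subspace E \<Longrightarrow> v \<in> E \<Longrightarrow> proj E v = v"
  by (simp add: proj_def onb_expand)

lemma proj_inner:
  assumes "subspace E" "w \<in> E"
  shows "proj E v \<bullet> w = v \<bullet> w"
proof -
  have "proj E v \<bullet> w = (\<Sum>b\<in>onb E. (v \<bullet> b) * (w \<bullet> b))"
    by (simp add: proj_def inner_sum_left inner_commute[of w])
  also have "\<dots> = v \<bullet> (\<Sum>b\<in>onb E. (w \<bullet> b) *\<^sub>R b)"
    by (simp add: inner_sum_right mult.commute)
  finally show ?thesis using onb_expand[OF assms] by simp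
qed

text \<open>Regularity is recorded for derivatives in fixed directions. Expanding a moving direction
  in a fixed orthonormal basis turns \<open>L v\<close> into scalar coefficients times values in
  fixed directions, the device behind most smoothness proofs below.\<close>

lemma linear_onb_expand:
  assumes "subspace E" "v \<in> E" "linear L"
  shows "L v = (\<Sum>b\<in>onb E. (v \<bullet> b) *\<^sub>R L b)"
proof -
  interpret linear L by fact
  have "L v = L (\<Sum>b\<in>onb E. (v \<bullet> b) *\<^sub>R b)" using onb_expand[OF assms(1,2)] by simp
  also have "\<dots> = (\<Sum>b\<in>onb E. (v \<bullet> b) *\<^sub>R L b)" by (simp add: sum scale)
  finally show ?thesis .
qed

section \<open>Derivatives within a subspace\<close>

lemma has_deriv_in:
  "f differentiable (at x within E) \<Longrightarrow> (f has_derivative deriv_in E f x) (at x within E)"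
  by (simp add: deriv_in_def frechet_derivative_works)

text \<open>A derivative within \<open>E\<close> is arbitrary off \<open>E\<close>, so uniqueness
  can hold only on vectors of \<open>E\<close>. There it follows by restricting to the line through
  \<open>x\<close> in direction \<open>v\<close>, which stays in \<open>E\<close>, and using
  uniqueness on the real line.\<close>

lemma deriv_in_eq:
  fixes E :: "'e::euclidean_space set"
  assumes "subspace E" "x \<in> E" "(f has_derivative D) (at x within E)" "v \<in> E"
  shows "deriv_in E f x v = D v"
proof -
  have 1: "(f has_derivative deriv_in E f x) (at x within E)"
    using assms(3) has_deriv_in differentiableI by blast
  have sub: "(\<lambda>t. x + t *\<^sub>R v) ` UNIV \<subseteq> E"
    using assms by (auto intro: subspace_add subspace_scale)
  have line: "((\<lambda>t::real. f (x + t *\<^sub>R v)) has_vector_derivative G v) (at 0)"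
    if "(f has_derivative G) (at x within E)" for G
  proof -
    have "((\<lambda>t. x + t *\<^sub>R v) has_derivative (\<lambda>t. t *\<^sub>R v)) (at 0)"
      by (auto intro!: derivative_eq_intros)
    moreover have "(f has_derivative G) (at (x + 0 *\<^sub>R v) within range (\<lambda>t. x + t *\<^sub>R v))"
      using has_derivative_subset[OF that sub] by simp
    ultimately have "((\<lambda>t. f (x + t *\<^sub>R v)) has_derivative (\<lambda>t. G (t *\<^sub>R v))) (at 0)"
      by (rule has_derivative_in_compose)
    then show ?thesis
      by (simp add: has_vector_derivative_def linear_cmul[OF has_derivative_linear[OF that]])
  qed
  show ?thesis using vector_derivative_unique_at[OF line[OF 1] line[OF assms(3)]] .
qed

lemma linear_deriv_in: "f differentiable (at x within E) \<Longrightarrow> linear (deriv_in E f x)"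
  using has_deriv_in has_derivative_linear by blast

lemma has_derivative_cong_rel:
  assumes "rel_open E U" "x \<in> U" "\<And>y. y \<in> U \<Longrightarrow> f y = g y" "(f has_derivative D) (at x within E)"
  shows "(g has_derivative D) (at x within E)"
  using has_derivative_transform[of x U g f D] assms rel_open_at_within[OF assms(1,2)] by simp

lemma deriv_in_cong:
  assumes "rel_open E U" "x \<in> U" "\<And>y. y \<in> U \<Longrightarrow> f y = g y"
  shows "deriv_in E f x = deriv_in E g x"
proof -
  have "(f has_derivative D) (at x within E) = (g has_derivative D) (at x within E)" for D
    using has_derivative_cong_rel[OF assms(1,2)] assms(3) by metis
  then show ?thesis unfolding deriv_in_def frechet_derivative_def by simp
qed

section \<open>Functions of class C^k and their closure properties\<close>

lemma C_k_on_cong: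
  assumes "rel_open E U" "\<And>y. y \<in> U \<Longrightarrow> f y = g y" "C_k_on k E U f"
  shows "C_k_on k E U g"
  using assms(2,3)
proof (induction k arbitrary: f g)
  case 0
  then show ?case using continuous_on_cong[of U U f g] by auto
next
  case (Suc k)
  have "deriv_in E f x = deriv_in E g x" if "x \<in> U" for x
    using deriv_in_cong[OF assms(1) that] Suc.prems by blast
  then have "C_k_on k E U (\<lambda>x. deriv_in E g x v)" if "v \<in> E" for v
    using Suc.IH[of "\<lambda>x. deriv_in E f x v" "\<lambda>x. deriv_in E g x v"] Suc.prems that by auto
  moreover have "g differentiable (at x within E)" if "x \<in> U" for x
  proof -
    have "(f has_derivative deriv_in E f x) (at x within E)" using has_deriv_in Suc.prems(2) that by auto
    from has_derivative_cong_rel[OF assms(1) that Suc.prems(1) this] show ?thesis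
      unfolding differentiable_def by blast
  qed
  ultimately show ?case by simp
qed

text \<open>Any family \<open>D\<close> of derivatives may stand in for the chosen representative
  \<open>deriv_in\<close>, since the two agree on vectors of \<open>E\<close>. This is how explicit
  derivative formulas enter the recursion.\<close>

lemma C_k_on_SucI:
  assumes "rel_open E U" "\<And>x. x \<in> U \<Longrightarrow> (f has_derivative D x) (at x within E)"
    "\<And>v. v \<in> E \<Longrightarrow> C_k_on k E U (\<lambda>x. D x v)"
  shows "C_k_on (Suc k) E U f"
proof -
  have "C_k_on k E U (\<lambda>x. deriv_in E f x v)" if "v \<in> E" for v
  proof (rule C_k_on_cong[OF assms(1) _ assms(3)[OF that]])
    show "D y v = deriv_in E f y v" if "y \<in> U" for y
      using deriv_in_eq[OF rel_open_subspace[OF assms(1)] _ assms(2) \<open>v \<in> E\<close>] that rel_open_subset[OF assms(1)] by force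
  qed
  moreover have "\<forall>x\<in>U. f differentiable (at x within E)"
    using assms(2) unfolding differentiable_def by blast
  ultimately show ?thesis by simp
qed

lemma C_k_on_SucD:
  assumes "C_k_on (Suc k) E U f"
  shows "x \<in> U \<Longrightarrow> (f has_derivative deriv_in E f x) (at x within E)"
    "v \<in> E \<Longrightarrow> C_k_on k E U (\<lambda>x. deriv_in E f x v)"
  using assms has_deriv_in by auto

lemma C_k_on_continuous:
  assumes "rel_open E U" "C_k_on k E U f"
  shows "continuous_on U f"
proof (cases k)
  case (Suc j)
  have "continuous (at x within U) f" if "x \<in> U" for x
    using C_k_on_SucD(1)[of j E U f x] assms Suc that rel_open_at_within[OF assms(1) that] has_derivative_continuous
    by metis
  then show ?thesis by (simp add: continuous_on_eq_continuous_within)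
qed (use assms in auto)

lemma C_k_on_Suc_imp: "rel_open E U \<Longrightarrow> C_k_on (Suc k) E U f \<Longrightarrow> C_k_on k E U f"
proof (induction k arbitrary: f)
  case 0
  then show ?case using C_k_on_continuous[of E U "Suc 0" f] by simp
next
  case (Suc k)
  then show ?case by (metis C_k_on.simps(2))
qed

lemma C_k_on_subset:
  "C_k_on k E U f \<Longrightarrow> V \<subseteq> U \<Longrightarrow> C_k_on k E V f"
  by (induction k arbitrary: f) (auto intro: continuous_on_subset)

lemma C_k_on_const [simp]: "rel_open E U \<Longrightarrow> C_k_on k E U (\<lambda>_. c)"
proof (induction k arbitrary: c)
  case (Suc k)
  show ?case by (rule C_k_on_SucI[OF Suc.prems, where D="\<lambda>_ _. 0"]) (use Suc in auto)
qed auto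

lemma C_k_on_bounded_linear_comp:
  assumes "rel_open E U" "bounded_linear L" "C_k_on k E U f"
  shows "C_k_on k E U (\<lambda>x. L (f x))"
  using assms(3)
proof (induction k arbitrary: f)
  case 0
  then show ?case using bounded_linear.continuous_on[OF assms(2)] by auto
next
  case (Suc k)
  show ?case
    by (rule C_k_on_SucI[OF assms(1), where D="\<lambda>x v. L (deriv_in E f x v)"])
      (auto intro: bounded_linear.has_derivative[OF assms(2)] C_k_on_SucD[OF Suc.prems] Suc.IH)
qed

lemma C_k_on_bounded_linear:
  assumes "rel_open E U" "bounded_linear L"
  shows "C_k_on k E U L"
proof (cases k)
  case 0
  then show ?thesis using linear_continuous_on[OF assms(2)] by auto
next
  case (Suc j)
  show ?thesis unfolding Suc
    by (rule C_k_on_SucI[OF assms(1), where D="\<lambda>x. L"])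
      (use assms bounded_linear_imp_has_derivative in auto)
qed

lemma C_k_on_id [simp]: "rel_open E U \<Longrightarrow> C_k_on k E U (\<lambda>x. x)"
  by (rule C_k_on_bounded_linear) auto

lemma C_k_on_add:
  assumes "rel_open E U" "C_k_on k E U f" "C_k_on k E U g"
  shows "C_k_on k E U (\<lambda>x. f x + g x)"
  using assms(2,3)
proof (induction k arbitrary: f g)
  case 0
  then show ?case by (auto intro: continuous_intros)
next
  case (Suc k)
  show ?case
    by (rule C_k_on_SucI[OF assms(1), where D="\<lambda>x v. deriv_in E f x v + deriv_in E g x v"])
      (auto intro: has_derivative_add C_k_on_SucD[OF Suc.prems(1)] C_k_on_SucD[OF Suc.prems(2)] Suc.IH)
qed

lemma C_k_on_scaleR_const:
  "rel_open E U \<Longrightarrow> C_k_on k E U f \<Longrightarrow> C_k_on k E U (\<lambda>x. c *\<^sub>R f x)"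
  by (rule C_k_on_bounded_linear_comp) (auto intro: bounded_linear_intros)

lemma C_k_on_minus:
  "rel_open E U \<Longrightarrow> C_k_on k E U f \<Longrightarrow> C_k_on k E U (\<lambda>x. - f x)"
  by (rule C_k_on_bounded_linear_comp[OF _ bounded_linear_minus[OF bounded_linear_ident]])

lemma C_k_on_diff:
  assumes "rel_open E U" "C_k_on k E U f" "C_k_on k E U g"
  shows "C_k_on k E U (\<lambda>x. f x - g x)"
  using C_k_on_add[OF assms(1,2) C_k_on_minus[OF assms(1,3)]] by simp

lemma C_k_on_sum:
  assumes "rel_open E U" "\<And>i. i \<in> I \<Longrightarrow> C_k_on k E U (f i)"
  shows "C_k_on k E U (\<lambda>x. \<Sum>i\<in>I. f i x)"
  using assms(2)
  by (induction I rule: infinite_finite_induct) (use assms(1) in \<open>auto intro: C_k_on_add\<close>)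

lemma C_k_on_bilinear:
  assumes "rel_open E U" "bounded_bilinear B" "C_k_on k E U f" "C_k_on k E U g"
  shows "C_k_on k E U (\<lambda>x. B (f x) (g x))"
  using assms(3,4)
proof (induction k arbitrary: f g)
  case 0
  then show ?case using bounded_bilinear.continuous_on[OF assms(2)] by auto
next
  case (Suc k)
  show ?case
  proof (rule C_k_on_SucI[OF assms(1), where D="\<lambda>x v. B (f x) (deriv_in E g x v) + B (deriv_in E f x v) (g x)"])
    fix v assume "v \<in> E"
    with Suc.prems show "C_k_on k E U (\<lambda>x. B (f x) (deriv_in E g x v) + B (deriv_in E f x v) (g x))"
      by (intro C_k_on_add Suc.IH assms(1)) (auto intro: C_k_on_Suc_imp[OF assms(1)] C_k_on_SucD(2))
  qed (auto intro: bounded_bilinear.FDERIV[OF assms(2)] C_k_on_SucD(1)[OF Suc.prems(1)] C_k_on_SucD(1)[OF Suc.prems(2)])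
qed

lemmas C_k_on_scaleR = C_k_on_bilinear[OF _ bounded_bilinear_scaleR]
lemmas C_k_on_mult = C_k_on_bilinear[OF _ bounded_bilinear_mult]
lemmas C_k_on_inner = C_k_on_bilinear[OF _ bounded_bilinear_inner]

lemma C_k_on_Pair:
  assumes "rel_open E U" "C_k_on k E U f" "C_k_on k E U g"
  shows "C_k_on k E U (\<lambda>x. (f x, g x))"
  using assms(2,3)
proof (induction k arbitrary: f g)
  case 0
  then show ?case by (auto intro: continuous_intros)
next
  case (Suc k)
  show ?case
    by (rule C_k_on_SucI[OF assms(1), where D="\<lambda>x v. (deriv_in E f x v, deriv_in E g x v)"])
      (auto intro: has_derivative_Pair C_k_on_SucD[OF Suc.prems(1)] C_k_on_SucD[OF Suc.prems(2)] Suc.IH)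
qed

text \<open>On \<open>U\<close> the map equals its own projection to \<open>E'\<close>, so by
  uniqueness on vectors of \<open>E\<close> the derivative equals its projection as well.\<close>

lemma has_derivative_in_subspace:
  fixes f :: "'e::euclidean_space \<Rightarrow> 'g::euclidean_space"
  assumes "rel_open E U" "x \<in> U" "f ` U \<subseteq> E'" "subspace E'" "(f has_derivative D) (at x within E)" "v \<in> E"
  shows "D v \<in> E'"
proof -
  have "((\<lambda>y. proj E' (f y)) has_derivative (\<lambda>v. proj E' (D v))) (at x within E)"
    by (rule bounded_linear.has_derivative[OF bounded_linear_proj assms(5)])
  then have "(f has_derivative (\<lambda>v. proj E' (D v))) (at x within E)"
    by (rule has_derivative_cong_rel[OF assms(1,2), rotated]) (use assms proj_id in fastforce)
  then have "D v = proj E' (D v)"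
    using deriv_in_eq[OF rel_open_subspace[OF assms(1)] _ _ assms(6)] assms(5) assms(1,2) rel_open_subset by (metis subsetD)
  then show ?thesis using proj_in[OF assms(4)] by metis
qed

lemma deriv_in_subspace:
  fixes f :: "'e::euclidean_space \<Rightarrow> 'g::euclidean_space"
  assumes "rel_open E U" "x \<in> U" "f ` U \<subseteq> E'" "subspace E'" "C_k_on (Suc k) E U f" "v \<in> E"
  shows "deriv_in E f x v \<in> E'"
  by (rule has_derivative_in_subspace[OF assms(1-4) _ assms(6)])
    (use C_k_on_SucD[OF assms(5)] assms(2) in auto)

section \<open>Chain rule and composition\<close>

lemma has_derivative_chain_rel:
  fixes f :: "'e::euclidean_space \<Rightarrow> 'f::euclidean_space"
  assumes "rel_open E U" "rel_open E' U'" "f ` U \<subseteq> U'" "x \<in> U"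
    "(f has_derivative f') (at x within E)" "(g has_derivative g') (at (f x) within E')"
  shows "((\<lambda>x. g (f x)) has_derivative (\<lambda>v. g' (f' v))) (at x within E)"
proof -
  have "f ` U \<subseteq> E'" using assms rel_open_subset by blast
  then have "(g has_derivative g') (at (f x) within f ` U)"
    using assms(6) has_derivative_subset by blast
  moreover have "(f has_derivative f') (at x within U)" using assms rel_open_at_within by metis
  ultimately have "((\<lambda>x. g (f x)) has_derivative (\<lambda>v. g' (f' v))) (at x within U)"
    using has_derivative_in_compose by blast
  then show ?thesis using assms rel_open_at_within by metis
qed

lemma C_k_on_compose:
  fixes f :: "'e::euclidean_space \<Rightarrow> 'f::euclidean_space" and g :: "'f \<Rightarrow> 'g::real_normed_vector"
  assumes "rel_open E U" "rel_open E' U'" "f ` U \<subseteq> U'" "C_k_on k E U f" "C_k_on k E' U' g"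
  shows "C_k_on k E U (\<lambda>x. g (f x))"
  using assms(4,5)
proof (induction k arbitrary: g)
  case 0
  then show ?case using continuous_on_compose2 assms(3) by (metis C_k_on.simps(1))
next
  case (Suc k)
  note f = C_k_on_SucD[OF Suc.prems(1)] and g = C_k_on_SucD[OF Suc.prems(2)]
  have E': "subspace E'" using assms rel_open_subspace by auto
  show ?case
  proof (rule C_k_on_SucI[OF assms(1), where D="\<lambda>x v. deriv_in E' g (f x) (deriv_in E f x v)"])
    fix v assume v: "v \<in> E"
    \<comment> \<open>In the chain rule the direction \<open>deriv_in E f x v\<close> moves with
      \<open>x\<close>, whereas the induction hypothesis concerns constant directions
      \<open>b\<close>; hence the expansion over a basis of \<open>E'\<close>.\<close>
    have "C_k_on k E U (\<lambda>x. \<Sum>b\<in>onb E'. (deriv_in E f x v \<bullet> b) *\<^sub>R deriv_in E' g (f x) b)"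
    proof (intro C_k_on_sum C_k_on_scaleR assms(1) C_k_on_inner C_k_on_const f v)
      fix b assume "b \<in> onb E'"
      then have "C_k_on k E' U' (\<lambda>y. deriv_in E' g y b)" using g(2) onb[OF E'] by blast
      then show "C_k_on k E U (\<lambda>x. deriv_in E' g (f x) b)"
        using Suc.IH[of "\<lambda>y. deriv_in E' g y b"] Suc.prems C_k_on_Suc_imp[OF assms(1)] by blast
    qed
    then show "C_k_on k E U (\<lambda>x. deriv_in E' g (f x) (deriv_in E f x v))"
    proof (rule C_k_on_cong[OF assms(1), rotated])
      fix x assume x: "x \<in> U"
      have "deriv_in E f x v \<in> E'"
        using deriv_in_subspace[OF assms(1) x _ E' Suc.prems(1) v] assms rel_open_subset by blast
      then show "(\<Sum>b\<in>onb E'. (deriv_in E f x v \<bullet> b) *\<^sub>R deriv_in E' g (f x) b)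
        = deriv_in E' g (f x) (deriv_in E f x v)"
        using linear_onb_expand[OF E'] linear_deriv_in Suc.prems(2) x assms(3)
        by (metis C_k_on.simps(2) image_subset_iff)
    qed
  qed (use has_derivative_chain_rel[OF assms(1-3) _ f(1) g(1)] assms(3) in auto)
qed

lemma deriv_in_chain:
  fixes f :: "'e::euclidean_space \<Rightarrow> 'f::euclidean_space"
  assumes "rel_open E U" "rel_open E' U'" "f ` U \<subseteq> U'" "x \<in> U"
    "f differentiable (at x within E)" "g differentiable (at (f x) within E')" "v \<in> E"
  shows "deriv_in E (\<lambda>x. g (f x)) x v = deriv_in E' g (f x) (deriv_in E f x v)"
  by (rule deriv_in_eq[OF rel_open_subspace[OF assms(1)] _ has_derivative_chain_rel[OF assms(1-4)] assms(7)])
   (use assms rel_open_subset has_deriv_in in auto)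

text \<open>The second difference of \<open>f\<close> over a small parallelogram is symmetric in
  \<open>v\<close> and \<open>w\<close>. Two applications of the mean value theorem, in either
  order, write it as a common factor times a mixed derivative at a nearby point, so by continuity
  the two mixed derivatives cannot differ at \<open>x\<close>.\<close>

lemma real_second_derivative_symmetric:
  fixes f :: "'e::euclidean_space \<Rightarrow> real"
  assumes U: "rel_open E U" and x: "x \<in> U" and f: "C_k_on 2 E U f" and v: "v \<in> E" and w: "w \<in> E"
  shows "deriv_in E (\<lambda>y. deriv_in E f y v) x w = deriv_in E (\<lambda>y. deriv_in E f y w) x v"
proof (rule ccontr)
  define a where "a v w y = deriv_in E (\<lambda>y. deriv_in E f y v) y w" for v w y
  assume "deriv_in E (\<lambda>y. deriv_in E f y v) x w \<noteq> deriv_in E (\<lambda>y. deriv_in E f y w) x v"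
  then have ne: "\<bar>a v w x - a w v x\<bar> / 2 > 0" by (simp add: a_def)
  define e where "e = \<bar>a v w x - a w v x\<bar> / 2"
  have e: "e > 0" using ne e_def by simp
  have f1: "C_k_on 1 E U (\<lambda>y. deriv_in E f y v)" if "v \<in> E" for v
    using C_k_on_SucD(2)[of 1 E U f v] f that by (simp add: numeral_2_eq_2)
  have cont: "continuous_on U (a v w)" if "v \<in> E" "w \<in> E" for v w
    using C_k_on_SucD(2)[of 0 E U "\<lambda>y. deriv_in E f y v" w] f1[OF that(1)] that by (simp add: a_def)
  have nb: "\<exists>d>0. \<forall>y\<in>U. dist y x < d \<longrightarrow> \<bar>a v w y - a v w x\<bar> < e" if "v \<in> E" "w \<in> E" for v w
    using cont[OF that] x e unfolding continuous_on_iff dist_real_def by metis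
  obtain d1 where d1: "d1 > 0" "\<And>y. y \<in> U \<Longrightarrow> dist y x < d1 \<Longrightarrow> \<bar>a v w y - a v w x\<bar> < e" using nb[OF v w] by metis
  obtain d2 where d2: "d2 > 0" "\<And>y. y \<in> U \<Longrightarrow> dist y x < d2 \<Longrightarrow> \<bar>a w v y - a w v x\<bar> < e" using nb[OF w v] by metis
  obtain d3 where d3: "d3 > 0" "E \<inter> ball x d3 \<subseteq> U" using rel_open_ball[OF U x] .
  \<comment> \<open>The denominator makes the whole parallelogram stay within half of the smallest
    radius around \<open>x\<close>; the summand 1 covers the case that both vectors vanish.\<close>
  define h where "h = min d1 (min d2 d3) / (2 * (norm v + norm w + 1))"
  have pos: "norm v + norm w + 1 > 0" using norm_ge_zero[of v] norm_ge_zero[of w] by linarith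
  have h: "h > 0" using d1 d2 d3 pos by (simp add: h_def)
  have hb: "h * (norm v + norm w) < min d1 (min d2 d3)"
  proof -
    have aux: "h * N = min d1 (min d2 d3) / 2" if "N = norm v + norm w + 1" "N > 0" for N
      unfolding h_def that(1)[symmetric] using that(2) by simp
    have "h * (norm v + norm w) \<le> h * (norm v + norm w + 1)" using h by simp
    also have "\<dots> = min d1 (min d2 d3) / 2" using aux[OF refl pos] .
    also have "\<dots> < min d1 (min d2 d3)" using d1(1) d2(1) d3(1) by (simp add: min_def)
    finally show ?thesis .
  qed
  have E: "subspace E" using U rel_open_subspace by auto
  have xE: "x \<in> E" using U x rel_open_subset by auto
  have near: "x + s *\<^sub>R v + t *\<^sub>R w \<in> U \<and> dist (x + s *\<^sub>R v + t *\<^sub>R w) x < d1 \<and> dist (x + s *\<^sub>R v + t *\<^sub>R w) x < d2"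
    if "0 \<le> s" "s \<le> h" "0 \<le> t" "t \<le> h" for s t
  proof -
    have "norm (s *\<^sub>R v + t *\<^sub>R w) \<le> s * norm v + t * norm w"
      using norm_triangle_ineq[of "s *\<^sub>R v" "t *\<^sub>R w"] that by simp
    also have "\<dots> \<le> h * norm v + h * norm w" using that by (intro add_mono mult_right_mono) auto
    also have "\<dots> < min d1 (min d2 d3)" using hb by (simp add: algebra_simps)
    finally have n: "norm (s *\<^sub>R v + t *\<^sub>R w) < min d1 (min d2 d3)" .
    have "x + s *\<^sub>R v + t *\<^sub>R w \<in> E" using E xE v w by (intro subspace_add subspace_scale) auto
    moreover have "dist (x + s *\<^sub>R v + t *\<^sub>R w) x = norm (s *\<^sub>R v + t *\<^sub>R w)"
      by (simp add: dist_norm algebra_simps)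
    ultimately show ?thesis using n d3 by (auto simp: dist_commute)
  qed
  have line: "((\<lambda>s. g (p + s *\<^sub>R u)) has_real_derivative deriv_in E g (p + s *\<^sub>R u) u) (at s)"
    if "C_k_on (Suc k) E U g" "u \<in> E" "p \<in> E" "p + s *\<^sub>R u \<in> U" for g :: "'e \<Rightarrow> real" and p u s k
  proof -
    have sub: "range (\<lambda>s. p + s *\<^sub>R u) \<subseteq> E" using that E by (auto intro: subspace_add subspace_scale)
    have "(g has_derivative deriv_in E g (p + s *\<^sub>R u)) (at (p + s *\<^sub>R u) within range (\<lambda>s. p + s *\<^sub>R u))"
      using C_k_on_SucD(1)[OF that(1,4)] has_derivative_subset[OF _ sub] by blast
    moreover have "((\<lambda>s. p + s *\<^sub>R u) has_derivative (\<lambda>t. t *\<^sub>R u)) (at s)"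
      by (auto intro!: derivative_eq_intros)
    ultimately have "((\<lambda>s. g (p + s *\<^sub>R u)) has_derivative (\<lambda>t. deriv_in E g (p + s *\<^sub>R u) (t *\<^sub>R u))) (at s)"
      by (rule has_derivative_in_compose[rotated])
    moreover have "linear (deriv_in E g (p + s *\<^sub>R u))" using linear_deriv_in that C_k_on.simps(2) by blast
    ultimately show ?thesis
      by (simp add: has_field_derivative_def linear_cmul mult.commute[of "deriv_in E g (p + s *\<^sub>R u) u"]
        mult_commute_abs)
  qed
  have f2: "C_k_on (Suc 1) E U f" using f by (simp add: numeral_2_eq_2)
  have mvt: "\<exists>y\<in>U. dist y x < d1 \<and> dist y x < d2 \<and>
      f (x + h *\<^sub>R v + h *\<^sub>R w) - f (x + h *\<^sub>R v) - f (x + h *\<^sub>R w) + f x = h * (h * a v w y)"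
    if "v \<in> E" "w \<in> E" and near: "\<And>s t. 0 \<le> s \<Longrightarrow> s \<le> h \<Longrightarrow> 0 \<le> t \<Longrightarrow> t \<le> h \<Longrightarrow>
      x + s *\<^sub>R v + t *\<^sub>R w \<in> U \<and> dist (x + s *\<^sub>R v + t *\<^sub>R w) x < d1 \<and> dist (x + s *\<^sub>R v + t *\<^sub>R w) x < d2" for v w
  proof -
    \<comment> \<open>Taking the difference in direction \<open>w\<close> first makes the second
      difference an increment of \<open>?F\<close>. The mean value theorem in direction
      \<open>v\<close>, and then in direction \<open>w\<close>, leaves a single mixed
      derivative.\<close>
    let ?F = "\<lambda>s. f ((x + h *\<^sub>R w) + s *\<^sub>R v) - f (x + s *\<^sub>R v)"
    have "\<exists>z::real. z > 0 \<and> z < h \<and> ?F h - ?F 0 = (h - 0) *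
       (deriv_in E f ((x + h *\<^sub>R w) + z *\<^sub>R v) v - deriv_in E f (x + z *\<^sub>R v) v)"
    proof (rule MVT2)
      fix s assume s: "0 \<le> s" "s \<le> h"
      have "(x + h *\<^sub>R w) + s *\<^sub>R v \<in> U" "x + s *\<^sub>R v \<in> U"
        using near[of s h] near[of s 0] h s by (auto simp: algebra_simps)
      moreover have "x + h *\<^sub>R w \<in> E" using E xE that by (intro subspace_add subspace_scale) auto
      ultimately show "(?F has_real_derivative
         (deriv_in E f ((x + h *\<^sub>R w) + s *\<^sub>R v) v - deriv_in E f (x + s *\<^sub>R v) v)) (at s)"
        using that xE by (intro DERIV_diff line[OF f2]) auto
    qed (use h in auto)
    then obtain z where z: "z > 0" "z < h" "?F h - ?F 0 = h *
       (deriv_in E f ((x + h *\<^sub>R w) + z *\<^sub>R v) v - deriv_in E f (x + z *\<^sub>R v) v)" by auto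
    let ?G = "\<lambda>t. deriv_in E f ((x + z *\<^sub>R v) + t *\<^sub>R w) v"
    have xz: "x + z *\<^sub>R v \<in> E" using E xE that by (intro subspace_add subspace_scale) auto
    have f1': "C_k_on (Suc 0) E U (\<lambda>y. deriv_in E f y v)" using f1[OF that(1)] by simp
    have "\<exists>t::real. t > 0 \<and> t < h \<and> ?G h - ?G 0 = (h - 0) * a v w ((x + z *\<^sub>R v) + t *\<^sub>R w)"
    proof (rule MVT2)
      fix t assume t: "0 \<le> t" "t \<le> h"
      have "(x + z *\<^sub>R v) + t *\<^sub>R w \<in> U" using near[of z t] z t by auto
      then show "(?G has_real_derivative a v w ((x + z *\<^sub>R v) + t *\<^sub>R w)) (at t)"
        unfolding a_def using that xz by (intro line[OF f1']) auto
    qed (use h in auto)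
    then obtain t where t: "t > 0" "t < h" "?G h - ?G 0 = h * a v w ((x + z *\<^sub>R v) + t *\<^sub>R w)" by auto
    have "f (x + h *\<^sub>R v + h *\<^sub>R w) - f (x + h *\<^sub>R v) - f (x + h *\<^sub>R w) + f x = ?F h - ?F 0"
      by (simp add: algebra_simps)
    also have "\<dots> = h * (?G h - ?G 0)" using z(3) by (simp add: algebra_simps)
    also have "\<dots> = h * (h * a v w ((x + z *\<^sub>R v) + t *\<^sub>R w))" using t(3) by simp
    finally show ?thesis using near[of z t] z t by auto
  qed
  obtain y1 where y1: "y1 \<in> U" "dist y1 x < d1"
    "f (x + h *\<^sub>R v + h *\<^sub>R w) - f (x + h *\<^sub>R v) - f (x + h *\<^sub>R w) + f x = h * (h * a v w y1)"
    using mvt[OF v w near] by blast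
  have near': "x + s *\<^sub>R w + t *\<^sub>R v \<in> U \<and> dist (x + s *\<^sub>R w + t *\<^sub>R v) x < d1 \<and> dist (x + s *\<^sub>R w + t *\<^sub>R v) x < d2"
    if "0 \<le> s" "s \<le> h" "0 \<le> t" "t \<le> h" for s t
    using near[of t s] that by (simp add: algebra_simps)
  obtain y2 where y2: "y2 \<in> U" "dist y2 x < d2"
    "f (x + h *\<^sub>R w + h *\<^sub>R v) - f (x + h *\<^sub>R w) - f (x + h *\<^sub>R v) + f x = h * (h * a w v y2)"
    using mvt[OF w v near'] by blast
  have "h * (h * a v w y1) = h * (h * a w v y2)" using y1(3) y2(3) by (simp add: algebra_simps)
  then have "a v w y1 = a w v y2" using h by simp
  moreover have "\<bar>a v w y1 - a v w x\<bar> < e" "\<bar>a w v y2 - a w v x\<bar> < e" using d1 d2 y1 y2 by auto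
  ultimately have "\<bar>a v w x - a w v x\<bar> < 2 * e" by linarith
  then show False by (simp add: e_def)
qed

lemma deriv_in_inner:
  assumes "rel_open E U" "x \<in> U" "f differentiable (at x within E)" "v \<in> E"
  shows "deriv_in E (\<lambda>y. f y \<bullet> i) x v = deriv_in E f x v \<bullet> i"
  using deriv_in_eq[OF rel_open_subspace[OF assms(1)] _ has_derivative_inner_left[OF has_deriv_in[OF assms(3)]] assms(4)]
    assms(2) rel_open_subset[OF assms(1)] by blast

lemma second_derivative_symmetric:
  fixes f :: "'e::euclidean_space \<Rightarrow> 'f::euclidean_space"
  assumes U: "rel_open E U" and x: "x \<in> U" and f: "C_k_on 2 E U f" and v: "v \<in> E" and w: "w \<in> E"
  shows "deriv_in E (\<lambda>y. deriv_in E f y v) x w = deriv_in E (\<lambda>y. deriv_in E f y w) x v"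
proof (rule euclidean_eqI)
  fix i :: 'f assume "i \<in> Basis"
  have f2: "C_k_on (Suc (Suc 0)) E U f" using f by (simp add: numeral_2_eq_2)
  have *: "deriv_in E (\<lambda>y. deriv_in E (\<lambda>y. f y \<bullet> i) y v) x w = deriv_in E (\<lambda>y. deriv_in E f y v) x w \<bullet> i"
    if "v \<in> E" "w \<in> E" for v w
  proof -
    have "deriv_in E (\<lambda>y. deriv_in E (\<lambda>y. f y \<bullet> i) y v) x = deriv_in E (\<lambda>y. deriv_in E f y v \<bullet> i) x"
      by (rule deriv_in_cong[OF U x], rule deriv_in_inner[OF U]) (use f2 that in auto)
    then show ?thesis using deriv_in_inner[OF U x, of "\<lambda>y. deriv_in E f y v" w i] f2 that x by simp
  qed
  have "C_k_on 2 E U (\<lambda>y. f y \<bullet> i)" by (intro C_k_on_inner U f C_k_on_const)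
  from real_second_derivative_symmetric[OF U x this v w]
  show "deriv_in E (\<lambda>y. deriv_in E f y v) x w \<bullet> i = deriv_in E (\<lambda>y. deriv_in E f y w) x v \<bullet> i"
    using * v w by simp
qed

section \<open>Linear equations with smooth coefficients\<close>

text \<open>The lower bound gives injectivity and at the same time bounds the inverse by
  \<open>K\<close>.\<close>

lemma bounded_below_inv:
  fixes T :: "'x::real_normed_vector \<Rightarrow>\<^sub>L 'x"
  assumes K: "\<And>w. norm w \<le> K * norm (T w)" and surj: "surj (blinfun_apply T)"
  shows "bounded_linear (inv (blinfun_apply T))" "\<And>w. T (inv (blinfun_apply T) w) = w"
    "\<And>w. inv (blinfun_apply T) (T w) = w"
proof -
  have inj: "inj (blinfun_apply T)"
  proof (rule injI)
    fix x y assume "T x = T y"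
    then have "norm (x - y) \<le> 0" using K[of "x - y"] by (simp add: blinfun.diff_right)
    then show "x = y" by simp
  qed
  show 1: "\<And>w. T (inv (blinfun_apply T) w) = w" using surj by (simp add: surj_f_inv_f)
  show 2: "\<And>w. inv (blinfun_apply T) (T w) = w" using inj by simp
  have eq: "inv (blinfun_apply T) w = z" if "T z = w" for w z using that 2 by blast
  show "bounded_linear (inv (blinfun_apply T))"
  proof (rule bounded_linear_intro[of _ K])
    show "norm (inv (blinfun_apply T) x) \<le> norm x * K" for x
      using K[of "inv (blinfun_apply T) x"] 1[of x] by (simp add: mult.commute)
  qed (auto intro!: eq simp: blinfun.add_right blinfun.scaleR_right 1)
qed

text \<open>
  The error term may be proportional to the increment of \<open>h\<close> itself, so that no continuity of
  \<open>h\<close> has to be known beforehand.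
\<close>

lemma implicit_has_derivative:
  fixes h :: "'e::euclidean_space \<Rightarrow> 'x::real_normed_vector" and T :: "'x \<Rightarrow>\<^sub>L 'x"
  assumes U: "rel_open E U" and p: "p \<in> U"
    and K: "\<And>w. norm w \<le> K * norm (T w)" and surj: "surj (blinfun_apply T)"
    and c: "bounded_linear c"
    and rem: "\<And>e. e > 0 \<Longrightarrow> \<exists>d>0. \<forall>q\<in>U. norm (q - p) < d \<longrightarrow>
      norm (T (h q - h p) - c (q - p)) \<le> e * (norm (q - p) + norm (h q - h p))"
  shows "(h has_derivative (\<lambda>v. inv (blinfun_apply T) (c v))) (at p within E)"
proof -
  note inv = bounded_below_inv[OF K surj]
  define L where "L = \<bar>K\<bar> + 1"
  have L: "L > 0" "norm w \<le> L * norm (T w)" for w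
  proof -
    show "L > 0" by (simp add: L_def)
    have "K \<le> L" by (simp add: L_def)
    then show "norm w \<le> L * norm (T w)" using order_trans[OF K[of w] mult_right_mono] by simp
  qed
  obtain C where C: "C > 0" "\<And>v. norm (c v) \<le> norm v * C"
    using bounded_linear.pos_bounded[OF c] by blast
  have "(h has_derivative (\<lambda>v. inv (blinfun_apply T) (c v))) (at p within U)"
    unfolding has_derivative_within_alt
  proof (intro conjI allI impI)
    show "bounded_linear (\<lambda>v. inv (blinfun_apply T) (c v))"
      using bounded_linear_compose[OF inv(1) c] .
    fix e :: real assume e: "e > 0"
    \<comment> \<open>\<open>M\<close> bounds the increment of \<open>h\<close> relative to that of
      its argument. With \<open>L * e'\<close> at most 1/2 the error proportional to
      \<open>norm (h q - h p)\<close> is absorbed into the left side, and what remains is at most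
      \<open>M\<close> times \<open>norm (q - p)\<close>. The last entry in the minimum defining
      \<open>e'\<close> then brings the final error below \<open>e\<close>.\<close>
    define M where "M = 2 * L * (C + 1)"
    have M: "M > 0" using L C by (simp add: M_def)
    define e' where "e' = min (min 1 (1 / (2 * L))) (e / (L * (1 + M)))"
    have e': "e' > 0" "e' \<le> 1" "L * e' \<le> 1 / 2" "L * (1 + M) * e' \<le> e"
    proof -
      show "e' > 0" "e' \<le> 1" using e L M by (auto simp: e'_def)
      have "L * e' \<le> L * (1 / (2 * L))" using L by (intro mult_left_mono) (auto simp: e'_def)
      then show "L * e' \<le> 1 / 2" using L by simp
      have "L * (1 + M) * e' \<le> L * (1 + M) * (e / (L * (1 + M)))" using L M by (intro mult_left_mono) (auto simp: e'_def)
      then show "L * (1 + M) * e' \<le> e" using L(1) M by simp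
    qed
    obtain d where d: "d > 0" "\<And>q. q \<in> U \<Longrightarrow> norm (q - p) < d \<Longrightarrow>
      norm (T (h q - h p) - c (q - p)) \<le> e' * (norm (q - p) + norm (h q - h p))"
      using rem[OF e'(1)] by metis
    show "\<exists>d>0. \<forall>y\<in>U. norm (y - p) < d \<longrightarrow> norm (h y - h p - inv (blinfun_apply T) (c (y - p))) \<le> e * norm (y - p)"
    proof (intro exI[of _ d] conjI d ballI impI)
      fix q assume q: "q \<in> U" "norm (q - p) < d"
      let ?r = "norm (q - p)" and ?H = "norm (h q - h p)"
      have r: "norm (T (h q - h p) - c (q - p)) \<le> e' * (?r + ?H)" using d(2)[OF q] .
      have "?H \<le> L * norm (T (h q - h p))" by (rule L)
      also have "\<dots> \<le> L * (norm (T (h q - h p) - c (q - p)) + norm (c (q - p)))"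
        using L(1) norm_triangle_ineq[of "T (h q - h p) - c (q - p)" "c (q - p)"] by (intro mult_left_mono) auto
      also have "\<dots> \<le> L * (e' * (?r + ?H) + ?r * C)" using L(1) r C(2) by (intro mult_left_mono add_mono) auto
      also have "\<dots> = L * e' * ?H + L * (e' * ?r + ?r * C)" by (simp add: algebra_simps)
      also have "\<dots> \<le> 1/2 * ?H + L * (1 * ?r + ?r * C)" using e' L(1) by (intro add_mono mult_left_mono mult_right_mono) auto
      finally have "?H \<le> M * ?r" by (simp add: M_def algebra_simps)
      have r2: "norm (T (h q - h p) - c (q - p)) \<le> e' * (1 + M) * ?r"
      proof -
        have "e' * ?H \<le> e' * (M * ?r)" using e'(1) \<open>?H \<le> M * ?r\<close> by (intro mult_left_mono) auto
        then show ?thesis using r by (simp add: algebra_simps)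
      qed
      have "norm (h q - h p - inv (blinfun_apply T) (c (q - p))) \<le> L * norm (T (h q - h p) - c (q - p))"
        using L(2)[of "h q - h p - inv (blinfun_apply T) (c (q - p))"] by (simp add: blinfun.diff_right inv(2))
      also have "\<dots> \<le> L * (e' * (1 + M) * ?r)" using r2 L(1) by (intro mult_left_mono) auto
      also have "\<dots> = (L * (1 + M) * e') * ?r" by (simp add: algebra_simps)
      also have "\<dots> \<le> e * ?r" using e' by (intro mult_right_mono) auto
      finally show "norm (h q - h p - inv (blinfun_apply T) (c (q - p))) \<le> e * ?r" .
    qed
  qed
  then show ?thesis using rel_open_at_within[OF U p] by simp
qed

lemma solve_has_derivative:
  fixes T :: "'e::euclidean_space \<Rightarrow> ('x::real_normed_vector \<Rightarrow>\<^sub>L 'x)"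
  assumes U: "rel_open E U" and p: "p \<in> U"
    and K: "\<And>w. norm w \<le> K * norm (T p w)" and surj: "surj (blinfun_apply (T p))"
    and T': "(T has_derivative T') (at p within E)" and b': "(b has_derivative b') (at p within E)"
    and h: "\<And>q. q \<in> U \<Longrightarrow> T q (h q) = b q"
  shows "(h has_derivative (\<lambda>v. inv (blinfun_apply (T p)) (b' v - T' v (h p)))) (at p within E)"
proof (rule implicit_has_derivative[OF U p K surj])
  show "bounded_linear (\<lambda>v. b' v - T' v (h p))"
    by (intro bounded_linear_sub has_derivative_bounded_linear[OF b']
      bounded_linear_compose[OF blinfun.bounded_linear_left has_derivative_bounded_linear[OF T']])
  fix e :: real assume e: "e > 0"
  have TU: "(T has_derivative T') (at p within U)" and bU: "(b has_derivative b') (at p within U)"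
    using T' b' rel_open_at_within[OF U p] by auto
  have cT: "continuous (at p within U) T" using TU has_derivative_continuous by blast
  define e1 where "e1 = e / (2 * (1 + norm (h p)))"
  have hp: "1 + norm (h p) > 0" using norm_ge_zero[of "h p"] by linarith
  have e1: "e1 > 0" using e hp by (simp add: e1_def)
  have e12: "e1 + e1 * norm (h p) \<le> e"
  proof -
    have "e1 + e1 * norm (h p) = e1 * (1 + norm (h p))" by (simp add: algebra_simps)
    also have "\<dots> = e / 2" using hp unfolding e1_def by (metis divide_divide_eq_left nonzero_eq_divide_eq order_less_irrefl)
    finally show ?thesis using e by simp
  qed
  obtain d1 where d1: "d1 > 0" "\<And>q. q \<in> U \<Longrightarrow> norm (q - p) < d1 \<Longrightarrow> norm (T q - T p - T' (q - p)) \<le> e1 * norm (q - p)"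
    using TU e1 unfolding has_derivative_within_alt by blast
  obtain d2 where d2: "d2 > 0" "\<And>q. q \<in> U \<Longrightarrow> norm (q - p) < d2 \<Longrightarrow> norm (b q - b p - b' (q - p)) \<le> e1 * norm (q - p)"
    using bU e1 unfolding has_derivative_within_alt by blast
  obtain d3 where d3: "d3 > 0" "\<And>q. q \<in> U \<Longrightarrow> norm (q - p) < d3 \<Longrightarrow> norm (T q - T p) < e"
    using cT e unfolding continuous_within_eps_delta dist_norm by blast
  show "\<exists>d>0. \<forall>q\<in>U. norm (q - p) < d \<longrightarrow>
      norm (T p (h q - h p) - (b' (q - p) - T' (q - p) (h p))) \<le> e * (norm (q - p) + norm (h q - h p))"
  proof (intro exI[of _ "min d1 (min d2 d3)"] conjI ballI impI)
    fix q assume q: "q \<in> U" "norm (q - p) < min d1 (min d2 d3)"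
    have "T p (h q - h p) - (b' (q - p) - T' (q - p) (h p))
      = (b q - b p - b' (q - p)) - (T q - T p - T' (q - p)) (h p) - (T q - T p) (h q - h p)"
      by (simp add: blinfun.diff_left blinfun.diff_right h[OF q(1)] h[OF p])
    also have "norm \<dots> \<le> norm (b q - b p - b' (q - p)) + norm ((T q - T p - T' (q - p)) (h p)) + norm ((T q - T p) (h q - h p))"
      by (meson add_mono norm_triangle_ineq4 norm_triangle_le_diff order_refl order_trans)
    also have "\<dots> \<le> e1 * norm (q - p) + norm (T q - T p - T' (q - p)) * norm (h p) + norm (T q - T p) * norm (h q - h p)"
      using d2 q by (intro add_mono norm_blinfun) auto
    also have "\<dots> \<le> e1 * norm (q - p) + e1 * norm (q - p) * norm (h p) + e * norm (h q - h p)"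
      using d1(2)[OF q(1)] d3(2)[OF q(1)] q by (intro add_mono mult_right_mono) auto
    also have "\<dots> = (e1 + e1 * norm (h p)) * norm (q - p) + e * norm (h q - h p)" by (simp add: algebra_simps)
    also have "\<dots> \<le> e * norm (q - p) + e * norm (h q - h p)" using e12 by (intro add_mono mult_right_mono) auto
    finally show "norm (T p (h q - h p) - (b' (q - p) - T' (q - p) (h p))) \<le> e * (norm (q - p) + norm (h q - h p))"
      by (simp add: algebra_simps)
  qed (use d1 d2 d3 in auto)
qed

text \<open>Near \<open>p\<close> the operator \<open>T q\<close> differs from \<open>T p\<close> by
  less than \<open>1 / (2 * L)\<close>, so the part of the error that involves
  \<open>h q - h p\<close> is absorbed into the left side; the rest tends to 0.\<close>

lemma solve_continuous_on:
  fixes T :: "'e::euclidean_space \<Rightarrow> ('x::real_normed_vector \<Rightarrow>\<^sub>L 'x)"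
  assumes T: "continuous_on U T" and b: "continuous_on U b"
    and K: "\<And>p. p \<in> U \<Longrightarrow> \<exists>K. \<forall>w. norm w \<le> K * norm (T p w)"
    and h: "\<And>q. q \<in> U \<Longrightarrow> T q (h q) = b q"
  shows "continuous_on U h"
  unfolding continuous_on_def
proof
  fix p assume p: "p \<in> U"
  obtain K0 where "\<forall>w. norm w \<le> K0 * norm (T p w)" using K[OF p] by blast
  then have K0: "norm w \<le> K0 * norm (T p w)" for w by blast
  define L where "L = \<bar>K0\<bar> + 1"
  have L: "L > 0" "norm w \<le> L * norm (T p w)" for w
  proof -
    show "L > 0" by (simp add: L_def)
    have "K0 \<le> L" by (simp add: L_def)
    then show "norm w \<le> L * norm (T p w)" using order_trans[OF K0[of w] mult_right_mono] by simp
  qed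
  have Tp: "(T \<longlongrightarrow> T p) (at p within U)" and bp: "(b \<longlongrightarrow> b p) (at p within U)"
    using T b p by (auto simp: continuous_on_def)
  have ev: "\<forall>\<^sub>F q in at p within U. norm (h q - h p) \<le> 2 * L * (norm (b q - b p) + norm (T q - T p) * norm (h p))"
  proof -
    have "\<forall>\<^sub>F q in at p within U. dist (T q) (T p) < 1 / (2 * L)" using tendstoD[OF Tp] L by simp
    moreover have "\<forall>\<^sub>F q in at p within U. q \<in> U" by (simp add: eventually_at_filter)
    ultimately show ?thesis
    proof eventually_elim
      case (elim q)
      have "T p (h q - h p) = (b q - b p) - (T q - T p) (h p) - (T q - T p) (h q - h p)"
        by (simp add: blinfun.diff_left blinfun.diff_right h[OF elim(2)] h[OF p])
      also have "norm \<dots> \<le> norm (b q - b p) + norm ((T q - T p) (h p)) + norm ((T q - T p) (h q - h p))"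
        by (meson add_mono norm_triangle_ineq4 norm_triangle_le_diff order_refl order_trans)
      also have "\<dots> \<le> norm (b q - b p) + norm (T q - T p) * norm (h p) + norm (T q - T p) * norm (h q - h p)"
        by (intro add_mono norm_blinfun) auto
      also have "\<dots> \<le> norm (b q - b p) + norm (T q - T p) * norm (h p) + 1 / (2 * L) * norm (h q - h p)"
        using elim by (intro add_mono mult_right_mono) (auto simp: dist_norm)
      finally have n: "norm (T p (h q - h p)) \<le> norm (b q - b p) + norm (T q - T p) * norm (h p) + 1 / (2 * L) * norm (h q - h p)" .
      have "norm (h q - h p) \<le> L * norm (T p (h q - h p))" by (rule L(2))
      also have "\<dots> \<le> L * (norm (b q - b p) + norm (T q - T p) * norm (h p) + 1 / (2 * L) * norm (h q - h p))"
        using n L(1) by (intro mult_left_mono) auto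
      also have "\<dots> = L * (norm (b q - b p) + norm (T q - T p) * norm (h p)) + norm (h q - h p) / 2"
        using L(1) by (simp add: algebra_simps)
      finally show ?case by simp
    qed
  qed
  have "((\<lambda>q. 2 * L * (norm (b q - b p) + norm (T q - T p) * norm (h p))) \<longlongrightarrow>
     2 * L * (norm (b p - b p) + norm (T p - T p) * norm (h p))) (at p within U)"
    by (intro tendsto_intros Tp bp)
  then have "((\<lambda>q. 2 * L * (norm (b q - b p) + norm (T q - T p) * norm (h p))) \<longlongrightarrow> 0) (at p within U)" by simp
  from Lim_null_comparison[OF ev this] show "(h \<longlongrightarrow> h p) (at p within U)"
    using LIM_zero_cancel by blast
qed

text \<open>The derivative of the solution solves an equation with the same operator, whose
  right-hand side is built from the derivatives of \<open>b\<close> and \<open>T\<close> and from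
  \<open>h\<close> itself. This is of class C^k once \<open>h\<close> is, so the induction on the
  order generalises over \<open>b\<close> and \<open>h\<close>.\<close>

lemma C_k_on_solve:
  fixes T :: "'e::euclidean_space \<Rightarrow> ('x::real_normed_vector \<Rightarrow>\<^sub>L 'x)"
  assumes U: "rel_open E U"
    and T: "C_k_on k E U T" and b: "C_k_on k E U b"
    and K: "\<And>p. p \<in> U \<Longrightarrow> \<exists>K. \<forall>w. norm w \<le> K * norm (T p w)"
    and surj: "\<And>p. p \<in> U \<Longrightarrow> surj (blinfun_apply (T p))"
    and h: "\<And>q. q \<in> U \<Longrightarrow> T q (h q) = b q"
  shows "C_k_on k E U h"
  using T b h
proof (induction k arbitrary: b h)
  case 0
  then show ?case using solve_continuous_on[of U T b h] K by simp
next
  case (Suc k)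
  note T = C_k_on_SucD[OF Suc.prems(1)] and b = C_k_on_SucD[OF Suc.prems(2)]
  have hk: "C_k_on k E U h"
    using Suc.IH[OF C_k_on_Suc_imp[OF U Suc.prems(1)] C_k_on_Suc_imp[OF U Suc.prems(2)]] Suc.prems(3) by blast
  let ?D = "\<lambda>q v. inv (blinfun_apply (T q)) (deriv_in E b q v - deriv_in E T q v (h q))"
  show ?case
  proof (rule C_k_on_SucI[OF U, where D="?D"])
    fix p assume p: "p \<in> U"
    obtain K0 where K0: "\<forall>w. norm w \<le> K0 * norm (T p w)" using K[OF p] by blast
    show "(h has_derivative ?D p) (at p within E)"
      by (rule solve_has_derivative[OF U p, where K=K0]) (use K0 surj p T b Suc.prems(3) in auto)
  next
    fix v assume v: "v \<in> E"
    show "C_k_on k E U (\<lambda>q. ?D q v)"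
    proof (rule Suc.IH[OF C_k_on_Suc_imp[OF U Suc.prems(1)]])
      show "C_k_on k E U (\<lambda>q. deriv_in E b q v - deriv_in E T q v (h q))"
        by (intro C_k_on_diff U b T v C_k_on_bilinear[OF U bounded_bilinear_blinfun_apply] hk)
      show "T q (?D q v) = deriv_in E b q v - deriv_in E T q v (h q)" if "q \<in> U" for q
        using surj[OF that] by (simp add: surj_f_inv_f)
    qed
  qed
qed

text \<open>Metrics and derivatives are meaningful on vectors of the model space only, so linearity
  is demanded on a subspace rather than on the whole type.\<close>

definition linear_on :: "'a::real_vector set \<Rightarrow> ('a \<Rightarrow> 'b::real_vector) \<Rightarrow> bool" where
  "linear_on D A \<longleftrightarrow> (\<forall>v\<in>D. \<forall>w\<in>D. \<forall>a b. A (a *\<^sub>R v + b *\<^sub>R w) = a *\<^sub>R A v + b *\<^sub>R A w)"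

lemma linear_onD:
  assumes "linear_on D A" "subspace D"
  shows "v \<in> D \<Longrightarrow> w \<in> D \<Longrightarrow> A (v + w) = A v + A w"
    "v \<in> D \<Longrightarrow> A (a *\<^sub>R v) = a *\<^sub>R A v" "A 0 = 0"
    "v \<in> D \<Longrightarrow> w \<in> D \<Longrightarrow> A (v - w) = A v - A w"
    "v \<in> D \<Longrightarrow> A (- v) = - A v"
proof -
  have *: "A (a *\<^sub>R v + b *\<^sub>R w) = a *\<^sub>R A v + b *\<^sub>R A w" if "v \<in> D" "w \<in> D" for v w a b
    using assms that unfolding linear_on_def by blast
  show "v \<in> D \<Longrightarrow> w \<in> D \<Longrightarrow> A (v + w) = A v + A w" using *[of v w 1 1] by simp
  show "v \<in> D \<Longrightarrow> A (a *\<^sub>R v) = a *\<^sub>R A v" using *[of v v a 0] by simp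
  show "A 0 = 0" using *[of 0 0 0 0] subspace_0[OF assms(2)] by simp
  show "v \<in> D \<Longrightarrow> w \<in> D \<Longrightarrow> A (v - w) = A v - A w" using *[of v w 1 "-1"] by simp
  show "v \<in> D \<Longrightarrow> A (- v) = - A v" using *[of v v "-1" 0] by simp
qed

lemma linear_imp_linear_on: "linear A \<Longrightarrow> linear_on D A"
  by (simp add: linear_on_def linear_add linear_cmul)

lemma linear_on_sum:
  assumes "linear_on D A" "subspace D" "finite I" "\<And>i. i \<in> I \<Longrightarrow> f i \<in> D"
  shows "A (\<Sum>i\<in>I. f i) = (\<Sum>i\<in>I. A (f i))"
  using assms(3,4)
proof (induction I)
  case empty
  then show ?case using linear_onD(3)[OF assms(1,2)] by simp
next
  case (insert x F)
  then show ?case using linear_onD(1)[OF assms(1,2), of "f x" "sum f F"] subspace_sum[OF assms(2), of F f] by auto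
qed

lemma linear_on_expand:
  assumes "linear_on D A" "subspace D" "v \<in> D"
  shows "A v = (\<Sum>b\<in>onb D. (v \<bullet> b) *\<^sub>R A b)"
proof -
  have "A v = A (\<Sum>b\<in>onb D. (v \<bullet> b) *\<^sub>R b)" using onb_expand[OF assms(2,3)] by simp
  also have "\<dots> = (\<Sum>b\<in>onb D. A ((v \<bullet> b) *\<^sub>R b))"
    by (rule linear_on_sum[OF assms(1,2)]) (use onb[OF assms(2)] subspace_scale[OF assms(2)] in auto)
  also have "\<dots> = (\<Sum>b\<in>onb D. (v \<bullet> b) *\<^sub>R A b)"
    using onb[OF assms(2)] linear_onD(2)[OF assms(1,2)] by (intro sum.cong) auto
  finally show ?thesis .
qed

text \<open>
  The identity on the orthogonal complement keeps the extension invertible, which reduces linear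
  equations on a subspace to linear equations on a Banach space.
\<close>

definition ext_blinfun :: "'d::euclidean_space set \<Rightarrow> ('d \<Rightarrow> 'd) \<Rightarrow> 'd \<Rightarrow>\<^sub>L 'd" where
  "ext_blinfun D A = (\<Sum>b\<in>onb D. blinfun_scaleR_left (A b) o\<^sub>L blinfun_inner_left b) + (id_blinfun - Blinfun (proj D))"

lemma ext_blinfun_apply:
  assumes "linear_on D A" "subspace D"
  shows "ext_blinfun D A w = A (proj D w) + (w - proj D w)"
proof -
  have "A (proj D w) = (\<Sum>b\<in>onb D. (w \<bullet> b) *\<^sub>R A b)"
    using linear_on_expand[OF assms proj_in[OF assms(2), of w]] proj_inner[OF assms(2)] onb(1)[OF assms(2)]
    by (simp add: subset_iff)
  then show ?thesis
    by (simp add: ext_blinfun_def blinfun.add_left blinfun.diff_left blinfun.sum_left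
      bounded_linear_Blinfun_apply[OF bounded_linear_proj] blinfun_scaleR_left.rep_eq blinfun_inner_left.rep_eq inner_commute)
qed

lemma C_k_on_ext_blinfun:
  assumes "rel_open E U" "subspace D" "\<And>b. b \<in> D \<Longrightarrow> C_k_on k E U (\<lambda>q. A q b)"
  shows "C_k_on k E U (\<lambda>q. ext_blinfun D (A q))"
  unfolding ext_blinfun_def
proof (intro C_k_on_add C_k_on_sum assms(1) C_k_on_const)
  fix b assume b: "b \<in> onb D"
  have "bounded_linear (\<lambda>a. blinfun_scaleR_left a o\<^sub>L blinfun_inner_left b)"
    by (rule bounded_linear_compose[OF bounded_bilinear.bounded_linear_left[OF bounded_bilinear_blinfun_compose] bounded_linear_blinfun_scaleR_left])
  from C_k_on_bounded_linear_comp[OF assms(1) this assms(3)]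
  show "C_k_on k E U (\<lambda>q. blinfun_scaleR_left (A q b) o\<^sub>L blinfun_inner_left b)" using b onb(1)[OF assms(2)] by blast
qed

text \<open>A zero of the extension satisfies \<open>w = proj D w - A (proj D w)\<close> and hence
  lies in \<open>D\<close>, where the extension is \<open>A\<close> itself.\<close>

lemma ext_blinfun_inj:
  assumes "linear_on D A" "subspace D" "\<And>w. w \<in> D \<Longrightarrow> A w \<in> D" "\<And>w. w \<in> D \<Longrightarrow> A w = 0 \<Longrightarrow> w = 0"
  shows "inj (blinfun_apply (ext_blinfun D A))"
proof (rule linear_injective_0[THEN iffD2, OF _ allI[OF impI]])
  show "linear (blinfun_apply (ext_blinfun D A))" using blinfun.bounded_linear_right bounded_linear.linear by blast
  fix w assume "blinfun_apply (ext_blinfun D A) w = 0"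
  then have eq: "A (proj D w) + (w - proj D w) = 0" using ext_blinfun_apply[OF assms(1,2)] by simp
  then have "w = proj D w - A (proj D w)" by (simp add: algebra_simps eq_neg_iff_add_eq_0)
  then have "w \<in> D" using assms(3)[OF proj_in[OF assms(2), of w]] proj_in[OF assms(2), of w] subspace_diff[OF assms(2)] by metis
  then show "w = 0" using eq assms(4)[of w] proj_id[OF assms(2)] by simp
qed

text \<open>\<open>C_k_on_solve\<close> asks for a lower bound and for surjectivity. In finite
  dimension both follow from injectivity of the extended operator.\<close>

lemma C_k_on_solve_subspace:
  fixes A :: "'e::euclidean_space \<Rightarrow> 'd::euclidean_space \<Rightarrow> 'd"
  assumes U: "rel_open E U" and D: "subspace D"
    and lin: "\<And>q. q \<in> U \<Longrightarrow> linear_on D (A q)"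
    and into: "\<And>q w. q \<in> U \<Longrightarrow> w \<in> D \<Longrightarrow> A q w \<in> D"
    and inj: "\<And>q w. q \<in> U \<Longrightarrow> w \<in> D \<Longrightarrow> A q w = 0 \<Longrightarrow> w = 0"
    and A: "\<And>w. w \<in> D \<Longrightarrow> C_k_on k E U (\<lambda>q. A q w)"
    and b: "C_k_on k E U b"
    and h: "\<And>q. q \<in> U \<Longrightarrow> h q \<in> D" "\<And>q. q \<in> U \<Longrightarrow> A q (h q) = b q"
  shows "C_k_on k E U h"
proof (rule C_k_on_solve[OF U C_k_on_ext_blinfun[OF U D A] b])
  fix p assume p: "p \<in> U"
  have inj': "inj (blinfun_apply (ext_blinfun D (A p)))"
    by (rule ext_blinfun_inj[OF lin[OF p] D]) (use into inj p in auto)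
  have l: "linear (blinfun_apply (ext_blinfun D (A p)))" using blinfun.bounded_linear_right bounded_linear.linear by blast
  show "surj (blinfun_apply (ext_blinfun D (A p)))" using linear_injective_imp_surjective[OF l inj' refl] .
  obtain B where B: "B > 0" "\<And>x. B * norm x \<le> norm (ext_blinfun D (A p) x)"
    using linear_inj_bounded_below_pos[OF l inj'] by blast
  show "\<exists>K. \<forall>w. norm w \<le> K * norm (ext_blinfun D (A p) w)"
    using B by (intro exI[of _ "1 / B"]) (auto simp: field_simps)
next
  fix q assume q: "q \<in> U"
  show "ext_blinfun D (A q) (h q) = b q"
    using ext_blinfun_apply[OF lin[OF q] D] h[OF q] proj_id[OF D] by simp
qed

text \<open>The extended operator is injective, hence onto. A preimage \<open>w\<close> of a vector
  \<open>y\<close> of \<open>D\<close> lies in \<open>D\<close> again, because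
  \<open>w = y - A (proj D w) + proj D w\<close>.\<close>

lemma linear_on_surj:
  fixes A :: "'d::euclidean_space \<Rightarrow> 'd"
  assumes lin: "linear_on D A" and D: "subspace D" and into: "\<And>w. w \<in> D \<Longrightarrow> A w \<in> D"
    and inj: "\<And>w. w \<in> D \<Longrightarrow> A w = 0 \<Longrightarrow> w = 0" and y: "y \<in> D"
  shows "\<exists>w\<in>D. A w = y"
proof -
  have l: "linear (blinfun_apply (ext_blinfun D A))" using blinfun.bounded_linear_right bounded_linear.linear by blast
  have "surj (blinfun_apply (ext_blinfun D A))"
    using linear_injective_imp_surjective[OF l ext_blinfun_inj[OF lin D] refl] into inj by blast
  then obtain w where w: "ext_blinfun D A w = y" by (metis surjD)
  then have eq: "A (proj D w) + (w - proj D w) = y" using ext_blinfun_apply[OF lin D] by simp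
  have "w = y - A (proj D w) + proj D w" using eq by (simp add: algebra_simps)
  then have "w \<in> D" using into[OF proj_in[OF D, of w]] proj_in[OF D, of w] y subspace_diff[OF D] subspace_add[OF D] by metis
  then show ?thesis using eq proj_id[OF D] by auto
qed

section \<open>Flows of vector fields\<close>

definition clamp1 :: "real \<Rightarrow> real" where "clamp1 s = max (-1) (min 1 s)"

lemma clamp1_in: "clamp1 s \<in> {-1..1}"
  by (auto simp: clamp1_def)

lemma clamp1_id: "s \<in> {-1..1} \<Longrightarrow> clamp1 s = s"
  by (auto simp: clamp1_def)

lemma continuous_clamp1: "continuous_on S clamp1"
  unfolding clamp1_def by (intro continuous_intros)

text \<open>
  Curves on \<open>[-1, 1]\<close> are continued to the line by their end values, so that they form a Banach
  space. Smooth dependence of a flow on its initial value is smoothness of a fixed point in that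
  space, where time no longer appears as a variable.
\<close>

definition curve :: "(real \<Rightarrow> 'd::real_normed_vector) \<Rightarrow> real \<Rightarrow>\<^sub>C 'd" where
  "curve f = Bcontfun (\<lambda>s. f (clamp1 s))"

lemma curve_apply:
  assumes "continuous_on {-1..1} f"
  shows "apply_bcontfun (curve f) s = f (clamp1 s)"
proof -
  have c: "continuous_on UNIV (\<lambda>s. f (clamp1 s))"
    using continuous_on_compose2[OF assms continuous_clamp1] clamp1_in by blast
  have "compact (f ` {-1..1})" using compact_continuous_image[OF assms] by simp
  then have "bounded (range (\<lambda>s. f (clamp1 s)))"
    by (rule bounded_subset[OF compact_imp_bounded]) (use clamp1_in in auto)
  then have "(\<lambda>s. f (clamp1 s)) \<in> bcontfun" using c by (simp add: bcontfun_def)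
  then show ?thesis by (simp add: curve_def Bcontfun_inverse)
qed

text \<open>The primitive that vanishes at time 0. It is a difference of integrals from -1 because
  the interval \<open>{0..s}\<close> is empty for negative \<open>s\<close>.\<close>

definition curve_integral :: "(real \<Rightarrow>\<^sub>C 'd::euclidean_space) \<Rightarrow> real \<Rightarrow>\<^sub>C 'd" where
  "curve_integral w = curve (\<lambda>s. integral {-1..s} (apply_bcontfun w) - integral {-1..0} (apply_bcontfun w))"

lemma integral_deriv:
  fixes w :: "real \<Rightarrow>\<^sub>C 'd::euclidean_space"
  assumes "s \<in> {-1..1}"
  shows "((\<lambda>s. integral {-1..s} (apply_bcontfun w) - integral {-1..0} (apply_bcontfun w)) has_vector_derivative w s) (at s within {-1..1})"
proof -
  have "((\<lambda>s. integral {-1..s} (apply_bcontfun w) - integral {-1..0} (apply_bcontfun w)) has_vector_derivative w s - 0) (at s within {-1..1})"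
    by (intro has_vector_derivative_diff has_vector_derivative_const integral_has_vector_derivative[OF _ assms]) simp
  then show ?thesis by simp
qed

lemma curve_integral_apply:
  "curve_integral w s = integral {-1..clamp1 s} (apply_bcontfun w) - integral {-1..0} (apply_bcontfun w)"
  unfolding curve_integral_def
  by (rule curve_apply) (use integral_deriv has_vector_derivative_continuous in \<open>blast intro: continuous_at_imp_continuous_on continuous_on_eq_continuous_within[THEN iffD2]\<close>)

lemma curve_integral_deriv:
  assumes "s \<in> {-1..1}"
  shows "(apply_bcontfun (curve_integral w) has_vector_derivative w s) (at s within {-1..1})"
  by (rule has_vector_derivative_transform[OF assms _ integral_deriv[OF assms]])
     (simp add: curve_integral_apply clamp1_id)

lemma curve_integral_0: "curve_integral w 0 = 0"
  by (simp add: curve_integral_apply clamp1_def)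

text \<open>Mean value inequality. With \<open>B = 0\<close> it serves throughout to show that a
  quantity is constant in time.\<close>

lemma vector_derivative_bound:
  fixes f :: "real \<Rightarrow> 'd::real_normed_vector"
  assumes "\<And>s. s \<in> {a..b} \<Longrightarrow> (f has_vector_derivative f' s) (at s within {a..b})"
    "\<And>s. s \<in> {a..b} \<Longrightarrow> norm (f' s) \<le> B" "x \<in> {a..b}" "y \<in> {a..b}"
  shows "norm (f x - f y) \<le> B * \<bar>x - y\<bar>"
proof -
  have "norm (f x - f y) \<le> B * norm (x - y)"
  proof (rule differentiable_bound[OF convex_real_interval(5) _ _ assms(3,4)])
    show "(f has_derivative (\<lambda>h. h *\<^sub>R f' s)) (at s within {a..b})" if "s \<in> {a..b}" for s
      using assms(1)[OF that] by (simp add: has_vector_derivative_def)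
    show "onorm (\<lambda>h. h *\<^sub>R f' s) \<le> B" if "s \<in> {a..b}" for s
      using assms(2)[OF that] by (intro onorm_le) (simp add: mult.commute[of B] mult_left_mono)
  qed
  then show ?thesis by simp
qed

lemma curve_integral_unique:
  fixes g :: "real \<Rightarrow> 'd::euclidean_space" and w :: "real \<Rightarrow>\<^sub>C 'd"
  assumes "\<And>s. s \<in> {-1..1} \<Longrightarrow> (g has_vector_derivative w s) (at s within {-1..1})" "s \<in> {-1..1}"
  shows "g s = g 0 + curve_integral w s"
proof -
  let ?f = "\<lambda>s. g s - curve_integral w s"
  have "norm (?f s - ?f 0) \<le> 0 * \<bar>s - 0\<bar>"
  proof (rule vector_derivative_bound[where a="-1" and b=1 and f'="\<lambda>_. 0"])
    show "(?f has_vector_derivative 0) (at t within {-1..1})" if "t \<in> {-1..1}" for t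
      using has_vector_derivative_diff[OF assms(1)[OF that] curve_integral_deriv[OF that, of w]] by simp
  qed (use assms in auto)
  then show ?thesis by (simp add: curve_integral_0 algebra_simps)
qed

text \<open>No time in \<open>[-1, 1]\<close> is further than 1 from 0. With this normalisation of
  the interval, whether the Picard map contracts depends on the vector field alone.\<close>

lemma norm_curve_integral: "norm (curve_integral w) \<le> norm w"
proof (rule norm_bound)
  fix s
  have "curve_integral w s = curve_integral w (clamp1 s)" by (simp add: curve_integral_apply clamp1_id[OF clamp1_in])
  then have "norm (curve_integral w s) = norm (curve_integral w (clamp1 s) - curve_integral w 0)" by (simp add: curve_integral_0)
  also have "\<dots> \<le> norm w * \<bar>clamp1 s - 0\<bar>"
    by (rule vector_derivative_bound[OF curve_integral_deriv]) (use clamp1_in norm_bounded in auto)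
  also have "\<dots> \<le> norm w * 1" using clamp1_in[of s] by (intro mult_left_mono) auto
  finally show "norm (curve_integral w s) \<le> norm w" by simp
qed

lemma bounded_linear_curve_integral: "bounded_linear (curve_integral :: (real \<Rightarrow>\<^sub>C 'd::euclidean_space) \<Rightarrow> _)"
proof (rule bounded_linear_intro[where K=1])
  show "curve_integral (x + y) = curve_integral x + curve_integral y" for x y :: "real \<Rightarrow>\<^sub>C 'd"
    by (rule bcontfun_eqI) (simp add: curve_integral_apply integral_add integrable_continuous_interval algebra_simps)
  show "curve_integral (r *\<^sub>R x) = r *\<^sub>R curve_integral x" for r and x :: "real \<Rightarrow>\<^sub>C 'd"
    by (rule bcontfun_eqI) (simp add: curve_integral_apply algebra_simps)
qed (simp add: norm_curve_integral)

text \<open>Integration commutes with the bounded linear map \<open>proj D\<close>, which fixes the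
  values of the integrand.\<close>

lemma curve_integral_in_subspace:
  fixes w :: "real \<Rightarrow>\<^sub>C 'd::euclidean_space"
  assumes "subspace D" "\<And>s. s \<in> {-1..1} \<Longrightarrow> w s \<in> D"
  shows "curve_integral w s \<in> D"
proof -
  have "integral {-1..t} (apply_bcontfun w) \<in> D" if t: "t \<in> {-1..1}" for t
  proof -
    have "proj D (integral {-1..t} (apply_bcontfun w)) = integral {-1..t} (proj D \<circ> apply_bcontfun w)"
      by (rule integral_linear[symmetric]) (auto simp: bounded_linear_proj integrable_continuous_interval)
    also have "\<dots> = integral {-1..t} (apply_bcontfun w)"
      by (rule Henstock_Kurzweil_Integration.integral_cong) (use proj_id[OF assms(1)] assms(2) t in auto)
    finally show ?thesis using proj_in[OF assms(1)] by metis
  qed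
  then show ?thesis using subspace_diff[OF assms(1)] clamp1_in by (auto simp: curve_integral_apply)
qed

section \<open>Pointwise operations on curves and superposition operators\<close>

definition cscale :: "(real \<Rightarrow>\<^sub>C 'd::real_normed_vector) \<Rightarrow> (real \<Rightarrow>\<^sub>C real) \<Rightarrow> real \<Rightarrow>\<^sub>C 'd" where
  "cscale w a = curve (\<lambda>s. a s *\<^sub>R w s)"

lemma cscale_apply: "cscale w a s = a (clamp1 s) *\<^sub>R w (clamp1 s)"
  unfolding cscale_def by (subst curve_apply) (auto intro!: continuous_intros)

lemma bounded_bilinear_cscale: "bounded_bilinear (cscale :: (real \<Rightarrow>\<^sub>C 'd::real_normed_vector) \<Rightarrow> _)"
proof
  have "norm (cscale a b) \<le> norm a * norm b * 1" for a :: "real \<Rightarrow>\<^sub>C 'd" and b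
    by (rule norm_bound) (auto simp: cscale_apply mult.commute[of "norm a"] intro!: mult_mono order_trans[OF _ norm_bounded[of b]] norm_bounded)
  then show "\<exists>K. \<forall>a b. norm (cscale a b :: real \<Rightarrow>\<^sub>C 'd) \<le> norm a * norm b * K" by blast
qed (auto intro!: bcontfun_eqI simp: cscale_apply algebra_simps)

text \<open>Pairing with a fixed basis vector, followed by \<open>cscale\<close> with a curve of
  coefficients, generates the pointwise linear operators on curves that occur below. These thereby
  become sums of compositions of bounded linear and bilinear maps.\<close>

definition cinner :: "'d::euclidean_space \<Rightarrow> (real \<Rightarrow>\<^sub>C 'd) \<Rightarrow> real \<Rightarrow>\<^sub>C real" where
  "cinner b w = curve (\<lambda>s. w s \<bullet> b)"

lemma cinner_apply: "cinner b w s = w (clamp1 s) \<bullet> b"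
  unfolding cinner_def by (subst curve_apply) (auto intro!: continuous_intros)

lemma bounded_linear_cinner: "bounded_linear (cinner b)"
proof (rule bounded_linear_intro[where K="norm b"])
  show "norm (cinner b x) \<le> norm x * norm b" for x
    by (rule norm_bound) (auto simp: cinner_apply intro!: order_trans[OF Cauchy_Schwarz_ineq2] mult_right_mono norm_bounded)
qed (auto intro!: bcontfun_eqI simp: cinner_apply inner_add_left)

lemma bounded_linear_eval: "bounded_linear (\<lambda>w::real \<Rightarrow>\<^sub>C 'd::real_normed_vector. w s)"
  by (rule bounded_linear_intro[where K=1]) (auto simp: norm_bounded)

lemma bounded_linear_const_bcontfun: "bounded_linear (const_bcontfun :: 'd::real_normed_vector \<Rightarrow> real \<Rightarrow>\<^sub>C 'd)"
  by (rule bounded_linear_intro[where K=1]) (auto intro!: bcontfun_eqI norm_bound)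

text \<open>The superposition operator, which applies \<open>g\<close> at each time. The vector
  field enters the Picard map only through it.\<close>

definition nemytskii :: "('d::euclidean_space \<Rightarrow> 'h::real_normed_vector) \<Rightarrow> (real \<Rightarrow>\<^sub>C 'd) \<Rightarrow> real \<Rightarrow>\<^sub>C 'h" where
  "nemytskii g u = curve (\<lambda>s. g (u s))"

lemma nemytskii_apply:
  fixes u :: "real \<Rightarrow>\<^sub>C 'd::euclidean_space"
  assumes "continuous_on \<Omega> g" "\<And>s. s \<in> {-1..1} \<Longrightarrow> u s \<in> \<Omega>"
  shows "nemytskii g u s = g (u (clamp1 s))"
  unfolding nemytskii_def
  by (rule curve_apply) (use assms in \<open>auto intro!: continuous_on_compose2[OF assms(1)]\<close>)

lemma compact_enlarge:
  assumes "rel_open D \<Omega>" "compact K" "K \<subseteq> \<Omega>"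
  obtains e where "e > 0" "compact (D \<inter> (\<Union>x\<in>K. cball x e))" "D \<inter> (\<Union>x\<in>K. cball x e) \<subseteq> \<Omega>"
proof -
  obtain T where T: "open T" "\<Omega> = D \<inter> T" using assms unfolding rel_open_def openin_open by auto
  obtain e where e: "e > 0" "(\<Union>x\<in>K. cball x e) \<subseteq> T"
    using compact_subset_open_imp_cball_epsilon_subset[of K T] assms T by auto
  have "compact (\<Union>x\<in>K. cball x e)" using compact_minkowski_sum_cball[OF assms(2)] .
  then have "compact (D \<inter> (\<Union>x\<in>K. cball x e))"
    using closed_subspace[OF rel_open_subspace[OF assms(1)]] by (simp add: closed_Int_compact)
  then show ?thesis using that e T by blast
qed

text \<open>A compact set has a compact neighbourhood relative to \<open>D\<close> inside
  \<open>\<Omega>\<close>, and \<open>f\<close> is uniformly continuous there. The point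
  \<open>y\<close> may lie outside \<open>K\<close> because a perturbed curve leaves the image of
  the original one.\<close>

lemma uniform_near_compact:
  fixes f :: "'d::euclidean_space \<Rightarrow> 'h::real_normed_vector"
  assumes "rel_open D \<Omega>" "compact K" "K \<subseteq> \<Omega>" "continuous_on \<Omega> f" "e > 0"
  obtains d where "d > 0" "\<And>k y. k \<in> K \<Longrightarrow> y \<in> D \<Longrightarrow> norm (y - k) < d \<Longrightarrow> y \<in> \<Omega> \<and> norm (f y - f k) < e"
proof -
  obtain e1 where e1: "e1 > 0" "compact (D \<inter> (\<Union>x\<in>K. cball x e1))" "D \<inter> (\<Union>x\<in>K. cball x e1) \<subseteq> \<Omega>"
    using compact_enlarge[OF assms(1-3)] .
  let ?K = "D \<inter> (\<Union>x\<in>K. cball x e1)"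
  have "uniformly_continuous_on ?K f"
    using compact_uniformly_continuous[OF continuous_on_subset[OF assms(4) e1(3)] e1(2)] .
  then obtain d where d: "d > 0" "\<And>x y. x \<in> ?K \<Longrightarrow> y \<in> ?K \<Longrightarrow> norm (y - x) < d \<Longrightarrow> norm (f y - f x) < e"
    using assms(5) unfolding uniformly_continuous_on_def dist_norm by metis
  show ?thesis
  proof (rule that[of "min d e1"])
    fix k y assume k: "k \<in> K" "y \<in> D" "norm (y - k) < min d e1"
    have "y \<in> ?K" using k by (auto simp: dist_norm norm_minus_commute intro!: bexI[of _ k])
    moreover have "k \<in> ?K" using k e1 assms rel_open_subset[OF assms(1)] by force
    ultimately have "norm (f y - f k) < e" using d(2) k by simp
    then show "y \<in> \<Omega> \<and> norm (f y - f k) < e" using \<open>y \<in> ?K\<close> e1(3) by blast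
  qed (use d e1 in auto)
qed

lemma onb_sum_norm_le:
  assumes "subspace D"
  shows "norm (\<Sum>b\<in>onb D. (w \<bullet> b) *\<^sub>R F b) \<le> norm w * (\<Sum>b\<in>onb D. norm (F b))"
proof -
  have "norm (\<Sum>b\<in>onb D. (w \<bullet> b) *\<^sub>R F b) \<le> (\<Sum>b\<in>onb D. norm w * norm (F b))"
  proof (rule sum_norm_le)
    fix b assume b: "b \<in> onb D"
    have "\<bar>w \<bullet> b\<bar> \<le> norm w" using Cauchy_Schwarz_ineq2[of w b] onb(6)[OF assms] b by simp
    then show "norm ((w \<bullet> b) *\<^sub>R F b) \<le> norm w * norm (F b)" by (simp add: mult_right_mono)
  qed
  then show ?thesis by (simp add: sum_distrib_left)
qed

lemma segment_derivative:
  fixes g :: "'d::euclidean_space \<Rightarrow> 'h::real_normed_vector"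
  assumes "rel_open D \<Omega>" "C_k_on (Suc j) D \<Omega> g" "k \<in> D" "v \<in> D" "k + t *\<^sub>R v \<in> \<Omega>"
  shows "((\<lambda>t. g (k + t *\<^sub>R v)) has_vector_derivative (\<Sum>b\<in>onb D. (v \<bullet> b) *\<^sub>R deriv_in D g (k + t *\<^sub>R v) b)) (at t within S)"
proof -
  have D: "subspace D" using assms rel_open_subspace by auto
  have sub: "(\<lambda>t. k + t *\<^sub>R v) ` S \<subseteq> D" using assms D by (auto intro: subspace_add subspace_scale)
  have "(g has_derivative deriv_in D g (k + t *\<^sub>R v)) (at (k + t *\<^sub>R v) within (\<lambda>t. k + t *\<^sub>R v) ` S)"
    using C_k_on_SucD(1)[OF assms(2,5)] has_derivative_subset[OF _ sub] by blast
  moreover have "((\<lambda>s. k + s *\<^sub>R v) has_derivative (\<lambda>t. t *\<^sub>R v)) (at t within S)"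
    by (auto intro!: derivative_eq_intros)
  ultimately have 1: "((\<lambda>s. g (k + s *\<^sub>R v)) has_derivative (\<lambda>s. deriv_in D g (k + t *\<^sub>R v) (s *\<^sub>R v))) (at t within S)"
    by (rule has_derivative_in_compose[rotated])
  have lin: "linear (deriv_in D g (k + t *\<^sub>R v))" using linear_deriv_in assms(2,5) C_k_on.simps(2) by blast
  show ?thesis using 1 linear_onb_expand[OF D assms(4) lin]
    by (simp add: has_vector_derivative_def linear_cmul[OF lin])
qed

text \<open>The mean value inequality is applied on the segment from \<open>k\<close> to
  \<open>y\<close> to \<open>g\<close> minus its linearisation at \<open>k\<close>. Uniform
  closeness of the directional derivatives near \<open>K\<close> makes the bound independent of
  \<open>k\<close>, as differentiation in the supremum norm of curves requires.\<close>

lemma uniform_differentiable_near_compact: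
  fixes g :: "'d::euclidean_space \<Rightarrow> 'h::real_normed_vector"
  assumes "rel_open D \<Omega>" "compact K" "K \<subseteq> \<Omega>" "C_k_on (Suc j) D \<Omega> g" "e > 0"
  obtains d where "d > 0" "\<And>k y. k \<in> K \<Longrightarrow> y \<in> D \<Longrightarrow> norm (y - k) < d \<Longrightarrow>
     norm (g y - g k - (\<Sum>b\<in>onb D. ((y - k) \<bullet> b) *\<^sub>R deriv_in D g k b)) \<le> e * norm (y - k)"
proof -
  have D: "subspace D" using assms rel_open_subspace by auto
  \<comment> \<open>The error is shared among the basis vectors; adding 1 keeps \<open>N\<close>
    positive for the zero subspace.\<close>
  define N where "N = real (card (onb D)) + 1"
  have N: "N > 0" by (simp add: N_def)
  have "\<exists>d>0. \<forall>k\<in>K. \<forall>y\<in>D. norm (y - k) < d \<longrightarrow> y \<in> \<Omega> \<and> norm (deriv_in D g y b - deriv_in D g k b) < e / N" if "b \<in> onb D" for b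
  proof -
    have "continuous_on \<Omega> (\<lambda>y. deriv_in D g y b)"
      using C_k_on_continuous[OF assms(1) C_k_on_SucD(2)[OF assms(4)]] that onb(1)[OF D] by blast
    from uniform_near_compact[OF assms(1-3) this] show ?thesis using assms(5) N by (metis divide_pos_pos)
  qed
  then obtain dd where dd: "\<And>b. b \<in> onb D \<Longrightarrow> dd b > 0" "\<And>b k y. b \<in> onb D \<Longrightarrow> k \<in> K \<Longrightarrow> y \<in> D \<Longrightarrow> norm (y - k) < dd b \<Longrightarrow>
    norm (deriv_in D g y b - deriv_in D g k b) < e / N" by metis
  obtain d0 where d0: "d0 > 0" "\<And>k y. k \<in> K \<Longrightarrow> y \<in> D \<Longrightarrow> norm (y - k) < d0 \<Longrightarrow> y \<in> \<Omega>"
    using uniform_near_compact[OF assms(1-3), of "\<lambda>_. 0::real" 1] by auto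
  define d where "d = Min (insert d0 (dd ` onb D))"
  have fin: "finite (insert d0 (dd ` onb D))" using onb(2)[OF D] by simp
  have d: "d > 0" using dd d0 fin by (auto simp: d_def)
  have dle: "d \<le> d0" "\<And>b. b \<in> onb D \<Longrightarrow> d \<le> dd b" using fin by (auto simp: d_def)
  show ?thesis
  proof (rule that[OF d])
    fix k y assume k: "k \<in> K" and y: "y \<in> D" and yk: "norm (y - k) < d"
    have kD: "k \<in> D" using k assms rel_open_subset by blast
    have vD: "y - k \<in> D" using D y kD by (simp add: subspace_diff)
    define G where "G t = (\<Sum>b\<in>onb D. ((y - k) \<bullet> b) *\<^sub>R deriv_in D g (k + t *\<^sub>R (y - k)) b)" for t
    let ?f = "\<lambda>t. g (k + t *\<^sub>R (y - k)) - t *\<^sub>R G 0"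
    have near: "k + t *\<^sub>R (y - k) \<in> D" "norm ((k + t *\<^sub>R (y - k)) - k) < d" if "t \<in> {0..1}" for t
    proof -
      show "k + t *\<^sub>R (y - k) \<in> D" using D kD vD by (intro subspace_add subspace_scale)
      have "t * norm (y - k) \<le> 1 * norm (y - k)" using that by (intro mult_right_mono) auto
      then show "norm ((k + t *\<^sub>R (y - k)) - k) < d" using that yk by simp
    qed
    have "norm (?f 1 - ?f 0) \<le> (norm (y - k) * e) * \<bar>1 - 0\<bar>"
    proof (rule vector_derivative_bound[where a=0 and b=1 and f'="\<lambda>t. G t - G 0"])
      fix t :: real assume t: "t \<in> {0..1}"
      have in\<Omega>: "k + t *\<^sub>R (y - k) \<in> \<Omega>" using near[OF t] d0(2)[OF k] dle(1) by force
      show "(?f has_vector_derivative G t - G 0) (at t within {0..1})"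
        unfolding G_def
        by (intro has_vector_derivative_diff segment_derivative[OF assms(1,4) kD vD in\<Omega>])
          (auto intro!: derivative_eq_intros)
      have "G t - G 0 = (\<Sum>b\<in>onb D. ((y - k) \<bullet> b) *\<^sub>R (deriv_in D g (k + t *\<^sub>R (y - k)) b - deriv_in D g k b))"
        by (simp add: G_def sum_subtractf scaleR_diff_right)
      also have "norm \<dots> \<le> norm (y - k) * (\<Sum>b\<in>onb D. norm (deriv_in D g (k + t *\<^sub>R (y - k)) b - deriv_in D g k b))"
        by (rule onb_sum_norm_le[OF D])
      also have "\<dots> \<le> norm (y - k) * (\<Sum>b\<in>onb D. e / N)"
        using dd(2)[OF _ k near(1)[OF t]] near(2)[OF t] dle by (intro mult_left_mono sum_mono) (force intro: less_imp_le)+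
      also have "(\<Sum>b\<in>onb D. e / N) \<le> e"
        using N assms(5) by (simp add: N_def field_simps)
      finally show "norm (G t - G 0) \<le> norm (y - k) * e" by (simp add: mult_left_mono)
    qed auto
    then show "norm (g y - g k - (\<Sum>b\<in>onb D. ((y - k) \<bullet> b) *\<^sub>R deriv_in D g k b)) \<le> e * norm (y - k)"
      by (simp add: G_def algebra_simps)
  qed
qed

lemma compact_curve_image: "compact (apply_bcontfun u ` {-1..1::real})"
  by (rule compact_continuous_image) auto

lemma nemytskii_continuous_on:
  fixes u :: "'e::euclidean_space \<Rightarrow> real \<Rightarrow>\<^sub>C 'd::euclidean_space" and g :: "'d \<Rightarrow> 'h::real_normed_vector"
  assumes "rel_open D \<Omega>" "continuous_on U u" "\<And>p s. p \<in> U \<Longrightarrow> s \<in> {-1..1} \<Longrightarrow> u p s \<in> \<Omega>" "continuous_on \<Omega> g"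
  shows "continuous_on U (\<lambda>p. nemytskii g (u p))"
  unfolding continuous_on_iff
proof (intro ballI allI impI)
  fix p and e :: real assume p: "p \<in> U" and e: "e > 0"
  have "apply_bcontfun (u p) ` {-1..1} \<subseteq> \<Omega>" using assms p by auto
  from uniform_near_compact[OF assms(1) compact_curve_image this assms(4), of "e/2"] e
  obtain d where d: "d > 0" "\<And>k y. k \<in> apply_bcontfun (u p) ` {-1..1} \<Longrightarrow> y \<in> D \<Longrightarrow> norm (y - k) < d \<Longrightarrow> norm (g y - g k) < e / 2"
    by (metis half_gt_zero)
  obtain d' where d': "d' > 0" "\<And>q. q \<in> U \<Longrightarrow> dist q p < d' \<Longrightarrow> dist (u q) (u p) < d"
    using assms(2) p d(1) unfolding continuous_on_iff by metis
  show "\<exists>d>0. \<forall>x'\<in>U. dist x' p < d \<longrightarrow> dist (nemytskii g (u x')) (nemytskii g (u p)) < e"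
  proof (intro exI[of _ d'] conjI ballI impI d')
    fix q assume q: "q \<in> U" "dist q p < d'"
    have "dist (nemytskii g (u q)) (nemytskii g (u p)) \<le> e / 2"
    proof (rule dist_bound)
      fix s
      have "norm (u q (clamp1 s) - u p (clamp1 s)) < d"
        using d'(2)[OF q] norm_bounded[of "u q - u p" "clamp1 s"] by (simp add: dist_norm)
      moreover have "u q (clamp1 s) \<in> D" using assms(3)[OF q(1) clamp1_in] rel_open_subset[OF assms(1)] by blast
      ultimately have "norm (g (u q (clamp1 s)) - g (u p (clamp1 s))) < e / 2" using d(2) clamp1_in by blast
      then show "dist (nemytskii g (u q) s) (nemytskii g (u p) s) \<le> e / 2"
        using nemytskii_apply[OF assms(4) assms(3)] q p by (simp add: dist_norm)
    qed
    then show "dist (nemytskii g (u q)) (nemytskii g (u p)) < e" using e by linarith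
  qed
qed

lemma sum_bcontfun_apply: "apply_bcontfun (\<Sum>i\<in>I. f i) s = (\<Sum>i\<in>I. apply_bcontfun (f i) s)"
  by (induction I rule: infinite_finite_induct) auto

text \<open>The superposition operator has as derivative the multiplication by the derivative of
  \<open>g\<close> along the curve. In basis components this is built from the superposition
  operators of the directional derivatives of \<open>g\<close>, which have one order less, so the
  induction on \<open>k\<close> closes.\<close>

lemma C_k_on_nemytskii:
  fixes u :: "'e::euclidean_space \<Rightarrow> real \<Rightarrow>\<^sub>C 'd::euclidean_space" and g :: "'d \<Rightarrow> 'h::real_normed_vector"
  assumes D: "rel_open D \<Omega>" and U: "rel_open E U" and in\<Omega>: "\<And>p s. p \<in> U \<Longrightarrow> s \<in> {-1..1} \<Longrightarrow> u p s \<in> \<Omega>"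
    and u: "C_k_on k E U u" and g: "C_k_on k D \<Omega> g"
  shows "C_k_on k E U (\<lambda>p. nemytskii g (u p))"
  using u g
proof (induction k arbitrary: g)
  case 0
  then show ?case using nemytskii_continuous_on[OF D _ in\<Omega>] by simp
next
  case (Suc k)
  have subD: "subspace D" using D rel_open_subspace by auto
  note u = C_k_on_SucD[OF Suc.prems(1)] and g = C_k_on_SucD[OF Suc.prems(2)]
  have contg: "continuous_on \<Omega> g" using C_k_on_continuous[OF D Suc.prems(2)] .
  have contdg: "continuous_on \<Omega> (\<lambda>y. deriv_in D g y b)" if "b \<in> onb D" for b
    using C_k_on_continuous[OF D g(2)] that onb(1)[OF subD] by blast
  define A where "A p w = (\<Sum>b\<in>onb D. cscale (nemytskii (\<lambda>y. deriv_in D g y b) (u p)) (cinner b w))" for p w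
  have A_apply: "A p w s = (\<Sum>b\<in>onb D. (w (clamp1 s) \<bullet> b) *\<^sub>R deriv_in D g (u p (clamp1 s)) b)" if "p \<in> U" for p w s
    using nemytskii_apply[OF contdg in\<Omega>] that
    by (simp add: A_def sum_bcontfun_apply cscale_apply cinner_apply clamp1_id[OF clamp1_in])
  show ?case
  proof (rule C_k_on_SucI[OF U, where D="\<lambda>p v. A p (deriv_in E u p v)"])
    fix v assume v: "v \<in> E"
    show "C_k_on k E U (\<lambda>p. A p (deriv_in E u p v))" unfolding A_def
      using v u(2) g(2) onb(1)[OF subD] Suc.IH C_k_on_Suc_imp[OF U Suc.prems(1)]
      by (intro C_k_on_sum U C_k_on_bilinear[OF U bounded_bilinear_cscale] C_k_on_bounded_linear_comp[OF U bounded_linear_cinner]) auto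
  next
    fix p assume p: "p \<in> U"
    have bA: "bounded_linear (A p)" unfolding A_def
      by (intro bounded_linear_sum bounded_linear_compose[OF bounded_bilinear.bounded_linear_right[OF bounded_bilinear_cscale] bounded_linear_cinner])
    obtain C where C: "C > 0" "\<And>w. norm (A p w) \<le> norm w * C" using bounded_linear.pos_bounded[OF bA] by blast
    have u': "(u has_derivative deriv_in E u p) (at p within U)" using u(1)[OF p] rel_open_at_within[OF U p] by simp
    obtain C2 where C2: "C2 > 0" "\<And>v. norm (deriv_in E u p v) \<le> norm v * C2"
      using bounded_linear.pos_bounded[OF has_derivative_bounded_linear[OF u']] by blast
    have "((\<lambda>p. nemytskii g (u p)) has_derivative (\<lambda>v. A p (deriv_in E u p v))) (at p within U)"
      unfolding has_derivative_within_alt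
    proof (intro conjI allI impI)
      show "bounded_linear (\<lambda>v. A p (deriv_in E u p v))"
        using bounded_linear_compose[OF bA has_derivative_bounded_linear[OF u']] .
      fix e :: real assume e: "e > 0"
      \<comment> \<open>\<open>e1\<close> controls the remainder of \<open>g\<close> and is
        multiplied by the growth bound \<open>C2 + 1\<close> of \<open>u\<close>; \<open>e2\<close>
        controls the remainder of \<open>u\<close> and is multiplied by the bound \<open>C\<close>
        of \<open>A p\<close>. Each contributes \<open>e / 2\<close>.\<close>
      define e1 where "e1 = e / 2 / (C2 + 1)"
      define e2 where "e2 = min 1 (e / (2 * C))"
      have e1: "e1 > 0" "e1 * (C2 + 1) = e / 2"
        using e C2(1) nonzero_eq_divide_eq[THEN iffD1, OF _ e1_def] by (auto simp: e1_def)
      have "e2 * C \<le> e / (2 * C) * C" using C(1) by (intro mult_right_mono) (auto simp: e2_def)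
      then have e2: "e2 > 0" "e2 \<le> 1" "e2 * C \<le> e / 2" using e C(1) by (auto simp: e2_def)
      have "apply_bcontfun (u p) ` {-1..1} \<subseteq> \<Omega>" using in\<Omega> p by auto
      from uniform_differentiable_near_compact[OF D compact_curve_image this Suc.prems(2) e1(1)]
      obtain d where d: "d > 0" "\<And>k y. k \<in> apply_bcontfun (u p) ` {-1..1} \<Longrightarrow> y \<in> D \<Longrightarrow> norm (y - k) < d \<Longrightarrow>
         norm (g y - g k - (\<Sum>b\<in>onb D. ((y - k) \<bullet> b) *\<^sub>R deriv_in D g k b)) \<le> e1 * norm (y - k)" by blast
      obtain d' where d': "d' > 0" "\<And>q. q \<in> U \<Longrightarrow> norm (q - p) < d' \<Longrightarrow> norm (u q - u p - deriv_in E u p (q - p)) \<le> e2 * norm (q - p)"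
        using u' e2(1) unfolding has_derivative_within_alt by blast
      show "\<exists>d>0. \<forall>y\<in>U. norm (y - p) < d \<longrightarrow>
          norm (nemytskii g (u y) - nemytskii g (u p) - A p (deriv_in E u p (y - p))) \<le> e * norm (y - p)"
      proof (intro exI[of _ "min d' (d / (C2 + 1))"] conjI ballI impI)
        fix q assume q: "q \<in> U" "norm (q - p) < min d' (d / (C2 + 1))"
        let ?r = "norm (q - p)"
        have r1: "norm (u q - u p - deriv_in E u p (q - p)) \<le> e2 * ?r" using d'(2) q by simp
        have "norm (u q - u p) \<le> norm (u q - u p - deriv_in E u p (q - p)) + norm (deriv_in E u p (q - p))"
          using norm_triangle_ineq[of "u q - u p - deriv_in E u p (q - p)" "deriv_in E u p (q - p)"] by simp
        also have "\<dots> \<le> 1 * ?r + ?r * C2" using r1 C2(2) e2(2) mult_right_mono[of e2 1 ?r] by (intro add_mono) auto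
        finally have uq: "norm (u q - u p) \<le> ?r * (C2 + 1)" by (simp add: algebra_simps)
        also have "\<dots> < d" using q C2(1) by (simp add: field_simps)
        finally have uqd: "norm (u q - u p) < d" .
        have "norm (nemytskii g (u q) - nemytskii g (u p) - A p (u q - u p)) \<le> e1 * norm (u q - u p)"
        proof (rule norm_bound)
          fix s
          have n: "norm (u q (clamp1 s) - u p (clamp1 s)) \<le> norm (u q - u p)"
            using norm_bounded[of "u q - u p" "clamp1 s"] by simp
          have "norm (g (u q (clamp1 s)) - g (u p (clamp1 s)) - (\<Sum>b\<in>onb D. ((u q (clamp1 s) - u p (clamp1 s)) \<bullet> b) *\<^sub>R deriv_in D g (u p (clamp1 s)) b)) \<le> e1 * norm (u q (clamp1 s) - u p (clamp1 s))"
            using n uqd in\<Omega>[OF q(1) clamp1_in] rel_open_subset[OF D] clamp1_in by (intro d(2)) auto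
          also have "\<dots> \<le> e1 * norm (u q - u p)" using n e1 by (intro mult_left_mono) auto
          finally show "norm (apply_bcontfun (nemytskii g (u q) - nemytskii g (u p) - A p (u q - u p)) s) \<le> e1 * norm (u q - u p)"
            using nemytskii_apply[OF contg in\<Omega>] q p by (simp add: A_apply)
        qed
        also have "\<dots> \<le> e1 * (?r * (C2 + 1))" using uq e1 by (intro mult_left_mono) auto
        also have "\<dots> = (e1 * (C2 + 1)) * ?r" by simp
        also have "\<dots> = e / 2 * ?r" by (simp only: e1(2))
        finally have t1: "norm (nemytskii g (u q) - nemytskii g (u p) - A p (u q - u p)) \<le> e / 2 * ?r" .
        have "norm (A p (u q - u p - deriv_in E u p (q - p))) \<le> norm (u q - u p - deriv_in E u p (q - p)) * C" by (rule C)
        also have "\<dots> \<le> (e2 * ?r) * C" using r1 C(1) by (intro mult_right_mono) auto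
        also have "\<dots> = (e2 * C) * ?r" by simp
        also have "\<dots> \<le> e / 2 * ?r" using e2(3) by (intro mult_right_mono) auto
        finally have t2: "norm (A p (u q - u p - deriv_in E u p (q - p))) \<le> e / 2 * ?r" .
        have eq: "nemytskii g (u q) - nemytskii g (u p) - A p (deriv_in E u p (q - p)) =
          (nemytskii g (u q) - nemytskii g (u p) - A p (u q - u p)) + A p (u q - u p - deriv_in E u p (q - p))"
          by (simp add: linear_diff[OF bounded_linear.linear[OF bA]])
        show "norm (nemytskii g (u q) - nemytskii g (u p) - A p (deriv_in E u p (q - p))) \<le> e * ?r"
          unfolding eq using norm_triangle_le[OF add_mono[OF t1 t2]] by simp
      qed (use d d' C2 in auto)
    qed
    then show "((\<lambda>p. nemytskii g (u p)) has_derivative (\<lambda>v. A p (deriv_in E u p v))) (at p within E)"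
      using rel_open_at_within[OF U p] by simp
  qed
qed

text \<open>The multiplication operator depends in a bounded linear way on its coefficient curve, so
  smoothness of the coefficients passes to the operator-valued map \<open>T\<close> of the flow
  theorem.\<close>

lemma bounded_linear_Blinfun_cscale:
  "bounded_linear (\<lambda>a :: real \<Rightarrow>\<^sub>C 'd::real_normed_vector. Blinfun (cscale a))"
proof -
  have ap: "blinfun_apply (Blinfun (cscale a)) = cscale a" for a :: "real \<Rightarrow>\<^sub>C 'd"
    by (rule bounded_linear_Blinfun_apply[OF bounded_bilinear.bounded_linear_right[OF bounded_bilinear_cscale]])
  have n: "norm (cscale a b) \<le> norm a * norm b" for a :: "real \<Rightarrow>\<^sub>C 'd" and b
    by (rule norm_bound) (auto simp: cscale_apply mult.commute[of "norm a"] intro!: mult_mono order_trans[OF _ norm_bounded[of b]] norm_bounded)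
  show ?thesis
  proof (rule bounded_linear_intro[where K=1])
    show "norm (Blinfun (cscale x)) \<le> norm x * 1" for x :: "real \<Rightarrow>\<^sub>C 'd"
      by (rule norm_blinfun_bound) (simp_all add: ap n)
  qed (auto intro!: blinfun_eqI simp: ap blinfun.add_left blinfun.scaleR_left
      bounded_bilinear.add_left[OF bounded_bilinear_cscale] bounded_bilinear.scaleR_left[OF bounded_bilinear_cscale])
qed

text \<open>Rescaling time by \<open>\<epsilon>\<close> puts all solutions on the fixed interval
  \<open>[-1, 1]\<close>, where the Picard map is a contraction whose fixed point can be
  differentiated in the initial value \<open>b\<close>. The last conclusion identifies the
  derivative of the flow: it suffices to exhibit a solution \<open>W\<close> of the linearised
  equation in \<open>D\<close> with the right initial value.\<close>

theorem local_flow: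
  fixes X :: "'d::euclidean_space \<Rightarrow> 'd"
  assumes \<Omega>: "rel_open D \<Omega>" and X: "smooth_on D \<Omega> X" and into: "X ` \<Omega> \<subseteq> D" and z0: "z0 \<in> \<Omega>"
  obtains \<epsilon> \<delta> \<phi> where "\<epsilon> > 0" "\<delta> > 0" "D \<inter> ball z0 \<delta> \<subseteq> \<Omega>"
    "\<And>b. b \<in> D \<inter> ball z0 \<delta> \<Longrightarrow> \<phi> b 0 = b"
    "\<And>b s. b \<in> D \<inter> ball z0 \<delta> \<Longrightarrow> s \<in> {-1..1} \<Longrightarrow> \<phi> b s \<in> \<Omega>"
    "\<And>b s. b \<in> D \<inter> ball z0 \<delta> \<Longrightarrow> s \<in> {-1..1} \<Longrightarrow> (\<phi> b has_vector_derivative \<epsilon> *\<^sub>R X (\<phi> b s)) (at s within {-1..1})"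
    "\<And>s k. C_k_on k D (D \<inter> ball z0 \<delta>) (\<lambda>b. \<phi> b s)"
    "\<And>b v W s. b \<in> D \<inter> ball z0 \<delta> \<Longrightarrow> v \<in> D \<Longrightarrow>
      (\<And>s. s \<in> {-1..1} \<Longrightarrow> (W has_vector_derivative \<epsilon> *\<^sub>R deriv_in D X (\<phi> b s) (W s)) (at s within {-1..1})) \<Longrightarrow>
      (\<And>s. s \<in> {-1..1} \<Longrightarrow> W s \<in> D) \<Longrightarrow> W 0 = v \<Longrightarrow> s \<in> {-1..1} \<Longrightarrow> deriv_in D (\<lambda>b. \<phi> b s) b v = W s"
proof -
  have D: "subspace D" using \<Omega> rel_open_subspace by auto
  have Xk: "C_k_on k D \<Omega> X" for k using X by (simp add: smooth_on_def)
  have z0D: "z0 \<in> D" using z0 \<Omega> rel_open_subset by auto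
  obtain d where d: "d > 0" "D \<inter> ball z0 d \<subseteq> \<Omega>" using rel_open_ball[OF \<Omega> z0] .
  define R where "R = d / 2"
  have R: "R > 0" "D \<inter> cball z0 R \<subseteq> \<Omega>" using d by (auto simp: R_def)
  define S where "S = D \<inter> cball z0 R"
  have S: "compact S" "convex S" "S \<subseteq> \<Omega>" "S \<subseteq> D" "closed S"
    using R closed_subspace[OF D] subspace_imp_convex[OF D] by (auto simp: S_def closed_Int_compact convex_Int closed_Int)
  have "compact (X ` S)"
    using compact_continuous_image[OF continuous_on_subset[OF C_k_on_continuous[OF \<Omega> Xk[of 0]] S(3)] S(1)] .
  from compact_imp_bounded[OF this] obtain M where M: "M > 0" "\<And>y. y \<in> S \<Longrightarrow> norm (X y) \<le> M"
    unfolding bounded_pos by blast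
  have contDX: "continuous_on \<Omega> (\<lambda>y. deriv_in D X y b)" if "b \<in> onb D" for b
    using C_k_on_continuous[OF \<Omega> C_k_on_SucD(2)[OF Xk[of "Suc 0"]]] that onb(1)[OF D] by blast
  have "continuous_on \<Omega> (\<lambda>y. \<Sum>b\<in>onb D. norm (deriv_in D X y b))"
    by (intro continuous_intros contDX)
  from compact_imp_bounded[OF compact_continuous_image[OF continuous_on_subset[OF this S(3)] S(1)]]
  obtain L where L: "L > 0" "\<And>y. y \<in> S \<Longrightarrow> \<bar>\<Sum>b\<in>onb D. norm (deriv_in D X y b)\<bar> \<le> L"
    unfolding bounded_pos by auto
  \<comment> \<open>The first bound limits the displacement over unit time to \<open>R / 2\<close>;
    the second gives the rescaled field \<open>Y\<close> the Lipschitz constant 1/2 on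
    \<open>S\<close>.\<close>
  define \<epsilon> where "\<epsilon> = min (R / 2 / M) (1 / 2 / L)"
  have "\<epsilon> * M \<le> R / 2 / M * M" using M(1) by (intro mult_right_mono) (auto simp: \<epsilon>_def)
  then have \<epsilon>M: "\<epsilon> * M \<le> R / 2" using M(1) by simp
  have "\<epsilon> * L \<le> 1 / 2 / L * L" using L(1) by (intro mult_right_mono) (auto simp: \<epsilon>_def)
  then have \<epsilon>L: "\<epsilon> * L \<le> 1 / 2" using L(1) by simp
  have \<epsilon>: "\<epsilon> > 0" using R M L by (auto simp: \<epsilon>_def)
  define Y where "Y y = \<epsilon> *\<^sub>R X y" for y
  have Yk: "C_k_on k D \<Omega> Y" for k unfolding Y_def by (intro C_k_on_scaleR_const \<Omega> Xk)
  have Yinto: "Y y \<in> D" if "y \<in> \<Omega>" for y using into that D by (auto simp: Y_def intro: subspace_scale)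
  have DY: "deriv_in D Y y v = \<epsilon> *\<^sub>R deriv_in D X y v" if "y \<in> \<Omega>" "v \<in> D" for y v
    unfolding Y_def
    using deriv_in_eq[OF D _ has_derivative_scaleR_right[OF C_k_on_SucD(1)[OF Xk that(1)]] that(2)]
      that(1) rel_open_subset[OF \<Omega>] by blast
  have YM: "norm (Y y) \<le> R / 2" if "y \<in> S" for y
    using order_trans[OF mult_left_mono[OF M(2)[OF that], of \<epsilon>] \<epsilon>M] \<epsilon> by (simp add: Y_def)
  have YL: "(\<Sum>b\<in>onb D. norm (deriv_in D Y y b)) \<le> 1 / 2" if "y \<in> S" for y
  proof -
    have "(\<Sum>b\<in>onb D. norm (deriv_in D Y y b)) = (\<Sum>b\<in>onb D. \<epsilon> * norm (deriv_in D X y b))"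
      using DY[OF subsetD[OF S(3) that] subsetD[OF onb(1)[OF D]]] \<epsilon> by (intro sum.cong) auto
    also have "\<dots> = \<epsilon> * (\<Sum>b\<in>onb D. norm (deriv_in D X y b))" by (simp add: sum_distrib_left)
    also have "\<dots> \<le> \<epsilon> * L" using order_trans[OF abs_ge_self L(2)[OF that]] \<epsilon> by (intro mult_left_mono) auto
    finally show ?thesis using \<epsilon>L by linarith
  qed
  have bound: "norm (\<Sum>b\<in>onb D. (w \<bullet> b) *\<^sub>R deriv_in D Y y b) \<le> norm w / 2" if "y \<in> S" for w y
  proof -
    have "norm w * (\<Sum>b\<in>onb D. norm (deriv_in D Y y b)) \<le> norm w * (1 / 2)"
      by (rule mult_left_mono[OF YL[OF that]]) simp
    then show ?thesis using onb_sum_norm_le[OF D, of w "deriv_in D Y y"] by linarith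
  qed
  have Ylip: "norm (Y y - Y k) \<le> norm (y - k) / 2" if "y \<in> S" "k \<in> S" for y k
  proof -
    have kD: "k \<in> D" "y - k \<in> D" using that S(4) D by (auto intro: subspace_diff)
    have seg: "k + t *\<^sub>R (y - k) \<in> S" if "t \<in> {0..1}" for t
      using convexD[OF S(2) \<open>k \<in> S\<close> \<open>y \<in> S\<close>, of "1 - t" t] that by (simp add: algebra_simps)
    have "norm (Y (k + 1 *\<^sub>R (y - k)) - Y (k + 0 *\<^sub>R (y - k))) \<le> (norm (y - k) / 2) * \<bar>1 - 0\<bar>"
      by (rule vector_derivative_bound[where a=0 and b=1, OF segment_derivative[OF \<Omega> Yk kD] bound])
        (use seg S in auto)
    then show ?thesis by simp
  qed
  \<comment> \<open>Initial values use one half of the radius and the motion the other half, so all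
    curves stay in \<open>S\<close>.\<close>
  define V where "V = D \<inter> ball z0 (R / 2)"
  have V: "rel_open D V" unfolding V_def using rel_open_Int_open[OF rel_open_self[OF D]] by blast
  have VS: "V \<subseteq> S" using R by (auto simp: V_def S_def)
  have contY: "continuous_on \<Omega> Y" using C_k_on_continuous[OF \<Omega> Yk] .
  \<comment> \<open>The field is controlled on \<open>S\<close> only, so the fixed point is sought
    among curves with values in \<open>S\<close>. Since \<open>S\<close> is closed, these form a
    complete set.\<close>
  define P where "P = {w :: real \<Rightarrow>\<^sub>C 'd. \<forall>s. w s \<in> S}"
  have nemY: "nemytskii Y w s = Y (w (clamp1 s))" if "w \<in> P" for w s
    using nemytskii_apply[OF contY, of w s] that S(3) by (auto simp: P_def)
  have "P = PiC UNIV (\<lambda>_. S)" by (auto simp: P_def mem_PiC_iff Pi_iff)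
  then have "complete P" using closed_PiC[of UNIV "\<lambda>_. S"] S(5) by (simp add: complete_eq_closed)
  have P: "w s \<in> S" if "w \<in> P" for w s using that by (simp add: P_def)
  have nemlip: "norm (nemytskii Y w - nemytskii Y w') \<le> norm (w - w') / 2" if "w \<in> P" "w' \<in> P" for w w'
  proof (rule norm_bound)
    fix s
    have "norm (Y (w (clamp1 s)) - Y (w' (clamp1 s))) \<le> norm (w (clamp1 s) - w' (clamp1 s)) / 2"
      by (rule Ylip) (use P that in auto)
    also have "\<dots> \<le> norm (w - w') / 2" using norm_bounded[of "w - w'" "clamp1 s"] by simp
    finally show "norm (apply_bcontfun (nemytskii Y w - nemytskii Y w') s) \<le> norm (w - w') / 2"
      using that by (simp add: nemY)
  qed
  define \<Psi> where "\<Psi> b w = const_bcontfun b + curve_integral (nemytskii Y w)" for b w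
  have ci_diff: "curve_integral (a - b) = curve_integral a - curve_integral b" for a b :: "real \<Rightarrow>\<^sub>C 'd"
    using linear_diff[OF bounded_linear.linear[OF bounded_linear_curve_integral]] .
  have \<Psi>P: "\<Psi> b w \<in> P" if b: "b \<in> V" and w: "w \<in> P" for b w
    unfolding P_def mem_Collect_eq
  proof
    fix s
    have bD: "b \<in> D" using b by (simp add: V_def)
    have "curve_integral (nemytskii Y w) s \<in> D"
      by (rule curve_integral_in_subspace[OF D]) (use nemY[OF w] Yinto P[OF w] S in auto)
    then have 1: "\<Psi> b w s \<in> D" using bD D by (simp add: \<Psi>_def subspace_add)
    have "norm (nemytskii Y w) \<le> R / 2" by (rule norm_bound) (use nemY[OF w] YM P[OF w] in auto)
    then have "norm (curve_integral (nemytskii Y w) s) \<le> R / 2"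
      using norm_bounded[of "curve_integral (nemytskii Y w)" s] norm_curve_integral[of "nemytskii Y w"] by linarith
    moreover have "norm (b - z0) < R / 2" using b by (simp add: V_def dist_norm norm_minus_commute)
    moreover have eqz: "\<Psi> b w s - z0 = (b - z0) + curve_integral (nemytskii Y w) s" by (simp add: \<Psi>_def)
    ultimately have "norm (\<Psi> b w s - z0) \<le> R"
      unfolding eqz using norm_triangle_ineq[of "b - z0" "curve_integral (nemytskii Y w) s"] by linarith
    then show "\<Psi> b w s \<in> S" using 1 by (simp add: S_def dist_norm norm_minus_commute)
  qed
  have "\<exists>w\<in>P. \<Psi> b w = w" if b: "b \<in> V" for b
  proof -
    have "P \<noteq> {}" using VS that by (auto simp: P_def intro!: exI[of _ "const_bcontfun b"])
    moreover have "dist (\<Psi> b w) (\<Psi> b w') \<le> 1/2 * dist w w'" if "w \<in> P" "w' \<in> P" for w w'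
      using order_trans[OF norm_curve_integral nemlip[OF that]] by (simp add: \<Psi>_def dist_norm ci_diff[symmetric])
    ultimately have "\<exists>!w. w \<in> P \<and> \<Psi> b w = w"
      using Banach_fix[OF \<open>complete P\<close>, of "1/2" "\<Psi> b"] \<Psi>P[OF b] by auto
    then show ?thesis by blast
  qed
  then obtain u where u: "\<And>b. b \<in> V \<Longrightarrow> u b \<in> P" "\<And>b. b \<in> V \<Longrightarrow> \<Psi> b (u b) = u b" by metis
  have u\<Omega>: "u b s \<in> \<Omega>" if "b \<in> V" for b s using P[OF u(1)[OF that]] S by blast
  \<comment> \<open>Half of the increment is absorbed by the contraction. The bound keeps
    \<open>u q\<close> within the range in which the uniform linearisation of \<open>Y\<close> along
    \<open>u p\<close> is valid.\<close>
  have ulip: "norm (u b - u c) \<le> 2 * norm (b - c)" if "b \<in> V" "c \<in> V" for b c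
  proof -
    have "u b - u c = (const_bcontfun b - const_bcontfun c) + curve_integral (nemytskii Y (u b) - nemytskii Y (u c))"
      using u(2)[OF that(1)] u(2)[OF that(2)] unfolding \<Psi>_def ci_diff by (metis add_diff_add)
    moreover have "norm (const_bcontfun b - const_bcontfun c) \<le> norm (b - c)"
      by (rule norm_bound) simp
    moreover have "norm (curve_integral (nemytskii Y (u b) - nemytskii Y (u c))) \<le> norm (u b - u c) / 2"
      using order_trans[OF norm_curve_integral nemlip[OF u(1)[OF that(1)] u(1)[OF that(2)]]] .
    ultimately have "norm (u b - u c) \<le> norm (b - c) + norm (u b - u c) / 2"
      using norm_triangle_le[OF add_mono] by metis
    then show ?thesis by simp
  qed
  define G where "G p k = nemytskii (\<lambda>y. deriv_in D Y y k) (u p)" for p k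
  define A where "A p w = (\<Sum>k\<in>onb D. cscale (G p k) (cinner k w))" for p w
  \<comment> \<open>The linearisation at \<open>u p\<close> of the map taking \<open>w\<close> to
    \<open>w - curve_integral (nemytskii Y w)\<close>, that is, the Volterra operator of the
    variational equation. Writing it as a composition of bounded operators makes its smooth
    dependence on \<open>p\<close> through \<open>G p k\<close> visible.\<close>
  define T where "T p = id_blinfun - (\<Sum>k\<in>onb D. Blinfun curve_integral o\<^sub>L (Blinfun (cscale (G p k)) o\<^sub>L Blinfun (cinner k)))" for p
  have contDY: "continuous_on \<Omega> (\<lambda>y. deriv_in D Y y k)" if "k \<in> onb D" for k
    using C_k_on_continuous[OF \<Omega> C_k_on_SucD(2)[OF Yk[of "Suc 0"]]] that onb(1)[OF D] by blast
  have A_apply: "A p w s = (\<Sum>k\<in>onb D. (w (clamp1 s) \<bullet> k) *\<^sub>R deriv_in D Y (u p (clamp1 s)) k)" if "p \<in> V" for p w s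
    using nemytskii_apply[OF contDY u\<Omega>[OF that]]
    by (simp add: A_def G_def sum_bcontfun_apply cscale_apply cinner_apply clamp1_id[OF clamp1_in])
  have T_apply: "T p w = w - curve_integral (A p w)" for p w
    by (simp add: T_def A_def blinfun.diff_left blinfun.sum_left bounded_linear_Blinfun_apply[OF bounded_linear_curve_integral]
      bounded_linear_Blinfun_apply[OF bounded_linear_cinner]
      bounded_linear_Blinfun_apply[OF bounded_bilinear.bounded_linear_right[OF bounded_bilinear_cscale]]
      linear_sum[OF bounded_linear.linear[OF bounded_linear_curve_integral]])
  have A_diff: "A p (w - w') = A p w - A p w'" for p w w'
    by (simp add: A_def linear_diff[OF bounded_linear.linear[OF bounded_linear_cinner]]
      bounded_bilinear.diff_right[OF bounded_bilinear_cscale] sum_subtractf)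
  have A_norm: "norm (A p w) \<le> norm w / 2" if "p \<in> V" for p w
  proof (rule norm_bound)
    fix s
    have "norm (A p w s) \<le> norm (w (clamp1 s)) / 2"
      unfolding A_apply[OF that] by (rule bound) (use P[OF u(1)[OF that]] in auto)
    also have "\<dots> \<le> norm w / 2" using norm_bounded[of w] by simp
    finally show "norm (A p w s) \<le> norm w / 2" .
  qed
  have ciA: "norm (curve_integral (A p w)) \<le> norm w / 2" if "p \<in> V" for p w
    using order_trans[OF norm_curve_integral A_norm[OF that]] .
  have TK: "norm w \<le> 2 * norm (T p w)" if "p \<in> V" for p w
    using ciA[OF that, of w] norm_triangle_ineq[of "T p w" "curve_integral (A p w)"] by (simp add: T_apply)
  \<comment> \<open>\<open>T p w = y\<close> is the fixed point equation of an affine contraction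
    with constant 1/2.\<close>
  have Tsurj: "surj (blinfun_apply (T p))" if p: "p \<in> V" for p
  proof -
    have "\<exists>w. y = T p w" for y
    proof -
      have "\<exists>!w. y + curve_integral (A p w) = w"
        using ciA[OF p] by (intro banach_fix_type[of "1/2"]) (auto simp: dist_norm ci_diff[symmetric] A_diff[symmetric])
      then obtain w where "y + curve_integral (A p w) = w" by blast
      then show ?thesis by (metis T_apply add_diff_cancel_right')
    qed
    then show ?thesis unfolding surj_def by blast
  qed
  have der: "(u has_derivative (\<lambda>v. inv (blinfun_apply (T p)) (const_bcontfun v))) (at p within D)" if p: "p \<in> V" for p
  proof (rule implicit_has_derivative[OF V p TK[OF p] Tsurj[OF p] bounded_linear_const_bcontfun])
    fix e :: real assume e: "e > 0"
    have "apply_bcontfun (u p) ` {-1..1} \<subseteq> \<Omega>" using u\<Omega> p by auto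
    from uniform_differentiable_near_compact[OF \<Omega> compact_curve_image this Yk e]
    obtain d where d: "d > 0" "\<And>k y. k \<in> apply_bcontfun (u p) ` {-1..1} \<Longrightarrow> y \<in> D \<Longrightarrow> norm (y - k) < d \<Longrightarrow>
       norm (Y y - Y k - (\<Sum>b\<in>onb D. ((y - k) \<bullet> b) *\<^sub>R deriv_in D Y k b)) \<le> e * norm (y - k)" by blast
    show "\<exists>d>0. \<forall>q\<in>V. norm (q - p) < d \<longrightarrow> norm (T p (u q - u p) - const_bcontfun (q - p))
             \<le> e * (norm (q - p) + norm (u q - u p))"
    proof (intro exI[of _ "d / 2"] conjI ballI impI)
      fix q assume q: "q \<in> V" "norm (q - p) < d / 2"
      have uqd: "norm (u q - u p) < d" using ulip[OF q(1) p] q(2) by linarith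
      have "norm (nemytskii Y (u q) - nemytskii Y (u p) - A p (u q - u p)) \<le> e * norm (u q - u p)"
      proof (rule norm_bound)
        fix s
        have n: "norm (u q (clamp1 s) - u p (clamp1 s)) \<le> norm (u q - u p)"
          using norm_bounded[of "u q - u p" "clamp1 s"] by simp
        have "norm (Y (u q (clamp1 s)) - Y (u p (clamp1 s)) - (\<Sum>b\<in>onb D. ((u q (clamp1 s) - u p (clamp1 s)) \<bullet> b) *\<^sub>R deriv_in D Y (u p (clamp1 s)) b)) \<le> e * norm (u q (clamp1 s) - u p (clamp1 s))"
          using n uqd u\<Omega>[OF q(1)] rel_open_subset[OF \<Omega>] clamp1_in by (intro d(2)) auto
        also have "\<dots> \<le> e * norm (u q - u p)" using n e by (intro mult_left_mono) auto
        finally show "norm (apply_bcontfun (nemytskii Y (u q) - nemytskii Y (u p) - A p (u q - u p)) s) \<le> e * norm (u q - u p)"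
          using nemY[OF u(1)] q p by (simp add: A_apply)
      qed
      moreover have eqT: "T p (u q - u p) - const_bcontfun (q - p) = curve_integral (nemytskii Y (u q) - nemytskii Y (u p) - A p (u q - u p))"
      proof -
        have comm: "x - y - z = x - z - y" for x y z :: "real \<Rightarrow>\<^sub>C 'd" by (simp add: algebra_simps)
        have c1: "const_bcontfun (q - p) = const_bcontfun q - const_bcontfun p" by (rule bcontfun_eqI) simp
        have c2: "u q - u p = (const_bcontfun q - const_bcontfun p) + (curve_integral (nemytskii Y (u q)) - curve_integral (nemytskii Y (u p)))"
          using u(2)[OF q(1)] u(2)[OF p] unfolding \<Psi>_def by (metis add_diff_add)
        have "T p (u q - u p) - const_bcontfun (q - p) = (u q - u p) - curve_integral (A p (u q - u p)) - (const_bcontfun q - const_bcontfun p)"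
          by (simp only: T_apply c1)
        also have "\<dots> = ((u q - u p) - (const_bcontfun q - const_bcontfun p)) - curve_integral (A p (u q - u p))"
          by (rule comm)
        also have "(u q - u p) - (const_bcontfun q - const_bcontfun p) = curve_integral (nemytskii Y (u q)) - curve_integral (nemytskii Y (u p))"
          by (simp only: c2 add_diff_cancel_left')
        finally show ?thesis by (simp only: ci_diff)
      qed
      ultimately have "norm (T p (u q - u p) - const_bcontfun (q - p)) \<le> e * norm (u q - u p)"
        unfolding eqT by (intro order_trans[OF norm_curve_integral])
      also have "\<dots> \<le> e * (norm (q - p) + norm (u q - u p))" using e by (intro mult_left_mono) auto
      finally show "norm (T p (u q - u p) - const_bcontfun (q - p)) \<le> e * (norm (q - p) + norm (u q - u p))" .
    qed (use d in auto)
  qed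
  \<comment> \<open>If \<open>u\<close> is of class C^k, then so are the coefficients of
    \<open>T\<close>, and so is the derivative of \<open>u\<close>, which solves a linear equation
    with operator \<open>T p\<close>. Hence \<open>u\<close> gains one order.\<close>
  have uk: "C_k_on k D V u" for k
  proof (induction k)
    case 0
    have "continuous (at p within V) u" if "p \<in> V" for p
      using has_derivative_continuous[OF der[OF that]] rel_open_at_within[OF V that] by simp
    then show ?case by (simp add: continuous_on_eq_continuous_within)
  next
    case (Suc k)
    show ?case
    proof (rule C_k_on_SucI[OF V der])
      fix v assume "v \<in> D"
      show "C_k_on k D V (\<lambda>p. inv (blinfun_apply (T p)) (const_bcontfun v))"
      proof (rule C_k_on_solve[OF V])
        have "C_k_on k D V (\<lambda>p. Blinfun curve_integral o\<^sub>L (Blinfun (cscale (G p j)) o\<^sub>L Blinfun (cinner j)))" if "j \<in> onb D" for j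
        proof (intro C_k_on_bilinear[OF V bounded_bilinear_blinfun_compose] C_k_on_const V)
          have "C_k_on k D V (\<lambda>p. G p j)" unfolding G_def
            by (rule C_k_on_nemytskii[OF \<Omega> V u\<Omega> Suc C_k_on_SucD(2)[OF Yk]]) (use that onb(1)[OF D] in auto)
          then show "C_k_on k D V (\<lambda>p. Blinfun (cscale (G p j)))"
            by (rule C_k_on_bounded_linear_comp[OF V bounded_linear_Blinfun_cscale])
        qed
        then show "C_k_on k D V T" unfolding T_def by (intro C_k_on_diff C_k_on_sum V C_k_on_const)
        show "C_k_on k D V (\<lambda>p. const_bcontfun v)" by (rule C_k_on_const[OF V])
        show "\<exists>K. \<forall>w. norm w \<le> K * norm (T p w)" if "p \<in> V" for p using TK[OF that] by blast
        show "surj (blinfun_apply (T p))" if "p \<in> V" for p using Tsurj[OF that] .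
        show "T p (inv (blinfun_apply (T p)) (const_bcontfun v)) = const_bcontfun v" if "p \<in> V" for p
          using Tsurj[OF that] by (simp add: surj_f_inv_f)
      qed
    qed
  qed
  show ?thesis
  proof (rule that[of \<epsilon> "R / 2" "\<lambda>b s. u b s"], unfold V_def[symmetric])
    show "\<epsilon> > 0" "R / 2 > 0" "V \<subseteq> \<Omega>" using \<epsilon> R VS S by auto
    fix b assume b: "b \<in> V"
    have ub: "u b s = b + curve_integral (nemytskii Y (u b)) s" for s
      using arg_cong[OF u(2)[OF b], of "\<lambda>w. apply_bcontfun w s"] by (simp add: \<Psi>_def)
    show "u b 0 = b" using ub[of 0] by (simp add: curve_integral_0)
    show "u b s \<in> \<Omega>" for s using u\<Omega>[OF b] .
    show "(apply_bcontfun (u b) has_vector_derivative \<epsilon> *\<^sub>R X (u b s)) (at s within {-1..1})" if s: "s \<in> {-1..1}" for s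
    proof -
      have "((\<lambda>s. b + curve_integral (nemytskii Y (u b)) s) has_vector_derivative 0 + nemytskii Y (u b) s) (at s within {-1..1})"
        by (intro has_vector_derivative_add has_vector_derivative_const curve_integral_deriv s)
      moreover have "nemytskii Y (u b) s = \<epsilon> *\<^sub>R X (u b s)" using nemY[OF u(1)[OF b]] clamp1_id[OF s] by (simp add: Y_def)
      moreover have "(\<lambda>s. b + curve_integral (nemytskii Y (u b)) s) = apply_bcontfun (u b)" using ub by auto
      ultimately show ?thesis by simp
    qed
    fix v W s assume v: "v \<in> D" and W: "\<And>s. s \<in> {-1..1} \<Longrightarrow> (W has_vector_derivative \<epsilon> *\<^sub>R deriv_in D X (u b s) (W s)) (at s within {-1..1})"
      and WD: "\<And>s. s \<in> {-1..1} \<Longrightarrow> W s \<in> D" and W0: "W 0 = v" and s: "s \<in> {-1..1::real}"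
    have contW: "continuous_on {-1..1} W"
      using W has_vector_derivative_continuous by (blast intro: continuous_on_eq_continuous_within[THEN iffD2])
    have cW: "curve W t = W (clamp1 t)" for t using curve_apply[OF contW] .
    have AW: "A b (curve W) t = \<epsilon> *\<^sub>R deriv_in D X (u b t) (W t)" if t: "t \<in> {-1..1}" for t
    proof -
      have "linear (deriv_in D Y (u b t))"
        by (rule linear_deriv_in) (use Yk[of "Suc 0"] u\<Omega>[OF b] in auto)
      from linear_onb_expand[OF D WD[OF t] this]
      have "A b (curve W) t = deriv_in D Y (u b t) (W t)" using A_apply[OF b, of "curve W" t] cW clamp1_id[OF t] by simp
      then show ?thesis using DY[OF u\<Omega>[OF b] WD[OF t]] by simp
    qed
    \<comment> \<open>This is the variational equation for \<open>W\<close> in integrated form;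
      inverting \<open>T b\<close> identifies \<open>W\<close> with the derivative found
      above.\<close>
    have "T b (curve W) = const_bcontfun v"
    proof (rule bcontfun_eqI)
      fix t
      have "W (clamp1 t) = W 0 + curve_integral (A b (curve W)) (clamp1 t)"
        by (rule curve_integral_unique) (use W AW clamp1_in in auto)
      moreover have "curve_integral (A b (curve W)) (clamp1 t) = curve_integral (A b (curve W)) t"
        by (simp add: curve_integral_apply clamp1_id[OF clamp1_in])
      ultimately show "apply_bcontfun (T b (curve W)) t = const_bcontfun v t"
        by (simp add: T_apply cW W0)
    qed
    then have inv: "inv (blinfun_apply (T b)) (const_bcontfun v) = curve W"
      using bounded_below_inv(3)[OF TK[OF b] Tsurj[OF b]] by metis
    have "deriv_in D (\<lambda>b. u b s) b v = inv (blinfun_apply (T b)) (const_bcontfun v) s"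
      using deriv_in_eq[OF D _ bounded_linear.has_derivative[OF bounded_linear_eval der[OF b]] v] b by (simp add: V_def)
    then show "deriv_in D (\<lambda>b. u b s) b v = W s" using inv cW clamp1_id[OF s] by simp
  next
    show "C_k_on k D V (\<lambda>b. u b s)" for s k
      by (rule C_k_on_bounded_linear_comp[OF V bounded_linear_eval uk])
  qed
qed

text \<open>Extending \<open>\<Theta>\<close> by the identity on the orthogonal complement of
  \<open>E\<close> gives a map \<open>f\<close> on an open set of the whole space, to which the
  inverse function theorem applies. The inverse of \<open>f\<close> is then shown to respect
  \<open>E\<close>, and its smoothness comes from the linear equation for its derivative.\<close>

theorem local_inverse:
  fixes \<Theta> :: "'e::euclidean_space \<Rightarrow> 'e"
  assumes N: "rel_open E N" and p0: "p0 \<in> N" and sm: "smooth_on E N \<Theta>" and into: "\<Theta> ` N \<subseteq> E"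
    and inj: "\<And>v. v \<in> E \<Longrightarrow> deriv_in E \<Theta> p0 v = 0 \<Longrightarrow> v = 0"
  obtains N' \<Psi> where "rel_open E N'" "p0 \<in> N'" "N' \<subseteq> N" "\<And>p. p \<in> N' \<Longrightarrow> \<Psi> (\<Theta> p) = p"
    "rel_open E (\<Theta> ` N')" "smooth_on E (\<Theta> ` N') \<Psi>"
    "\<And>p v. p \<in> N' \<Longrightarrow> v \<in> E \<Longrightarrow> deriv_in E \<Theta> p v = 0 \<Longrightarrow> v = 0"
proof -
  have E: "subspace E" using N rel_open_subspace by auto
  have \<Theta>k: "C_k_on k E N \<Theta>" for k using sm by (simp add: smooth_on_def)
  note D\<Theta> = C_k_on_SucD(1)[OF \<Theta>k]
  have lin: "linear_on E (deriv_in E \<Theta> p)" if "p \<in> N" for p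
    by (rule linear_imp_linear_on[OF linear_deriv_in]) (use \<Theta>k[of "Suc 0"] that in auto)
  have DE: "deriv_in E \<Theta> p v \<in> E" if "p \<in> N" "v \<in> E" for p v
    using deriv_in_subspace[OF N that(1) into E \<Theta>k that(2)] .
  obtain T where T: "open T" "N = E \<inter> T" using N unfolding rel_open_def openin_open by auto
  define U where "U = proj E -` T"
  have "open U" unfolding U_def
    using open_vimage[OF T(1)] linear_continuous_on[OF bounded_linear_proj] by blast
  have proj_U: "proj E z \<in> N" if "z \<in> U" for z using that proj_in[OF E] T by (auto simp: U_def)
  define f where "f z = \<Theta> (proj E z) + (z - proj E z)" for z
  define f' where "f' z = ext_blinfun E (deriv_in E \<Theta> (proj E z))" for z
  have f'_apply: "f' z w = deriv_in E \<Theta> (proj E z) (proj E w) + (w - proj E w)" if "z \<in> U" for z w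
    unfolding f'_def using ext_blinfun_apply[OF lin[OF proj_U[OF that]] E] .
  have derf: "(f has_derivative blinfun_apply (f' z)) (at z)" if z: "z \<in> U" for z
  proof -
    have "(\<Theta> has_derivative deriv_in E \<Theta> (proj E z)) (at (proj E z) within range (proj E))"
      using has_derivative_subset[OF D\<Theta>[OF proj_U[OF z]]] proj_in[OF E] by blast
    moreover have "(proj E has_derivative proj E) (at z)" by (rule bounded_linear_imp_has_derivative[OF bounded_linear_proj])
    ultimately have "((\<lambda>z. \<Theta> (proj E z)) has_derivative (\<lambda>w. deriv_in E \<Theta> (proj E z) (proj E w))) (at z)"
      by (rule has_derivative_in_compose[rotated])
    then have "(f has_derivative (\<lambda>w. deriv_in E \<Theta> (proj E z) (proj E w) + (w - proj E w))) (at z)"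
      unfolding f_def by (intro has_derivative_add has_derivative_diff has_derivative_ident
        bounded_linear_imp_has_derivative[OF bounded_linear_proj])
    moreover have "blinfun_apply (f' z) = (\<lambda>w. deriv_in E \<Theta> (proj E z) (proj E w) + (w - proj E w))"
      using f'_apply[OF z] by auto
    ultimately show ?thesis by simp
  qed
  have "C_k_on 0 E N (\<lambda>p. ext_blinfun E (deriv_in E \<Theta> p))"
    by (rule C_k_on_ext_blinfun[OF N E C_k_on_SucD(2)[OF \<Theta>k]])
  then have contf': "continuous_on U f'" unfolding f'_def
    using proj_U by (auto intro!: continuous_on_compose2[of N _ U "proj E"] linear_continuous_on[OF bounded_linear_proj])
  have p0E: "p0 \<in> E" "proj E p0 = p0" using p0 N rel_open_subset proj_id[OF E] by auto
  have p0U: "p0 \<in> U" using p0 p0E T by (auto simp: U_def)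
  have l: "linear (blinfun_apply (f' z))" for z using blinfun.bounded_linear_right bounded_linear.linear by blast
  have "inj (blinfun_apply (f' p0))" unfolding f'_def
    by (rule ext_blinfun_inj[OF lin E]) (use p0 p0E DE inj in auto)
  then obtain g0 where g0: "linear g0" "g0 \<circ> blinfun_apply (f' p0) = id"
    using linear_injective_left_inverse[OF l] by blast
  have "Blinfun g0 o\<^sub>L f' p0 = id_blinfun"
    using g0 by (auto intro!: blinfun_eqI simp: bounded_linear_Blinfun_apply linear_conv_bounded_linear fun_eq_iff)
  from inverse_function_theorem[OF \<open>open U\<close> derf contf' p0U this]
  obtain U' V g g' where U': "open U'" "U' \<subseteq> U" "p0 \<in> U'" and V: "open V" "f p0 \<in> V" and hom: "homeomorphism U' V f g"
    and g: "\<And>y. y \<in> V \<Longrightarrow> (g has_derivative g' y) (at y)" "\<And>y. y \<in> V \<Longrightarrow> g' y = inv (blinfun_apply (f' (g y)))"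
    "\<And>y. y \<in> V \<Longrightarrow> bij (blinfun_apply (f' (g y)))" by blast
  define N' where "N' = E \<inter> U'"
  have N': "rel_open E N'" unfolding N'_def using rel_open_Int_open[OF rel_open_self[OF E] U'(1)] .
  have sub: "N' \<subseteq> N"
  proof
    fix p assume "p \<in> N'"
    then show "p \<in> N" using proj_U[of p] U'(2) proj_id[OF E, of p] by (auto simp: N'_def)
  qed
  have f\<Theta>: "f p = \<Theta> p" if "p \<in> E" for p using proj_id[OF E that] by (simp add: f_def)
  \<comment> \<open>\<open>f\<close> changes only the component in \<open>E\<close>:
    \<open>g y\<close> differs from its projection by \<open>y - \<Theta> (proj E (g y))\<close>,
    which lies in \<open>E\<close>.\<close>
  have gE: "g y \<in> N'" if y: "y \<in> E \<inter> V" for y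
  proof -
    have z: "g y \<in> U'" "f (g y) = y" using hom y by (auto simp: homeomorphism_def)
    have "proj E (g y) \<in> N" using z U' proj_U by blast
    then have "\<Theta> (proj E (g y)) \<in> E" using into by blast
    moreover have "g y = proj E (g y) + (y - \<Theta> (proj E (g y)))" using z(2) by (simp add: f_def algebra_simps)
    ultimately have "g y \<in> E" using y proj_in[OF E] E by (metis IntD1 subspace_add subspace_diff)
    then show ?thesis using z by (simp add: N'_def)
  qed
  have fg: "\<Theta> (g y) = y" if "y \<in> E \<inter> V" for y
    using gE[OF that] f\<Theta>[of "g y"] hom that by (auto simp: homeomorphism_def N'_def)
  have img: "\<Theta> ` N' = E \<inter> V"
  proof
    show "\<Theta> ` N' \<subseteq> E \<inter> V"
    proof
      fix y assume "y \<in> \<Theta> ` N'"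
      then obtain p where p: "p \<in> N'" "y = \<Theta> p" by blast
      have "f p \<in> V" using p hom by (auto simp: homeomorphism_def N'_def)
      then show "y \<in> E \<inter> V" using p f\<Theta>[of p] sub into by (auto simp: N'_def)
    qed
    show "E \<inter> V \<subseteq> \<Theta> ` N'" using fg gE by (metis image_eqI subsetI)
  qed
  have EV: "rel_open E (E \<inter> V)" using rel_open_Int_open[OF rel_open_self[OF E] V(1)] .
  \<comment> \<open>Differentiating \<open>\<Theta> (g y) = y\<close> shows that
    \<open>g' y v\<close> solves a linear equation with coefficients
    \<open>deriv_in E \<Theta> (g y)\<close>. These are as smooth as \<open>g\<close>, so each order
    of smoothness yields the next.\<close>
  have gk: "C_k_on k E (E \<inter> V) g" for k
  proof (induction k)
    case 0
    then show ?case using hom by (auto simp: homeomorphism_def intro: continuous_on_subset)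
  next
    case (Suc k)
    show ?case
    proof (rule C_k_on_SucI[OF EV, where D=g'])
      show "(g has_derivative g' y) (at y within E)" if "y \<in> E \<inter> V" for y
        using g(1) that has_derivative_at_withinI by blast
      fix v assume v: "v \<in> E"
      show "C_k_on k E (E \<inter> V) (\<lambda>y. g' y v)"
      proof (rule C_k_on_solve_subspace[OF EV E, where A="\<lambda>y. deriv_in E \<Theta> (g y)" and b="\<lambda>_. v"])
        fix q assume q: "q \<in> E \<inter> V"
        have gq: "g q \<in> N" "g q \<in> U" "proj E (g q) = g q" using gE[OF q] sub U' proj_id[OF E] by (auto simp: N'_def)
        show "linear_on E (deriv_in E \<Theta> (g q))" using lin gq by simp
        show "deriv_in E \<Theta> (g q) w \<in> E" if "w \<in> E" for w using DE gq that by simp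
        show "w = 0" if "w \<in> E" "deriv_in E \<Theta> (g q) w = 0" for w
        proof -
          have "f' (g q) w = f' (g q) 0" using f'_apply[OF gq(2)] gq(3) that proj_id[OF E]
            by (simp add: blinfun.zero_right)
          then show ?thesis using bij_is_inj[OF g(3)[of q]] q by (metis IntD2 injD)
        qed
        show g'E: "g' q v \<in> E"
        proof (rule has_derivative_in_subspace[OF EV q _ E _ v])
          show "g ` (E \<inter> V) \<subseteq> E" using gE by (auto simp: N'_def)
          show "(g has_derivative g' q) (at q within E)" using g(1)[of q] q has_derivative_at_withinI by blast
        qed
        have "f' (g q) (g' q v) = v" using g(2,3)[of q] q by (simp add: bij_is_surj surj_f_inv_f)
        then show "deriv_in E \<Theta> (g q) (g' q v) = v" using f'_apply[OF gq(2)] gq(3) proj_id[OF E g'E] by simp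
      next
        fix w assume "w \<in> E"
        show "C_k_on k E (E \<inter> V) (\<lambda>q. deriv_in E \<Theta> (g q) w)"
          by (rule C_k_on_compose[OF EV N _ Suc C_k_on_SucD(2)[OF \<Theta>k \<open>w \<in> E\<close>]]) (use gE sub in auto)
      qed (simp add: EV)
    qed
  qed
  show ?thesis
  proof (rule that[OF N' _ sub, of g])
    show "p0 \<in> N'" using p0E U' by (simp add: N'_def)
    show g\<Theta>: "g (\<Theta> p) = p" if "p \<in> N'" for p using that f\<Theta>[of p] hom by (auto simp: homeomorphism_def N'_def)
    show "rel_open E (\<Theta> ` N')" "smooth_on E (\<Theta> ` N') g" using EV gk img by (auto simp: smooth_on_def)
    show "v = 0" if p: "p \<in> N'" and v: "v \<in> E" "deriv_in E \<Theta> p v = 0" for p v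
    proof -
      have pU: "p \<in> U" "proj E p = p" using p U' proj_id[OF E] by (auto simp: N'_def)
      have y: "\<Theta> p \<in> V" using img p by blast
      have "f' p v = f' p 0" using f'_apply[OF pU(1)] pU(2) v proj_id[OF E] by (simp add: blinfun.zero_right)
      then show ?thesis using bij_is_inj[OF g(3)[OF y]] g\<Theta>[OF p] by (metis injD)
    qed
  qed
qed

section \<open>Families of linear maps\<close>

text \<open>Smoothness is assumed for each fixed vector; the basis expansion of \<open>c l\<close>
  turns it into joint smoothness. This covers horizontal lifts, in which the base point and the
  lifted vector move together.\<close>

lemma C_k_on_linear_family:
  fixes f :: "'e::euclidean_space \<Rightarrow> 'd::euclidean_space" and c :: "'e \<Rightarrow> 'c::euclidean_space"
  assumes N: "rel_open F N" and U: "rel_open E U" and C: "subspace C" and fN: "f ` N \<subseteq> U" and cN: "c ` N \<subseteq> C"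
    and lin: "\<And>u. u \<in> U \<Longrightarrow> linear_on C (K u)"
    and K: "\<And>b. b \<in> C \<Longrightarrow> C_k_on k E U (\<lambda>u. K u b)" and f: "C_k_on k F N f" and c: "C_k_on k F N c"
  shows "C_k_on k F N (\<lambda>l. K (f l) (c l))"
proof (rule C_k_on_cong[OF N])
  show "(\<Sum>b\<in>onb C. (c l \<bullet> b) *\<^sub>R K (f l) b) = K (f l) (c l)" if "l \<in> N" for l
    using linear_on_expand[OF lin C, of "f l" "c l"] fN cN that by (metis image_subset_iff)
  show "C_k_on k F N (\<lambda>l. \<Sum>b\<in>onb C. (c l \<bullet> b) *\<^sub>R K (f l) b)"
  proof (intro C_k_on_sum N C_k_on_scaleR C_k_on_inner c C_k_on_const)
    fix b assume "b \<in> onb C"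
    then show "C_k_on k F N (\<lambda>l. K (f l) b)"
      using C_k_on_compose[OF N U fN f K] onb(1)[OF C] by blast
  qed
qed

lemma linear_family_deriv:
  fixes f :: "'e::euclidean_space \<Rightarrow> 'd::euclidean_space" and c :: "'e \<Rightarrow> 'c::euclidean_space"
  assumes N: "rel_open F N" and U: "rel_open E U" and C: "subspace C" and fN: "f ` N \<subseteq> U" and cN: "c ` N \<subseteq> C"
    and lin: "\<And>u. u \<in> U \<Longrightarrow> linear_on C (K u)"
    and K: "\<And>b. b \<in> C \<Longrightarrow> C_k_on (Suc k) E U (\<lambda>u. K u b)" and l: "l \<in> N"
    and f: "(f has_derivative f') (at l within F)" and c: "(c has_derivative c') (at l within F)" and w: "w \<in> F"
  shows "deriv_in F (\<lambda>l. K (f l) (c l)) l w = deriv_in E (\<lambda>u. K u (c l)) (f l) (f' w) + K (f l) (c' w)"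
    "(\<lambda>l. K (f l) (c l)) differentiable (at l within F)"
proof -
  have flU: "f l \<in> U" "c l \<in> C" using fN cN l by auto
  have Kd: "((\<lambda>u. K u b) has_derivative deriv_in E (\<lambda>u. K u b) (f l)) (at (f l) within E)" if "b \<in> C" for b
    using C_k_on_SucD(1)[OF K[OF that] flU(1)] .
  have 1: "((\<lambda>l. \<Sum>b\<in>onb C. (c l \<bullet> b) *\<^sub>R K (f l) b) has_derivative
    (\<lambda>w. \<Sum>b\<in>onb C. (c l \<bullet> b) *\<^sub>R deriv_in E (\<lambda>u. K u b) (f l) (f' w) + (c' w \<bullet> b) *\<^sub>R K (f l) b)) (at l within F)"
  proof (intro has_derivative_sum has_derivative_scaleR has_derivative_inner_left c)
    fix b assume "b \<in> onb C"
    then show "((\<lambda>l. K (f l) b) has_derivative (\<lambda>w. deriv_in E (\<lambda>u. K u b) (f l) (f' w))) (at l within F)"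
      using has_derivative_chain_rel[OF N U fN l f Kd] onb(1)[OF C] by blast
  qed
  have 2: "((\<lambda>l. K (f l) (c l)) has_derivative
    (\<lambda>w. \<Sum>b\<in>onb C. (c l \<bullet> b) *\<^sub>R deriv_in E (\<lambda>u. K u b) (f l) (f' w) + (c' w \<bullet> b) *\<^sub>R K (f l) b)) (at l within F)"
    by (rule has_derivative_cong_rel[OF N l _ 1])
      (use linear_on_expand[OF lin C] fN cN in \<open>auto simp: image_subset_iff\<close>)
  then show "(\<lambda>l. K (f l) (c l)) differentiable (at l within F)" by (rule differentiableI)
  have "deriv_in F (\<lambda>l. K (f l) (c l)) l w = (\<Sum>b\<in>onb C. (c l \<bullet> b) *\<^sub>R deriv_in E (\<lambda>u. K u b) (f l) (f' w) + (c' w \<bullet> b) *\<^sub>R K (f l) b)"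
    by (rule deriv_in_eq[OF rel_open_subspace[OF N] _ 2 w]) (use l rel_open_subset[OF N] in auto)
  also have "\<dots> = (\<Sum>b\<in>onb C. (c l \<bullet> b) *\<^sub>R deriv_in E (\<lambda>u. K u b) (f l) (f' w)) + K (f l) (c' w)"
  proof -
    have "c' w \<in> C" by (rule has_derivative_in_subspace[OF N l cN C c w])
    then show ?thesis using linear_on_expand[OF lin[OF flU(1)] C] by (simp add: sum.distrib)
  qed
  also have "(\<Sum>b\<in>onb C. (c l \<bullet> b) *\<^sub>R deriv_in E (\<lambda>u. K u b) (f l) (f' w)) = deriv_in E (\<lambda>u. K u (c l)) (f l) (f' w)"
  proof (rule deriv_in_eq[OF rel_open_subspace[OF U], symmetric])
    have "((\<lambda>u. \<Sum>b\<in>onb C. (c l \<bullet> b) *\<^sub>R K u b) has_derivative (\<lambda>z. \<Sum>b\<in>onb C. (c l \<bullet> b) *\<^sub>R deriv_in E (\<lambda>u. K u b) (f l) z)) (at (f l) within E)"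
      using onb(1)[OF C] by (intro has_derivative_sum has_derivative_scaleR_right Kd) auto
    then show "((\<lambda>u. K u (c l)) has_derivative (\<lambda>z. \<Sum>b\<in>onb C. (c l \<bullet> b) *\<^sub>R deriv_in E (\<lambda>u. K u b) (f l) z)) (at (f l) within E)"
      by (rule has_derivative_cong_rel[OF U flU(1), rotated]) (use linear_on_expand[OF lin C flU(2)] in auto)
    show "f' w \<in> E" by (rule has_derivative_in_subspace[OF N l _ rel_open_subspace[OF U] f w]) (use fN rel_open_subset[OF U] in auto)
  qed (use flU rel_open_subset[OF U] in auto)
  finally show "deriv_in F (\<lambda>l. K (f l) (c l)) l w = deriv_in E (\<lambda>u. K u (c l)) (f l) (f' w) + K (f l) (c' w)" .
qed

section \<open>Submersions and horizontal lifts in coordinates\<close>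

definition metric_on :: "'e::euclidean_space set \<Rightarrow> 'e set \<Rightarrow> ('e \<Rightarrow> 'e \<Rightarrow> 'e \<Rightarrow> real) \<Rightarrow> bool" where
  "metric_on E U G \<longleftrightarrow>
     (\<forall>v\<in>E. \<forall>w\<in>E. smooth_on E U (\<lambda>u. G u v w)) \<and>
     (\<forall>u\<in>U. (\<forall>w\<in>E. linear_on E (\<lambda>v. G u v w)) \<and> (\<forall>v\<in>E. \<forall>w\<in>E. G u v w = G u w v) \<and> (\<forall>v\<in>E. v \<noteq> 0 \<longrightarrow> G u v v > 0))"

lemma metric_onD:
  assumes "metric_on E U G"
  shows "v \<in> E \<Longrightarrow> w \<in> E \<Longrightarrow> C_k_on k E U (\<lambda>u. G u v w)"
    "u \<in> U \<Longrightarrow> w \<in> E \<Longrightarrow> linear_on E (\<lambda>v. G u v w)"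
    "u \<in> U \<Longrightarrow> v \<in> E \<Longrightarrow> w \<in> E \<Longrightarrow> G u v w = G u w v"
    "u \<in> U \<Longrightarrow> v \<in> E \<Longrightarrow> v \<noteq> 0 \<Longrightarrow> G u v v > 0"
  using assms unfolding metric_on_def smooth_on_def by auto

lemma metric_on_linear_right:
  assumes "metric_on E U G" "subspace E" "u \<in> U" "v \<in> E"
  shows "linear_on E (G u v)"
  unfolding linear_on_def
proof (intro ballI allI)
  fix x y a b assume xy: "x \<in> E" "y \<in> E"
  have in_E: "a *\<^sub>R x + b *\<^sub>R y \<in> E" using xy assms(2) by (auto intro: subspace_add subspace_scale)
  have "G u (a *\<^sub>R x + b *\<^sub>R y) v = a *\<^sub>R G u x v + b *\<^sub>R G u y v"
    using metric_onD(2)[OF assms(1,3,4)] xy unfolding linear_on_def by blast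
  then show "G u v (a *\<^sub>R x + b *\<^sub>R y) = a *\<^sub>R G u v x + b *\<^sub>R G u v y"
    using metric_onD(3)[OF assms(1,3)] xy assms(4) in_E by auto
qed

text \<open>The vector that represents a linear functional on \<open>E\<close> in the Euclidean
  inner product. It turns equations tested against all vectors of \<open>E\<close> into vector
  equations, to which the linear solver applies.\<close>

definition riesz :: "'e::euclidean_space set \<Rightarrow> ('e \<Rightarrow> real) \<Rightarrow> 'e" where
  "riesz E L = (\<Sum>b\<in>onb E. L b *\<^sub>R b)"

lemma riesz_in: "subspace E \<Longrightarrow> riesz E L \<in> E"
  unfolding riesz_def using onb(1)[of E] by (intro subspace_sum subspace_scale) auto

lemma riesz_inner:
  assumes "subspace E" "linear_on E L" "w \<in> E"
  shows "riesz E L \<bullet> w = L w"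
  using linear_on_expand[OF assms(2,1,3)] by (simp add: riesz_def inner_sum_left inner_commute[of w] mult.commute)

lemma riesz_linear: "riesz E (\<lambda>w. a * L w + b * L' w) = a *\<^sub>R riesz E L + b *\<^sub>R riesz E L'"
  by (simp add: riesz_def scaleR_add_left sum.distrib scaleR_sum_right)

lemma C_k_on_riesz:
  assumes "rel_open F U" "subspace E" "\<And>b. b \<in> E \<Longrightarrow> C_k_on k F U (\<lambda>u. L u b)"
  shows "C_k_on k F U (\<lambda>u. riesz E (L u))"
  unfolding riesz_def using assms onb(1)[OF assms(2)] by (intro C_k_on_sum C_k_on_scaleR C_k_on_const) auto

text \<open>The local form of a submersion whose target coordinates have been moved into a subspace
  \<open>E1\<close> of the model space of the source, so that base and fibre coordinates live in one
  space.\<close>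

locale coordinate_submersion =
  fixes E :: "'e::euclidean_space set" and U :: "'e set" and G :: "'e \<Rightarrow> 'e \<Rightarrow> 'e \<Rightarrow> real"
    and E1 :: "'e set" and Q :: "'e \<Rightarrow> 'e"
  assumes U: "rel_open E U" and G: "metric_on E U G" and E1: "subspace E1" "E1 \<subseteq> E"
    and Q: "smooth_on E U Q" and Q_in: "Q ` U \<subseteq> E1" and DQ_surj: "\<And>u. u \<in> U \<Longrightarrow> deriv_in E Q u ` E = E1"
begin

lemma E: "subspace E" using U rel_open_subspace by auto

lemma U_in: "u \<in> U \<Longrightarrow> u \<in> E" using U rel_open_subset by auto

lemma Qk: "C_k_on k E U Q" using Q by (simp add: smooth_on_def)

lemma DQ_linear: "u \<in> U \<Longrightarrow> linear (deriv_in E Q u)"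
  by (rule linear_deriv_in) (use Qk[of "Suc 0"] in auto)

lemma DQ_in: "u \<in> U \<Longrightarrow> v \<in> E \<Longrightarrow> deriv_in E Q u v \<in> E1" using DQ_surj by blast

lemma DQ_has: "u \<in> U \<Longrightarrow> (Q has_derivative deriv_in E Q u) (at u within E)"
  using C_k_on_SucD(1)[OF Qk[of "Suc 0"]] .

definition "vert u = {v \<in> E. deriv_in E Q u v = 0}"
definition "hor u = {v \<in> E. \<forall>w\<in>vert u. G u v w = 0}"

text \<open>
  The horizontal lift of \<open>\<xi>\<close> is the minimiser of \<open>G u h h / 2\<close> under the constraint that \<open>h\<close>
  projects to \<open>\<xi>\<close>; the saddle-point system determines it together with a Lagrange multiplier.
\<close>

definition "saddle u z = (riesz E (\<lambda>w. G u (fst z) w - deriv_in E Q u w \<bullet> snd z), deriv_in E Q u (fst z))"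

lemma saddle_linear: "u \<in> U \<Longrightarrow> linear_on (E \<times> E1) (saddle u)"
proof -
  assume u: "u \<in> U"
  have "saddle u (a *\<^sub>R z + b *\<^sub>R z') = a *\<^sub>R saddle u z + b *\<^sub>R saddle u z'"
    if z: "z \<in> E \<times> E1" "z' \<in> E \<times> E1" for z z' a b
  proof -
    have lin: "linear_on E (\<lambda>v. G u v w)" if "w \<in> E" for w using metric_onD(2)[OF G u that] .
    have "riesz E (\<lambda>w. G u (fst (a *\<^sub>R z + b *\<^sub>R z')) w - deriv_in E Q u w \<bullet> snd (a *\<^sub>R z + b *\<^sub>R z'))
       = riesz E (\<lambda>w. a * (G u (fst z) w - deriv_in E Q u w \<bullet> snd z) + b * (G u (fst z') w - deriv_in E Q u w \<bullet> snd z'))"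
      unfolding riesz_def
    proof (rule sum.cong[OF refl])
      fix w assume "w \<in> onb E"
      then have "w \<in> E" using onb(1)[OF E] by blast
      then have "G u (a *\<^sub>R fst z + b *\<^sub>R fst z') w = a * G u (fst z) w + b * G u (fst z') w"
        using lin z unfolding linear_on_def by (auto simp: mem_Times_iff)
      then show "(G u (fst (a *\<^sub>R z + b *\<^sub>R z')) w - deriv_in E Q u w \<bullet> snd (a *\<^sub>R z + b *\<^sub>R z')) *\<^sub>R w =
         (a * (G u (fst z) w - deriv_in E Q u w \<bullet> snd z) + b * (G u (fst z') w - deriv_in E Q u w \<bullet> snd z')) *\<^sub>R w"
        by (simp add: inner_add_right algebra_simps)
    qed
    then show ?thesis
      by (simp add: saddle_def riesz_linear linear_add[OF DQ_linear[OF u]] linear_cmul[OF DQ_linear[OF u]])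
  qed
  then show ?thesis unfolding linear_on_def by blast
qed

lemma saddle_in: "u \<in> U \<Longrightarrow> z \<in> E \<times> E1 \<Longrightarrow> saddle u z \<in> E \<times> E1"
  using riesz_in[OF E] DQ_in by (auto simp: saddle_def)

lemma saddle_functional:
  assumes u: "u \<in> U" and z: "z \<in> E \<times> E1" and w: "w \<in> E"
  shows "fst (saddle u z) \<bullet> w = G u (fst z) w - deriv_in E Q u w \<bullet> snd z"
proof -
  have "linear_on E (\<lambda>w. G u (fst z) w - deriv_in E Q u w \<bullet> snd z)"
    using metric_on_linear_right[OF G E u, of "fst z"] z DQ_linear[OF u]
    unfolding linear_on_def by (auto simp: linear_add linear_cmul inner_add_left algebra_simps)
  from riesz_inner[OF E this w] show ?thesis by (simp add: saddle_def)
qed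

text \<open>The second equation makes \<open>fst z\<close> vertical; testing the first with
  \<open>fst z\<close> itself gives \<open>G u (fst z) (fst z) = 0\<close>, so \<open>fst z\<close>
  vanishes. As \<open>deriv_in E Q u\<close> is onto \<open>E1\<close>, the first equation then
  kills the multiplier \<open>snd z\<close>.\<close>

lemma saddle_inj:
  assumes u: "u \<in> U" and z: "z \<in> E \<times> E1" and 0: "saddle u z = 0"
  shows "z = 0"
proof -
  have z': "fst z \<in> E" "snd z \<in> E1" using z by auto
  have eq: "G u (fst z) w = deriv_in E Q u w \<bullet> snd z" if "w \<in> E" for w
    using saddle_functional[OF u z that] 0 by simp
  have DQ0: "deriv_in E Q u (fst z) = 0" using 0 by (simp add: saddle_def zero_prod_def)
  then have "G u (fst z) (fst z) = 0" using eq z' by simp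
  then have f0: "fst z = 0" using metric_onD(4)[OF G u, of "fst z"] z' by force
  obtain w where w: "w \<in> E" "deriv_in E Q u w = snd z" using DQ_surj[OF u] z'(2) by (metis imageE)
  have "G u 0 w = 0" using linear_onD(3)[OF metric_onD(2)[OF G u w(1)] E] .
  then have "snd z \<bullet> snd z = 0" using eq[OF w(1)] f0 w(2) by simp
  then show ?thesis using f0 by (simp add: prod_eq_iff)
qed

lemma EE1: "subspace (E \<times> E1)" using E E1 by (simp add: subspace_Times)

lemma saddle_solution:
  assumes "u \<in> U" "\<xi> \<in> E1"
  shows "\<exists>!z. z \<in> E \<times> E1 \<and> saddle u z = (0, \<xi>)"
proof -
  have "(0, \<xi>) \<in> E \<times> E1" using assms E by (auto simp: subspace_0)
  have "\<exists>z\<in>E \<times> E1. saddle u z = (0, \<xi>)"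
    by (rule linear_on_surj[OF saddle_linear[OF assms(1)] EE1 _ _ \<open>(0, \<xi>) \<in> E \<times> E1\<close>])
      (fact saddle_in[OF assms(1)], fact saddle_inj[OF assms(1)])
  moreover have "z = z'" if "z \<in> E \<times> E1" "z' \<in> E \<times> E1" "saddle u z = saddle u z'" for z z'
  proof -
    have "saddle u (z - z') = 0" using linear_onD(4)[OF saddle_linear[OF assms(1)] EE1 that(1,2)] that(3) by simp
    then have "z - z' = 0" using saddle_inj[OF assms(1) subspace_diff[OF EE1 that(1,2)]] by blast
    then show ?thesis by simp
  qed
  ultimately show ?thesis by metis
qed

definition "lift_pair u \<xi> = (THE z. z \<in> E \<times> E1 \<and> saddle u z = (0, \<xi>))"
definition "hlift u \<xi> = fst (lift_pair u \<xi>)"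

lemma lift_pair:
  assumes "u \<in> U" "\<xi> \<in> E1"
  shows "lift_pair u \<xi> \<in> E \<times> E1" "saddle u (lift_pair u \<xi>) = (0, \<xi>)"
  using theI'[OF saddle_solution[OF assms]] unfolding lift_pair_def by auto

lemma hlift:
  assumes "u \<in> U" "\<xi> \<in> E1"
  shows "hlift u \<xi> \<in> E" "deriv_in E Q u (hlift u \<xi>) = \<xi>" "hlift u \<xi> \<in> hor u"
proof -
  note z = lift_pair[OF assms]
  show 1: "hlift u \<xi> \<in> E" using z(1) by (auto simp: hlift_def)
  show "deriv_in E Q u (hlift u \<xi>) = \<xi>" using z(2) by (simp add: hlift_def saddle_def)
  have "G u (hlift u \<xi>) w = 0" if "w \<in> vert u" for w
    using saddle_functional[OF assms(1) z(1), of w] that z(2) by (simp add: vert_def hlift_def)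
  then show "hlift u \<xi> \<in> hor u" using 1 by (simp add: hor_def)
qed

text \<open>The saddle-point system has smooth coefficients on a fixed space and is uniquely
  solvable at every point of \<open>U\<close>, although the vertical spaces themselves vary with the
  point.\<close>

lemma C_k_on_hlift:
  assumes \<xi>: "\<xi> \<in> E1"
  shows "C_k_on k E U (\<lambda>u. hlift u \<xi>)"
proof -
  have "C_k_on k E U (\<lambda>u. lift_pair u \<xi>)"
  proof (rule C_k_on_solve_subspace[OF U EE1, where A=saddle and b="\<lambda>_. (0, \<xi>)"])
    show "C_k_on k E U (\<lambda>u. saddle u w)" if w: "w \<in> E \<times> E1" for w
      unfolding saddle_def using w
      by (intro C_k_on_Pair U C_k_on_riesz E C_k_on_diff C_k_on_inner C_k_on_const metric_onD(1)[OF G] C_k_on_SucD(2)[OF Qk]) auto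
  qed (use saddle_linear saddle_in saddle_inj lift_pair[OF _ \<xi>] C_k_on_const[OF U] in blast)+
  then show ?thesis unfolding hlift_def by (rule C_k_on_bounded_linear_comp[OF U bounded_linear_fst])
qed

text \<open>Two horizontal vectors with the same image differ by a vector that is both horizontal
  and vertical, hence orthogonal to itself.\<close>

lemma hor_eq_hlift:
  assumes "u \<in> U" "h \<in> hor u"
  shows "h = hlift u (deriv_in E Q u h)"
proof -
  have h: "h \<in> E" using assms by (simp add: hor_def)
  note l = hlift[OF assms(1) DQ_in[OF assms(1) h]]
  let ?d = "h - hlift u (deriv_in E Q u h)"
  have dE: "?d \<in> E" using h l(1) E by (simp add: subspace_diff)
  have dv: "?d \<in> vert u" using dE l(2) linear_diff[OF DQ_linear[OF assms(1)]] by (simp add: vert_def)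
  have "G u ?d ?d = G u h ?d - G u (hlift u (deriv_in E Q u h)) ?d"
    by (rule linear_onD(4)[OF metric_onD(2)[OF G assms(1) dE] E h l(1)])
  also have "\<dots> = 0" using dv assms(2) l(3) by (simp add: hor_def)
  finally show ?thesis using metric_onD(4)[OF G assms(1) dE] by force
qed

lemma hor_subspace:
  assumes "u \<in> U" shows "subspace (hor u)"
proof (rule subspaceI)
  have vE: "w \<in> E" if "w \<in> vert u" for w using that by (simp add: vert_def)
  note lin = linear_onD[OF metric_onD(2)[OF G assms vE] E]
  show "0 \<in> hor u" using lin(3) subspace_0[OF E] by (auto simp: hor_def)
  show "x + y \<in> hor u" if "x \<in> hor u" "y \<in> hor u" for x y
    using that lin(1) subspace_add[OF E] by (auto simp: hor_def)
  show "c *\<^sub>R x \<in> hor u" if "x \<in> hor u" for c x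
    using that lin(2) subspace_scale[OF E] by (auto simp: hor_def)
qed

lemma hlift_linear: "u \<in> U \<Longrightarrow> linear_on E1 (hlift u)"
  unfolding linear_on_def
proof (intro ballI allI)
  fix \<xi> \<eta> a b assume u: "u \<in> U" and \<xi>: "\<xi> \<in> E1" and \<eta>: "\<eta> \<in> E1"
  have "a *\<^sub>R hlift u \<xi> + b *\<^sub>R hlift u \<eta> \<in> hor u"
    using hor_subspace[OF u] hlift(3)[OF u] \<xi> \<eta> by (auto intro: subspace_add subspace_scale)
  from hor_eq_hlift[OF u this]
  show "hlift u (a *\<^sub>R \<xi> + b *\<^sub>R \<eta>) = a *\<^sub>R hlift u \<xi> + b *\<^sub>R hlift u \<eta>"
    using hlift(2)[OF u] \<xi> \<eta> by (simp add: linear_add[OF DQ_linear[OF u]] linear_cmul[OF DQ_linear[OF u]])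
qed

text \<open>The difference of the two sides is the bracket of the horizontal lifts of the constant
  fields \<open>\<xi>\<close> and \<open>\<eta>\<close>, so the condition says that these lifts
  commute. It is the infinitesimal form in which integrability enters.\<close>

definition torsion_free :: bool where
  "torsion_free \<longleftrightarrow> (\<forall>u\<in>U. \<forall>\<xi>\<in>E1. \<forall>\<eta>\<in>E1.
     deriv_in E (\<lambda>u. hlift u \<eta>) u (hlift u \<xi>) = deriv_in E (\<lambda>u. hlift u \<xi>) u (hlift u \<eta>))"

text \<open>
  Along an integral manifold \<open>D \<iota> v = hlift \<iota> (D (Q \<iota>) v)\<close>. Differentiating this identity once more,
  the second derivatives of \<open>\<iota>\<close> and \<open>Q \<iota>\<close> are symmetric, hence so is the remaining term.
\<close>

lemma integral_torsion:
  fixes \<iota> :: "'l::euclidean_space \<Rightarrow> 'e"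
  assumes N: "rel_open F N" and \<iota>: "smooth_on F N \<iota>" and \<iota>N: "\<iota> ` N \<subseteq> U"
    and tan: "\<And>l. l \<in> N \<Longrightarrow> deriv_in F \<iota> l ` F = hor (\<iota> l)" and l: "l \<in> N"
    and \<xi>: "\<xi> \<in> E1" and \<eta>: "\<eta> \<in> E1"
  shows "deriv_in E (\<lambda>u. hlift u \<eta>) (\<iota> l) (hlift (\<iota> l) \<xi>) = deriv_in E (\<lambda>u. hlift u \<xi>) (\<iota> l) (hlift (\<iota> l) \<eta>)"
proof -
  have \<iota>k: "C_k_on k F N \<iota>" for k using \<iota> by (simp add: smooth_on_def)
  have Q\<iota>k: "C_k_on k F N (\<lambda>l. Q (\<iota> l))" for k using C_k_on_compose[OF N U \<iota>N \<iota>k Qk] .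
  have Q\<iota>E1: "(\<lambda>l. Q (\<iota> l)) ` N \<subseteq> E1" using \<iota>N Q_in by auto
  define c where "c v l = deriv_in F (\<lambda>l. Q (\<iota> l)) l v" for v l
  have cE1: "c v l \<in> E1" if "v \<in> F" "l \<in> N" for v l unfolding c_def
    using deriv_in_subspace[OF N that(2) Q\<iota>E1 E1(1) Q\<iota>k that(1)] .
  have \<iota>U: "\<iota> l \<in> U" if "l \<in> N" for l using \<iota>N that by auto
  have chain: "c v l = deriv_in E Q (\<iota> l) (deriv_in F \<iota> l v)" if "v \<in> F" "l \<in> N" for v l
    unfolding c_def
    by (rule deriv_in_chain[OF N U \<iota>N that(2) _ _ that(1)])
      (use \<iota>k[of "Suc 0"] Qk[of "Suc 0"] that \<iota>U in auto)
  have key: "deriv_in F \<iota> l v = hlift (\<iota> l) (c v l)" if "v \<in> F" "l \<in> N" for v l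
    using hor_eq_hlift[OF \<iota>U[OF that(2)], of "deriv_in F \<iota> l v"] tan[OF that(2)] that chain[OF that] by auto
  have second: "deriv_in F (\<lambda>l. deriv_in F \<iota> l v) l w =
     deriv_in E (\<lambda>u. hlift u (c v l)) (\<iota> l) (deriv_in F \<iota> l w) + hlift (\<iota> l) (deriv_in F (c v) l w)" if "v \<in> F" "w \<in> F" for v w
  proof -
    have "deriv_in F (\<lambda>l. deriv_in F \<iota> l v) l w = deriv_in F (\<lambda>l. hlift (\<iota> l) (c v l)) l w"
      using deriv_in_cong[OF N l] key[OF that(1)] by (metis (no_types, lifting))
    also have "\<dots> = deriv_in E (\<lambda>u. hlift u (c v l)) (\<iota> l) (deriv_in F \<iota> l w) + hlift (\<iota> l) (deriv_in F (c v) l w)"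
    proof (rule linear_family_deriv(1)[OF N U E1(1) \<iota>N _ hlift_linear C_k_on_hlift l])
      show "c v ` N \<subseteq> E1" using cE1 that by auto
      show "(\<iota> has_derivative deriv_in F \<iota> l) (at l within F)" using C_k_on_SucD(1)[OF \<iota>k l] .
      have "C_k_on (Suc 0) F N (c v)" using C_k_on_SucD(2)[OF Q\<iota>k that(1)] by (simp add: c_def[abs_def])
      then show "(c v has_derivative deriv_in F (c v) l) (at l within F)" using C_k_on_SucD(1) l by blast
    qed (use that in auto)
    finally show ?thesis .
  qed
  obtain v where v: "v \<in> F" "deriv_in F \<iota> l v = hlift (\<iota> l) \<xi>" using tan[OF l] hlift(3)[OF \<iota>U[OF l] \<xi>] by (metis imageE)
  obtain w where w: "w \<in> F" "deriv_in F \<iota> l w = hlift (\<iota> l) \<eta>" using tan[OF l] hlift(3)[OF \<iota>U[OF l] \<eta>] by (metis imageE)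
  have cv: "c v l = \<xi>" "c w l = \<eta>" using chain l v w hlift(2)[OF \<iota>U[OF l]] \<xi> \<eta> by auto
  have s1: "deriv_in F (\<lambda>l. deriv_in F \<iota> l v) l w = deriv_in F (\<lambda>l. deriv_in F \<iota> l w) l v"
    using second_derivative_symmetric[OF N l \<iota>k v(1) w(1)] .
  have s2: "deriv_in F (c v) l w = deriv_in F (c w) l v"
    using second_derivative_symmetric[OF N l Q\<iota>k v(1) w(1)] by (simp add: c_def[abs_def])
  show ?thesis using second[OF v(1) w(1)] second[OF w(1) v(1)] s1 s2 v(2) w(2) cv by simp
qed

text \<open>
  Moving along the horizontal lifts of the radial lines in \<open>E1\<close> straightens the leaves: the
  derivative of the flow in direction \<open>a\<close> solves the variational equation, and by symmetry of
  the lifts so does \<open>s \<mapsto> s *\<^sub>R hlift (u s) a\<close>.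
\<close>

theorem straightening:
  assumes tf: torsion_free and u0: "u0 \<in> U" and Q0: "Q u0 = 0"
    and DQ0: "\<And>v. v \<in> E \<Longrightarrow> deriv_in E Q u0 v = proj E1 v"
  obtains N \<Theta> \<Psi> where "rel_open E N" "0 \<in> N" "smooth_on E N \<Theta>" "\<Theta> ` N \<subseteq> U" "rel_open E (\<Theta> ` N)"
    "smooth_on E (\<Theta> ` N) \<Psi>" "\<And>p. p \<in> N \<Longrightarrow> \<Psi> (\<Theta> p) = p" "\<Theta> 0 = u0"
    "\<And>p. p \<in> N \<Longrightarrow> Q (\<Theta> p) = proj E1 p"
    "\<And>p a. p \<in> N \<Longrightarrow> a \<in> E1 \<Longrightarrow> deriv_in E \<Theta> p a \<in> hor (\<Theta> p)"
    "\<And>p v. p \<in> N \<Longrightarrow> v \<in> E \<Longrightarrow> deriv_in E Q (\<Theta> p) (deriv_in E \<Theta> p v) = proj E1 v"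
    "\<And>p v. p \<in> N \<Longrightarrow> v \<in> E \<Longrightarrow> deriv_in E \<Theta> p v = 0 \<Longrightarrow> v = 0"
proof -
  define D where "D = E1 \<times> E"
  define \<Omega> where "\<Omega> = E1 \<times> U"
  \<comment> \<open>The direction is carried along as a constant first component. This turns the
    family of lifts into a single vector field and makes the direction part of the initial
    value.\<close>
  define X where "X z = (0::'e, hlift (snd z) (fst z))" for z
  have \<Omega>: "rel_open D \<Omega>" unfolding D_def \<Omega>_def using rel_open_Times[OF rel_open_self[OF E1(1)] U] .
  have D: "subspace D" using \<Omega> rel_open_subspace by blast
  have Xk: "C_k_on k D \<Omega> X" for k unfolding X_def
    by (intro C_k_on_Pair C_k_on_const \<Omega> C_k_on_linear_family[OF \<Omega> U E1(1) _ _ hlift_linear C_k_on_hlift]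
       C_k_on_bounded_linear[OF \<Omega> bounded_linear_fst] C_k_on_bounded_linear[OF \<Omega> bounded_linear_snd])
      (auto simp: \<Omega>_def)
  have X: "smooth_on D \<Omega> X" using Xk by (simp add: smooth_on_def)
  have X_in: "X ` \<Omega> \<subseteq> D" using hlift subspace_0[OF E1(1)] by (auto simp: X_def D_def \<Omega>_def)
  have DX: "deriv_in D X z w = (0, deriv_in E (\<lambda>u. hlift u (fst z)) (snd z) (snd w) + hlift (snd z) (fst w))"
    if z: "z \<in> \<Omega>" and w: "w \<in> D" for z w
  proof -
    have f1: "(\<lambda>z. snd z) ` \<Omega> \<subseteq> U" and f2: "(\<lambda>z. fst z) ` \<Omega> \<subseteq> E1" by (auto simp: \<Omega>_def)
    have d1: "((\<lambda>z::'e\<times>'e. snd z) has_derivative (\<lambda>z. snd z)) (at z within D)" and d2: "((\<lambda>z::'e\<times>'e. fst z) has_derivative (\<lambda>z. fst z)) (at z within D)"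
      using bounded_linear_imp_has_derivative[OF bounded_linear_snd] bounded_linear_imp_has_derivative[OF bounded_linear_fst] by blast+
    note fam = linear_family_deriv[OF \<Omega> U E1(1) f1 f2 hlift_linear C_k_on_hlift z d1 d2 w]
    have "((\<lambda>z. (0::'e, hlift (snd z) (fst z))) has_derivative (\<lambda>w. (0, deriv_in D (\<lambda>z. hlift (snd z) (fst z)) z w))) (at z within D)"
      by (intro has_derivative_Pair has_derivative_const has_deriv_in fam(2))
    from deriv_in_eq[OF D _ this w] show ?thesis
      using fam(1) z rel_open_subset[OF \<Omega>] by (auto simp: X_def[abs_def])
  qed
  have z0: "(0, u0) \<in> \<Omega>" using u0 subspace_0[OF E1(1)] by (simp add: \<Omega>_def)
  obtain \<epsilon> \<delta> \<phi> where \<epsilon>: "\<epsilon> > 0" and \<delta>: "\<delta> > 0" and ball: "D \<inter> ball (0, u0) \<delta> \<subseteq> \<Omega>"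
    and \<phi>0: "\<And>b. b \<in> D \<inter> ball (0, u0) \<delta> \<Longrightarrow> \<phi> b 0 = b"
    and \<phi>\<Omega>: "\<And>b s. b \<in> D \<inter> ball (0, u0) \<delta> \<Longrightarrow> s \<in> {-1..1} \<Longrightarrow> \<phi> b s \<in> \<Omega>"
    and \<phi>': "\<And>b s. b \<in> D \<inter> ball (0, u0) \<delta> \<Longrightarrow> s \<in> {-1..1} \<Longrightarrow> (\<phi> b has_vector_derivative \<epsilon> *\<^sub>R X (\<phi> b s)) (at s within {-1..1})"
    and \<phi>k: "\<And>s k. C_k_on k D (D \<inter> ball (0, u0) \<delta>) (\<lambda>b. \<phi> b s)"
    and var: "\<And>b v W s. b \<in> D \<inter> ball (0, u0) \<delta> \<Longrightarrow> v \<in> D \<Longrightarrow>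
      (\<And>s. s \<in> {-1..1} \<Longrightarrow> (W has_vector_derivative \<epsilon> *\<^sub>R deriv_in D X (\<phi> b s) (W s)) (at s within {-1..1})) \<Longrightarrow>
      (\<And>s. s \<in> {-1..1} \<Longrightarrow> W s \<in> D) \<Longrightarrow> W 0 = v \<Longrightarrow> s \<in> {-1..1} \<Longrightarrow> deriv_in D (\<lambda>b. \<phi> b s) b v = W s"
    by (rule local_flow[OF \<Omega> X X_in z0]) blast
  define B where "B = D \<inter> ball (0, u0) \<delta>"
  have B: "rel_open D B" unfolding B_def using rel_open_Int_open[OF rel_open_self[OF D]] by blast
  note \<phi> = \<phi>0[folded B_def] \<phi>\<Omega>[folded B_def] \<phi>'[folded B_def] \<phi>k[folded B_def] and var = var[folded B_def]
  have fst\<phi>: "fst (\<phi> b s) = fst b" if b: "b \<in> B" and s: "s \<in> {-1..1}" for b s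
  proof -
    have "norm (fst (\<phi> b s) - fst (\<phi> b 0)) \<le> 0 * \<bar>s - 0\<bar>"
    proof (rule vector_derivative_bound[where a="-1" and b=1 and f'="\<lambda>_. 0"])
      fix t :: real assume t: "t \<in> {-1..1}"
      show "((\<lambda>s. fst (\<phi> b s)) has_vector_derivative 0) (at t within {-1..1})"
        using bounded_linear.has_vector_derivative[OF bounded_linear_fst \<phi>(3)[OF b t]] by (simp add: X_def)
    qed (use s in auto)
    then show ?thesis using \<phi>(1)[OF b] by simp
  qed
  have snd\<phi>: "((\<lambda>s. snd (\<phi> b s)) has_vector_derivative hlift (snd (\<phi> b s)) (\<epsilon> *\<^sub>R fst b)) (at s within {-1..1})"
    if b: "b \<in> B" and s: "s \<in> {-1..1}" for b s
  proof -
    have "snd (\<phi> b s) \<in> U" "fst b \<in> E1" using \<phi>(2)[OF b s] b by (auto simp: \<Omega>_def B_def D_def)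
    then have "hlift (snd (\<phi> b s)) (\<epsilon> *\<^sub>R fst b) = \<epsilon> *\<^sub>R hlift (snd (\<phi> b s)) (fst b)"
      using linear_onD(2)[OF hlift_linear E1(1)] by blast
    then show ?thesis
      using bounded_linear.has_vector_derivative[OF bounded_linear_snd \<phi>(3)[OF b s]] fst\<phi>[OF b s] by (simp add: X_def)
  qed
  have snd\<phi>U: "snd (\<phi> b s) \<in> U" if "b \<in> B" "s \<in> {-1..1}" for b s using \<phi>(2)[OF that] by (auto simp: \<Omega>_def)
  \<comment> \<open>Along the flow \<open>Q\<close> moves with the constant velocity
    \<open>\<epsilon> *\<^sub>R fst b\<close>, because a lift projects to the vector that it
    lifts.\<close>
  have Q\<phi>: "Q (snd (\<phi> b 1)) = Q (snd b) + \<epsilon> *\<^sub>R fst b" if b: "b \<in> B" for b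
  proof -
    have fb: "\<epsilon> *\<^sub>R fst b \<in> E1" using b subspace_scale[OF E1(1)] by (auto simp: B_def D_def)
    let ?f = "\<lambda>s. Q (snd (\<phi> b s)) - s *\<^sub>R (\<epsilon> *\<^sub>R fst b)"
    have "norm (?f 1 - ?f 0) \<le> 0 * \<bar>1 - 0\<bar>"
    proof (rule vector_derivative_bound[where a="-1" and b=1 and f'="\<lambda>_. 0"])
      fix t :: real assume t: "t \<in> {-1..1}"
      have sub: "(\<lambda>s. snd (\<phi> b s)) ` {-1..1} \<subseteq> E" using snd\<phi>U[OF b] U_in by auto
      have "((\<lambda>s. Q (snd (\<phi> b s))) has_derivative (\<lambda>h. deriv_in E Q (snd (\<phi> b t)) (h *\<^sub>R hlift (snd (\<phi> b t)) (\<epsilon> *\<^sub>R fst b)))) (at t within {-1..1})"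
        by (rule has_derivative_in_compose[OF snd\<phi>[OF b t, unfolded has_vector_derivative_def] has_derivative_subset[OF DQ_has[OF snd\<phi>U[OF b t]] sub]])
      then have "((\<lambda>s. Q (snd (\<phi> b s))) has_vector_derivative \<epsilon> *\<^sub>R fst b) (at t within {-1..1})"
        using hlift(2)[OF snd\<phi>U[OF b t] fb] by (simp add: has_vector_derivative_def linear_cmul[OF DQ_linear[OF snd\<phi>U[OF b t]]])
      then have "(?f has_vector_derivative \<epsilon> *\<^sub>R fst b - 1 *\<^sub>R (\<epsilon> *\<^sub>R fst b)) (at t within {-1..1})"
        by (intro has_vector_derivative_diff has_vector_derivative_scaleR[where g="\<lambda>_. \<epsilon> *\<^sub>R fst b" and g'=0, simplified] derivative_eq_intros) auto
      then show "(?f has_vector_derivative 0) (at t within {-1..1})" by simp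
    qed auto
    then show ?thesis using \<phi>(1)[OF b] by (simp add: algebra_simps)
  qed
  define P2 where "P2 p = p - proj E1 p" for p
  have bP2: "bounded_linear P2" unfolding P2_def by (intro bounded_linear_sub bounded_linear_ident bounded_linear_proj)
  have P2_in: "P2 p \<in> E" if "p \<in> E" for p using that proj_in[OF E1(1)] E1(2) E by (auto simp: P2_def intro: subspace_diff)
  define N0 where "N0 = {p \<in> E. u0 + P2 p \<in> U}"
  have EE: "rel_open E E" using rel_open_self[OF E] .
  have c1: "C_k_on k E E (\<lambda>p. u0 + P2 p)" for k
    by (intro C_k_on_add EE C_k_on_const C_k_on_bounded_linear[OF EE bP2])
  have into1: "(\<lambda>p. u0 + P2 p) ` E \<subseteq> E" using P2_in U_in[OF u0] E by (auto intro: subspace_add)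
  have N0: "rel_open E N0" unfolding N0_def
    by (rule rel_open_vimage[OF EE U C_k_on_continuous[OF EE c1] into1])
  have N0U: "(\<lambda>p. u0 + P2 p) ` N0 \<subseteq> U" by (auto simp: N0_def)
  \<comment> \<open>The start \<open>u0 + P2 p\<close> need not lie on the zero level of
    \<open>Q\<close>, so the value of \<open>Q\<close> there is subtracted. Together with the factor
    \<open>1 / \<epsilon>\<close>, which undoes the time rescaling, this makes \<open>Q\<close>
    equal to \<open>proj E1 p\<close> at time 1.\<close>
  define b where "b p = ((1 / \<epsilon>) *\<^sub>R (proj E1 p - Q (u0 + P2 p)), u0 + P2 p)" for p
  have c1': "C_k_on k E N0 (\<lambda>p. u0 + P2 p)" for k by (rule C_k_on_subset[OF c1]) (auto simp: N0_def)
  have bk: "C_k_on k E N0 b" for k unfolding b_def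
    by (intro C_k_on_Pair N0 C_k_on_scaleR_const C_k_on_diff C_k_on_bounded_linear[OF N0 bounded_linear_proj] c1'
      C_k_on_compose[OF N0 U N0U c1' Qk])
  have b_in: "b ` N0 \<subseteq> D" using N0U Q_in U_in proj_in[OF E1(1)] E1(1)
    by (auto simp: b_def D_def intro!: subspace_scale subspace_diff)
  define N1 where "N1 = {p \<in> N0. b p \<in> B}"
  have N1: "rel_open E N1" unfolding N1_def by (rule rel_open_vimage[OF N0 B C_k_on_continuous[OF N0 bk] b_in])
  have N1E: "N1 \<subseteq> E" using rel_open_subset[OF N1] .
  have N1N0: "N1 \<subseteq> N0" by (auto simp: N1_def)
  have bN1: "b ` N1 \<subseteq> B" by (auto simp: N1_def)
  have P20: "P2 0 = 0" "proj E1 0 = 0" using linear_0[OF linear_proj] by (auto simp: P2_def)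
  have b0: "b 0 = (0, u0)" using P20 Q0 by (simp add: b_def)
  have zB: "(0, u0) \<in> B" using \<delta> U_in[OF u0] subspace_0[OF E1(1)] by (simp add: B_def D_def)
  have 0: "0 \<in> N1" using b0 P20 u0 subspace_0[OF E] zB by (simp add: N1_def N0_def)
  define \<Theta> where "\<Theta> p = snd (\<phi> (b p) 1)" for p
  have bk1: "C_k_on k E N1 b" for k using C_k_on_subset[OF bk N1N0] .
  have \<Theta>k: "C_k_on k E N1 \<Theta>" for k unfolding \<Theta>_def
    by (intro C_k_on_bounded_linear_comp[OF N1 bounded_linear_snd] C_k_on_compose[OF N1 B bN1 bk1 \<phi>(4)])
  have \<Theta>U: "\<Theta> p \<in> U" if "p \<in> N1" for p using snd\<phi>U[of "b p" 1] that by (auto simp: \<Theta>_def N1_def)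
  have Q\<Theta>: "Q (\<Theta> p) = proj E1 p" if p: "p \<in> N1" for p
    using Q\<phi>[of "b p"] p \<epsilon> by (simp add: \<Theta>_def N1_def) (simp add: b_def)
  have D\<Theta>: "deriv_in E \<Theta> p v = snd (deriv_in D (\<lambda>b. \<phi> b 1) (b p) (deriv_in E b p v))" if p: "p \<in> N1" and v: "v \<in> E" for p v
  proof -
    have 1: "deriv_in E (\<lambda>p. \<phi> (b p) 1) p v = deriv_in D (\<lambda>b. \<phi> b 1) (b p) (deriv_in E b p v)"
      by (rule deriv_in_chain[OF N1 B bN1 p _ _ v])
        (use bk1[of "Suc 0"] \<phi>(4)[of "Suc 0"] p bN1 in auto)
    have "C_k_on (Suc 0) E N1 (\<lambda>p. \<phi> (b p) 1)" by (rule C_k_on_compose[OF N1 B bN1 bk1 \<phi>(4)])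
    from bounded_linear.has_derivative[OF bounded_linear_snd C_k_on_SucD(1)[OF this p]]
    have "((\<lambda>p. snd (\<phi> (b p) 1)) has_derivative (\<lambda>v. snd (deriv_in E (\<lambda>p. \<phi> (b p) 1) p v))) (at p within E)" .
    from deriv_in_eq[OF E _ this v] show ?thesis using 1 p N1E by (auto simp: \<Theta>_def[abs_def])
  qed
  have Db: "deriv_in E b p v = ((1 / \<epsilon>) *\<^sub>R (proj E1 v - deriv_in E Q (u0 + P2 p) (P2 v)), P2 v)" if p: "p \<in> N1" and v: "v \<in> E" for p v
  proof (rule deriv_in_eq[OF E _ _ v])
    show "p \<in> E" using p N1E by auto
    have pU: "u0 + P2 p \<in> U" using p N1N0 by (auto simp: N0_def)
    have d1: "((\<lambda>p. u0 + P2 p) has_derivative P2) (at p within E)"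
      using has_derivative_add[OF has_derivative_const bounded_linear_imp_has_derivative[OF bP2]] by simp
    show "(b has_derivative (\<lambda>v. ((1 / \<epsilon>) *\<^sub>R (proj E1 v - deriv_in E Q (u0 + P2 p) (P2 v)), P2 v))) (at p within E)"
      unfolding b_def
      by (intro has_derivative_Pair has_derivative_scaleR_right has_derivative_diff
        bounded_linear_imp_has_derivative[OF bounded_linear_proj] d1
        has_derivative_chain_rel[OF N0 U N0U _ d1 DQ_has[OF pU]]) (use p N1N0 in auto)
  qed
  have \<Theta>_hlift: "deriv_in E \<Theta> p a = hlift (\<Theta> p) a" if p: "p \<in> N1" and a: "a \<in> E1" for p a
  proof -
    have aE: "a \<in> E" using a E1 by auto
    have P2a: "P2 a = 0" using proj_id[OF E1(1) a] by (simp add: P2_def)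
    have pU: "u0 + P2 p \<in> U" using p N1N0 by (auto simp: N0_def)
    have bp: "b p \<in> B" using p by (simp add: N1_def)
    let ?u = "\<lambda>s. snd (\<phi> (b p) s)"
    let ?\<xi> = "\<epsilon> *\<^sub>R fst (b p)"
    have \<xi>: "?\<xi> \<in> E1" "fst (b p) \<in> E1" using bp subspace_scale[OF E1(1)] by (auto simp: B_def D_def)
    have Dba: "deriv_in E b p a = ((1 / \<epsilon>) *\<^sub>R a, 0)"
      using Db[OF p aE] P2a proj_id[OF E1(1) a] linear_0[OF DQ_linear[OF pU]] by simp
    \<comment> \<open>The initial value is \<open>deriv_in E b p a\<close>: the starting point does
      not move with the \<open>E1\<close> part of \<open>p\<close>, so the second component vanishes
      at time 0.\<close>
    define W where "W s = ((1 / \<epsilon>) *\<^sub>R a, s *\<^sub>R hlift (?u s) a)" for s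
    have "deriv_in D (\<lambda>b. \<phi> b 1) (b p) ((1 / \<epsilon>) *\<^sub>R a, 0) = W 1"
    proof (rule var[OF bp])
      show "((1 / \<epsilon>) *\<^sub>R a, 0) \<in> D" using a subspace_scale[OF E1(1)] subspace_0[OF E] by (simp add: D_def)
      show WD: "W s \<in> D" if "s \<in> {-1..1}" for s
        using a subspace_scale[OF E1(1)] subspace_scale[OF E] hlift(1)[OF snd\<phi>U[OF bp that] a] by (simp add: D_def W_def)
      show "W 0 = ((1 / \<epsilon>) *\<^sub>R a, 0)" by (simp add: W_def)
      fix s :: real assume s: "s \<in> {-1..1}"
      have us: "?u s \<in> U" using snd\<phi>U[OF bp s] .
      have sub: "?u ` {-1..1} \<subseteq> E" using snd\<phi>U[OF bp] U_in by auto
      have lina: "linear (deriv_in E (\<lambda>u. hlift u a) (?u s))"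
        by (rule linear_deriv_in) (use C_k_on_hlift[OF a, of "Suc 0"] us in auto)
      have "((\<lambda>s. hlift (?u s) a) has_derivative (\<lambda>h. deriv_in E (\<lambda>u. hlift u a) (?u s) (h *\<^sub>R hlift (?u s) ?\<xi>))) (at s within {-1..1})"
        by (rule has_derivative_in_compose[OF snd\<phi>[OF bp s, unfolded has_vector_derivative_def]
            has_derivative_subset[OF C_k_on_SucD(1)[OF C_k_on_hlift[OF a] us] sub]])
      then have "((\<lambda>s. hlift (?u s) a) has_vector_derivative deriv_in E (\<lambda>u. hlift u a) (?u s) (hlift (?u s) ?\<xi>)) (at s within {-1..1})"
        by (simp add: has_vector_derivative_def linear_cmul[OF lina])
      then have hv: "((\<lambda>s. hlift (?u s) a) has_vector_derivative deriv_in E (\<lambda>u. hlift u ?\<xi>) (?u s) (hlift (?u s) a)) (at s within {-1..1})"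
        using tf us a \<xi>(1) unfolding torsion_free_def by metis
      have "((\<lambda>s. s *\<^sub>R hlift (?u s) a) has_vector_derivative s *\<^sub>R deriv_in E (\<lambda>u. hlift u ?\<xi>) (?u s) (hlift (?u s) a) + 1 *\<^sub>R hlift (?u s) a) (at s within {-1..1})"
        by (rule has_vector_derivative_scaleR[OF _ hv]) (auto intro!: derivative_eq_intros)
      then have "(W has_vector_derivative (0, s *\<^sub>R deriv_in E (\<lambda>u. hlift u ?\<xi>) (?u s) (hlift (?u s) a) + hlift (?u s) a)) (at s within {-1..1})"
        unfolding W_def by (intro has_vector_derivative_Pair has_vector_derivative_const) simp
      moreover have "\<epsilon> *\<^sub>R deriv_in D X (\<phi> (b p) s) (W s) = (0, s *\<^sub>R deriv_in E (\<lambda>u. hlift u ?\<xi>) (?u s) (hlift (?u s) a) + hlift (?u s) a)"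
      proof -
        have "deriv_in E (\<lambda>u. hlift u ?\<xi>) (?u s) (hlift (?u s) a) = \<epsilon> *\<^sub>R deriv_in E (\<lambda>u. hlift u (fst (b p))) (?u s) (hlift (?u s) a)"
        proof (rule deriv_in_eq[OF E U_in[OF us] _ hlift(1)[OF us a]])
          have "((\<lambda>u. \<epsilon> *\<^sub>R hlift u (fst (b p))) has_derivative (\<lambda>v. \<epsilon> *\<^sub>R deriv_in E (\<lambda>u. hlift u (fst (b p))) (?u s) v)) (at (?u s) within E)"
            by (rule has_derivative_scaleR_right[OF C_k_on_SucD(1)[OF C_k_on_hlift[OF \<xi>(2)] us]])
          then show "((\<lambda>u. hlift u ?\<xi>) has_derivative (\<lambda>v. \<epsilon> *\<^sub>R deriv_in E (\<lambda>u. hlift u (fst (b p))) (?u s) v)) (at (?u s) within E)"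
            by (rule has_derivative_cong_rel[OF U us, rotated]) (use linear_onD(2)[OF hlift_linear E1(1) \<xi>(2)] in simp)
        qed
        moreover have "hlift (?u s) ((1 / \<epsilon>) *\<^sub>R a) = (1 / \<epsilon>) *\<^sub>R hlift (?u s) a"
          using linear_onD(2)[OF hlift_linear[OF us] E1(1) a] .
        moreover have "deriv_in E (\<lambda>u. hlift u (fst (b p))) (?u s) (s *\<^sub>R hlift (?u s) a) = s *\<^sub>R deriv_in E (\<lambda>u. hlift u (fst (b p))) (?u s) (hlift (?u s) a)"
          by (rule linear_cmul[OF linear_deriv_in]) (use C_k_on_hlift[OF \<xi>(2), of "Suc 0"] us in auto)
        ultimately show ?thesis
          using DX[OF \<phi>(2)[OF bp s] WD[OF s]] fst\<phi>[OF bp s] \<epsilon> by (simp add: W_def algebra_simps)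
      qed
      ultimately show "(W has_vector_derivative \<epsilon> *\<^sub>R deriv_in D X (\<phi> (b p) s) (W s)) (at s within {-1..1})" by simp
    qed simp
    then show ?thesis using D\<Theta>[OF p aE] Dba by (simp add: W_def \<Theta>_def)
  qed
  have DQ\<Theta>: "deriv_in E Q (\<Theta> p) (deriv_in E \<Theta> p v) = proj E1 v" if p: "p \<in> N1" and v: "v \<in> E" for p v
  proof -
    have "deriv_in E (\<lambda>p. Q (\<Theta> p)) p v = deriv_in E Q (\<Theta> p) (deriv_in E \<Theta> p v)"
      by (rule deriv_in_chain[OF N1 U _ p _ _ v]) (use \<Theta>k[of "Suc 0"] Qk[of "Suc 0"] p \<Theta>U in auto)
    moreover have "deriv_in E (\<lambda>p. Q (\<Theta> p)) p = deriv_in E (proj E1) p"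
      by (rule deriv_in_cong[OF N1 p Q\<Theta>])
    moreover have "deriv_in E (proj E1) p v = proj E1 v"
      using deriv_in_eq[OF E _ bounded_linear_imp_has_derivative[OF bounded_linear_proj] v] p N1E by blast
    ultimately show ?thesis by simp
  qed
  have snd\<phi>z: "snd (\<phi> (0, u0) s) = u0" if s: "s \<in> {-1..1}" for s
  proof -
    have "norm (snd (\<phi> (0, u0) s) - snd (\<phi> (0, u0) 0)) \<le> 0 * \<bar>s - 0\<bar>"
    proof (rule vector_derivative_bound[where a="-1" and b=1 and f'="\<lambda>_. 0"])
      fix t :: real assume t: "t \<in> {-1..1}"
      have "hlift (snd (\<phi> (0, u0) t)) 0 = 0" using linear_onD(3)[OF hlift_linear[OF snd\<phi>U[OF zB t]] E1(1)] .
      then show "((\<lambda>s. snd (\<phi> (0, u0) s)) has_vector_derivative 0) (at t within {-1..1})"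
        using snd\<phi>[OF zB t] by simp
    qed (use s in auto)
    then show ?thesis using \<phi>(1)[OF zB] by simp
  qed
  have \<Theta>0: "\<Theta> 0 = u0" using snd\<phi>z[of 1] b0 by (simp add: \<Theta>_def)
  \<comment> \<open>For such \<open>v\<close> the initial value \<open>b\<close> moves in direction
    \<open>(0, v)\<close>. Lifts of 0 vanish, so this variation is constant in time. Knowing the
    derivative in fibre directions at the one point 0 gives the injectivity required by
    \<open>local_inverse\<close>.\<close>
  have D\<Theta>0: "deriv_in E \<Theta> 0 v = v" if v: "v \<in> E" "proj E1 v = 0" for v
  proof -
    have P2v: "P2 v = v" using v by (simp add: P2_def)
    have Dbv: "deriv_in E b 0 v = (0, v)" using Db[OF 0 v(1)] P2v v P20 DQ0[OF v(1)] by simp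
    have "deriv_in D (\<lambda>b. \<phi> b 1) (0, u0) (0, v) = (\<lambda>s::real. (0, v)) 1"
    proof (rule var[OF zB])
      show vD: "(0, v) \<in> D" using v subspace_0[OF E1(1)] by (simp add: D_def)
      then show "(0, v) \<in> D" .
      fix s :: real assume s: "s \<in> {-1..1}"
      have us: "snd (\<phi> (0, u0) s) \<in> U" using snd\<phi>U[OF zB s] .
      have "deriv_in E (\<lambda>u. hlift u 0) (snd (\<phi> (0, u0) s)) v = 0"
      proof (rule deriv_in_eq[OF E U_in[OF us] _ v(1)])
        show "((\<lambda>u. hlift u 0) has_derivative (\<lambda>v. 0)) (at (snd (\<phi> (0, u0) s)) within E)"
          by (rule has_derivative_cong_rel[OF U us _ has_derivative_const[of 0]])
            (use linear_onD(3)[OF hlift_linear E1(1)] in auto)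
      qed
      then have "deriv_in D X (\<phi> (0, u0) s) (0, v) = 0"
        using DX[OF \<phi>(2)[OF zB s] vD] fst\<phi>[OF zB s] linear_onD(3)[OF hlift_linear[OF us] E1(1)] by (simp add: zero_prod_def)
      then show "((\<lambda>s. (0, v)) has_vector_derivative \<epsilon> *\<^sub>R deriv_in D X (\<phi> (0, u0) s) (0, v)) (at s within {-1..1})" by simp
    qed auto
    then show ?thesis using D\<Theta>[OF 0 v(1)] Dbv b0 by simp
  qed
  have inj0: "v = 0" if v: "v \<in> E" and 0: "deriv_in E \<Theta> 0 v = 0" for v
  proof -
    have "proj E1 v = 0" using DQ\<Theta>[OF \<open>0 \<in> N1\<close> v] 0 \<Theta>0 linear_0[OF DQ_linear[OF u0]] by simp
    then show ?thesis using D\<Theta>0[OF v] 0 by simp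
  qed
  have sm: "smooth_on E N1 \<Theta>" using \<Theta>k by (simp add: smooth_on_def)
  have into: "\<Theta> ` N1 \<subseteq> E" using \<Theta>U U_in by auto
  obtain N \<Psi> where N: "rel_open E N" "0 \<in> N" "N \<subseteq> N1" "\<And>p. p \<in> N \<Longrightarrow> \<Psi> (\<Theta> p) = p"
    "rel_open E (\<Theta> ` N)" "smooth_on E (\<Theta> ` N) \<Psi>"
    "\<And>p v. p \<in> N \<Longrightarrow> v \<in> E \<Longrightarrow> deriv_in E \<Theta> p v = 0 \<Longrightarrow> v = 0"
    using local_inverse[OF N1 0 sm into inj0] by blast
  show ?thesis
  proof (rule that[OF N(1,2) _ _ N(5,6,4) \<Theta>0])
    show "smooth_on E N \<Theta>" using \<Theta>k C_k_on_subset[OF _ N(3)] by (auto simp: smooth_on_def)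
    show "\<Theta> ` N \<subseteq> U" using \<Theta>U N(3) by auto
    show "deriv_in E \<Theta> p a \<in> hor (\<Theta> p)" if "p \<in> N" "a \<in> E1" for p a
      using \<Theta>_hlift[of p a] hlift(3)[OF \<Theta>U] that N(3) by auto
  qed (use Q\<Theta> DQ\<Theta> N in auto)
qed

end

section \<open>Bilinear families and metrics along maps and curves\<close>

lemma C_k_on_bilinear_family:
  fixes f :: "'e::euclidean_space \<Rightarrow> 'd::euclidean_space" and a :: "'e \<Rightarrow> 'a::euclidean_space" and b :: "'e \<Rightarrow> 'b::euclidean_space"
  assumes N: "rel_open F N" and U: "rel_open E U" and A: "subspace A" and C: "subspace C"
    and fN: "f ` N \<subseteq> U" and aN: "a ` N \<subseteq> A" and bN: "b ` N \<subseteq> C"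
    and lin1: "\<And>u y. u \<in> U \<Longrightarrow> y \<in> C \<Longrightarrow> linear_on A (\<lambda>x. B u x y)"
    and lin2: "\<And>u x. u \<in> U \<Longrightarrow> x \<in> A \<Longrightarrow> linear_on C (B u x)"
    and B: "\<And>x y. x \<in> A \<Longrightarrow> y \<in> C \<Longrightarrow> C_k_on k E U (\<lambda>u. B u x y)"
    and f: "C_k_on k F N f" and a: "C_k_on k F N a" and b: "C_k_on k F N b"
  shows "C_k_on k F N (\<lambda>l. B (f l) (a l) (b l))"
proof -
  have UC: "rel_open (E \<times> C) (U \<times> C)" using rel_open_Times[OF U rel_open_self[OF C]] .
  have f1: "fst ` (U \<times> C) \<subseteq> U" and f2: "snd ` (U \<times> C) \<subseteq> C" by auto
  have K: "C_k_on k (E \<times> C) (U \<times> C) (\<lambda>z. B (fst z) x (snd z))" if x: "x \<in> A" for x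
    by (rule C_k_on_linear_family[OF UC U C f1 f2 lin2[OF _ x] B[OF x] C_k_on_bounded_linear[OF UC bounded_linear_fst]
        C_k_on_bounded_linear[OF UC bounded_linear_snd]])
  have g: "(\<lambda>l. (f l, b l)) ` N \<subseteq> U \<times> C" using fN bN by auto
  have lin: "linear_on A (\<lambda>x. B (fst z) x (snd z))" if "z \<in> U \<times> C" for z using lin1 that by auto
  show ?thesis
    using C_k_on_linear_family[OF N UC A g aN lin K C_k_on_Pair[OF N f b] a] by simp
qed

lemma bilinear_family_deriv:
  fixes f :: "'e::euclidean_space \<Rightarrow> 'd::euclidean_space" and a :: "'e \<Rightarrow> 'a::euclidean_space" and b :: "'e \<Rightarrow> 'b::euclidean_space"
  assumes N: "rel_open F N" and U: "rel_open E U" and A: "subspace A" and C: "subspace C"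
    and fN: "f ` N \<subseteq> U" and aN: "a ` N \<subseteq> A" and bN: "b ` N \<subseteq> C"
    and lin1: "\<And>u y. u \<in> U \<Longrightarrow> y \<in> C \<Longrightarrow> linear_on A (\<lambda>x. B u x y)"
    and lin2: "\<And>u x. u \<in> U \<Longrightarrow> x \<in> A \<Longrightarrow> linear_on C (B u x)"
    and B: "\<And>x y. x \<in> A \<Longrightarrow> y \<in> C \<Longrightarrow> C_k_on (Suc k) E U (\<lambda>u. B u x y)" and l: "l \<in> N"
    and f: "(f has_derivative f') (at l within F)" and a: "(a has_derivative a') (at l within F)"
    and b: "(b has_derivative b') (at l within F)" and w: "w \<in> F"
  shows "deriv_in F (\<lambda>l. B (f l) (a l) (b l)) l w =
      deriv_in E (\<lambda>u. B u (a l) (b l)) (f l) (f' w) + B (f l) (a' w) (b l) + B (f l) (a l) (b' w)"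
    "(\<lambda>l. B (f l) (a l) (b l)) differentiable (at l within F)"
proof -
  have UC: "rel_open (E \<times> C) (U \<times> C)" using rel_open_Times[OF U rel_open_self[OF C]] .
  have f1: "fst ` (U \<times> C) \<subseteq> U" and f2: "snd ` (U \<times> C) \<subseteq> C" by auto
  have K: "C_k_on (Suc k) (E \<times> C) (U \<times> C) (\<lambda>z. B (fst z) x (snd z))" if x: "x \<in> A" for x
    by (rule C_k_on_linear_family[OF UC U C f1 f2 lin2[OF _ x] B[OF x] C_k_on_bounded_linear[OF UC bounded_linear_fst]
        C_k_on_bounded_linear[OF UC bounded_linear_snd]])
  have g: "(\<lambda>l. (f l, b l)) ` N \<subseteq> U \<times> C" using fN bN by auto
  have lin: "linear_on A (\<lambda>x. B (fst z) x (snd z))" if "z \<in> U \<times> C" for z using lin1 that by auto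
  note 1 = linear_family_deriv[OF N UC A g aN lin K l has_derivative_Pair[OF f b] a w, simplified]
  show "(\<lambda>l. B (f l) (a l) (b l)) differentiable (at l within F)" using 1(2) .
  have al: "a l \<in> A" and z: "(f l, b l) \<in> U \<times> C" using aN fN bN l by auto
  have "f' w \<in> E" by (rule has_derivative_in_subspace[OF N l _ rel_open_subspace[OF U] f w])
      (use fN rel_open_subset[OF U] in auto)
  moreover have "b' w \<in> C" by (rule has_derivative_in_subspace[OF N l bN C b w])
  ultimately have w': "(f' w, b' w) \<in> E \<times> C" by simp
  have d1: "(fst has_derivative fst) (at (f l, b l) within E \<times> C)" and d2: "(snd has_derivative snd) (at (f l, b l) within E \<times> C)"
    using bounded_linear_imp_has_derivative[OF bounded_linear_fst] bounded_linear_imp_has_derivative[OF bounded_linear_snd] by blast+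
  have "deriv_in (E \<times> C) (\<lambda>z. B (fst z) (a l) (snd z)) (f l, b l) (f' w, b' w) =
     deriv_in E (\<lambda>u. B u (a l) (b l)) (f l) (f' w) + B (f l) (a l) (b' w)"
    using linear_family_deriv(1)[OF UC U C f1 f2 lin2[OF _ al] B[OF al] z d1 d2 w'] by simp
  then show "deriv_in F (\<lambda>l. B (f l) (a l) (b l)) l w =
      deriv_in E (\<lambda>u. B u (a l) (b l)) (f l) (f' w) + B (f l) (a' w) (b l) + B (f l) (a l) (b' w)"
    using 1(1) by simp
qed

lemma metric_on_subset: "metric_on E U G \<Longrightarrow> V \<subseteq> U \<Longrightarrow> metric_on E V G"
  unfolding metric_on_def smooth_on_def using C_k_on_subset by blast

lemma metric_family_deriv:
  fixes f :: "'e::euclidean_space \<Rightarrow> 'd::euclidean_space"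
  assumes N: "rel_open F N" and U: "rel_open E U" and G: "metric_on E U G"
    and fN: "f ` N \<subseteq> U" and aN: "a ` N \<subseteq> E" and bN: "b ` N \<subseteq> E" and l: "l \<in> N"
    and f: "(f has_derivative f') (at l within F)" and a: "(a has_derivative a') (at l within F)"
    and b: "(b has_derivative b') (at l within F)" and w: "w \<in> F"
  shows "deriv_in F (\<lambda>l. G (f l) (a l) (b l)) l w =
      deriv_in E (\<lambda>u. G u (a l) (b l)) (f l) (f' w) + G (f l) (a' w) (b l) + G (f l) (a l) (b' w)"
    "(\<lambda>l. G (f l) (a l) (b l)) differentiable (at l within F)"
proof -
  have E: "subspace E" using U rel_open_subspace by auto
  note * = bilinear_family_deriv[OF N U E E fN aN bN metric_onD(2)[OF G] metric_on_linear_right[OF G E] metric_onD(1)[OF G] l f a b w]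
  show "deriv_in F (\<lambda>l. G (f l) (a l) (b l)) l w =
      deriv_in E (\<lambda>u. G u (a l) (b l)) (f l) (f' w) + G (f l) (a' w) (b l) + G (f l) (a l) (b' w)"
    "(\<lambda>l. G (f l) (a l) (b l)) differentiable (at l within F)"
    using * by blast+
qed

lemma has_vector_derivative_deriv_in_UNIV:
  fixes g :: "real \<Rightarrow> 'a::real_normed_vector"
  assumes "g differentiable (at t)"
  shows "(g has_vector_derivative deriv_in UNIV g t 1) (at t)"
proof -
  have "(g has_derivative deriv_in UNIV g t) (at t)" using has_deriv_in[of g t UNIV] assms by simp
  moreover have "deriv_in UNIV g t h = h *\<^sub>R deriv_in UNIV g t 1" for h
    using linear_cmul[OF linear_deriv_in[of g t UNIV], of h 1] assms by simp
  ultimately show ?thesis unfolding has_vector_derivative_def by (metis (no_types, lifting) ext)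
qed

text \<open>The time axis is a relatively open subset of the model space \<open>UNIV\<close>, so
  this is \<open>metric_family_deriv\<close> in the direction 1.\<close>

lemma metric_time_deriv:
  fixes x :: "real \<Rightarrow> 'e::euclidean_space"
  assumes J: "open J" and U: "rel_open E U" and G: "metric_on E U G"
    and xJ: "\<And>t. t \<in> J \<Longrightarrow> x t \<in> U" and aJ: "\<And>t. t \<in> J \<Longrightarrow> a t \<in> E" and bJ: "\<And>t. t \<in> J \<Longrightarrow> b t \<in> E" and t: "t \<in> J"
    and x: "(x has_vector_derivative x') (at t)" and a: "(a has_vector_derivative a') (at t)"
    and b: "(b has_vector_derivative b') (at t)"
  shows "((\<lambda>t. G (x t) (a t) (b t)) has_vector_derivative
      (deriv_in E (\<lambda>u. G u (a t) (b t)) (x t) x' + G (x t) a' (b t) + G (x t) (a t) b')) (at t)"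
proof -
  have J': "rel_open UNIV J" using J by (simp add: rel_open_def subspace_UNIV open_openin[symmetric])
  note * = metric_family_deriv[OF J' U G _ _ _ t x[unfolded has_vector_derivative_def] a[unfolded has_vector_derivative_def]
     b[unfolded has_vector_derivative_def] UNIV_I[of 1]]
  have "(\<lambda>t. G (x t) (a t) (b t)) differentiable (at t)" using *(2) xJ aJ bJ by blast
  from has_vector_derivative_deriv_in_UNIV[OF this] show ?thesis using *(1) xJ aJ bJ by (simp add: image_subset_iff)
qed

section \<open>The geodesic equation in weak form\<close>

text \<open>For the energy \<open>h p v v / 2\<close> this is the time derivative of the momentum
  minus the force, tested with \<open>w\<close>, where \<open>v\<close> is the velocity and
  \<open>a\<close> the acceleration in coordinates. Equivalently it is the covariant acceleration
  paired with \<open>w\<close>.\<close>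

definition euler_lagrange ::
    "'e::euclidean_space set \<Rightarrow> ('e \<Rightarrow> 'e \<Rightarrow> 'e \<Rightarrow> real) \<Rightarrow> 'e \<Rightarrow> 'e \<Rightarrow> 'e \<Rightarrow> 'e \<Rightarrow> real" where
  "euler_lagrange E h p v a w =
     h p a w + deriv_in E (\<lambda>q. h q v w) p v - deriv_in E (\<lambda>q. h q v v) p w / 2"

definition geodesic_curve ::
    "'e::euclidean_space set \<Rightarrow> 'e set \<Rightarrow> ('e \<Rightarrow> 'e \<Rightarrow> 'e \<Rightarrow> real) \<Rightarrow> real set \<Rightarrow>
     (real \<Rightarrow> 'e) \<Rightarrow> (real \<Rightarrow> 'e) \<Rightarrow> (real \<Rightarrow> 'e) \<Rightarrow> bool" where
  "geodesic_curve E U h J \<gamma> \<gamma>' \<gamma>'' \<longleftrightarrow>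
     (\<forall>t\<in>J. \<gamma> t \<in> U \<and> \<gamma>' t \<in> E \<and> \<gamma>'' t \<in> E \<and> (\<gamma> has_vector_derivative \<gamma>' t) (at t) \<and>
       (\<gamma>' has_vector_derivative \<gamma>'' t) (at t) \<and> (\<forall>w\<in>E. euler_lagrange E h (\<gamma> t) (\<gamma>' t) (\<gamma>'' t) w = 0))"

lemma geodesic_curve_subset: "geodesic_curve E U h J \<gamma> \<gamma>' \<gamma>'' \<Longrightarrow> J' \<subseteq> J \<Longrightarrow> geodesic_curve E U h J' \<gamma> \<gamma>' \<gamma>''"
  unfolding geodesic_curve_def by blast

text \<open>Let \<open>P\<close> and \<open>S\<close> denote the first and second derivatives of
  \<open>\<psi>\<close>. The pulled back metric produces terms pairing \<open>P p v\<close> with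
  \<open>S v w\<close> in the momentum and with \<open>S w v\<close> in the force; by symmetry of
  second derivatives they cancel, and \<open>S v v\<close> alone survives, as part of the new
  acceleration.\<close>

lemma euler_lagrange_pullback:
  fixes \<psi> :: "'e::euclidean_space \<Rightarrow> 'd::euclidean_space"
  assumes N: "rel_open E N" and U: "rel_open E' U" and k: "metric_on E' U k"
    and \<psi>: "smooth_on E N \<psi>" and \<psi>N: "\<psi> ` N \<subseteq> U"
    and pull: "\<And>p v w. p \<in> N \<Longrightarrow> v \<in> E \<Longrightarrow> w \<in> E \<Longrightarrow> h p v w = k (\<psi> p) (deriv_in E \<psi> p v) (deriv_in E \<psi> p w)"
    and p: "p \<in> N" and v: "v \<in> E" and a: "a \<in> E" and w: "w \<in> E"
  shows "euler_lagrange E h p v a w = euler_lagrange E' k (\<psi> p) (deriv_in E \<psi> p v)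
     (deriv_in E (\<lambda>q. deriv_in E \<psi> q v) p v + deriv_in E \<psi> p a) (deriv_in E \<psi> p w)"
proof -
  have E': "subspace E'" using U rel_open_subspace by auto
  have \<psi>k: "C_k_on j E N \<psi>" for j using \<psi> by (simp add: smooth_on_def)
  have \<psi>E: "\<psi> ` N \<subseteq> E'" using \<psi>N rel_open_subset[OF U] by auto
  have \<psi>p: "\<psi> p \<in> U" using \<psi>N p by auto
  define P where "P q v = deriv_in E \<psi> q v" for q v
  define S where "S z v = deriv_in E (\<lambda>q. P q v) p z" for z v
  have Pk: "C_k_on j E N (\<lambda>q. P q v)" if "v \<in> E" for v j unfolding P_def using C_k_on_SucD(2)[OF \<psi>k that] .
  have P_in: "P q v \<in> E'" if "q \<in> N" "v \<in> E" for q v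
    unfolding P_def using deriv_in_subspace[OF N that(1) \<psi>E E' \<psi>k that(2)] .
  have S_in: "S z v \<in> E'" if "z \<in> E" "v \<in> E" for z v
    unfolding S_def by (rule deriv_in_subspace[OF N p _ E' Pk]) (use P_in that in auto)
  have S_sym: "S z v = S v z" if "z \<in> E" "v \<in> E" for z v
    unfolding S_def P_def using second_derivative_symmetric[OF N p \<psi>k that(2,1)] .
  have dh: "deriv_in E (\<lambda>q. h q v w) p z = deriv_in E' (\<lambda>u. k u (P p v) (P p w)) (\<psi> p) (P p z)
      + k (\<psi> p) (S z v) (P p w) + k (\<psi> p) (P p v) (S z w)" if "v \<in> E" "w \<in> E" "z \<in> E" for v w z
  proof -
    have "deriv_in E (\<lambda>q. h q v w) p z = deriv_in E (\<lambda>q. k (\<psi> q) (P q v) (P q w)) p z"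
      using deriv_in_cong[OF N p, of "\<lambda>q. h q v w"] pull that by (metis (no_types, lifting) P_def)
    also have "\<dots> = deriv_in E' (\<lambda>u. k u (P p v) (P p w)) (\<psi> p) (P p z)
      + k (\<psi> p) (S z v) (P p w) + k (\<psi> p) (P p v) (S z w)" unfolding S_def
      by (rule metric_family_deriv(1)[OF N U k \<psi>N _ _ p _ _ _ that(3)])
        (use P_in that C_k_on_SucD(1)[OF Pk p] C_k_on_SucD(1)[OF \<psi>k p] in \<open>auto simp: P_def[abs_def]\<close>)
    finally show ?thesis .
  qed
  note sym = metric_onD(3)[OF k \<psi>p]
  have add: "k (\<psi> p) (S v v + P p a) (P p w) = k (\<psi> p) (S v v) (P p w) + k (\<psi> p) (P p a) (P p w)"
    by (rule linear_onD(1)[OF metric_onD(2)[OF k \<psi>p P_in[OF p w]] E' S_in[OF v v] P_in[OF p a]])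
  have "euler_lagrange E h p v a w = euler_lagrange E' k (\<psi> p) (P p v) (S v v + P p a) (P p w)"
    unfolding euler_lagrange_def
    using dh[OF v w v] dh[OF v v w] S_sym[OF v w] pull[OF p a w] add sym[OF P_in[OF p v] S_in[OF w v]]
    by (simp add: P_def[symmetric] field_simps)
  then show ?thesis by (simp add: P_def[abs_def] S_def)
qed

text \<open>Surjectivity of the derivative makes every test vector of the target an image, so the
  weak equation in the target can be checked in the source.\<close>

lemma geodesic_curve_image:
  fixes \<psi> :: "'e::euclidean_space \<Rightarrow> 'd::euclidean_space"
  assumes J: "open J" and N: "rel_open E N" and U: "rel_open E' U" and k: "metric_on E' U k"
    and \<psi>: "smooth_on E N \<psi>" and \<psi>N: "\<psi> ` N \<subseteq> U"
    and pull: "\<And>p v w. p \<in> N \<Longrightarrow> v \<in> E \<Longrightarrow> w \<in> E \<Longrightarrow> h p v w = k (\<psi> p) (deriv_in E \<psi> p v) (deriv_in E \<psi> p w)"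
    and surj: "\<And>p. p \<in> N \<Longrightarrow> deriv_in E \<psi> p ` E = E'"
    and \<gamma>: "geodesic_curve E N h J \<gamma> \<gamma>' \<gamma>''"
  shows "geodesic_curve E' U k J (\<lambda>t. \<psi> (\<gamma> t)) (\<lambda>t. deriv_in E \<psi> (\<gamma> t) (\<gamma>' t))
    (\<lambda>t. deriv_in E (\<lambda>q. deriv_in E \<psi> q (\<gamma>' t)) (\<gamma> t) (\<gamma>' t) + deriv_in E \<psi> (\<gamma> t) (\<gamma>'' t))"
  unfolding geodesic_curve_def
proof (intro ballI conjI)
  fix t assume t: "t \<in> J"
  have E: "subspace E" and E': "subspace E'" using N U rel_open_subspace by auto
  have J': "rel_open UNIV J" using J by (simp add: rel_open_def subspace_UNIV open_openin[symmetric])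
  have \<gamma>N: "\<gamma> ` J \<subseteq> N" and \<gamma>'E: "\<gamma>' ` J \<subseteq> E" using \<gamma> by (auto simp: geodesic_curve_def)
  have \<gamma>t: "\<gamma> t \<in> N" "\<gamma>' t \<in> E" "\<gamma>'' t \<in> E" and d1: "(\<gamma> has_derivative (\<lambda>h. h *\<^sub>R \<gamma>' t)) (at t)"
    and d2: "(\<gamma>' has_derivative (\<lambda>h. h *\<^sub>R \<gamma>'' t)) (at t)"
    and el: "\<forall>w\<in>E. euler_lagrange E h (\<gamma> t) (\<gamma>' t) (\<gamma>'' t) w = 0"
    using \<gamma> t unfolding geodesic_curve_def has_vector_derivative_def by blast+
  have \<psi>k: "C_k_on j E N \<psi>" for j using \<psi> by (simp add: smooth_on_def)
  have \<psi>E: "\<psi> ` N \<subseteq> E'" using \<psi>N rel_open_subset[OF U] by auto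
  have lin: "linear_on E (deriv_in E \<psi> q)" if "q \<in> N" for q
    by (rule linear_imp_linear_on[OF linear_deriv_in]) (use \<psi>k[of "Suc 0"] that in auto)
  have P_in: "deriv_in E \<psi> q v \<in> E'" if "q \<in> N" "v \<in> E" for q v
    using deriv_in_subspace[OF N that(1) \<psi>E E' \<psi>k that(2)] .
  show "\<psi> (\<gamma> t) \<in> U" using \<gamma>t \<psi>N by auto
  show 1: "deriv_in E \<psi> (\<gamma> t) (\<gamma>' t) \<in> E'" using P_in \<gamma>t by auto
  have S_in: "deriv_in E (\<lambda>q. deriv_in E \<psi> q (\<gamma>' t)) (\<gamma> t) (\<gamma>' t) \<in> E'"
    by (rule deriv_in_subspace[OF N \<gamma>t(1) _ E' C_k_on_SucD(2)[OF \<psi>k]]) (use P_in \<gamma>t in auto)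
  then show "deriv_in E (\<lambda>q. deriv_in E \<psi> q (\<gamma>' t)) (\<gamma> t) (\<gamma>' t) + deriv_in E \<psi> (\<gamma> t) (\<gamma>'' t) \<in> E'"
    using P_in \<gamma>t E' by (auto intro: subspace_add)
  have "((\<lambda>t. \<psi> (\<gamma> t)) has_derivative (\<lambda>h. deriv_in E \<psi> (\<gamma> t) (h *\<^sub>R \<gamma>' t))) (at t)"
    using has_derivative_chain_rel[OF J' N \<gamma>N t d1 C_k_on_SucD(1)[OF \<psi>k \<gamma>t(1)]] .
  then show "((\<lambda>t. \<psi> (\<gamma> t)) has_vector_derivative deriv_in E \<psi> (\<gamma> t) (\<gamma>' t)) (at t)"
    unfolding has_vector_derivative_def using linear_onD(2)[OF lin[OF \<gamma>t(1)] E \<gamma>t(2)] by simp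
  have "\<And>b. b \<in> E \<Longrightarrow> C_k_on (Suc 0) E N (\<lambda>q. deriv_in E \<psi> q b)" using C_k_on_SucD(2)[OF \<psi>k] .
  note fam = linear_family_deriv[OF J' N E \<gamma>N \<gamma>'E lin this t d1 d2 UNIV_I[of 1]]
  show "((\<lambda>t. deriv_in E \<psi> (\<gamma> t) (\<gamma>' t)) has_vector_derivative
      deriv_in E (\<lambda>q. deriv_in E \<psi> q (\<gamma>' t)) (\<gamma> t) (\<gamma>' t) + deriv_in E \<psi> (\<gamma> t) (\<gamma>'' t)) (at t)"
    using has_vector_derivative_deriv_in_UNIV[OF fam(2)] fam(1) by simp
  fix w' assume "w' \<in> E'"
  then obtain w where w: "w \<in> E" "w' = deriv_in E \<psi> (\<gamma> t) w" using surj[OF \<gamma>t(1)] by (metis imageE)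
  show "euler_lagrange E' k (\<psi> (\<gamma> t)) (deriv_in E \<psi> (\<gamma> t) (\<gamma>' t))
        (deriv_in E (\<lambda>q. deriv_in E \<psi> q (\<gamma>' t)) (\<gamma> t) (\<gamma>' t) + deriv_in E \<psi> (\<gamma> t) (\<gamma>'' t)) w' = 0"
    using euler_lagrange_pullback[OF N U k \<psi> \<psi>N pull \<gamma>t w(1)] el w by simp
qed

lemma linear_on_deriv_param:
  assumes U: "rel_open E U" and p: "p \<in> U" and C: "subspace C"
    and lin: "\<And>u. u \<in> U \<Longrightarrow> linear_on C (K u)" and K: "\<And>b. b \<in> C \<Longrightarrow> C_k_on (Suc 0) E U (\<lambda>u. K u b)" and z: "z \<in> E"
  shows "linear_on C (\<lambda>v. deriv_in E (\<lambda>u. K u v) p z)"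
  unfolding linear_on_def
proof (intro ballI allI)
  fix v w a b assume vw: "v \<in> C" "w \<in> C"
  show "deriv_in E (\<lambda>u. K u (a *\<^sub>R v + b *\<^sub>R w)) p z = a *\<^sub>R deriv_in E (\<lambda>u. K u v) p z + b *\<^sub>R deriv_in E (\<lambda>u. K u w) p z"
  proof (rule deriv_in_eq[OF rel_open_subspace[OF U] _ _ z])
    show "p \<in> E" using p rel_open_subset[OF U] by auto
    have "((\<lambda>u. a *\<^sub>R K u v + b *\<^sub>R K u w) has_derivative (\<lambda>z. a *\<^sub>R deriv_in E (\<lambda>u. K u v) p z + b *\<^sub>R deriv_in E (\<lambda>u. K u w) p z)) (at p within E)"
      by (intro has_derivative_add has_derivative_scaleR_right C_k_on_SucD(1)[OF K p] vw)
    then show "((\<lambda>u. K u (a *\<^sub>R v + b *\<^sub>R w)) has_derivative (\<lambda>z. a *\<^sub>R deriv_in E (\<lambda>u. K u v) p z + b *\<^sub>R deriv_in E (\<lambda>u. K u w) p z)) (at p within E)"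
      by (rule has_derivative_cong_rel[OF U p, rotated]) (use lin vw in \<open>auto simp: linear_on_def\<close>)
  qed
qed

lemma metric_deriv_linear:
  assumes U: "rel_open E U" and h: "metric_on E U h" and p: "p \<in> U" and v: "v \<in> E" and w: "w \<in> E" and z: "z \<in> E"
  shows "linear_on E (\<lambda>v. deriv_in E (\<lambda>q. h q v w) p z)" "linear_on E (\<lambda>w. deriv_in E (\<lambda>q. h q v w) p z)"
    "linear_on E (\<lambda>z. deriv_in E (\<lambda>q. h q v w) p z)"
proof -
  have E: "subspace E" using U rel_open_subspace by auto
  show "linear_on E (\<lambda>v. deriv_in E (\<lambda>q. h q v w) p z)"
    by (rule linear_on_deriv_param[OF U p E metric_onD(2)[OF h _ w] metric_onD(1)[OF h _ w] z])
  show "linear_on E (\<lambda>w. deriv_in E (\<lambda>q. h q v w) p z)"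
    by (rule linear_on_deriv_param[OF U p E metric_on_linear_right[OF h E _ v] metric_onD(1)[OF h v] z])
  show "linear_on E (\<lambda>z. deriv_in E (\<lambda>q. h q v w) p z)"
    by (rule linear_imp_linear_on[OF linear_deriv_in]) (use metric_onD(1)[OF h v w, of "Suc 0"] p in auto)
qed

text \<open>The weak equation is solved for the acceleration and becomes a first order system on
  \<open>N \<times> E\<close>. Its flow is rescaled in time, whence the initial velocity
  \<open>\<epsilon> *\<^sub>R v\<close>.\<close>

theorem geodesic_exists:
  fixes E :: "'e::euclidean_space set"
  assumes N: "rel_open E N" and h: "metric_on E N h" and p: "p \<in> N" and v: "v \<in> E"
  obtains \<epsilon> \<gamma> \<gamma>' \<gamma>'' where "\<epsilon> > 0" "geodesic_curve E N h {-1<..<1} \<gamma> \<gamma>' \<gamma>''" "\<gamma> 0 = p" "\<gamma>' 0 = \<epsilon> *\<^sub>R v"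
    "\<And>k. C_k_on k UNIV {-1<..<1} \<gamma>"
proof -
  have E: "subspace E" using N rel_open_subspace by auto
  \<comment> \<open>At the point \<open>fst z\<close> with velocity \<open>snd z\<close> the
    Euler-Lagrange equation for an acceleration \<open>a\<close> reads
    \<open>h (fst z) a w = c z w\<close>; \<open>A z\<close> is the metric written as an
    operator.\<close>
  define c where "c z w = deriv_in E (\<lambda>q. h q (snd z) (snd z)) (fst z) w / 2 - deriv_in E (\<lambda>q. h q (snd z) w) (fst z) (snd z)" for z w
  define A where "A z a = riesz E (h (fst z) a)" for z :: "'e \<times> 'e" and a
  define \<Omega> where "\<Omega> = N \<times> E"
  have \<Omega>: "rel_open (E \<times> E) \<Omega>" unfolding \<Omega>_def using rel_open_Times[OF N rel_open_self[OF E]] .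
  have EE: "subspace (E \<times> E)" using E subspace_Times by auto
  have fstk: "C_k_on k (E \<times> E) \<Omega> fst" and sndk: "C_k_on k (E \<times> E) \<Omega> snd" for k
    using C_k_on_bounded_linear[OF \<Omega>] bounded_linear_fst bounded_linear_snd by blast+
  have im: "fst ` \<Omega> \<subseteq> N" "snd ` \<Omega> \<subseteq> E" by (auto simp: \<Omega>_def)
  have lin_A: "linear_on E (A z)" if "z \<in> \<Omega>" for z
    unfolding linear_on_def
  proof (intro ballI allI)
    fix x y a b assume xy: "x \<in> E" "y \<in> E"
    have "riesz E (h (fst z) (a *\<^sub>R x + b *\<^sub>R y)) = riesz E (\<lambda>w. a * h (fst z) x w + b * h (fst z) y w)"
      unfolding riesz_def
    proof (rule sum.cong[OF refl])
      fix w assume "w \<in> onb E"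
      then have "w \<in> E" using onb(1)[OF E] by blast
      then show "h (fst z) (a *\<^sub>R x + b *\<^sub>R y) w *\<^sub>R w = (a * h (fst z) x w + b * h (fst z) y w) *\<^sub>R w"
        using metric_onD(2)[OF h, of "fst z" w] im that xy unfolding linear_on_def by auto
    qed
    then show "A z (a *\<^sub>R x + b *\<^sub>R y) = a *\<^sub>R A z x + b *\<^sub>R A z y" by (simp add: A_def riesz_linear)
  qed
  have A_inner: "A z a \<bullet> w = h (fst z) a w" if "z \<in> \<Omega>" "a \<in> E" "w \<in> E" for z a w
    unfolding A_def using riesz_inner[OF E metric_on_linear_right[OF h E]] that im by auto
  have A_in: "A z a \<in> E" for z a unfolding A_def using riesz_in[OF E] .
  have A_inj: "a = 0" if "z \<in> \<Omega>" "a \<in> E" "A z a = 0" for z a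
    using A_inner[OF that(1,2,2)] that metric_onD(4)[OF h, of "fst z" a] im by force
  have c_lin: "linear_on E (c z)" if z: "z \<in> \<Omega>" for z
  proof -
    have z': "fst z \<in> N" "snd z \<in> E" using z by (auto simp: \<Omega>_def)
    show ?thesis
      using metric_deriv_linear(3)[OF N h z'(1,2,2,2)] metric_deriv_linear(2)[OF N h z'(1,2,2,2)]
      unfolding c_def[abs_def] linear_on_def by (auto simp: algebra_simps add_divide_distrib)
  qed
  have "\<exists>a\<in>E. A z a = riesz E (c z)" if "z \<in> \<Omega>" for z
    by (rule linear_on_surj[OF lin_A[OF that] E _ _ riesz_in[OF E]]) (use A_in A_inj that in auto)
  then obtain acc where acc: "\<And>z. z \<in> \<Omega> \<Longrightarrow> acc z \<in> E" "\<And>z. z \<in> \<Omega> \<Longrightarrow> A z (acc z) = riesz E (c z)" by metis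
  have acc_k: "C_k_on k (E \<times> E) \<Omega> acc" for k
  proof (rule C_k_on_solve_subspace[OF \<Omega> E, where A=A and b="\<lambda>z. riesz E (c z)"])
    show "C_k_on k (E \<times> E) \<Omega> (\<lambda>z. A z w)" if w: "w \<in> E" for w
      unfolding A_def by (intro C_k_on_riesz[OF \<Omega> E] C_k_on_compose[OF \<Omega> N im(1) fstk metric_onD(1)[OF h w]])
    show "C_k_on k (E \<times> E) \<Omega> (\<lambda>z. riesz E (c z))"
    proof (rule C_k_on_riesz[OF \<Omega> E])
      fix b assume b: "b \<in> E"
      have hk: "C_k_on k E N (\<lambda>u. deriv_in E (\<lambda>q. h q v w) u z)" if "v \<in> E" "w \<in> E" "z \<in> E" for v w z
        using C_k_on_SucD(2)[OF metric_onD(1)[OF h that(1,2)] that(3)] .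
      have "C_k_on k (E \<times> E) \<Omega> (\<lambda>z. deriv_in E (\<lambda>q. h q (snd z) (snd z)) (fst z) b)"
        by (rule C_k_on_bilinear_family[OF \<Omega> N E E im(1,2,2) _ _ _ fstk sndk sndk, where B="\<lambda>u x y. deriv_in E (\<lambda>q. h q x y) u b"])
          (use metric_deriv_linear[OF N h _ _ _ b] hk b in auto)
      moreover have "C_k_on k (E \<times> E) \<Omega> (\<lambda>z. deriv_in E (\<lambda>q. h q (snd z) b) (fst z) (snd z))"
        by (rule C_k_on_bilinear_family[OF \<Omega> N E E im(1,2,2) _ _ _ fstk sndk sndk, where B="\<lambda>u x y. deriv_in E (\<lambda>q. h q x b) u y"])
          (use metric_deriv_linear[OF N h _ _ b] hk b in auto)
      ultimately show "C_k_on k (E \<times> E) \<Omega> (\<lambda>z. c z b)" unfolding c_def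
        by (intro C_k_on_diff \<Omega> C_k_on_bounded_linear_comp[OF \<Omega> bounded_linear_divide])
    qed
  qed (use lin_A A_in A_inj acc in auto)
  have acc_eq: "h (fst z) (acc z) w = c z w" if z: "z \<in> \<Omega>" and w: "w \<in> E" for z w
    using A_inner[OF z acc(1)[OF z] w] acc(2)[OF z] riesz_inner[OF E c_lin[OF z] w] by simp
  define X where "X z = (snd z, acc z)" for z
  have Xk: "C_k_on k (E \<times> E) \<Omega> X" for k unfolding X_def by (intro C_k_on_Pair \<Omega> sndk acc_k)
  have X: "smooth_on (E \<times> E) \<Omega> X" using Xk by (simp add: smooth_on_def)
  have X_in: "X ` \<Omega> \<subseteq> E \<times> E" using acc by (auto simp: X_def \<Omega>_def)
  have z0: "(p, v) \<in> \<Omega>" using p v by (simp add: \<Omega>_def)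
  obtain \<epsilon> \<delta> \<phi> where \<epsilon>: "\<epsilon> > 0" and \<delta>: "\<delta> > 0"
    and \<phi>0: "\<And>b. b \<in> (E \<times> E) \<inter> ball (p, v) \<delta> \<Longrightarrow> \<phi> b 0 = b"
    and \<phi>\<Omega>: "\<And>b s. b \<in> (E \<times> E) \<inter> ball (p, v) \<delta> \<Longrightarrow> s \<in> {-1..1} \<Longrightarrow> \<phi> b s \<in> \<Omega>"
    and \<phi>': "\<And>b s. b \<in> (E \<times> E) \<inter> ball (p, v) \<delta> \<Longrightarrow> s \<in> {-1..1} \<Longrightarrow> (\<phi> b has_vector_derivative \<epsilon> *\<^sub>R X (\<phi> b s)) (at s within {-1..1})"
    by (rule local_flow[OF \<Omega> X X_in z0]) blast
  define u where "u = \<phi> (p, v)"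
  have b: "(p, v) \<in> (E \<times> E) \<inter> ball (p, v) \<delta>" using z0 \<delta> rel_open_subset[OF \<Omega>] by auto
  have u\<Omega>: "u s \<in> \<Omega>" if "s \<in> {-1<..<1}" for s using \<phi>\<Omega>[OF b, of s] that by (simp add: u_def)
  have u': "(u has_vector_derivative \<epsilon> *\<^sub>R X (u s)) (at s)" if s: "s \<in> {-1<..<1}" for s
  proof -
    have "at s within {-1..1} = at s" using s by (intro at_within_interior) (simp add: interior_atLeastAtMost_real)
    then show ?thesis using \<phi>'[OF b, of s] s by (simp add: u_def)
  qed
  have J: "rel_open UNIV {-1<..<1::real}" by (simp add: rel_open_def subspace_UNIV open_openin[symmetric])
  \<comment> \<open>The velocity of an integral curve is the field along it, so each order of
    smoothness in time gives the next.\<close>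
  have uk: "C_k_on k UNIV {-1<..<1} u" for k
  proof (induction k)
    case 0
    have "continuous (at s within {-1<..<1}) u" if "s \<in> {-1<..<1}" for s
      using has_vector_derivative_continuous[OF u'[OF that]] continuous_at_imp_continuous_at_within by blast
    then show ?case unfolding C_k_on.simps(1) continuous_on_eq_continuous_within by blast
  next
    case (Suc k)
    show ?case
    proof (rule C_k_on_SucI[OF J])
      show "(u has_derivative (\<lambda>h. h *\<^sub>R (\<epsilon> *\<^sub>R X (u s)))) (at s)" if "s \<in> {-1<..<1}" for s
        using u'[OF that] by (simp add: has_vector_derivative_def)
      show "C_k_on k UNIV {-1<..<1} (\<lambda>s. h *\<^sub>R (\<epsilon> *\<^sub>R X (u s)))" for h
        using u\<Omega> by (intro C_k_on_scaleR_const J C_k_on_compose[OF J \<Omega> _ Suc Xk]) auto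
    qed
  qed
  show ?thesis
  proof (rule that[OF \<epsilon>])
    show "(\<lambda>s. fst (u s)) 0 = p" "(\<lambda>s. \<epsilon> *\<^sub>R snd (u s)) 0 = \<epsilon> *\<^sub>R v" using \<phi>0[OF b] by (auto simp: u_def)
    show "C_k_on k UNIV {-1<..<1} (\<lambda>s. fst (u s))" for k using C_k_on_bounded_linear_comp[OF J bounded_linear_fst uk] .
    show "geodesic_curve E N h {-1<..<1} (\<lambda>s. fst (u s)) (\<lambda>s. \<epsilon> *\<^sub>R snd (u s)) (\<lambda>s. \<epsilon> *\<^sub>R (\<epsilon> *\<^sub>R acc (u s)))"
      unfolding geodesic_curve_def
    proof (intro ballI conjI)
      fix s :: real assume s: "s \<in> {-1<..<1}"
      have us: "fst (u s) \<in> N" "snd (u s) \<in> E" using u\<Omega>[OF s] by (auto simp: \<Omega>_def)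
      show "fst (u s) \<in> N" "\<epsilon> *\<^sub>R snd (u s) \<in> E" "\<epsilon> *\<^sub>R (\<epsilon> *\<^sub>R acc (u s)) \<in> E"
        using us acc(1)[OF u\<Omega>[OF s]] subspace_scale[OF E] by auto
      show "((\<lambda>s. fst (u s)) has_vector_derivative \<epsilon> *\<^sub>R snd (u s)) (at s)"
        using bounded_linear.has_vector_derivative[OF bounded_linear_fst u'[OF s]] by (simp add: X_def)
      have "((\<lambda>s. snd (u s)) has_vector_derivative \<epsilon> *\<^sub>R acc (u s)) (at s)"
        using bounded_linear.has_vector_derivative[OF bounded_linear_snd u'[OF s]] by (simp add: X_def)
      from bounded_linear.has_vector_derivative[OF bounded_linear_scaleR_right[of \<epsilon>] this]
      show "((\<lambda>s. \<epsilon> *\<^sub>R snd (u s)) has_vector_derivative \<epsilon> *\<^sub>R (\<epsilon> *\<^sub>R acc (u s))) (at s)" by simp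
      \<comment> \<open>The acceleration and both metric derivatives scale with the square of
        \<open>\<epsilon>\<close>, so the rescaled curve satisfies the same equation.\<close>
      fix w assume w: "w \<in> E"
      let ?p = "fst (u s)" and ?v = "snd (u s)"
      have ev: "\<epsilon> *\<^sub>R ?v \<in> E" using us subspace_scale[OF E] by auto
      have 1: "h ?p (\<epsilon> *\<^sub>R (\<epsilon> *\<^sub>R acc (u s))) w = \<epsilon> * (\<epsilon> * c (u s) w)"
        using linear_onD(2)[OF metric_onD(2)[OF h us(1) w] E, of "acc (u s)" "\<epsilon> * \<epsilon>"]
          acc(1)[OF u\<Omega>[OF s]] acc_eq[OF u\<Omega>[OF s] w] by simp
      have 2: "deriv_in E (\<lambda>q. h q (\<epsilon> *\<^sub>R ?v) w) ?p (\<epsilon> *\<^sub>R ?v) = \<epsilon> * (\<epsilon> * deriv_in E (\<lambda>q. h q ?v w) ?p ?v)"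
        using linear_onD(2)[OF metric_deriv_linear(1)[OF N h us(1) us(2) w ev] E us(2), of \<epsilon>]
          linear_onD(2)[OF metric_deriv_linear(3)[OF N h us(1) us(2) w us(2)] E us(2), of \<epsilon>] by simp
      have 3: "deriv_in E (\<lambda>q. h q (\<epsilon> *\<^sub>R ?v) (\<epsilon> *\<^sub>R ?v)) ?p w = \<epsilon> * (\<epsilon> * deriv_in E (\<lambda>q. h q ?v ?v) ?p w)"
        using linear_onD(2)[OF metric_deriv_linear(1)[OF N h us(1) us(2) ev w] E us(2), of \<epsilon>]
          linear_onD(2)[OF metric_deriv_linear(2)[OF N h us(1) us(2) us(2) w] E us(2), of \<epsilon>] by simp
      show "euler_lagrange E h ?p (\<epsilon> *\<^sub>R ?v) (\<epsilon> *\<^sub>R (\<epsilon> *\<^sub>R acc (u s))) w = 0"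
        unfolding euler_lagrange_def 1 2 3 by (simp add: c_def algebra_simps)
    qed
  qed
qed

section \<open>The Clairaut relation\<close>

lemma const_along:
  fixes f :: "'e::euclidean_space \<Rightarrow> 'h::real_normed_vector"
  assumes N: "rel_open E N" and f: "C_k_on (Suc j) E N f" and c: "c \<in> E"
    and seg: "\<And>t. t \<in> {0..1} \<Longrightarrow> q + t *\<^sub>R c \<in> N" and 0: "\<And>t. t \<in> {0..1} \<Longrightarrow> deriv_in E f (q + t *\<^sub>R c) c = 0"
  shows "f (q + c) = f q"
proof -
  have E: "subspace E" using N rel_open_subspace by auto
  have qE: "q \<in> E" using seg[of 0] rel_open_subset[OF N] by auto
  have "norm (f (q + 1 *\<^sub>R c) - f (q + 0 *\<^sub>R c)) \<le> 0 * \<bar>1 - 0\<bar>"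
  proof (rule vector_derivative_bound[where a=0 and b=1])
    fix t :: real assume t: "t \<in> {0..1}"
    show "((\<lambda>t. f (q + t *\<^sub>R c)) has_vector_derivative (\<Sum>b\<in>onb E. (c \<bullet> b) *\<^sub>R deriv_in E f (q + t *\<^sub>R c) b)) (at t within {0..1})"
      by (rule segment_derivative[OF N f qE c seg[OF t]])
    have "linear (deriv_in E f (q + t *\<^sub>R c))" by (rule linear_deriv_in) (use f seg[OF t] in auto)
    from linear_onb_expand[OF E c this]
    show "norm (\<Sum>b\<in>onb E. (c \<bullet> b) *\<^sub>R deriv_in E f (q + t *\<^sub>R c) b) \<le> 0" using 0[OF t] by simp
  qed auto
  then show ?thesis by simp
qed

text \<open>A product of balls in \<open>E1\<close> and in its orthogonal complement within
  \<open>E\<close>. With each point it contains the segments to both of its components, and it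
  corresponds to a product of coordinate domains.\<close>

definition split_ball :: "'e::euclidean_space set \<Rightarrow> 'e set \<Rightarrow> real \<Rightarrow> 'e set" where
  "split_ball E E1 s = {p \<in> E. norm (proj E1 p) < s \<and> norm (p - proj E1 p) < s}"

text \<open>The situation in straightened coordinates: \<open>\<rho>\<close> is the square of the
  Clairaut function, \<open>v - proj E1 v\<close> the vertical part of \<open>v\<close>, and
  \<open>C\<close> the square of the Clairaut constant. One short geodesic for each point and
  direction suffices, with its velocity known up to a positive factor, because the identity
  extracted at time 0 is homogeneous.\<close>

locale clairaut_metric =
  fixes E N E1 :: "'e::euclidean_space set" and h :: "'e \<Rightarrow> 'e \<Rightarrow> 'e \<Rightarrow> real" and \<rho> :: "'e \<Rightarrow> real"
  assumes N: "rel_open E N" and E1: "subspace E1" "E1 \<subseteq> E" and h: "metric_on E N h"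
    and block: "\<And>p a b. p \<in> N \<Longrightarrow> a \<in> E1 \<Longrightarrow> b \<in> E \<Longrightarrow> proj E1 b = 0 \<Longrightarrow> h p a b = 0"
    and \<rho>: "smooth_on E N \<rho>" and \<rho>_pos: "\<And>p. p \<in> N \<Longrightarrow> \<rho> p > 0"
    and clairaut: "\<And>p v. p \<in> N \<Longrightarrow> v \<in> E \<Longrightarrow> v \<noteq> 0 \<Longrightarrow>
      \<exists>\<epsilon> \<gamma> \<gamma>' \<gamma>'' d C. \<epsilon> > 0 \<and> d > 0 \<and> geodesic_curve E N h {-d<..<d} \<gamma> \<gamma>' \<gamma>'' \<and> \<gamma> 0 = p \<and> \<gamma>' 0 = \<epsilon> *\<^sub>R v \<and>
        (\<forall>t\<in>{-d<..<d}. \<rho> (\<gamma> t) * h (\<gamma> t) (\<gamma>' t - proj E1 (\<gamma>' t)) (\<gamma>' t - proj E1 (\<gamma>' t)) = C * h (\<gamma> t) (\<gamma>' t) (\<gamma>' t))"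
begin

lemma E: "subspace E" using N rel_open_subspace by auto

lemma N_in: "p \<in> N \<Longrightarrow> p \<in> E" using N rel_open_subset by auto

definition "D p v w z = deriv_in E (\<lambda>q. h q v w) p z"

lemma \<rho>k: "C_k_on k E N \<rho>" using \<rho> by (simp add: smooth_on_def)

lemma D\<rho>_linear: "p \<in> N \<Longrightarrow> linear (deriv_in E \<rho> p)"
  by (rule linear_deriv_in) (use \<rho>k[of "Suc 0"] in auto)

lemma proj_E: "v \<in> E \<Longrightarrow> proj E1 v \<in> E" using proj_in[OF E1(1)] E1(2) by auto

lemma fibre_in: "v \<in> E \<Longrightarrow> v - proj E1 v \<in> E" using proj_E E by (auto intro: subspace_diff)

lemma fibre_proj: "proj E1 (v - proj E1 v) = 0"
  by (simp add: linear_diff[OF linear_proj] proj_id[OF E1(1) proj_in[OF E1(1)]])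

lemma h_add: "p \<in> N \<Longrightarrow> v \<in> E \<Longrightarrow> v' \<in> E \<Longrightarrow> w \<in> E \<Longrightarrow> h p (v + v') w = h p v w + h p v' w"
  using linear_onD(1)[OF metric_onD(2)[OF h] E] by blast

lemma h_add_right: "p \<in> N \<Longrightarrow> v \<in> E \<Longrightarrow> w \<in> E \<Longrightarrow> w' \<in> E \<Longrightarrow> h p v (w + w') = h p v w + h p v w'"
  using linear_onD(1)[OF metric_on_linear_right[OF h E] E] by blast

lemma h_block:
  assumes p: "p \<in> N" and ab: "a \<in> E1" "b \<in> E" "proj E1 b = 0" "a' \<in> E1" "b' \<in> E" "proj E1 b' = 0"
  shows "h p (a + b) (a' + b') = h p a a' + h p b b'"
proof -
  have aE: "a \<in> E" "a' \<in> E" using ab E1 by auto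
  have a'b': "a' + b' \<in> E" using aE ab E by (auto intro: subspace_add)
  have "h p b a' = 0" using block[OF p ab(4,2,3)] metric_onD(3)[OF h p ab(2) aE(2)] by simp
  moreover have "h p a b' = 0" using block[OF p ab(1,5,6)] .
  ultimately show ?thesis using h_add[OF p aE(1) ab(2) a'b'] h_add_right[OF p _ aE(2) ab(5)] aE ab by simp
qed

text \<open>Both sides of the Clairaut relation are differentiated at time 0. The right side
  contributes nothing, since the energy is conserved; on the left, the derivative of the vertical
  energy is rewritten with the geodesic equation tested against the vertical part \<open>B\<close>
  of the velocity.\<close>

lemma clairaut_identity_scaled:
  assumes p: "p \<in> N" and v: "v \<in> E" "v \<noteq> 0"
  shows "\<exists>\<epsilon>>0. deriv_in E \<rho> p (\<epsilon> *\<^sub>R v) * h p (\<epsilon> *\<^sub>R v - proj E1 (\<epsilon> *\<^sub>R v)) (\<epsilon> *\<^sub>R v - proj E1 (\<epsilon> *\<^sub>R v)) +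
    \<rho> p * (D p (proj E1 (\<epsilon> *\<^sub>R v)) (proj E1 (\<epsilon> *\<^sub>R v)) (\<epsilon> *\<^sub>R v - proj E1 (\<epsilon> *\<^sub>R v))
      - D p (\<epsilon> *\<^sub>R v - proj E1 (\<epsilon> *\<^sub>R v)) (\<epsilon> *\<^sub>R v - proj E1 (\<epsilon> *\<^sub>R v)) (proj E1 (\<epsilon> *\<^sub>R v))) = 0"
proof -
  obtain \<epsilon> \<gamma> \<gamma>' \<gamma>'' d C where \<epsilon>: "\<epsilon> > 0" and d: "d > 0" and g: "geodesic_curve E N h {-d<..<d} \<gamma> \<gamma>' \<gamma>''"
    and \<gamma>0: "\<gamma> 0 = p" "\<gamma>' 0 = \<epsilon> *\<^sub>R v"
    and C: "\<And>t. t \<in> {-d<..<d} \<Longrightarrow> \<rho> (\<gamma> t) * h (\<gamma> t) (\<gamma>' t - proj E1 (\<gamma>' t)) (\<gamma>' t - proj E1 (\<gamma>' t)) = C * h (\<gamma> t) (\<gamma>' t) (\<gamma>' t)"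
    using clairaut[OF p v] by blast
  define V where "V = \<epsilon> *\<^sub>R v"
  define A where "A = proj E1 V"
  define B where "B = V - proj E1 V"
  have V: "V \<in> E" "A \<in> E1" "A \<in> E" "B \<in> E" "proj E1 B = 0" "V = A + B"
    using v subspace_scale[OF E] proj_in[OF E1(1)] proj_E fibre_in fibre_proj by (auto simp: V_def A_def B_def)
  let ?J = "{-d<..<d}"
  have J: "open ?J" and 0: "0 \<in> ?J" using d by auto
  have \<gamma>: "\<gamma> t \<in> N" "\<gamma>' t \<in> E" "\<gamma>'' t \<in> E" "(\<gamma> has_vector_derivative \<gamma>' t) (at t)" "(\<gamma>' has_vector_derivative \<gamma>'' t) (at t)"
    "w \<in> E \<Longrightarrow> euler_lagrange E h (\<gamma> t) (\<gamma>' t) (\<gamma>'' t) w = 0" if "t \<in> ?J" for t w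
    using g that unfolding geodesic_curve_def by blast+
  define P2 where "P2 v = v - proj E1 v" for v
  have bP2: "bounded_linear P2" unfolding P2_def by (intro bounded_linear_sub bounded_linear_ident bounded_linear_proj)
  have P2': "((\<lambda>t. P2 (\<gamma>' t)) has_vector_derivative P2 (\<gamma>'' 0)) (at 0)"
    using bounded_linear.has_vector_derivative[OF bP2 \<gamma>(5)[OF 0]] .
  let ?a = "\<gamma>'' 0"
  have aE: "?a \<in> E" using \<gamma>(3)[OF 0] .
  have P2E: "P2 w \<in> E" if "w \<in> E" for w using fibre_in[OF that] by (simp add: P2_def)
  have PB: "P2 (\<gamma>' 0) = B" using \<gamma>0 by (simp add: P2_def B_def V_def)
  have VV: "\<gamma>' 0 = V" using \<gamma>0 by (simp add: V_def)
  have n': "((\<lambda>t. h (\<gamma> t) (P2 (\<gamma>' t)) (P2 (\<gamma>' t))) has_vector_derivative (D p B B V + h p (P2 ?a) B + h p B (P2 ?a))) (at 0)"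
    using metric_time_deriv[OF J N h \<gamma>(1) P2E[OF \<gamma>(2)] P2E[OF \<gamma>(2)] 0 \<gamma>(4)[OF 0] P2' P2']
    by (simp only: VV PB[unfolded VV] \<gamma>0(1) D_def)
  have m': "((\<lambda>t. h (\<gamma> t) (\<gamma>' t) (\<gamma>' t)) has_vector_derivative (D p V V V + h p ?a V + h p V ?a)) (at 0)"
    using metric_time_deriv[OF J N h \<gamma>(1) \<gamma>(2) \<gamma>(2) 0 \<gamma>(4)[OF 0] \<gamma>(5)[OF 0] \<gamma>(5)[OF 0]] by (simp add: \<gamma>0 D_def V_def)
  have J': "rel_open UNIV ?J" using J by (simp add: rel_open_def subspace_UNIV open_openin[symmetric])
  have "((\<lambda>t. \<rho> (\<gamma> t)) has_derivative (\<lambda>x. deriv_in E \<rho> p (x *\<^sub>R V))) (at 0)"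
    using has_derivative_chain_rel[OF J' N _ 0 \<gamma>(4)[OF 0, unfolded has_vector_derivative_def] C_k_on_SucD(1)[OF \<rho>k \<gamma>(1)[OF 0]]] \<gamma>(1)
    by (simp add: image_subset_iff VV \<gamma>0)
  then have r': "((\<lambda>t. \<rho> (\<gamma> t)) has_vector_derivative deriv_in E \<rho> p V) (at 0)"
    by (simp add: has_vector_derivative_def linear_cmul[OF D\<rho>_linear[OF p]])
  have el: "h p ?a w + D p V w V - D p V V w / 2 = 0" if "w \<in> E" for w
    using \<gamma>(6)[OF 0 that] by (simp add: euler_lagrange_def D_def VV \<gamma>0)
  \<comment> \<open>Conservation of energy: the geodesic equation tested with the velocity
    itself.\<close>
  have m0: "D p V V V + h p ?a V + h p V ?a = 0"
    using el[OF V(1)] metric_onD(3)[OF h p V(1) aE] by simp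
  \<comment> \<open>This eliminates the unknown acceleration. By the block form, pairing with
    \<open>B\<close> sees only the vertical part of the acceleration, and \<open>D p V V\<close>
    splits into the contributions of \<open>A\<close> and \<open>B\<close>, so that only derivatives
    of the two blocks remain.\<close>
  have n0: "D p B B V + h p (P2 ?a) B + h p B (P2 ?a) = D p A A B - D p B B A"
  proof -
    have 1: "h p (P2 ?a) B = h p ?a B"
    proof -
      have "h p ?a B = h p (proj E1 ?a + P2 ?a) (0 + B)" by (simp add: P2_def)
      also have "\<dots> = h p (proj E1 ?a) 0 + h p (P2 ?a) B"
        by (rule h_block[OF p]) (use proj_in[OF E1(1)] V P2E aE fibre_proj subspace_0[OF E1(1)] in \<open>auto simp: P2_def\<close>)
      also have "h p (proj E1 ?a) 0 = 0" using linear_onD(3)[OF metric_on_linear_right[OF h E p proj_E[OF aE]] E] .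
      finally show ?thesis by simp
    qed
    have 2: "h p B (P2 ?a) = h p (P2 ?a) B" using metric_onD(3)[OF h p V(4) P2E[OF aE]] .
    have 3: "D p V B z = D p B B z" for z unfolding D_def
    proof (rule arg_cong[where f="\<lambda>F. F z"], rule deriv_in_cong[OF N p])
      fix q assume q: "q \<in> N"
      have "h q (A + B) (0 + B) = h q A 0 + h q B B"
        by (rule h_block[OF q]) (use V subspace_0[OF E1(1)] in auto)
      then show "h q V B = h q B B" using V(6) linear_onD(3)[OF metric_on_linear_right[OF h E q V(3)] E] by simp
    qed
    have 4: "D p V V z = D p A A z + D p B B z" if z: "z \<in> E" for z
    proof -
      have hA: "C_k_on (Suc 0) E N (\<lambda>q. h q A A)" and hB: "C_k_on (Suc 0) E N (\<lambda>q. h q B B)"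
        using metric_onD(1)[OF h V(3,3)] metric_onD(1)[OF h V(4,4)] by blast+
      have "deriv_in E (\<lambda>q. h q V V) p = deriv_in E (\<lambda>q. h q A A + h q B B) p"
        by (rule deriv_in_cong[OF N p]) (use h_block V in auto)
      moreover have "deriv_in E (\<lambda>q. h q A A + h q B B) p z = deriv_in E (\<lambda>q. h q A A) p z + deriv_in E (\<lambda>q. h q B B) p z"
        by (rule deriv_in_eq[OF E N_in[OF p] has_derivative_add[OF C_k_on_SucD(1)[OF hA p] C_k_on_SucD(1)[OF hB p]] z])
      ultimately show ?thesis by (simp add: D_def)
    qed
    have 5: "D p B B V = D p B B A + D p B B B"
      using linear_onD(1)[OF metric_deriv_linear(3)[OF N h p V(4,4,4)] E V(3,4)] V(6) by (simp add: D_def)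
    show ?thesis using 1 2 3[of V] 4[OF V(4)] 5 el[OF V(4)] by simp
  qed
  have prod: "((\<lambda>t. \<rho> (\<gamma> t) * h (\<gamma> t) (P2 (\<gamma>' t)) (P2 (\<gamma>' t))) has_vector_derivative
     (\<rho> p * (D p A A B - D p B B A) + deriv_in E \<rho> p V * h p B B)) (at 0)"
    using has_vector_derivative_mult[OF r' n'[unfolded n0]] by (simp only: \<gamma>0(1) PB)
  have "((\<lambda>t. C * h (\<gamma> t) (\<gamma>' t) (\<gamma>' t)) has_vector_derivative C * 0) (at 0)"
    using has_vector_derivative_mult[OF has_vector_derivative_const m'[unfolded m0]] by simp
  then have "((\<lambda>t. \<rho> (\<gamma> t) * h (\<gamma> t) (P2 (\<gamma>' t)) (P2 (\<gamma>' t))) has_vector_derivative C * 0) (at 0)"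
    by (rule has_vector_derivative_transform_within_open[OF _ J 0]) (use C in \<open>simp add: P2_def\<close>)
  from vector_derivative_unique_at[OF prod this]
  show ?thesis using \<epsilon> unfolding A_def B_def V_def by (intro exI[of _ \<epsilon>]) (simp add: add.commute)
qed

text \<open>Every term has degree three in the velocity, so the unknown factor
  \<open>\<epsilon>\<close> cancels. Geodesics are available for nonzero velocity; if
  \<open>a + b = 0\<close>, then both components vanish and so does every term.\<close>

lemma clairaut_identity:
  assumes p: "p \<in> N" and a: "a \<in> E1" and b: "b \<in> E" "proj E1 b = 0"
  shows "(deriv_in E \<rho> p a + deriv_in E \<rho> p b) * h p b b + \<rho> p * (D p a a b - D p b b a) = 0"
proof (cases "a + b = 0")
  case True
  then have "proj E1 (a + b) = 0" using linear_0[OF linear_proj] by metis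
  then have "a = 0" using b proj_id[OF E1(1) a] by (simp add: linear_add[OF linear_proj])
  moreover from this True have "b = 0" by simp
  ultimately show ?thesis
    using linear_onD(3)[OF metric_on_linear_right[OF h E p subspace_0[OF E]] E] subspace_0[OF E]
      linear_onD(3)[OF metric_deriv_linear(3)[OF N h p] E] by (simp add: D_def)
next
  case False
  have aE: "a \<in> E" using a E1 by auto
  have abE: "a + b \<in> E" using aE b E by (auto intro: subspace_add)
  obtain \<epsilon> where \<epsilon>: "\<epsilon> > 0" and id: "deriv_in E \<rho> p (\<epsilon> *\<^sub>R (a + b)) * h p (\<epsilon> *\<^sub>R (a + b) - proj E1 (\<epsilon> *\<^sub>R (a + b))) (\<epsilon> *\<^sub>R (a + b) - proj E1 (\<epsilon> *\<^sub>R (a + b))) +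
    \<rho> p * (D p (proj E1 (\<epsilon> *\<^sub>R (a + b))) (proj E1 (\<epsilon> *\<^sub>R (a + b))) (\<epsilon> *\<^sub>R (a + b) - proj E1 (\<epsilon> *\<^sub>R (a + b)))
      - D p (\<epsilon> *\<^sub>R (a + b) - proj E1 (\<epsilon> *\<^sub>R (a + b))) (\<epsilon> *\<^sub>R (a + b) - proj E1 (\<epsilon> *\<^sub>R (a + b))) (proj E1 (\<epsilon> *\<^sub>R (a + b)))) = 0"
    using clairaut_identity_scaled[OF p abE False] by blast
  have pr: "proj E1 (\<epsilon> *\<^sub>R (a + b)) = \<epsilon> *\<^sub>R a"
    using proj_id[OF E1(1) a] b by (simp add: linear_cmul[OF linear_proj] linear_add[OF linear_proj])
  have pr2: "\<epsilon> *\<^sub>R (a + b) - \<epsilon> *\<^sub>R a = \<epsilon> *\<^sub>R b" by (simp add: algebra_simps)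
  have sc: "\<epsilon> *\<^sub>R v \<in> E" if "v \<in> E" for v using subspace_scale[OF E that] .
  have h2: "h p (\<epsilon> *\<^sub>R b) (\<epsilon> *\<^sub>R b) = \<epsilon> * (\<epsilon> * h p b b)"
    using linear_onD(2)[OF metric_onD(2)[OF h p sc[OF b(1)]] E b(1), of \<epsilon>] linear_onD(2)[OF metric_on_linear_right[OF h E p b(1)] E b(1), of \<epsilon>]
    by simp
  have D3: "D p (\<epsilon> *\<^sub>R v) (\<epsilon> *\<^sub>R v) (\<epsilon> *\<^sub>R z) = \<epsilon> * (\<epsilon> * (\<epsilon> * D p v v z))" if "v \<in> E" "z \<in> E" for v z
    unfolding D_def
    using linear_onD(2)[OF metric_deriv_linear(1)[OF N h p that(1) sc[OF that(1)] sc[OF that(2)]] E that(1), of \<epsilon>]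
      linear_onD(2)[OF metric_deriv_linear(2)[OF N h p that(1) that(1) sc[OF that(2)]] E that(1), of \<epsilon>]
      linear_onD(2)[OF metric_deriv_linear(3)[OF N h p that(1) that(1) that(2)] E that(2), of \<epsilon>]
    by simp
  have "deriv_in E \<rho> p (\<epsilon> *\<^sub>R (a + b)) = \<epsilon> * (deriv_in E \<rho> p a + deriv_in E \<rho> p b)"
    by (simp add: linear_cmul[OF D\<rho>_linear[OF p]] linear_add[OF D\<rho>_linear[OF p]] del: scaleR_add_right)
  then have "\<epsilon> * \<epsilon> * \<epsilon> * ((deriv_in E \<rho> p a + deriv_in E \<rho> p b) * h p b b + \<rho> p * (D p a a b - D p b b a)) = 0"
    using id unfolding pr pr2 h2 D3[OF aE b(1)] D3[OF b(1) aE] by (simp add: algebra_simps)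
  then show ?thesis using \<epsilon> by simp
qed

text \<open>
  The terms of the identity have different parity in \<open>a\<close>, so replacing \<open>a\<close> by \<open>- a\<close> separates them.
\<close>

lemma clairaut_consequences:
  assumes p: "p \<in> N" and a: "a \<in> E1" and b: "b \<in> E" "proj E1 b = 0"
  shows "deriv_in E \<rho> p b = 0" "D p a a b = 0" "\<rho> p * D p b b a = deriv_in E \<rho> p a * h p b b"
proof -
  have aE: "a \<in> E" using a E1 by auto
  have 0: "(0::'e) \<in> E1" using subspace_0[OF E1(1)] .
  \<comment> \<open>Taking \<open>a = 0\<close> isolates this derivative: both metric derivatives
    vanish, and \<open>h p b b\<close> is positive for nonzero \<open>b\<close>.\<close>
  have 1: "deriv_in E \<rho> p b = 0" if "b \<in> E" "proj E1 b = 0" for b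
  proof (cases "b = 0")
    case True
    then show ?thesis using linear_0[OF D\<rho>_linear[OF p]] by simp
  next
    case False
    have "D p 0 0 b = 0" using linear_onD(3)[OF metric_deriv_linear(1)[OF N h p subspace_0[OF E] subspace_0[OF E] that(1)] E]
      by (simp add: D_def)
    moreover have "D p b b 0 = 0" using linear_onD(3)[OF metric_deriv_linear(3)[OF N h p that(1) that(1) that(1)] E] by (simp add: D_def)
    ultimately have "deriv_in E \<rho> p b * h p b b = 0"
      using clairaut_identity[OF p 0 that] linear_0[OF D\<rho>_linear[OF p]] by simp
    then show ?thesis using metric_onD(4)[OF h p that(1) False] by simp
  qed
  show "deriv_in E \<rho> p b = 0" using 1[OF b] .
  have ma: "- a \<in> E1" "- a \<in> E" using a E1 subspace_neg[OF E1(1) a] by auto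
  have D1: "D p (- a) (- a) b = D p a a b" unfolding D_def
    using linear_onD(5)[OF metric_deriv_linear(1)[OF N h p aE ma(2) b(1)] E aE]
      linear_onD(5)[OF metric_deriv_linear(2)[OF N h p aE aE b(1)] E aE] by simp
  have D2: "D p b b (- a) = - D p b b a" unfolding D_def
    using linear_onD(5)[OF metric_deriv_linear(3)[OF N h p b(1) b(1) aE] E aE] by simp
  have e1: "deriv_in E \<rho> p a * h p b b + \<rho> p * (D p a a b - D p b b a) = 0"
    using clairaut_identity[OF p a b] 1[OF b] by simp
  have e2: "- deriv_in E \<rho> p a * h p b b + \<rho> p * (D p a a b + D p b b a) = 0"
    using clairaut_identity[OF p ma(1) b] 1[OF b] D1 D2 linear_neg[OF D\<rho>_linear[OF p]] by simp
  have "2 * (\<rho> p * D p a a b) = 0" using e1 e2 by argo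
  then show "D p a a b = 0" using \<rho>_pos[OF p] by simp
  then show "\<rho> p * D p b b a = deriv_in E \<rho> p a * h p b b" using e1 by (simp add: algebra_simps)
qed

text \<open>Segments inside the box integrate the infinitesimal identities: the horizontal block is
  carried along the fibre direction to \<open>proj E1 p\<close>, and the vertical block divided by
  \<open>\<rho>\<close> is carried along the leaf direction to \<open>p - proj E1 p\<close>, where
  \<open>\<rho>\<close> has the value \<open>\<rho> 0\<close>. The identities concern quadratic
  forms, and polarisation recovers the bilinear ones.\<close>

lemma split_ball_warped:
  assumes box: "split_ball E E1 s \<subseteq> N" and p: "p \<in> split_ball E E1 s" and v: "v \<in> E" and w: "w \<in> E"
  shows "\<rho> p = \<rho> (proj E1 p)"
    "h p v w = h (proj E1 p) (proj E1 v) (proj E1 w) + \<rho> (proj E1 p) * (h (p - proj E1 p) (v - proj E1 v) (w - proj E1 w) / \<rho> 0)"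
proof -
  let ?x = "proj E1 p" and ?y = "p - proj E1 p"
  have pE: "p \<in> E" using p by (simp add: split_ball_def)
  have x: "?x \<in> E1" "?x \<in> E" "proj E1 ?x = ?x" using proj_in[OF E1(1)] proj_E[OF pE] proj_id[OF E1(1)] by auto
  have y: "?y \<in> E" "proj E1 ?y = 0" using fibre_in[OF pE] fibre_proj by auto
  have small: "t * norm z < s" if "t \<in> {0..1}" "norm z < s" for t and z :: 'e
    using mult_right_mono[of t 1 "norm z"] that by auto
  have seg: "s1 *\<^sub>R ?x + t *\<^sub>R ?y \<in> N" if "s1 \<in> {0..1}" "t \<in> {0..1}" for s1 t
  proof -
    have "proj E1 (s1 *\<^sub>R ?x + t *\<^sub>R ?y) = s1 *\<^sub>R ?x" using x y by (simp add: linear_add[OF linear_proj] linear_cmul[OF linear_proj])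
    then have "s1 *\<^sub>R ?x + t *\<^sub>R ?y \<in> split_ball E E1 s"
      using small[of s1 ?x] small[of t ?y] that p x y E by (auto simp: split_ball_def intro: subspace_add subspace_scale)
    then show ?thesis using box by auto
  qed
  have pN: "p \<in> N" and xN: "?x \<in> N" and yN: "?y \<in> N" and 0: "0 \<in> N" using seg[of 1 1] seg[of 1 0] seg[of 0 1] seg[of 0 0] by auto
  have segx: "?x + t *\<^sub>R ?y \<in> N" if "t \<in> {0..1}" for t using seg[of 1 t] that by simp
  have segy: "?y + t *\<^sub>R ?x \<in> N" if "t \<in> {0..1}" for t using seg[of t 1] that by (simp add: add.commute)
  have seg0: "0 + t *\<^sub>R ?y \<in> N" if "t \<in> {0..1}" for t using seg[of 0 t] that by simp
  note z1 = subspace_0[OF E1(1)]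
  have "\<rho> (?x + ?y) = \<rho> ?x"
    by (rule const_along[OF N \<rho>k y(1) segx]) (use clairaut_consequences(1)[OF segx z1 y] in auto)
  then show \<rho>x: "\<rho> p = \<rho> ?x" by simp
  have \<rho>y: "\<rho> ?y = \<rho> 0"
    using const_along[OF N \<rho>k y(1) seg0] clairaut_consequences(1)[OF seg0 z1 y] by auto
  have hx: "h p a a = h ?x a a" if a: "a \<in> E1" for a
  proof -
    have aE: "a \<in> E" using a E1 by auto
    have "h (?x + ?y) a a = h ?x a a"
      by (rule const_along[OF N metric_onD(1)[OF h aE aE] y(1) segx])
        (use clairaut_consequences(2)[OF segx a y] in \<open>auto simp: D_def\<close>)
    then show ?thesis by simp
  qed
  \<comment> \<open>The third of the \<open>clairaut_consequences\<close> says that the derivative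
    of this quotient in leaf directions is zero.\<close>
  have hy: "h p b b / \<rho> p = h ?y b b / \<rho> ?y" if b: "b \<in> E" "proj E1 b = 0" for b
  proof -
    have inv_k: "C_k_on (Suc 0) E N (\<lambda>q. h q b b / \<rho> q)"
      "\<And>q a. q \<in> N \<Longrightarrow> a \<in> E \<Longrightarrow> deriv_in E (\<lambda>q. h q b b / \<rho> q) q a = (D q b b a * \<rho> q - h q b b * deriv_in E \<rho> q a) / (\<rho> q * \<rho> q)"
    proof -
      have dd: "((\<lambda>q. h q b b / \<rho> q) has_derivative (\<lambda>a. (D q b b a * \<rho> q - h q b b * deriv_in E \<rho> q a) / (\<rho> q * \<rho> q))) (at q within E)"
        if "q \<in> N" for q
        unfolding D_def
        using has_derivative_divide'[OF C_k_on_SucD(1)[OF metric_onD(1)[OF h b(1) b(1)] that] C_k_on_SucD(1)[OF \<rho>k that]] \<rho>_pos[OF that] by force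
      show "deriv_in E (\<lambda>q. h q b b / \<rho> q) q a = (D q b b a * \<rho> q - h q b b * deriv_in E \<rho> q a) / (\<rho> q * \<rho> q)" if "q \<in> N" "a \<in> E" for q a
        using deriv_in_eq[OF E N_in[OF that(1)] dd[OF that(1)] that(2)] .
      show "C_k_on (Suc 0) E N (\<lambda>q. h q b b / \<rho> q)"
      proof (rule C_k_on_SucI[OF N dd])
        fix a assume a: "a \<in> E"
        have "continuous_on N \<rho>" "continuous_on N (\<lambda>q. h q b b)" "continuous_on N (\<lambda>q. D q b b a)" "continuous_on N (\<lambda>q. deriv_in E \<rho> q a)"
          using C_k_on_continuous[OF N \<rho>k] C_k_on_continuous[OF N metric_onD(1)[OF h b(1) b(1)]]
            C_k_on_continuous[OF N C_k_on_SucD(2)[OF \<rho>k a]] C_k_on_continuous[OF N C_k_on_SucD(2)[OF metric_onD(1)[OF h b(1) b(1)] a]]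
          by (auto simp: D_def)
        then show "C_k_on 0 E N (\<lambda>q. (D q b b a * \<rho> q - h q b b * deriv_in E \<rho> q a) / (\<rho> q * \<rho> q))"
          using \<rho>_pos by (auto intro!: continuous_intros simp: less_imp_neq[THEN not_sym])
      qed
    qed
    have "(\<lambda>q. h q b b / \<rho> q) (?y + ?x) = (\<lambda>q. h q b b / \<rho> q) ?y"
    proof (rule const_along[OF N inv_k(1) x(2) segy])
      fix t :: real assume t: "t \<in> {0..1}"
      show "deriv_in E (\<lambda>q. h q b b / \<rho> q) (?y + t *\<^sub>R ?x) ?x = 0"
        using inv_k(2)[OF segy[OF t] x(2)] clairaut_consequences(3)[OF segy[OF t] x(1) b] by (simp add: mult.commute)
    qed
    then show ?thesis by simp
  qed
  have polar: "h q v w = (h q (v + w) (v + w) - h q v v - h q w w) / 2" if "q \<in> N" "v \<in> E" "w \<in> E" for q v w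
    using h_add[OF that(1,2,3), of "v + w"] h_add_right[OF that(1,2,2,3)] h_add_right[OF that(1,3,2,3)]
      metric_onD(3)[OF h that(1,2,3)] that subspace_add[OF E that(2,3)] by simp
  let ?a = "proj E1 v" and ?a' = "proj E1 w" and ?b = "v - proj E1 v" and ?b' = "w - proj E1 w"
  have A: "?a \<in> E1" "?a' \<in> E1" "?a \<in> E" "?a' \<in> E" "?a + ?a' \<in> E1" using proj_in[OF E1(1)] proj_E v w subspace_add[OF E1(1)] by auto
  have B: "?b \<in> E" "?b' \<in> E" "proj E1 ?b = 0" "proj E1 ?b' = 0" using fibre_in fibre_proj v w by auto
  have B2: "?b + ?b' \<in> E" "proj E1 (?b + ?b') = 0" using B subspace_add[OF E B(1,2)] by (auto simp: linear_add[OF linear_proj])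
  have "h p v w = h p (?a + ?b) (?a' + ?b')" by simp
  also have "\<dots> = h p ?a ?a' + h p ?b ?b'" using h_block[OF pN A(1) B(1,3) A(2) B(2,4)] .
  also have "h p ?a ?a' = h ?x ?a ?a'"
    unfolding polar[OF pN A(3,4)] polar[OF xN A(3,4)] using hx[OF A(1)] hx[OF A(2)] hx[OF A(5)] by simp
  also have "h p ?b ?b' = \<rho> p * (h ?y ?b ?b' / \<rho> ?y)"
  proof -
    have *: "h p c c = \<rho> p * (h ?y c c / \<rho> ?y)" if "c \<in> E" "proj E1 c = 0" for c
      using hy[OF that] \<rho>_pos[OF pN] by (simp add: field_simps)
    have dist: "(R * (X / r) - R * (Y / r) - R * (Z / r)) / 2 = R * ((X - Y - Z) / 2 / r)" for R X Y Z r :: real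
      by (simp only: diff_divide_distrib right_diff_distrib times_divide_eq_right divide_divide_eq_left mult.commute)
    show ?thesis unfolding polar[OF pN B(1,2)] polar[OF yN B(1,2)] *[OF B(1,3)] *[OF B(2,4)] *[OF B2] by (rule dist)
  qed
  finally show "h p v w = h ?x ?a ?a' + \<rho> ?x * (h ?y ?b ?b' / \<rho> 0)" using \<rho>x \<rho>y by simp
qed

end

section \<open>Charts, tangent vectors and metrics\<close>

locale manifold =
  fixes M :: "('a, 'e::euclidean_space) manifold"
  assumes M: "smooth_manifold M"
begin

abbreviation "E \<equiv> model M"

lemma E: "subspace E" using M by (simp add: smooth_manifold_def)

lemma chart_open: "c \<in> atlas M \<Longrightarrow> openin (mtop M) (fst c)"
  using M by (simp add: smooth_manifold_def)

lemma chart_points: "c \<in> atlas M \<Longrightarrow> fst c \<subseteq> points M"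
  using chart_open openin_subset by blast

lemma chart_homeo: "c \<in> atlas M \<Longrightarrow> homeomorphic_map (subtopology (mtop M) (fst c)) (top_of_set (snd c ` fst c)) (snd c)"
  using M by (simp add: smooth_manifold_def)

lemma chart_exists: "p \<in> points M \<Longrightarrow> \<exists>c. c \<in> charts_at M p"
proof -
  assume "p \<in> points M"
  moreover have "(\<Union>c\<in>atlas M. fst c) = points M" using M unfolding smooth_manifold_def by blast
  ultimately show ?thesis unfolding charts_at_def by blast
qed

lemma charts_atD: "c \<in> charts_at M p \<Longrightarrow> c \<in> atlas M \<and> p \<in> fst c"
  by (simp add: charts_at_def)

lemma charts_at_point: "c \<in> charts_at M p \<Longrightarrow> p \<in> points M"
  using charts_atD chart_points by blast

lemma topspace_chart: "c \<in> atlas M \<Longrightarrow> topspace (subtopology (mtop M) (fst c)) = fst c"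
  using chart_points[of c] by (auto simp: topspace_subtopology)

lemma chart_inj: "c \<in> atlas M \<Longrightarrow> inj_on (snd c) (fst c)"
  using homeomorphic_imp_injective_map[OF chart_homeo] topspace_chart by metis

lemma param_chart: "c \<in> atlas M \<Longrightarrow> p \<in> fst c \<Longrightarrow> param c (snd c p) = p"
  using chart_inj by (simp add: param_def)

lemma chart_param: "x \<in> snd c ` fst c \<Longrightarrow> snd c (param c x) = x"
  by (simp add: param_def f_inv_into_f)

lemma param_in: "x \<in> snd c ` fst c \<Longrightarrow> param c x \<in> fst c"
  by (simp add: param_def inv_into_into)

lemma coord_in_iff:
  assumes "c \<in> atlas M"
  shows "x \<in> snd c ` (fst c \<inter> S) \<longleftrightarrow> x \<in> snd c ` fst c \<and> param c x \<in> S"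
proof
  assume "x \<in> snd c ` (fst c \<inter> S)"
  then obtain p where "p \<in> fst c" "p \<in> S" "x = snd c p" by blast
  then show "x \<in> snd c ` fst c \<and> param c x \<in> S" using param_chart[OF assms] by simp
next
  assume x: "x \<in> snd c ` fst c \<and> param c x \<in> S"
  then have "x = snd c (param c x)" "param c x \<in> fst c \<inter> S" using chart_param[of x c] param_in[of x c] by auto
  then show "x \<in> snd c ` (fst c \<inter> S)" by blast
qed

lemma chart_rel_open: "c \<in> atlas M \<Longrightarrow> rel_open E (snd c ` fst c)"
  using M by (simp add: smooth_manifold_def rel_open_def)

lemma chart_image_rel_open:
  assumes c: "c \<in> atlas M" and W: "openin (mtop M) W"
  shows "rel_open E (snd c ` (fst c \<inter> W))"
proof -
  have "openin (subtopology (mtop M) (fst c)) (fst c \<inter> W)"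
    using W by (auto simp: openin_subtopology)
  then have "openin (top_of_set (snd c ` fst c)) (snd c ` (fst c \<inter> W))"
    using homeomorphic_map_openness[OF chart_homeo[OF c], of "fst c \<inter> W"] by (simp only: topspace_chart[OF c] Int_lower1)
  then show ?thesis using chart_rel_open[OF c] unfolding rel_open_def by (metis openin_trans)
qed

lemma param_continuous:
  assumes c: "c \<in> atlas M"
  shows "continuous_map (top_of_set (snd c ` fst c)) (mtop M) (param c)"
proof -
  obtain g where g: "homeomorphic_maps (subtopology (mtop M) (fst c)) (top_of_set (snd c ` fst c)) (snd c) g"
    using chart_homeo[OF c] homeomorphic_map_maps by blast
  have "continuous_map (top_of_set (snd c ` fst c)) (mtop M) g"
    using g unfolding homeomorphic_maps_def by (auto simp: continuous_map_in_subtopology)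
  moreover have "g x = param c x" if "x \<in> snd c ` fst c" for x
  proof -
    have "g (snd c q) = q" if "q \<in> fst c" for q using g that topspace_chart[OF c] unfolding homeomorphic_maps_def by auto
    then show ?thesis using that param_chart[OF c] by auto
  qed
  ultimately show ?thesis by (rule continuous_map_eq) auto
qed

lemma openin_param_image:
  assumes c: "c \<in> atlas M" and V: "rel_open E V" "V \<subseteq> snd c ` fst c"
  shows "openin (mtop M) (param c ` V)"
proof -
  have eq: "param c ` V = {p \<in> fst c. snd c p \<in> V}"
  proof (intro equalityI subsetI)
    fix p assume "p \<in> param c ` V"
    then obtain x where x: "x \<in> V" "p = param c x" by blast
    then have "x \<in> snd c ` fst c" using V(2) by blast
    then show "p \<in> {p \<in> fst c. snd c p \<in> V}" using x param_in[of x c] chart_param[of x c] by simp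
  next
    fix p assume "p \<in> {p \<in> fst c. snd c p \<in> V}"
    then show "p \<in> param c ` V" using param_chart[OF c, of p] by (metis (mono_tags, lifting) image_eqI mem_Collect_eq)
  qed
  obtain T where T: "open T" "V = E \<inter> T" using V unfolding rel_open_def openin_open by auto
  have "V = snd c ` fst c \<inter> T" using T V rel_open_subset[OF chart_rel_open[OF c]] by auto
  then have "openin (top_of_set (snd c ` fst c)) V" using T by (auto simp: openin_open)
  moreover have "continuous_map (subtopology (mtop M) (fst c)) (top_of_set (snd c ` fst c)) (snd c)"
    using homeomorphic_imp_continuous_map[OF chart_homeo[OF c]] .
  ultimately have "openin (subtopology (mtop M) (fst c)) {p \<in> topspace (subtopology (mtop M) (fst c)). snd c p \<in> V}"
    using openin_continuous_map_preimage by blast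
  then show ?thesis using eq topspace_chart[OF c] chart_open[OF c] by (metis openin_trans_full)
qed

lemma transition_k:
  assumes "c \<in> atlas M" "d \<in> atlas M"
  shows "C_k_on k E (snd c ` (fst c \<inter> fst d)) (snd d \<circ> param c)"
  using M assms by (auto simp: smooth_manifold_def smooth_on_def)

lemma overlap_open: "c \<in> atlas M \<Longrightarrow> d \<in> atlas M \<Longrightarrow> rel_open E (snd c ` (fst c \<inter> fst d))"
  using chart_image_rel_open chart_open by blast

lemma coord_in: "c \<in> charts_at M p \<Longrightarrow> snd c p \<in> E"
  using charts_atD rel_open_subset[OF chart_rel_open] by blast

lemma transition_image: "c \<in> atlas M \<Longrightarrow> (snd d \<circ> param c) ` snd c ` (fst c \<inter> fst d) \<subseteq> snd d ` (fst c \<inter> fst d)"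
  by (auto simp: param_chart)

lemma transition_in:
  assumes "c \<in> charts_at M p" "d \<in> charts_at M p" "u \<in> E"
  shows "deriv_in E (snd d \<circ> param c) (snd c p) u \<in> E"
proof -
  have cd: "c \<in> atlas M" "p \<in> fst c" "d \<in> atlas M" "p \<in> fst d" using assms charts_atD by auto
  have "(snd d \<circ> param c) ` snd c ` (fst c \<inter> fst d) \<subseteq> E"
    using transition_image[OF cd(1), of d] rel_open_subset[OF chart_rel_open[OF cd(3)]] by blast
  from deriv_in_subspace[OF overlap_open[OF cd(1,3)] _ this E transition_k[OF cd(1,3)] assms(3)]
  show ?thesis using cd by blast
qed

text \<open>Chain rule through the transition map. With a chart map for \<open>f\<close> it gives
  the compatibility of coordinate vectors in three charts; with a chart of the target after a smooth
  map for \<open>f\<close> it shows that the differential does not depend on the chart.\<close>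

lemma change_chart:
  fixes f :: "'a \<Rightarrow> 'g::real_normed_vector"
  assumes c: "c \<in> charts_at M p" and d: "d \<in> charts_at M p"
    and f: "(f \<circ> param d) differentiable (at (snd d p) within E)" and u: "u \<in> E"
  shows "deriv_in E (f \<circ> param c) (snd c p) u = deriv_in E (f \<circ> param d) (snd d p) (deriv_in E (snd d \<circ> param c) (snd c p) u)"
proof -
  have cd: "c \<in> atlas M" "p \<in> fst c" "d \<in> atlas M" "p \<in> fst d" using c d charts_atD by auto
  let ?U = "snd c ` (fst c \<inter> fst d)"
  have U: "rel_open E ?U" using overlap_open cd by auto
  have x: "snd c p \<in> ?U" using cd by auto
  have eq: "(f \<circ> param c) y = (f \<circ> param d) ((snd d \<circ> param c) y)" if "y \<in> ?U" for y
    using that by (auto simp: param_chart[OF cd(1)] param_chart[OF cd(3)])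
  have im: "(snd d \<circ> param c) ` ?U \<subseteq> snd d ` fst d" using transition_image[OF cd(1), of d] by blast
  have px: "(snd d \<circ> param c) (snd c p) = snd d p" using cd param_chart by simp
  have "deriv_in E (f \<circ> param c) (snd c p) u = deriv_in E (\<lambda>y. (f \<circ> param d) ((snd d \<circ> param c) y)) (snd c p) u"
    by (rule arg_cong[where f="\<lambda>D. D u"], rule deriv_in_cong[OF U x eq])
  also have "\<dots> = deriv_in E (f \<circ> param d) ((snd d \<circ> param c) (snd c p)) (deriv_in E (snd d \<circ> param c) (snd c p) u)"
  proof (rule deriv_in_chain[OF U chart_rel_open[OF cd(3)] im x _ _ u])
    show "(snd d \<circ> param c) differentiable (at (snd c p) within E)"
      using C_k_on_SucD(1)[OF transition_k[OF cd(1,3)] x] by (rule differentiableI)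
    show "(f \<circ> param d) differentiable (at ((snd d \<circ> param c) (snd c p)) within E)" unfolding px by (rule f)
  qed
  finally show ?thesis using px by simp
qed

lemma transition_differentiable:
  assumes "c \<in> charts_at M p" "d \<in> charts_at M p"
  shows "(snd d \<circ> param c) differentiable (at (snd c p) within E)"
proof -
  have cd: "c \<in> atlas M" "p \<in> fst c" "d \<in> atlas M" "p \<in> fst d" using assms charts_atD by auto
  then have "snd c p \<in> snd c ` (fst c \<inter> fst d)" by blast
  from C_k_on_SucD(1)[OF transition_k[OF cd(1,3)] this] show ?thesis by (rule differentiableI)
qed

lemma transition_self:
  assumes c: "c \<in> charts_at M p" and u: "u \<in> E"
  shows "deriv_in E (snd c \<circ> param c) (snd c p) u = u"
proof (rule deriv_in_eq[OF E coord_in[OF c] _ u])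
  have c': "c \<in> atlas M" "p \<in> fst c" using c charts_atD by auto
  show "((snd c \<circ> param c) has_derivative (\<lambda>u. u)) (at (snd c p) within E)"
    by (rule has_derivative_cong_rel[OF chart_rel_open[OF c'(1)] _ _ has_derivative_ident]) (use c' in \<open>auto simp: param_chart[OF c'(1)]\<close>)
qed

lemma coord_vec_self: "c \<in> charts_at M p \<Longrightarrow> u \<in> E \<Longrightarrow> coord_vec M c p u c = u"
  using transition_self by (simp add: coord_vec_def)

lemma coord_vec_in:
  assumes c: "c \<in> charts_at M p" and u: "u \<in> E"
  shows "coord_vec M c p u \<in> tangent_space M p"
  unfolding tangent_space_def mem_Collect_eq
proof (intro conjI ballI allI impI)
  show "coord_vec M c p u d = 0" if "d \<notin> charts_at M p" for d using that by (simp add: coord_vec_def)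
  show "coord_vec M c p u d \<in> E" if "d \<in> charts_at M p" for d
    using transition_in[OF c that u] that by (simp add: coord_vec_def)
  show "coord_vec M c p u d' = deriv_in E (snd d' \<circ> param d) (snd d p) (coord_vec M c p u d)"
    if "d \<in> charts_at M p" "d' \<in> charts_at M p" for d d'
    using change_chart[OF c that(1) transition_differentiable[OF that] u] that by (simp add: coord_vec_def)
qed

lemma tangent_in: "c \<in> charts_at M p \<Longrightarrow> v \<in> tangent_space M p \<Longrightarrow> v c \<in> E"
  unfolding tangent_space_def by blast

lemma tangent_zero: "v \<in> tangent_space M p \<Longrightarrow> c \<notin> charts_at M p \<Longrightarrow> v c = 0"
  unfolding tangent_space_def by blast

lemma tangent_change:
  "c \<in> charts_at M p \<Longrightarrow> d \<in> charts_at M p \<Longrightarrow> v \<in> tangent_space M p \<Longrightarrow>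
     v d = deriv_in E (snd d \<circ> param c) (snd c p) (v c)"
  unfolding tangent_space_def by blast

lemma tangent_eq_coord_vec:
  assumes c: "c \<in> charts_at M p" and v: "v \<in> tangent_space M p"
  shows "v = coord_vec M c p (v c)"
proof
  show "v d = coord_vec M c p (v c) d" for d
    using tangent_change[OF c _ v, of d] tangent_zero[OF v, of d] by (cases "d \<in> charts_at M p") (simp_all add: coord_vec_def)
qed

lemma tangent_eqI:
  assumes "c \<in> charts_at M p" "v \<in> tangent_space M p" "w \<in> tangent_space M p" "v c = w c"
  shows "v = w"
  using tangent_eq_coord_vec assms by metis

lemma coord_vec_linear:
  assumes c: "c \<in> charts_at M p" and "u \<in> E" "w \<in> E"
  shows "coord_vec M c p (a *\<^sub>R u + b *\<^sub>R w) = (\<lambda>d. a *\<^sub>R coord_vec M c p u d + b *\<^sub>R coord_vec M c p w d)"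
  using linear_deriv_in[OF transition_differentiable[OF c]]
  by (auto simp: coord_vec_def linear_add linear_cmul fun_eq_iff)

lemma tangent_linear:
  assumes p: "p \<in> points M" and "v \<in> tangent_space M p" "w \<in> tangent_space M p"
  shows "(\<lambda>d. a *\<^sub>R v d + b *\<^sub>R w d) \<in> tangent_space M p"
proof -
  obtain c where c: "c \<in> charts_at M p" using chart_exists[OF p] by blast
  have "(\<lambda>d. a *\<^sub>R v d + b *\<^sub>R w d) = coord_vec M c p (a *\<^sub>R v c + b *\<^sub>R w c)"
    using coord_vec_linear[OF c tangent_in[OF c assms(2)] tangent_in[OF c assms(3)]]
      tangent_eq_coord_vec[OF c assms(2)] tangent_eq_coord_vec[OF c assms(3)] by metis
  then show ?thesis
    using coord_vec_in[OF c] tangent_in[OF c] assms E by (simp add: subspace_add subspace_scale)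
qed

lemma smooth_fun_k:
  "smooth_fun M f \<Longrightarrow> c \<in> atlas M \<Longrightarrow> C_k_on k E (snd c ` fst c) (f \<circ> param c)"
  by (simp add: smooth_fun_def smooth_on_def)

end

section \<open>Smooth maps between manifolds and their differentials\<close>

locale manifold_map = M: manifold M + N: manifold N
  for M :: "('a, 'e::euclidean_space) manifold" and N :: "('b, 'f::euclidean_space) manifold" +
  fixes F :: "'a \<Rightarrow> 'b"
  assumes F: "smooth_map M N F"
begin

lemma F_points: "p \<in> points M \<Longrightarrow> F p \<in> points N"
  using F by (auto simp: smooth_map_def continuous_map_def)

lemma rep_domain_open:
  assumes c: "c \<in> atlas M" and W: "openin (mtop N) W"
  shows "rel_open M.E (snd c ` (fst c \<inter> F -` W))"
proof -
  have "openin (mtop M) {p \<in> topspace (mtop M). F p \<in> W}"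
    using F W openin_continuous_map_preimage unfolding smooth_map_def by blast
  from M.chart_image_rel_open[OF c this]
  have "rel_open M.E (snd c ` (fst c \<inter> {p \<in> topspace (mtop M). F p \<in> W}))" .
  moreover have "fst c \<inter> {p \<in> topspace (mtop M). F p \<in> W} = fst c \<inter> F -` W" using M.chart_points[OF c] by auto
  ultimately show ?thesis by simp
qed

lemma rep_k:
  assumes "c \<in> atlas M" "d \<in> atlas N"
  shows "C_k_on k M.E (snd c ` (fst c \<inter> F -` fst d)) (snd d \<circ> F \<circ> param c)"
  using F assms by (auto simp: smooth_map_def smooth_on_def)

lemma rep_image:
  assumes "c \<in> atlas M"
  shows "(snd d \<circ> F \<circ> param c) ` snd c ` (fst c \<inter> F -` W) \<subseteq> snd d ` W"
  by (auto simp: M.param_chart[OF assms])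

lemma rep_differentiable:
  assumes "c \<in> charts_at M p" "d \<in> charts_at N (F p)"
  shows "(snd d \<circ> F \<circ> param c) differentiable (at (snd c p) within M.E)"
proof -
  have cd: "c \<in> atlas M" "p \<in> fst c" "d \<in> atlas N" "F p \<in> fst d" using assms M.charts_atD N.charts_atD by auto
  then have "snd c p \<in> snd c ` (fst c \<inter> F -` fst d)" by blast
  from C_k_on_SucD(1)[OF rep_k[OF cd(1,3)] this] show ?thesis by (rule differentiableI)
qed

lemma rep_deriv_in:
  assumes c: "c \<in> charts_at M p" and d: "d \<in> charts_at N (F p)" and u: "u \<in> M.E"
  shows "deriv_in M.E (snd d \<circ> F \<circ> param c) (snd c p) u \<in> N.E"
proof -
  have cd: "c \<in> atlas M" "p \<in> fst c" "d \<in> atlas N" "F p \<in> fst d" using assms M.charts_atD N.charts_atD by auto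
  show ?thesis
  proof (rule deriv_in_subspace[OF rep_domain_open[OF cd(1) N.chart_open[OF cd(3)]] _ _ N.E rep_k[OF cd(1,3)] u])
    show "snd c p \<in> snd c ` (fst c \<inter> F -` fst d)" using cd by blast
    show "(snd d \<circ> F \<circ> param c) ` snd c ` (fst c \<inter> F -` fst d) \<subseteq> N.E"
      using rep_image[OF cd(1), of d "fst d"] rel_open_subset[OF N.chart_rel_open[OF cd(3)]] by blast
  qed
qed

text \<open>The definition evaluates in a chart picked by \<open>SOME\<close>; the transformation
  law of \<open>v\<close> and the chain rule cancel this choice.\<close>

lemma differential_chart:
  assumes c: "c \<in> charts_at M p" and d: "d \<in> charts_at N (F p)" and v: "v \<in> tangent_space M p"
  shows "differential M N F p v d = deriv_in M.E (snd d \<circ> F \<circ> param c) (snd c p) (v c)"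
proof -
  define c0 where "c0 = (SOME c. c \<in> charts_at M p)"
  have c0: "c0 \<in> charts_at M p" unfolding c0_def using c by (metis someI)
  have vc: "v c0 = deriv_in M.E (snd c0 \<circ> param c) (snd c p) (v c)" using M.tangent_change[OF c c0 v] .
  have "differential M N F p v d = deriv_in M.E (snd d \<circ> F \<circ> param c0) (snd c0 p) (v c0)"
    using d by (simp add: differential_def c0_def Let_def)
  then show ?thesis
    using M.change_chart[OF c c0 rep_differentiable[OF c0 d] M.tangent_in[OF c v]] vc by simp
qed

lemma rep_change_target:
  assumes c: "c \<in> charts_at M p" and d: "d \<in> charts_at N (F p)" and d': "d' \<in> charts_at N (F p)" and u: "u \<in> M.E"
  shows "deriv_in M.E (snd d' \<circ> F \<circ> param c) (snd c p) u =
    deriv_in N.E (snd d' \<circ> param d) (snd d (F p)) (deriv_in M.E (snd d \<circ> F \<circ> param c) (snd c p) u)"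
proof -
  have cd: "c \<in> atlas M" "p \<in> fst c" "d \<in> atlas N" "F p \<in> fst d" "d' \<in> atlas N" "F p \<in> fst d'"
    using assms M.charts_atD N.charts_atD by auto
  let ?W = "fst d \<inter> fst d'"
  let ?U = "snd c ` (fst c \<inter> F -` ?W)"
  have U: "rel_open M.E ?U" using rep_domain_open[OF cd(1)] N.chart_open cd by blast
  have x: "snd c p \<in> ?U" using cd by auto
  have eq: "(snd d' \<circ> F \<circ> param c) y = (snd d' \<circ> param d) ((snd d \<circ> F \<circ> param c) y)" if "y \<in> ?U" for y
    using that by (auto simp: M.param_chart[OF cd(1)] N.param_chart[OF cd(3)])
  have px: "(snd d \<circ> F \<circ> param c) (snd c p) = snd d (F p)" using cd M.param_chart by simp
  have "deriv_in M.E (snd d' \<circ> F \<circ> param c) (snd c p) u = deriv_in M.E (\<lambda>y. (snd d' \<circ> param d) ((snd d \<circ> F \<circ> param c) y)) (snd c p) u"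
    by (rule arg_cong[where f="\<lambda>D. D u"], rule deriv_in_cong[OF U x eq])
  also have "\<dots> = deriv_in N.E (snd d' \<circ> param d) ((snd d \<circ> F \<circ> param c) (snd c p)) (deriv_in M.E (snd d \<circ> F \<circ> param c) (snd c p) u)"
  proof (rule deriv_in_chain[OF U N.overlap_open[OF cd(3,5)] rep_image[OF cd(1)] x _ _ u])
    show "(snd d \<circ> F \<circ> param c) differentiable (at (snd c p) within M.E)" using rep_differentiable[OF c d] .
    show "(snd d' \<circ> param d) differentiable (at ((snd d \<circ> F \<circ> param c) (snd c p)) within N.E)"
      unfolding px using N.transition_differentiable[OF d d'] .
  qed
  finally show ?thesis using px by simp
qed

lemma differential_coord_vec:
  assumes c: "c \<in> charts_at M p" and d: "d \<in> charts_at N (F p)" and v: "v \<in> tangent_space M p"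
  shows "differential M N F p v = coord_vec N d (F p) (deriv_in M.E (snd d \<circ> F \<circ> param c) (snd c p) (v c))"
proof
  fix d'
  show "differential M N F p v d' = coord_vec N d (F p) (deriv_in M.E (snd d \<circ> F \<circ> param c) (snd c p) (v c)) d'"
  proof (cases "d' \<in> charts_at N (F p)")
    case True
    then show ?thesis
      using differential_chart[OF c True v] rep_change_target[OF c d True M.tangent_in[OF c v]] by (simp add: coord_vec_def)
  next
    case False
    then show ?thesis by (simp add: differential_def coord_vec_def)
  qed
qed

lemma differential_in:
  assumes "p \<in> points M" and v: "v \<in> tangent_space M p"
  shows "differential M N F p v \<in> tangent_space N (F p)"
proof -
  obtain c where c: "c \<in> charts_at M p" using M.chart_exists assms by blast
  obtain d where d: "d \<in> charts_at N (F p)" using N.chart_exists F_points assms by blast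
  show ?thesis using differential_coord_vec[OF c d v] N.coord_vec_in[OF d rep_deriv_in[OF c d M.tangent_in[OF c v]]] by simp
qed

lemma differential_zero_iff:
  assumes c: "c \<in> charts_at M p" and d: "d \<in> charts_at N (F p)" and v: "v \<in> tangent_space M p"
  shows "differential M N F p v = (\<lambda>_. 0) \<longleftrightarrow> deriv_in M.E (snd d \<circ> F \<circ> param c) (snd c p) (v c) = 0"
proof
  assume "differential M N F p v = (\<lambda>_. 0)"
  then show "deriv_in M.E (snd d \<circ> F \<circ> param c) (snd c p) (v c) = 0"
    using differential_chart[OF c d v] by simp
next
  assume "deriv_in M.E (snd d \<circ> F \<circ> param c) (snd c p) (v c) = 0"
  moreover have "coord_vec N d (F p) 0 = (\<lambda>_. 0)"
    using N.coord_vec_linear[OF d subspace_0[OF N.E] subspace_0[OF N.E], of 0 0] by simp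
  ultimately show "differential M N F p v = (\<lambda>_. 0)" using differential_coord_vec[OF c d v] by simp
qed

end

section \<open>Riemannian metrics in charts and their geodesics\<close>

locale riemannian = manifold M for M :: "('a, 'e::euclidean_space) manifold" +
  fixes g :: "('a, 'e) metric_field"
  assumes g: "riemannian_manifold M g"
begin

lemma g_linear:
  assumes "p \<in> points M" "u \<in> tangent_space M p" "v \<in> tangent_space M p" "w \<in> tangent_space M p"
  shows "g p (\<lambda>c. a *\<^sub>R u c + b *\<^sub>R v c) w = a * g p u w + b * g p v w"
  using g assms unfolding riemannian_manifold_def by blast

lemma g_sym: "p \<in> points M \<Longrightarrow> u \<in> tangent_space M p \<Longrightarrow> v \<in> tangent_space M p \<Longrightarrow> g p u v = g p v u"
  using g unfolding riemannian_manifold_def by blast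

lemma g_pos: "p \<in> points M \<Longrightarrow> v \<in> tangent_space M p \<Longrightarrow> v \<noteq> (\<lambda>_. 0) \<Longrightarrow> g p v v > 0"
  using g unfolding riemannian_manifold_def by blast

lemma g_coord:
  assumes c: "c \<in> charts_at M p" and "v \<in> tangent_space M p" "w \<in> tangent_space M p"
  shows "g p v w = metric_coord M g c (snd c p) (v c) (w c)"
  using tangent_eq_coord_vec[OF c assms(2)] tangent_eq_coord_vec[OF c assms(3)] param_chart charts_atD[OF c]
  by (simp add: metric_coord_def)

lemma metric_coord_metric_on:
  assumes c: "c \<in> atlas M"
  shows "metric_on E (snd c ` fst c) (metric_coord M g c)"
  unfolding metric_on_def
proof (intro conjI ballI impI)
  show "smooth_on E (snd c ` fst c) (\<lambda>x. metric_coord M g c x v w)" if "v \<in> E" "w \<in> E" for v w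
    using g c that unfolding riemannian_manifold_def by blast
  fix x assume x: "x \<in> snd c ` fst c"
  have ch: "c \<in> charts_at M (param c x)" using c param_in[OF x] by (simp add: charts_at_def)
  note p = charts_at_point[OF ch] and tan = coord_vec_in[OF ch]
  show "linear_on E (\<lambda>v. metric_coord M g c x v w)" if "w \<in> E" for w
    unfolding linear_on_def metric_coord_def
    using g_linear[OF p tan tan tan[OF that]] coord_vec_linear[OF ch] by simp
  show "metric_coord M g c x v w = metric_coord M g c x w v" if "v \<in> E" "w \<in> E" for v w
    unfolding metric_coord_def using g_sym[OF p tan[OF that(1)] tan[OF that(2)]] .
  show "metric_coord M g c x v v > 0" if "v \<in> E" "v \<noteq> 0" for v
  proof -
    have "coord_vec M c (param c x) v \<noteq> (\<lambda>_. 0)" using coord_vec_self[OF ch that(1)] that(2) by auto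
    then show ?thesis unfolding metric_coord_def using g_pos[OF p tan[OF that(1)]] by simp
  qed
qed

lemma metric_coord_transition:
  assumes c: "c \<in> atlas M" and d: "d \<in> atlas M" and x: "x \<in> snd c ` (fst c \<inter> fst d)" and vw: "v \<in> E" "w \<in> E"
  shows "metric_coord M g c x v w = metric_coord M g d ((snd d \<circ> param c) x)
    (deriv_in E (snd d \<circ> param c) x v) (deriv_in E (snd d \<circ> param c) x w)"
proof -
  let ?p = "param c x"
  have px: "?p \<in> fst c" "?p \<in> fst d" "snd c ?p = x" using x by (auto simp: param_chart[OF c])
  have ch: "c \<in> charts_at M ?p" "d \<in> charts_at M ?p" using px c d by (auto simp: charts_at_def)
  have dd: "coord_vec M c ?p v d = deriv_in E (snd d \<circ> param c) x v" for v
    using ch px(3) by (simp add: coord_vec_def)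
  show ?thesis
    using g_coord[OF ch(2) coord_vec_in[OF ch(1) vw(1)] coord_vec_in[OF ch(1) vw(2)]]
    by (simp add: metric_coord_def[of M g c] dd)
qed

text \<open>\<open>christoffel\<close> is a definite description and is evaluated by uniqueness: the
  difference of two candidates, tested with itself, has length zero.\<close>

lemma christoffel_eq:
  assumes c: "c \<in> atlas M" and x: "x \<in> snd c ` fst c" and v: "v \<in> E" and a: "a \<in> E"
    and el: "\<And>w. w \<in> E \<Longrightarrow> euler_lagrange E (metric_coord M g c) x v a w = 0"
  shows "a + christoffel M g c x v v = 0"
proof -
  let ?G = "metric_coord M g c"
  have G: "metric_on E (snd c ` fst c) ?G" using metric_coord_metric_on[OF c] .
  have "christoffel M g c x v v = - a"
    unfolding christoffel_def
  proof (rule the_equality)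
    have "?G x (- a) w = (deriv_in E (\<lambda>y. ?G y v w) x v + deriv_in E (\<lambda>y. ?G y v w) x v - deriv_in E (\<lambda>y. ?G y v v) x w) / 2"
      if w: "w \<in> E" for w
      using el[OF w] linear_onD(5)[OF metric_onD(2)[OF G x w] E a] by (simp add: euler_lagrange_def field_simps)
    then show "- a \<in> E \<and> (\<forall>w\<in>E. ?G x (- a) w = (deriv_in E (\<lambda>y. ?G y v w) x v + deriv_in E (\<lambda>y. ?G y v w) x v - deriv_in E (\<lambda>y. ?G y v v) x w) / 2)"
      using a subspace_neg[OF E] by blast
    fix b assume b: "b \<in> E \<and> (\<forall>w\<in>E. ?G x b w = (deriv_in E (\<lambda>y. ?G y v w) x v + deriv_in E (\<lambda>y. ?G y v w) x v - deriv_in E (\<lambda>y. ?G y v v) x w) / 2)"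
    have ab: "a + b \<in> E" using a b subspace_add[OF E] by blast
    have "?G x (a + b) (a + b) = ?G x a (a + b) + ?G x b (a + b)"
      using linear_onD(1)[OF metric_onD(2)[OF G x ab] E a] b by blast
    also have "\<dots> = 0" using el[OF ab] bspec[OF conjunct2[OF b] ab] by (simp add: euler_lagrange_def field_simps)
    finally have "a + b = 0" using metric_onD(4)[OF G x ab] by force
    then show "b = - a" by (simp add: eq_neg_iff_add_eq_0 add.commute)
  qed
  then show ?thesis by simp
qed

text \<open>Being a geodesic is a condition in every chart, whereas \<open>\<beta>\<close> solves
  the weak equation in one. On the open set of times spent in another chart the transition map, an
  isometry of the coordinate metrics, carries the equation over.\<close>

lemma geodesic_from_chart:
  assumes c: "c \<in> atlas M" and J: "open J" "is_interval J"
    and \<beta>: "geodesic_curve E (snd c ` fst c) (metric_coord M g c) J \<beta> \<beta>' \<beta>''" and \<beta>k: "\<And>k. C_k_on k UNIV J \<beta>"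
  shows "geodesic M g J (\<lambda>t. param c (\<beta> t))"
    "\<And>t. t \<in> J \<Longrightarrow> velocity M (\<lambda>t. param c (\<beta> t)) t c = \<beta>' t"
    "\<And>t. t \<in> J \<Longrightarrow> velocity M (\<lambda>t. param c (\<beta> t)) t \<in> tangent_space M (param c (\<beta> t))"
proof -
  let ?\<alpha> = "\<lambda>t. param c (\<beta> t)"
  have \<beta>U: "\<beta> t \<in> snd c ` fst c" and \<beta>'E: "\<beta>' t \<in> E" and \<beta>d: "(\<beta> has_vector_derivative \<beta>' t) (at t)" if "t \<in> J" for t
    using \<beta> that unfolding geodesic_curve_def by blast+
  have J': "rel_open UNIV J" using J by (simp add: rel_open_def subspace_UNIV open_openin[symmetric])
  have cont_\<beta>: "continuous_on J \<beta>" using C_k_on_continuous[OF J' \<beta>k] .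
  have \<alpha>_cont: "continuous_map (top_of_set J) (mtop M) ?\<alpha>"
  proof -
    have "continuous_map (top_of_set J) (top_of_set (snd c ` fst c)) \<beta>"
      using cont_\<beta> \<beta>U by (auto simp: image_subset_iff)
    from continuous_map_compose[OF this param_continuous[OF c]] show ?thesis by (simp add: o_def)
  qed
  have main: "C_k_on k UNIV {t \<in> J. ?\<alpha> t \<in> fst d} (snd d \<circ> ?\<alpha>) \<and>
     (\<forall>t\<in>{t \<in> J. ?\<alpha> t \<in> fst d}. vector_derivative (snd d \<circ> ?\<alpha>) (at t) = deriv_in E (snd d \<circ> param c) (\<beta> t) (\<beta>' t) \<and>
         vector_derivative (\<lambda>s. velocity M ?\<alpha> s d) (at t)
           + christoffel M g d (snd d (?\<alpha> t)) (velocity M ?\<alpha> t d) (velocity M ?\<alpha> t d) = 0)"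
    if d: "d \<in> atlas M" for d k
  proof -
    let ?J = "{t \<in> J. ?\<alpha> t \<in> fst d}" and ?U = "snd c ` (fst c \<inter> fst d)" and ?\<tau> = "snd d \<circ> param c"
    have "openin (top_of_set J) {t \<in> topspace (top_of_set J). ?\<alpha> t \<in> fst d}"
      using openin_continuous_map_preimage[OF \<alpha>_cont chart_open[OF d]] .
    then have Jo: "open ?J" using J by (simp add: openin_open_eq)
    have U: "rel_open E ?U" using overlap_open[OF c d] .
    have UJ: "\<beta> t \<in> ?U" if "t \<in> ?J" for t using that \<beta>U coord_in_iff[OF c] by blast
    have g1: "geodesic_curve E ?U (metric_coord M g c) ?J \<beta> \<beta>' \<beta>''"
      using \<beta> UJ unfolding geodesic_curve_def by blast
    have \<tau>: "smooth_on E ?U ?\<tau>" using transition_k[OF c d] by (simp add: smooth_on_def)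
    have \<tau>U: "?\<tau> ` ?U \<subseteq> snd d ` fst d" using transition_image[OF c, of d] by blast
    \<comment> \<open>The transition in the opposite direction provides a right inverse of the
      derivative.\<close>
    have surj: "deriv_in E ?\<tau> x ` E = E" if x: "x \<in> ?U" for x
    proof -
      let ?p = "param c x"
      have px: "?p \<in> fst c" "?p \<in> fst d" "snd c ?p = x" using x by (auto simp: param_chart[OF c])
      have ch: "c \<in> charts_at M ?p" "d \<in> charts_at M ?p" using px c d by (auto simp: charts_at_def)
      have "deriv_in E ?\<tau> x (deriv_in E (snd c \<circ> param d) (snd d ?p) u) = u" if "u \<in> E" for u
        using change_chart[OF ch(2,1) transition_differentiable[OF ch] that] transition_self[OF ch(2) that] px(3) by simp
      then have "E \<subseteq> deriv_in E ?\<tau> x ` E" using transition_in[OF ch(2,1)] by (metis image_eqI subsetI)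
      moreover have "deriv_in E ?\<tau> x ` E \<subseteq> E" using transition_in[OF ch] px(3) by auto
      ultimately show ?thesis by blast
    qed
    note gi = geodesic_curve_image[OF Jo U chart_rel_open[OF d] metric_coord_metric_on[OF d] \<tau> \<tau>U
       metric_coord_transition[OF c d] surj g1]
    have J2: "rel_open UNIV ?J" using Jo by (simp add: rel_open_def subspace_UNIV open_openin[symmetric])
    have sm: "C_k_on k UNIV ?J (snd d \<circ> ?\<alpha>)"
    proof (rule C_k_on_cong[OF J2])
      show "C_k_on k UNIV ?J (\<lambda>t. ?\<tau> (\<beta> t))"
        by (rule C_k_on_compose[OF J2 U _ C_k_on_subset[OF \<beta>k] transition_k[OF c d]]) (use UJ in auto)
    qed simp
    let ?b1 = "\<lambda>t. deriv_in E ?\<tau> (\<beta> t) (\<beta>' t)"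
    let ?b2 = "\<lambda>t. deriv_in E (\<lambda>q. deriv_in E ?\<tau> q (\<beta>' t)) (\<beta> t) (\<beta>' t) + deriv_in E ?\<tau> (\<beta> t) (\<beta>'' t)"
    have vd: "vector_derivative (snd d \<circ> ?\<alpha>) (at t) = ?b1 t" if "t \<in> ?J" for t
    proof -
      have "((\<lambda>t. ?\<tau> (\<beta> t)) has_vector_derivative ?b1 t) (at t)" using gi that unfolding geodesic_curve_def by blast
      then show ?thesis by (simp add: vector_derivative_at o_def)
    qed
    have vel: "velocity M ?\<alpha> t d = ?b1 t" if "t \<in> ?J" for t
      using vd[OF that] that d by (simp add: velocity_def charts_at_def)
    have "vector_derivative (\<lambda>s. velocity M ?\<alpha> s d) (at t)
           + christoffel M g d (snd d (?\<alpha> t)) (velocity M ?\<alpha> t d) (velocity M ?\<alpha> t d) = 0" if t: "t \<in> ?J" for t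
    proof -
      have b2: "(?b1 has_vector_derivative ?b2 t) (at t)" and b2E: "?b2 t \<in> E" and b1E: "?b1 t \<in> E"
        and x: "?\<tau> (\<beta> t) \<in> snd d ` fst d"
        and el: "\<And>w. w \<in> E \<Longrightarrow> euler_lagrange E (metric_coord M g d) (?\<tau> (\<beta> t)) (?b1 t) (?b2 t) w = 0"
        using gi t unfolding geodesic_curve_def by blast+
      have "((\<lambda>s. velocity M ?\<alpha> s d) has_vector_derivative ?b2 t) (at t)"
        by (rule has_vector_derivative_transform_within_open[OF b2 Jo t]) (use vel in simp)
      then have "vector_derivative (\<lambda>s. velocity M ?\<alpha> s d) (at t) = ?b2 t" by (rule vector_derivative_at)
      moreover have "?b2 t + christoffel M g d (?\<tau> (\<beta> t)) (?b1 t) (?b1 t) = 0"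
        by (rule christoffel_eq[OF d x b1E b2E el])
      ultimately show ?thesis using vel[OF t] by simp
    qed
    then show ?thesis using sm vd by blast
  qed
  show "geodesic M g J ?\<alpha>"
    unfolding geodesic_def smooth_on_def using J \<alpha>_cont main by blast
  fix t assume t: "t \<in> J"
  have tc: "c \<in> charts_at M (?\<alpha> t)" using c param_in[OF \<beta>U[OF t]] by (simp add: charts_at_def)
  have ct: "snd c (?\<alpha> t) = \<beta> t" using chart_param[OF \<beta>U[OF t]] .
  have vel: "velocity M ?\<alpha> t = coord_vec M c (?\<alpha> t) (\<beta>' t)"
  proof
    fix d
    show "velocity M ?\<alpha> t d = coord_vec M c (?\<alpha> t) (\<beta>' t) d"
      using main t ct by (auto simp: velocity_def coord_vec_def charts_at_def)
  qed
  show "velocity M ?\<alpha> t c = \<beta>' t" using vel coord_vec_self[OF tc \<beta>'E[OF t]] by simp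
  show "velocity M ?\<alpha> t \<in> tangent_space M (?\<alpha> t)" using vel coord_vec_in[OF tc \<beta>'E[OF t]] by simp
qed

end

section \<open>Manifolds with a single chart, products and open submanifolds\<close>

lemma second_countable_euclidean: "second_countable (euclidean :: 'e::second_countable_topology topology)"
proof -
  obtain B :: "'e set set" where B: "countable B" "\<And>C. C \<in> B \<Longrightarrow> open C" "\<And>S. open S \<Longrightarrow> \<exists>U. U \<subseteq> B \<and> S = \<Union>U"
    using univ_second_countable by metis
  have "\<exists>V\<in>B. x \<in> V \<and> V \<subseteq> U" if "open U" "x \<in> U" for U x using B(3)[OF that(1)] that(2) by blast
  then show ?thesis unfolding second_countable_def using B by (intro exI[of _ B]) auto
qed

lemma prod_topology_euclidean:
  "prod_topology (euclidean :: 'a::topological_space topology) (euclidean :: 'b::topological_space topology) = euclidean"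
proof (rule topology_eq[THEN iffD2], intro allI)
  fix S :: "('a \<times> 'b) set"
  show "openin (prod_topology euclidean euclidean) S = openin euclidean S"
    unfolding openin_prod_topology_alt open_openin[symmetric] open_prod_def
    by (simp add: Ball_def mem_Times_iff)
qed

lemma prod_top_of_set: "prod_topology (top_of_set A) (top_of_set B) = top_of_set (A \<times> B)"
  using subtopology_Times[of euclidean euclidean A B] prod_topology_euclidean by metis

text \<open>The homeomorphism transports the Hausdorff property and second countability from a
  subspace of a Euclidean space, and the only transition map is the identity on
  \<open>V\<close>.\<close>

lemma single_chart_manifold:
  fixes X :: "'a topology" and \<phi> :: "'a \<Rightarrow> 'e::euclidean_space"
  assumes V: "rel_open E V" and hom: "homeomorphic_map X (top_of_set V) \<phi>"
    and mt: "mtop M = X" "model M = E" "atlas M = {(topspace X, \<phi>)}"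
  shows "smooth_manifold M"
proof -
  have hs: "X homeomorphic_space top_of_set V" using homeomorphic_map_imp_homeomorphic_space[OF hom] .
  have img: "\<phi> ` topspace X = V" using homeomorphic_imp_surjective_map[OF hom] by simp
  have "Hausdorff_space (top_of_set V)" by (simp add: Hausdorff_space_subtopology)
  then have H: "Hausdorff_space X" using homeomorphic_Hausdorff_space[OF hs] by simp
  have "second_countable (top_of_set V)" using second_countable_subtopology[OF second_countable_euclidean] .
  then have S: "second_countable X" using homeomorphic_space_second_countability[OF hs] by simp
  have inj: "inj_on \<phi> (topspace X)" using homeomorphic_imp_injective_map[OF hom] .
  have "smooth_on E V (\<phi> \<circ> param (topspace X, \<phi>))"
    unfolding smooth_on_def
  proof
    show "C_k_on k E V (\<phi> \<circ> param (topspace X, \<phi>))" for k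
      by (rule C_k_on_cong[OF V _ C_k_on_id[OF V]]) (use img in \<open>auto simp: param_def f_inv_into_f\<close>)
  qed
  then show ?thesis unfolding smooth_manifold_def mt
    using H S V hom img rel_open_subspace[OF V] by (auto simp: rel_open_def)
qed

text \<open>Used to make a coordinate slice of \<open>M\<close> into a manifold of its own: its
  points remain points of the ambient type, while topology and smooth structure are carried over
  from \<open>V\<close>.\<close>

definition chart_manifold :: "'e::euclidean_space set \<Rightarrow> 'e set \<Rightarrow> ('e \<Rightarrow> 'a) \<Rightarrow> ('a, 'e) manifold" where
  "chart_manifold E V \<iota> =
     \<lparr>mtop = pullback_topology (\<iota> ` V) (inv_into V \<iota>) (top_of_set V), model = E, atlas = {(\<iota> ` V, inv_into V \<iota>)}\<rparr>"

lemma chart_manifold_simps [simp]: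
  "model (chart_manifold E V \<iota>) = E" "atlas (chart_manifold E V \<iota>) = {(\<iota> ` V, inv_into V \<iota>)}"
  by (auto simp: chart_manifold_def)

lemma points_chart_manifold [simp]: "points (chart_manifold E V \<iota>) = \<iota> ` V"
  by (auto simp: chart_manifold_def topspace_pullback_topology inv_into_into)

lemma charts_at_chart_manifold [simp]:
  "charts_at (chart_manifold E V \<iota>) q = (if q \<in> \<iota> ` V then {(\<iota> ` V, inv_into V \<iota>)} else {})"
  by (auto simp: charts_at_def)

lemma continuous_map_inv_chart:
  "continuous_map (mtop (chart_manifold E V \<iota>)) (top_of_set V) (inv_into V \<iota>)"
  using continuous_map_pullback[OF continuous_map_id, of "\<iota> ` V" "inv_into V \<iota>" "top_of_set V"]
  by (simp add: chart_manifold_def)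

lemma continuous_map_into_chart:
  assumes "continuous_map X (top_of_set V) f" and inj: "inj_on \<iota> V"
  shows "continuous_map X (mtop (chart_manifold E V \<iota>)) (\<lambda>x. \<iota> (f x))"
proof -
  have fV: "f x \<in> V" if "x \<in> topspace X" for x using assms(1) that by (auto simp: continuous_map_def)
  show ?thesis
    unfolding chart_manifold_def manifold.simps
  proof (rule continuous_map_pullback')
    show "continuous_map X (top_of_set V) (inv_into V \<iota> \<circ> (\<lambda>x. \<iota> (f x)))"
      by (rule continuous_map_eq[OF assms(1)]) (use fV inj in simp)
    show "topspace X \<subseteq> (\<lambda>x. \<iota> (f x)) -` \<iota> ` V" using fV by auto
  qed
qed

lemma chart_manifold_homeo:
  assumes inj: "inj_on \<iota> V"
  shows "homeomorphic_maps (mtop (chart_manifold E V \<iota>)) (top_of_set V) (inv_into V \<iota>) \<iota>"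
  unfolding homeomorphic_maps_def
  using continuous_map_inv_chart continuous_map_into_chart[OF continuous_map_id inj] inj
  by (auto simp: f_inv_into_f)

lemma smooth_chart_manifold:
  assumes V: "rel_open E V" and inj: "inj_on \<iota> V"
  shows "smooth_manifold (chart_manifold E V \<iota>)"
proof (rule single_chart_manifold[OF V])
  show "homeomorphic_map (mtop (chart_manifold E V \<iota>)) (top_of_set V) (inv_into V \<iota>)"
    using chart_manifold_homeo[OF inj] homeomorphic_map_maps by blast
qed auto

lemma param_chart_manifold: "inj_on \<iota> V \<Longrightarrow> x \<in> V \<Longrightarrow> param (\<iota> ` V, inv_into V \<iota>) x = \<iota> x"
proof -
  assume inj: "inj_on \<iota> V" and x: "x \<in> V"
  have "inj_on (inv_into V \<iota>) (\<iota> ` V)" by (rule inj_on_inv_into) simp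
  then have "inv_into (\<iota> ` V) (inv_into V \<iota>) (inv_into V \<iota> (\<iota> x)) = \<iota> x" using x by (intro inv_into_f_f) auto
  then show ?thesis using inj x by (simp add: param_def)
qed

lemma inv_image_chart: "inj_on \<iota> V \<Longrightarrow> inv_into V \<iota> ` \<iota> ` V = V"
  by (auto simp: image_iff)

text \<open>With a single chart a tangent vector is determined by one coordinate vector, at which
  the bilinear form \<open>\<Gamma>\<close> is evaluated.\<close>

definition chart_metric :: "('e \<Rightarrow> 'e \<Rightarrow> 'e \<Rightarrow> real) \<Rightarrow> 'e::euclidean_space set \<Rightarrow> ('e \<Rightarrow> 'a) \<Rightarrow> ('a, 'e) metric_field" where
  "chart_metric \<Gamma> V \<iota> q v w = \<Gamma> (inv_into V \<iota> q) (v (\<iota> ` V, inv_into V \<iota>)) (w (\<iota> ` V, inv_into V \<iota>))"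

lemma riemannian_chart_manifold:
  assumes V: "rel_open E V" and inj: "inj_on \<iota> V" and \<Gamma>: "metric_on E V \<Gamma>"
  shows "riemannian_manifold (chart_manifold E V \<iota>) (chart_metric \<Gamma> V \<iota>)"
proof -
  let ?M = "chart_manifold E V \<iota>" and ?c = "(\<iota> ` V, inv_into V \<iota>)"
  interpret manifold ?M by standard (rule smooth_chart_manifold[OF V inj])
  have E: "subspace E" using V rel_open_subspace by auto
  show ?thesis unfolding riemannian_manifold_def
  proof (intro conjI ballI allI impI)
    show "smooth_manifold ?M" by (rule smooth_chart_manifold[OF V inj])
    fix p assume "p \<in> points ?M"
    then have p: "p \<in> \<iota> ` V" by simp
    have ch: "?c \<in> charts_at ?M p" using p by simp
    have x: "inv_into V \<iota> p \<in> V" using p by (rule inv_into_into)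
    have tan: "v ?c \<in> E" if "v \<in> tangent_space ?M p" for v using tangent_in[OF ch that] by simp
    show "chart_metric \<Gamma> V \<iota> p (\<lambda>c. a *\<^sub>R u c + b *\<^sub>R v c) w = a * chart_metric \<Gamma> V \<iota> p u w + b * chart_metric \<Gamma> V \<iota> p v w"
      if "u \<in> tangent_space ?M p" "v \<in> tangent_space ?M p" "w \<in> tangent_space ?M p" for u v w a b
      using metric_onD(2)[OF \<Gamma> x tan[OF that(3)]] tan[OF that(1)] tan[OF that(2)] unfolding linear_on_def chart_metric_def by simp
    show "chart_metric \<Gamma> V \<iota> p u v = chart_metric \<Gamma> V \<iota> p v u" if "u \<in> tangent_space ?M p" "v \<in> tangent_space ?M p" for u v
      using metric_onD(3)[OF \<Gamma> x tan[OF that(1)] tan[OF that(2)]] by (simp add: chart_metric_def)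
    show "chart_metric \<Gamma> V \<iota> p v v > 0" if "v \<in> tangent_space ?M p" "v \<noteq> (\<lambda>_. 0)" for v
    proof -
      have "v ?c \<noteq> 0"
      proof
        assume "v ?c = 0"
        then have "v d = 0" for d using tangent_zero[OF that(1), of d] p by (cases "d = ?c") auto
        then show False using that(2) by auto
      qed
      then show ?thesis using metric_onD(4)[OF \<Gamma> x tan[OF that(1)]] by (simp add: chart_metric_def)
    qed
  next
    fix c u w assume c: "c \<in> atlas ?M" and uw: "u \<in> model ?M" "w \<in> model ?M"
    have c: "c = ?c" using c by simp
    have Vc: "snd c ` fst c = V" using inv_image_chart[OF inj] c by simp
    have "metric_coord ?M (chart_metric \<Gamma> V \<iota>) c x u w = \<Gamma> x u w" if x: "x \<in> V" for x
    proof -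
      have px: "param ?c x = \<iota> x" using param_chart_manifold[OF inj x] .
      have ch: "?c \<in> charts_at ?M (\<iota> x)" using x by simp
      show ?thesis
        unfolding metric_coord_def chart_metric_def c px using coord_vec_self[OF ch] uw inj x by simp
    qed
    then show "smooth_on (model ?M) (snd c ` fst c) (\<lambda>x. metric_coord ?M (chart_metric \<Gamma> V \<iota>) c x u w)"
      unfolding Vc smooth_on_def chart_manifold_simps using C_k_on_cong[OF V _ metric_onD(1)[OF \<Gamma>]] uw by auto
  qed
qed

lemma smooth_fun_chart_manifold:
  assumes V: "rel_open E V" and inj: "inj_on \<iota> V" and f: "\<And>k. C_k_on k E V (\<lambda>x. f (\<iota> x))"
  shows "smooth_fun (chart_manifold E V \<iota>) f"
  unfolding smooth_fun_def smooth_on_def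
  using C_k_on_cong[OF V _ f] inv_image_chart[OF inj] param_chart_manifold[OF inj] by auto

section \<open>Products of manifolds with a single chart\<close>

locale chart_product =
  fixes E1 V1 :: "'e::euclidean_space set" and \<iota>1 :: "'e \<Rightarrow> 'a" and E2 V2 :: "'f::euclidean_space set" and \<iota>2 :: "'f \<Rightarrow> 'b"
  assumes V1: "rel_open E1 V1" and V2: "rel_open E2 V2" and inj1: "inj_on \<iota>1 V1" and inj2: "inj_on \<iota>2 V2"
begin

abbreviation "M1 \<equiv> chart_manifold E1 V1 \<iota>1"
abbreviation "M2 \<equiv> chart_manifold E2 V2 \<iota>2"
abbreviation "c1 \<equiv> (\<iota>1 ` V1, inv_into V1 \<iota>1)"
abbreviation "c2 \<equiv> (\<iota>2 ` V2, inv_into V2 \<iota>2)"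
abbreviation "P \<equiv> product_manifold M1 M2"
definition "c12 = (\<iota>1 ` V1 \<times> \<iota>2 ` V2, map_prod (inv_into V1 \<iota>1) (inv_into V2 \<iota>2))"

lemma P_simps [simp]: "model P = E1 \<times> E2" "atlas P = {c12}" "points P = \<iota>1 ` V1 \<times> \<iota>2 ` V2"
  "mtop P = prod_topology (mtop M1) (mtop M2)"
  by (auto simp: product_manifold_def c12_def)

lemma V12: "rel_open (E1 \<times> E2) (V1 \<times> V2)" using rel_open_Times[OF V1 V2] .

lemma charts_at_P [simp]: "charts_at P z = (if z \<in> \<iota>1 ` V1 \<times> \<iota>2 ` V2 then {c12} else {})"
  by (auto simp: charts_at_def c12_def)

lemma P_homeo: "homeomorphic_maps (mtop P) (top_of_set (V1 \<times> V2)) (map_prod (inv_into V1 \<iota>1) (inv_into V2 \<iota>2)) (map_prod \<iota>1 \<iota>2)"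
  using homeomorphic_maps_prod[THEN iffD2, OF disjI2, OF conjI, OF chart_manifold_homeo[OF inj1] chart_manifold_homeo[OF inj2], of E1 E2]
  by (simp add: prod_top_of_set map_prod_def)

lemma P_manifold: "smooth_manifold P"
proof (rule single_chart_manifold[OF V12])
  show "homeomorphic_map (mtop P) (top_of_set (V1 \<times> V2)) (map_prod (inv_into V1 \<iota>1) (inv_into V2 \<iota>2))"
    using P_homeo homeomorphic_map_maps by blast
qed (auto simp: c12_def)

lemma param_c12:
  assumes "x \<in> V1" "y \<in> V2"
  shows "param c12 (x, y) = (\<iota>1 x, \<iota>2 y)"
proof -
  interpret P: manifold P by standard (rule P_manifold)
  have "(\<iota>1 x, \<iota>2 y) \<in> fst c12" "snd c12 (\<iota>1 x, \<iota>2 y) = (x, y)" using assms inj1 inj2 by (auto simp: c12_def)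
  then show ?thesis using P.param_chart[of c12 "(\<iota>1 x, \<iota>2 y)"] by simp
qed

text \<open>In the product chart the projection is the linear map \<open>fst\<close>, which is its
  own derivative.\<close>

lemma differential_fst:
  assumes z: "z \<in> points P" and w: "w c12 \<in> E1 \<times> E2"
  shows "differential P M1 fst z w c1 = fst (w c12)"
proof -
  obtain x y where xy: "x \<in> V1" "y \<in> V2" "z = (\<iota>1 x, \<iota>2 y)" using z by auto
  have ch: "charts_at P z = {c12}" "c1 \<in> charts_at M1 (fst z)" using xy by auto
  have sx: "snd c12 z = (x, y)" using xy inj1 inj2 by (simp add: c12_def)
  have xyV: "(x, y) \<in> V1 \<times> V2" using xy by simp
  have "((snd c1 \<circ> fst \<circ> param c12) has_derivative fst) (at (x, y) within E1 \<times> E2)"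
  proof (rule has_derivative_cong_rel[OF V12 xyV _ bounded_linear_imp_has_derivative[OF bounded_linear_fst]])
    show "fst q = (snd c1 \<circ> fst \<circ> param c12) q" if "q \<in> V1 \<times> V2" for q
      using that param_c12 inj1 by auto
  qed
  from deriv_in_eq[OF rel_open_subspace[OF V12] subsetD[OF rel_open_subset[OF V12] xyV] this w] show ?thesis
    using ch sx by (simp add: differential_def)
qed

lemma differential_snd:
  assumes z: "z \<in> points P" and w: "w c12 \<in> E1 \<times> E2"
  shows "differential P M2 snd z w c2 = snd (w c12)"
proof -
  obtain x y where xy: "x \<in> V1" "y \<in> V2" "z = (\<iota>1 x, \<iota>2 y)" using z by auto
  have ch: "charts_at P z = {c12}" "c2 \<in> charts_at M2 (snd z)" using xy by auto
  have sx: "snd c12 z = (x, y)" using xy inj1 inj2 by (simp add: c12_def)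
  have xyV: "(x, y) \<in> V1 \<times> V2" using xy by simp
  have "((snd c2 \<circ> snd \<circ> param c12) has_derivative snd) (at (x, y) within E1 \<times> E2)"
  proof (rule has_derivative_cong_rel[OF V12 xyV _ bounded_linear_imp_has_derivative[OF bounded_linear_snd]])
    show "snd q = (snd c2 \<circ> snd \<circ> param c12) q" if "q \<in> V1 \<times> V2" for q
      using that param_c12 inj2 by auto
  qed
  from deriv_in_eq[OF rel_open_subspace[OF V12] subsetD[OF rel_open_subset[OF V12] xyV] this w] show ?thesis
    using ch sx by (simp add: differential_def)
qed

end

section \<open>Open submanifolds\<close>

context manifold
begin

text \<open>Shrinking the domain of a chart changes the inverse taken by \<open>inv_into\<close>,
  but by injectivity not its values on the smaller image. Smoothness in restricted charts is thus
  inherited by congruence.\<close>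

lemma restrict_param:
  assumes "c \<in> atlas M" "y \<in> snd c ` (fst c \<inter> W)"
  shows "param (fst c \<inter> W, snd c) y = param c y"
proof -
  obtain q where q: "q \<in> fst c" "q \<in> W" "y = snd c q" using assms by blast
  have "inj_on (snd c) (fst c \<inter> W)" using chart_inj[OF assms(1)] by (rule inj_on_subset) auto
  then have "inv_into (fst c \<inter> W) (snd c) y = q" using q by simp
  then show ?thesis using q param_chart[OF assms(1)] by (simp add: param_def)
qed

lemma atlas_open_submanifold: "atlas (open_submanifold M W) = (\<lambda>c. (fst c \<inter> W, snd c)) ` atlas M"
  by (auto simp: open_submanifold_def case_prod_beta)

lemma open_submanifold_simps [simp]:
  "model (open_submanifold M W) = E" "mtop (open_submanifold M W) = subtopology (mtop M) W"
  by (auto simp: open_submanifold_def)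

lemma smooth_open_submanifold:
  assumes W: "openin (mtop M) W"
  shows "smooth_manifold (open_submanifold M W)"
proof -
  have WM: "W \<subseteq> points M" using openin_subset[OF W] .
  have cover: "(\<Union>c\<in>atlas (open_submanifold M W). fst c) = points M \<inter> W"
    using M unfolding smooth_manifold_def atlas_open_submanifold by auto
  have chart: "openin (subtopology (mtop M) W) (fst c \<inter> W) \<and> openin (top_of_set E) (snd c ` (fst c \<inter> W)) \<and>
     homeomorphic_map (subtopology (subtopology (mtop M) W) (fst c \<inter> W)) (top_of_set (snd c ` (fst c \<inter> W))) (snd c)"
    if c: "c \<in> atlas M" for c
  proof (intro conjI)
    show "openin (subtopology (mtop M) W) (fst c \<inter> W)" using chart_open[OF c] by (auto simp: openin_subtopology)
    show "openin (top_of_set E) (snd c ` (fst c \<inter> W))" using chart_image_rel_open[OF c W] by (simp add: rel_open_def)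
    have "homeomorphic_map (subtopology (subtopology (mtop M) (fst c)) W) (subtopology (top_of_set (snd c ` fst c)) (snd c ` (fst c \<inter> W))) (snd c)"
      by (rule homeomorphic_map_subtopologies[OF chart_homeo[OF c]]) (simp only: topspace_chart[OF c], auto)
    moreover have "subtopology (subtopology (mtop M) (fst c)) W = subtopology (subtopology (mtop M) W) (fst c \<inter> W)"
      by (simp add: subtopology_subtopology Int_ac)
    moreover have "subtopology (top_of_set (snd c ` fst c)) (snd c ` (fst c \<inter> W)) = top_of_set (snd c ` (fst c \<inter> W))"
    proof -
      have "snd c ` fst c \<inter> snd c ` (fst c \<inter> W) = snd c ` (fst c \<inter> W)" by auto
      then show ?thesis by (simp add: subtopology_subtopology)
    qed
    ultimately show "homeomorphic_map (subtopology (subtopology (mtop M) W) (fst c \<inter> W)) (top_of_set (snd c ` (fst c \<inter> W))) (snd c)"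
      by simp
  qed
  have trans: "smooth_on E (snd c ` (fst c \<inter> W \<inter> (fst d \<inter> W))) (snd d \<circ> param (fst c \<inter> W, snd c))"
    if c: "c \<in> atlas M" and d: "d \<in> atlas M" for c d
    unfolding smooth_on_def
  proof
    fix k
    have eq: "fst c \<inter> W \<inter> (fst d \<inter> W) = fst c \<inter> (fst d \<inter> W)" by auto
    have U: "rel_open E (snd c ` (fst c \<inter> (fst d \<inter> W)))"
      by (rule chart_image_rel_open[OF c openin_Int[OF chart_open[OF d] W]])
    show "C_k_on k E (snd c ` (fst c \<inter> W \<inter> (fst d \<inter> W))) (snd d \<circ> param (fst c \<inter> W, snd c))"
      unfolding eq
    proof (rule C_k_on_cong[OF U])
      show "C_k_on k E (snd c ` (fst c \<inter> (fst d \<inter> W))) (snd d \<circ> param c)"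
        by (rule C_k_on_subset[OF transition_k[OF c d]]) auto
      show "(snd d \<circ> param c) y = (snd d \<circ> param (fst c \<inter> W, snd c)) y" if "y \<in> snd c ` (fst c \<inter> (fst d \<inter> W))" for y
        using restrict_param[OF c, of y W] that by auto
    qed
  qed
  show ?thesis
    unfolding smooth_manifold_def
    using cover chart trans M
    by (auto simp: atlas_open_submanifold smooth_manifold_def Hausdorff_space_subtopology second_countable_subtopology)
qed

lemma smooth_inclusion:
  assumes W: "openin (mtop M) W"
  shows "smooth_map (open_submanifold M W) M (\<lambda>p. p)"
proof -
  have "C_k_on k E (snd c ` (fst c \<inter> W \<inter> (\<lambda>p. p) -` fst d)) (snd d \<circ> (\<lambda>p. p) \<circ> param (fst c \<inter> W, snd c))"
    if c: "c \<in> atlas M" and d: "d \<in> atlas M" for c d k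
  proof -
    have eq: "fst c \<inter> W \<inter> (\<lambda>p. p) -` fst d = fst c \<inter> (fst d \<inter> W)" by auto
    have U: "rel_open E (snd c ` (fst c \<inter> (fst d \<inter> W)))"
      by (rule chart_image_rel_open[OF c openin_Int[OF chart_open[OF d] W]])
    show ?thesis unfolding eq
    proof (rule C_k_on_cong[OF U])
      show "C_k_on k E (snd c ` (fst c \<inter> (fst d \<inter> W))) (snd d \<circ> param c)"
        by (rule C_k_on_subset[OF transition_k[OF c d]]) auto
      show "(snd d \<circ> param c) y = (snd d \<circ> (\<lambda>p. p) \<circ> param (fst c \<inter> W, snd c)) y" if "y \<in> snd c ` (fst c \<inter> (fst d \<inter> W))" for y
        using restrict_param[OF c, of y W] that by auto
    qed
  qed
  moreover have "continuous_map (subtopology (mtop M) W) (mtop M) (\<lambda>p. p)"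
    using continuous_map_from_subtopology[OF continuous_map_id, of "mtop M" W] by (simp add: id_def)
  ultimately show ?thesis unfolding smooth_map_def smooth_on_def by (auto simp: atlas_open_submanifold)
qed

end

lemma metric_on_subspace:
  assumes G: "metric_on E U G" and U: "rel_open E U" and V: "rel_open E' V" and sub: "E' \<subseteq> E" "V \<subseteq> U"
  shows "metric_on E' V G"
  unfolding metric_on_def smooth_on_def
proof (intro conjI ballI allI impI)
  show "C_k_on k E' V (\<lambda>u. G u v w)" if "v \<in> E'" "w \<in> E'" for v w k
    by (rule C_k_on_compose[OF V U _ C_k_on_id[OF V] metric_onD(1)[OF G]]) (use that sub in auto)
  fix u assume u: "u \<in> V"
  then have u': "u \<in> U" using sub by auto
  show "linear_on E' (\<lambda>v. G u v w)" if "w \<in> E'" for w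
    using metric_onD(2)[OF G u', of w] that sub unfolding linear_on_def by blast
  show "G u v w = G u w v" if "v \<in> E'" "w \<in> E'" for v w using metric_onD(3)[OF G u'] that sub by blast
  show "0 < G u v v" if "v \<in> E'" "v \<noteq> 0" for v using metric_onD(4)[OF G u'] that sub by blast
qed

lemma metric_on_divide:
  assumes G: "metric_on E U G" and U: "rel_open E U" and c: "c > 0"
  shows "metric_on E U (\<lambda>u v w. G u v w / c)"
  unfolding metric_on_def smooth_on_def
proof (intro conjI ballI allI impI)
  show "C_k_on k E U (\<lambda>u. G u v w / c)" if "v \<in> E" "w \<in> E" for v w k
    by (rule C_k_on_bounded_linear_comp[OF U bounded_linear_divide metric_onD(1)[OF G that]])
  fix u assume u: "u \<in> U"
  show "linear_on E (\<lambda>v. G u v w / c)" if "w \<in> E" for w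
    using metric_onD(2)[OF G u that] unfolding linear_on_def by (simp add: add_divide_distrib)
  show "G u v w / c = G u w v / c" if "v \<in> E" "w \<in> E" for v w using metric_onD(3)[OF G u that] by simp
  show "0 < G u v v / c" if "v \<in> E" "v \<noteq> 0" for v using metric_onD(4)[OF G u that] c by simp
qed

section \<open>The local structure theorem\<close>

text \<open>\<open>E1\<close> is the orthogonal complement of the kernel of \<open>L\<close> in
  \<open>E\<close>, and \<open>T\<close> inverts \<open>L\<close> on it. Composing target
  coordinates with \<open>T\<close> moves them into \<open>E1\<close> and makes the derivative at
  the chosen point an orthogonal projection, the normal form from which the straightening
  starts.\<close>

lemma submersion_splitting:
  fixes L :: "'e::euclidean_space \<Rightarrow> 'f::euclidean_space"
  assumes E: "subspace E" and L: "linear L" and img: "L ` E = H"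
  obtains E1 T where "subspace E1" "E1 \<subseteq> E" "bounded_linear T" "T ` H = E1" "\<And>y. y \<in> H \<Longrightarrow> L (T y) = y"
    "\<And>v. v \<in> E \<Longrightarrow> T (L v) = proj E1 v" "dim E1 = dim H" "dim {v \<in> E. proj E1 v = 0} = dim E - dim H"
proof -
  have H: "subspace H" using linear_subspace_image[OF L E] img by simp
  define K where "K = {v \<in> E. L v = 0}"
  have K: "subspace K" unfolding K_def
    using E by (auto intro!: subspaceI simp: subspace_0 subspace_add subspace_scale linear_0[OF L] linear_add[OF L] linear_cmul[OF L])
  define E1 where "E1 = {v \<in> E. \<forall>w\<in>K. orthogonal w v}"
  have E1: "subspace E1" unfolding E1_def
    using E by (auto intro!: subspaceI simp: subspace_0 subspace_add subspace_scale orthogonal_clauses)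
  have E1E: "E1 \<subseteq> E" by (auto simp: E1_def)
  have inj: "v = w" if "v \<in> E1" "w \<in> E1" "L v = L w" for v w
  proof -
    have vw: "v - w \<in> E1" using subspace_diff[OF E1 that(1,2)] .
    then have "v - w \<in> K" using E1E that(3) by (auto simp: K_def linear_diff[OF L])
    then have "orthogonal (v - w) (v - w)" using vw by (auto simp: E1_def)
    then show ?thesis by (simp add: orthogonal_def)
  qed
  have split: "v - proj K v \<in> E1" "L (v - proj K v) = L v" if v: "v \<in> E" for v
  proof -
    have pK: "proj K v \<in> K" using proj_in[OF K] .
    then have "v - proj K v \<in> E" using v E by (auto simp: K_def intro: subspace_diff)
    moreover have "orthogonal w (v - proj K v)" if "w \<in> K" for w
      using proj_inner[OF K that, of v] by (simp add: orthogonal_def inner_diff_right inner_commute)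
    ultimately show "v - proj K v \<in> E1" by (auto simp: E1_def)
    show "L (v - proj K v) = L v" using pK by (simp add: K_def linear_diff[OF L])
  qed
  have imgE1: "L ` E1 = H"
  proof
    show "L ` E1 \<subseteq> H" using E1E img by blast
    show "H \<subseteq> L ` E1" using split img by (metis (no_types, lifting) image_iff subsetI)
  qed
  define T where "T y = (\<Sum>b\<in>onb H. (y \<bullet> b) *\<^sub>R inv_into E1 L b)" for y
  have bT: "bounded_linear T" unfolding T_def by (intro bounded_linear_intros)
  have T_in: "T y \<in> E1" for y
    unfolding T_def using inv_into_into[of _ L E1] imgE1 onb(1)[OF H] by (intro subspace_sum[OF E1] subspace_scale[OF E1]) blast
  have LT: "L (T y) = y" if y: "y \<in> H" for y
  proof -
    have "L (T y) = (\<Sum>b\<in>onb H. (y \<bullet> b) *\<^sub>R L (inv_into E1 L b))" by (simp add: T_def linear_sum[OF L] linear_cmul[OF L])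
    also have "\<dots> = (\<Sum>b\<in>onb H. (y \<bullet> b) *\<^sub>R b)"
      using f_inv_into_f[of _ L E1] imgE1 onb(1)[OF H] by (intro sum.cong) auto
    finally show ?thesis using onb_expand[OF H y] by simp
  qed
  have TL: "T (L v) = proj E1 v" if v: "v \<in> E" for v
  proof -
    have "L v \<in> H" using img v by blast
    then have 1: "T (L v) = v - proj K v" using inj[OF T_in split(1)[OF v]] LT split(2)[OF v] by simp
    have pK: "proj K v \<in> K" using proj_in[OF K] .
    have "proj E1 (proj K v) = 0"
      unfolding proj_def[of E1] using pK onb(1)[OF E1] by (intro sum.neutral) (auto simp: E1_def orthogonal_def)
    moreover have "proj E1 v = proj E1 (v - proj K v) + proj E1 (proj K v)"
      by (simp add: linear_diff[OF linear_proj])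
    ultimately show ?thesis using 1 proj_id[OF E1 split(1)[OF v]] by simp
  qed
  have TH: "T ` H = E1"
  proof
    show "T ` H \<subseteq> E1" using T_in by blast
    show "E1 \<subseteq> T ` H"
    proof
      fix v assume v: "v \<in> E1"
      have "T (L v) = v" using TL[of v] proj_id[OF E1 v] v E1E by auto
      moreover have "L v \<in> H" using v imgE1 by blast
      ultimately show "v \<in> T ` H" by (metis image_eqI)
    qed
  qed
  have "inj_on L (span E1)" using inj span_eq_iff[THEN iffD2, OF E1] by (metis inj_onI)
  then have dE1: "dim E1 = dim H" using dim_image_eq[OF L, of E1] imgE1 by simp
  have ker: "{v \<in> E. proj E1 v = 0} = K"
  proof -
    have "proj E1 v = 0 \<longleftrightarrow> L v = 0" if v: "v \<in> E" for v
    proof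
      assume "proj E1 v = 0"
      then have "L (T (L v)) = 0" using TL[OF v] linear_0[OF L] by simp
      then show "L v = 0" using LT[of "L v"] img v by auto
    next
      assume "L v = 0"
      then show "proj E1 v = 0" using TL[OF v] linear_0[OF bounded_linear.linear[OF bT]] by simp
    qed
    then show ?thesis by (auto simp: K_def)
  qed
  have "dim E1 + dim K = dim E" unfolding E1_def
    by (rule dim_subspace_orthogonal_to_vectors[OF K E]) (auto simp: K_def)
  then have "dim {v \<in> E. proj E1 v = 0} = dim E - dim H" using ker dE1 by simp
  then show ?thesis using that[OF E1 E1E bT TH LT TL dE1] by blast
qed

section \<open>A submersion in a pair of charts\<close>

locale submersion_patch =
  fixes M :: "('a, 'e::euclidean_space) manifold" and g :: "('a, 'e) metric_field"
    and B :: "('b, 'f::euclidean_space) manifold" and F :: "'a \<Rightarrow> 'b"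
    and c :: "('a, 'e) chart" and d :: "('b, 'f) chart"
  assumes riem: "riemannian_manifold M g" and B_mfd: "smooth_manifold B" and sub: "submersion M B F"
    and c: "c \<in> atlas M" and d: "d \<in> atlas B"
begin

sublocale M: riemannian M g
  using riem by unfold_locales (auto simp: riemannian_manifold_def)

sublocale F: manifold_map M B F
  using riem B_mfd sub by unfold_locales (auto simp: riemannian_manifold_def submersion_def)

abbreviation "E \<equiv> model M"
definition "U = snd c ` (fst c \<inter> F -` fst d)"
definition "G = metric_coord M g c"
definition "R = snd d \<circ> F \<circ> param c"

lemma B_E: "subspace (model B)" using F.N.E .

lemma U_sub: "U \<subseteq> snd c ` fst c" by (auto simp: U_def)

lemma U_open: "rel_open E U"
  unfolding U_def by (rule F.rep_domain_open[OF c F.N.chart_open[OF d]])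

lemma U_in_iff: "x \<in> U \<longleftrightarrow> x \<in> snd c ` fst c \<and> F (param c x) \<in> fst d"
  unfolding U_def by (subst M.coord_in_iff[OF c]) auto

lemma G_metric: "metric_on E U G"
  unfolding G_def by (rule metric_on_subset[OF M.metric_coord_metric_on[OF c] U_sub])

lemma R_k: "C_k_on k E U R"
  unfolding R_def U_def by (rule F.rep_k[OF c d])

lemma R_in: "R ` U \<subseteq> model B"
  using F.rep_image[OF c, of d "fst d"] rel_open_subset[OF F.N.chart_rel_open[OF d]] unfolding R_def U_def by blast

lemma patch_charts:
  assumes "x \<in> U"
  shows "c \<in> charts_at M (param c x)" "d \<in> charts_at B (F (param c x))" "snd c (param c x) = x" "param c x \<in> points M"
proof -
  have x: "x \<in> snd c ` fst c" "F (param c x) \<in> fst d" using assms U_in_iff by auto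
  show c': "c \<in> charts_at M (param c x)" using c M.param_in[OF x(1)] by (simp add: charts_at_def)
  show "d \<in> charts_at B (F (param c x))" using d x by (simp add: charts_at_def)
  show "snd c (param c x) = x" using M.chart_param[OF x(1)] .
  show "param c x \<in> points M" using M.charts_at_point[OF c'] .
qed

lemma DR_linear: "x \<in> U \<Longrightarrow> linear (deriv_in E R x)"
  by (rule linear_deriv_in) (use R_k[of "Suc 0"] in auto)

lemma DR_surj:
  assumes x: "x \<in> U"
  shows "deriv_in E R x ` E = model B"
proof -
  note ch = patch_charts[OF x]
  have 1: "differential M B F (param c x) v d = deriv_in E R x (v c)" if "v \<in> tangent_space M (param c x)" for v
    using F.differential_chart[OF ch(1,2) that] ch(3) by (simp add: R_def)
  have 2: "differential M B F (param c x) ` tangent_space M (param c x) = tangent_space B (F (param c x))"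
    using sub ch(4) by (simp add: submersion_def)
  show ?thesis
  proof (intro equalityI subsetI)
    fix y assume "y \<in> deriv_in E R x ` E"
    then show "y \<in> model B" using F.rep_deriv_in[OF ch(1,2)] ch(3) by (auto simp: R_def)
  next
    fix y assume y: "y \<in> model B"
    have "coord_vec B d (F (param c x)) y \<in> tangent_space B (F (param c x))" using F.N.coord_vec_in[OF ch(2) y] .
    then obtain v where v: "v \<in> tangent_space M (param c x)" "coord_vec B d (F (param c x)) y = differential M B F (param c x) v"
      using 2 by (metis imageE)
    have "y = deriv_in E R x (v c)" using F.N.coord_vec_self[OF ch(2) y] v(2) 1[OF v(1)] by simp
    then show "y \<in> deriv_in E R x ` E" using M.tangent_in[OF ch(1) v(1)] by blast
  qed
qed

lemma vertical_iff:
  assumes x: "x \<in> U" and v: "v \<in> tangent_space M (param c x)"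
  shows "v \<in> vertical_space M B F (param c x) \<longleftrightarrow> deriv_in E R x (v c) = 0"
  using F.differential_zero_iff[OF patch_charts(1,2)[OF x] v] v patch_charts(3)[OF x]
  by (simp add: vertical_space_def R_def)

lemma horizontal_iff:
  assumes x: "x \<in> U" and v: "v \<in> tangent_space M (param c x)"
  shows "v \<in> horizontal_space M g B F (param c x) \<longleftrightarrow> (\<forall>w\<in>E. deriv_in E R x w = 0 \<longrightarrow> G x (v c) w = 0)"
proof -
  note ch = patch_charts[OF x]
  have gG: "g (param c x) v w = G x (v c) (w c)" if "w \<in> tangent_space M (param c x)" for w
    using M.g_coord[OF ch(1) v that] ch(3) by (simp add: G_def)
  show ?thesis
  proof
    assume hv: "v \<in> horizontal_space M g B F (param c x)"
    show "\<forall>w\<in>E. deriv_in E R x w = 0 \<longrightarrow> G x (v c) w = 0"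
    proof (intro ballI impI)
      fix w assume w: "w \<in> E" "deriv_in E R x w = 0"
      let ?w = "coord_vec M c (param c x) w"
      have t: "?w \<in> tangent_space M (param c x)" "?w c = w" using M.coord_vec_in[OF ch(1) w(1)] M.coord_vec_self[OF ch(1) w(1)] by auto
      then have "?w \<in> vertical_space M B F (param c x)" using vertical_iff[OF x t(1)] w by simp
      then show "G x (v c) w = 0" using hv gG[OF t(1)] t(2) by (simp add: horizontal_space_def)
    qed
  next
    assume *: "\<forall>w\<in>E. deriv_in E R x w = 0 \<longrightarrow> G x (v c) w = 0"
    have "g (param c x) v w = 0" if w: "w \<in> vertical_space M B F (param c x)" for w
    proof -
      have t: "w \<in> tangent_space M (param c x)" using w by (simp add: vertical_space_def)
      have "deriv_in E R x (w c) = 0" using vertical_iff[OF x t] w by blast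
      then show ?thesis using gG[OF t] * M.tangent_in[OF ch(1) t] by simp
    qed
    then show "v \<in> horizontal_space M g B F (param c x)"
      unfolding horizontal_space_def using v by simp
  qed
qed

text \<open>The squared cosine is \<open>G x a a / G x (v c) (v c)\<close>, and by orthogonality of
  \<open>a\<close> and \<open>b\<close> its complement to 1 is the vertical share. Squaring removes
  the square roots and the arccosine and leaves a relation that can be differentiated along
  geodesics.\<close>

lemma sin_horizontal_angle:
  assumes x: "x \<in> U" and v: "v \<in> tangent_space M (param c x)" and v0: "v c \<noteq> 0" and split: "v c = a + b"
    and a: "a \<in> E" "\<And>w. w \<in> E \<Longrightarrow> deriv_in E R x w = 0 \<Longrightarrow> G x a w = 0" and b: "b \<in> E" "deriv_in E R x b = 0"
  shows "(sin (horizontal_angle M g B F (param c x) v))\<^sup>2 * G x (v c) (v c) = G x b b"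
proof -
  note ch = patch_charts[OF x]
  let ?p = "param c x"
  let ?h = "coord_vec M c ?p a"
  have h: "?h \<in> tangent_space M ?p" "?h c = a" using M.coord_vec_in[OF ch(1) a(1)] M.coord_vec_self[OF ch(1) a(1)] by auto
  have diff_in: "(\<lambda>c. v c - h c) \<in> tangent_space M ?p" if "h \<in> tangent_space M ?p" for h
    using M.tangent_linear[OF ch(4) v that, of 1 "-1"] by simp
  have hh: "?h \<in> horizontal_space M g B F ?p" using horizontal_iff[OF x h(1)] h(2) a by simp
  have hv: "(\<lambda>c. v c - ?h c) \<in> vertical_space M B F ?p"
    using vertical_iff[OF x diff_in[OF h(1)]] h(2) split b by simp
  \<comment> \<open>The horizontal part is a definite description: a competitor differs from
    \<open>?h\<close> by a vector that is horizontal and vertical, hence zero.\<close>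
  have part: "horizontal_part M g B F ?p v = ?h"
    unfolding horizontal_part_def
  proof (rule the_equality)
    show "?h \<in> horizontal_space M g B F ?p \<and> (\<lambda>c. v c - ?h c) \<in> vertical_space M B F ?p" using hh hv by simp
    fix h' assume h': "h' \<in> horizontal_space M g B F ?p \<and> (\<lambda>c. v c - h' c) \<in> vertical_space M B F ?p"
    have t': "h' \<in> tangent_space M ?p" using h' by (simp add: horizontal_space_def)
    have a': "h' c \<in> E" using M.tangent_in[OF ch(1) t'] .
    have "deriv_in E R x (v c - h' c) = 0" using vertical_iff[OF x diff_in[OF t']] h' by simp
    moreover have "a - h' c = (v c - h' c) - b" using split by simp
    ultimately have k: "deriv_in E R x (a - h' c) = 0" using b by (simp add: linear_diff[OF DR_linear[OF x]])
    have dE: "a - h' c \<in> E" using a a' M.E by (simp add: subspace_diff)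
    have "G x (a - h' c) (a - h' c) = G x a (a - h' c) - G x (h' c) (a - h' c)"
      by (rule linear_onD(4)[OF metric_onD(2)[OF G_metric x dE] M.E a(1) a'])
    also have "\<dots> = 0" using a(2)[OF dE k] horizontal_iff[OF x t'] h' dE k by simp
    finally have "a = h' c" using metric_onD(4)[OF G_metric x dE] by force
    then show "h' = ?h" using M.tangent_eqI[OF ch(1) t' h(1)] h(2) by simp
  qed
  have ghh: "g ?p ?h ?h = G x a a" using M.g_coord[OF ch(1) h(1) h(1)] h(2) ch(3) by (simp add: G_def)
  have gvv: "g ?p v v = G x (v c) (v c)" using M.g_coord[OF ch(1) v v] ch(3) by (simp add: G_def)
  have vE: "v c \<in> E" using M.tangent_in[OF ch(1) v] .
  have pos: "G x (v c) (v c) > 0" using metric_onD(4)[OF G_metric x vE v0] .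
  have Gab: "G x a b = 0" "G x b a = 0" using a(2)[OF b] metric_onD(3)[OF G_metric x a(1) b(1)] by auto
  have abE: "a + b \<in> E" using a b M.E by (simp add: subspace_add)
  have sum: "G x (v c) (v c) = G x a a + G x b b"
    unfolding split linear_onD(1)[OF metric_onD(2)[OF G_metric x abE] M.E a(1) b(1)]
      linear_onD(1)[OF metric_on_linear_right[OF G_metric M.E x a(1)] M.E a(1) b(1)]
      linear_onD(1)[OF metric_on_linear_right[OF G_metric M.E x b(1)] M.E a(1) b(1)]
    using Gab by simp
  have nn: "G x w w \<ge> 0" if "w \<in> E" for w
    using metric_onD(4)[OF G_metric x that] linear_onD(3)[OF metric_onD(2)[OF G_metric x M.E[THEN subspace_0]] M.E] by (cases "w = 0") force+
  have le: "G x a a \<le> G x (v c) (v c)" using sum nn[OF b(1)] by simp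
  let ?q = "sqrt (G x a a) / sqrt (G x (v c) (v c))"
  have q: "\<bar>?q\<bar> \<le> 1" using le pos nn[OF a(1)] by (simp add: divide_le_eq)
  have "sin (horizontal_angle M g B F ?p v) = sqrt (1 - ?q\<^sup>2)"
    using sin_arccos_abs[OF q] by (simp add: horizontal_angle_def part ghh gvv)
  then have "(sin (horizontal_angle M g B F ?p v))\<^sup>2 = 1 - ?q\<^sup>2" using q by (simp add: abs_square_le_1)
  also have "\<dots> = 1 - G x a a / G x (v c) (v c)" using nn[OF a(1)] pos by (simp add: power_divide)
  finally show ?thesis using sum pos by (simp add: field_simps)
qed

text \<open>For each \<open>u\<close> a leaf through \<open>param c u\<close> is taken. Read in the
  charts it becomes a parametrised integral manifold, to which \<open>integral_torsion\<close>
  applies at the coordinate of \<open>param c u\<close>.\<close>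

lemma integrable_torsion_free:
  assumes S: "coordinate_submersion E U G E1 Q" and ker: "\<And>x v. x \<in> U \<Longrightarrow> v \<in> E \<Longrightarrow> deriv_in E Q x v = 0 \<longleftrightarrow> deriv_in E R x v = 0"
    and int: "integrable_distribution M (horizontal_space M g B F)"
  shows "coordinate_submersion.torsion_free E U G E1 Q"
proof -
  interpret S: coordinate_submersion E U G E1 Q by (rule S)
  have hor_iff: "h \<in> S.hor x \<longleftrightarrow> h \<in> E \<and> (\<forall>w\<in>E. deriv_in E R x w = 0 \<longrightarrow> G x h w = 0)" if "x \<in> U" for x h
    using ker[OF that] by (auto simp: S.hor_def S.vert_def)
  show ?thesis unfolding S.torsion_free_def
  proof (intro ballI)
    fix u \<xi> \<eta> assume u: "u \<in> U" and \<xi>: "\<xi> \<in> E1" and \<eta>: "\<eta> \<in> E1"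
    note ch = patch_charts[OF u]
    let ?q = "param c u"
    obtain L where L: "integral_manifold M (horizontal_space M g B F) L" "?q \<in> points L"
      using int ch(4) unfolding integrable_distribution_def by blast
    interpret L: manifold_map L M "\<lambda>q. q"
      using L(1) riem by unfold_locales (auto simp: integral_manifold_def immersion_def riemannian_manifold_def)
    obtain e where e: "e \<in> charts_at L ?q" using L.M.chart_exists[OF L(2)] by blast
    have eL: "e \<in> atlas L" "?q \<in> fst e" using L.M.charts_atD[OF e] by auto
    have Wopen: "openin (mtop M) (param c ` U)" by (rule M.openin_param_image[OF c U_open U_sub])
    \<comment> \<open>The part of the leaf inside the patch is open in the topology of the leaf
      because the inclusion is continuous; \<open>N\<close> is its image in the leaf chart
      \<open>e\<close>.\<close>
    define N where "N = snd e ` (fst e \<inter> (\<lambda>q. q) -` (param c ` U))"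
    define \<iota> where "\<iota> = snd c \<circ> (\<lambda>q. q) \<circ> param e"
    have cU: "param c ` U \<subseteq> fst c"
    proof
      fix p assume "p \<in> param c ` U"
      then obtain x where "x \<in> U" "p = param c x" by blast
      then show "p \<in> fst c" using M.param_in[of x c] U_sub by blast
    qed
    have N: "rel_open L.M.E N" unfolding N_def by (rule L.rep_domain_open[OF eL(1) Wopen])
    have Nsub: "N \<subseteq> snd e ` (fst e \<inter> (\<lambda>q. q) -` fst c)" unfolding N_def using cU by blast
    have \<iota>: "smooth_on L.M.E N \<iota>" unfolding smooth_on_def \<iota>_def
      using C_k_on_subset[OF L.rep_k[OF eL(1) c] Nsub] by (rule allI)
    have Npt: "param e l \<in> fst e" "param e l = param c (\<iota> l)" "\<iota> l \<in> U" "snd e (param e l) = l" if l: "l \<in> N" for l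
    proof -
      have l1: "l \<in> snd e ` fst e" "param e l \<in> param c ` U"
        using l L.M.coord_in_iff[OF eL(1), of l "(\<lambda>q. q) -` (param c ` U)"] unfolding N_def by auto
      show "param e l \<in> fst e" using L.M.param_in[OF l1(1)] .
      obtain x where x: "x \<in> U" "param e l = param c x" using l1(2) by blast
      have "\<iota> l = x" using x patch_charts(3)[OF x(1)] by (simp add: \<iota>_def)
      then show "param e l = param c (\<iota> l)" "\<iota> l \<in> U" using x by auto
      show "snd e (param e l) = l" using L.M.chart_param[OF l1(1)] .
    qed
    have tan: "deriv_in L.M.E \<iota> l ` L.M.E = S.hor (\<iota> l)" if l: "l \<in> N" for l
    proof -
      let ?p = "param e l"
      note n = Npt[OF l]
      have e': "e \<in> charts_at L ?p" using eL n by (simp add: charts_at_def)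
      have c': "c \<in> charts_at M ?p" using patch_charts(1)[OF n(3)] n(2) by simp
      have pL: "?p \<in> points L" using L.M.charts_at_point[OF e'] .
      have D: "differential L M (\<lambda>q. q) ?p v c = deriv_in L.M.E \<iota> l (v e)" if "v \<in> tangent_space L ?p" for v
        using L.differential_chart[OF e' c' that] n(4) by (simp add: \<iota>_def)
      have img: "differential L M (\<lambda>q. q) ?p ` tangent_space L ?p = horizontal_space M g B F ?p"
        using L(1) pL by (simp add: integral_manifold_def)
      have hz: "w \<in> horizontal_space M g B F ?p \<longleftrightarrow> w c \<in> S.hor (\<iota> l)" if "w \<in> tangent_space M ?p" for w
        using horizontal_iff[OF n(3), of w] hor_iff[OF n(3), of "w c"] that M.tangent_in[OF c' that] n(2) by simp
      have hz_tan: "w \<in> tangent_space M ?p" if "w \<in> horizontal_space M g B F ?p" for w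
        using that by (simp add: horizontal_space_def)
      show ?thesis
      proof (intro equalityI subsetI)
        fix y assume "y \<in> deriv_in L.M.E \<iota> l ` L.M.E"
        then obtain z where z: "z \<in> L.M.E" "y = deriv_in L.M.E \<iota> l z" by blast
        let ?v = "coord_vec L e ?p z"
        have v: "?v \<in> tangent_space L ?p" "?v e = z" using L.M.coord_vec_in[OF e' z(1)] L.M.coord_vec_self[OF e' z(1)] by auto
        have w: "differential L M (\<lambda>q. q) ?p ?v \<in> horizontal_space M g B F ?p" using img v(1) by blast
        then show "y \<in> S.hor (\<iota> l)" using hz[OF hz_tan[OF w]] D[OF v(1)] v(2) z(2) by simp
      next
        fix y assume y: "y \<in> S.hor (\<iota> l)"
        then have yE: "y \<in> E" by (simp add: S.hor_def)
        let ?w = "coord_vec M c ?p y"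
        have w: "?w \<in> tangent_space M ?p" "?w c = y" using M.coord_vec_in[OF c' yE] M.coord_vec_self[OF c' yE] by auto
        then have "?w \<in> horizontal_space M g B F ?p" using hz[OF w(1)] y by simp
        then obtain v where v: "v \<in> tangent_space L ?p" "?w = differential L M (\<lambda>q. q) ?p v" using img by (metis imageE)
        then have "y = deriv_in L.M.E \<iota> l (v e)" using D[OF v(1)] w(2) by simp
        then show "y \<in> deriv_in L.M.E \<iota> l ` L.M.E" using L.M.tangent_in[OF e' v(1)] by blast
      qed
    qed
    have l0: "snd e ?q \<in> N" unfolding N_def using eL u by blast
    have "\<iota> (snd e ?q) = u" using L.M.param_chart[OF eL] ch(3) by (simp add: \<iota>_def)
    then show "deriv_in E (\<lambda>u. S.hlift u \<eta>) u (S.hlift u \<xi>) = deriv_in E (\<lambda>u. S.hlift u \<xi>) u (S.hlift u \<eta>)"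
      using S.integral_torsion[OF N \<iota> _ tan l0 \<xi> \<eta>] Npt(3) by auto
  qed
qed

end

lemma split_ball_open: "subspace E \<Longrightarrow> rel_open E (split_ball E E1 s)"
proof -
  assume E: "subspace E"
  have "continuous_on UNIV (proj E1)" by (rule linear_continuous_on[OF bounded_linear_proj])
  then have "open ({p. norm (proj E1 p) < s} \<inter> {p. norm (p - proj E1 p) < s})"
    by (intro open_Int open_Collect_less continuous_intros)
  from rel_open_Int_open[OF rel_open_self[OF E] this]
  have "rel_open E (E \<inter> ({p. norm (proj E1 p) < s} \<inter> {p. norm (p - proj E1 p) < s}))" .
  moreover have "E \<inter> ({p. norm (proj E1 p) < s} \<inter> {p. norm (p - proj E1 p) < s}) = split_ball E E1 s"
    unfolding split_ball_def by blast
  ultimately show ?thesis by (simp only:)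
qed

section \<open>Straightened coordinates and the Clairaut relation\<close>

context submersion_patch
begin

text \<open>Pulled back by the straightening map the metric is block diagonal, and geodesics of the
  pulled back metric are carried to geodesics of \<open>M\<close>. The Clairaut hypothesis on
  \<open>M\<close> thereby becomes the assumption of the locale
  \<open>clairaut_metric\<close>.\<close>

lemma warped_coordinates:
  assumes x0: "x0 \<in> U" and r: "smooth_fun M r" "\<And>p. p \<in> points M \<Longrightarrow> r p > 0"
    and clairaut: "\<And>I \<alpha>. geodesic M g I \<alpha> \<Longrightarrow> (\<And>t. t \<in> I \<Longrightarrow> velocity M \<alpha> t \<noteq> (\<lambda>_. 0)) \<Longrightarrow>
        \<exists>C. \<forall>t\<in>I. r (\<alpha> t) * sin (horizontal_angle M g B F (\<alpha> t) (velocity M \<alpha> t)) = C"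
    and int: "integrable_distribution M (horizontal_space M g B F)"
  obtains E1 s N \<Theta> \<Psi> h where "subspace E1" "E1 \<subseteq> E" "dim E1 = dim (model B)" "dim {v \<in> E. proj E1 v = 0} = dim E - dim (model B)"
    "s > 0" "N = split_ball E E1 s" "rel_open E N" "smooth_on E N \<Theta>" "\<Theta> ` N \<subseteq> U" "rel_open E (\<Theta> ` N)" "smooth_on E (\<Theta> ` N) \<Psi>"
    "\<And>p. p \<in> N \<Longrightarrow> \<Psi> (\<Theta> p) = p" "x0 \<in> \<Theta> ` N"
    "metric_on E N h" "\<And>p v w. p \<in> N \<Longrightarrow> v \<in> E \<Longrightarrow> w \<in> E \<Longrightarrow> h p v w = G (\<Theta> p) (deriv_in E \<Theta> p v) (deriv_in E \<Theta> p w)"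
    "\<And>p v w. p \<in> N \<Longrightarrow> v \<in> E \<Longrightarrow> w \<in> E \<Longrightarrow> h p v w = h (proj E1 p) (proj E1 v) (proj E1 w) +
       (r (param c (\<Theta> (proj E1 p))))\<^sup>2 * (h (p - proj E1 p) (v - proj E1 v) (w - proj E1 w) / (r (param c (\<Theta> 0)))\<^sup>2)"
proof -
  have E: "subspace E" using M.E .
  have U_E: "U \<subseteq> E" using rel_open_subset[OF U_open] .
  obtain E1 T where E1: "subspace E1" "E1 \<subseteq> E" and bT: "bounded_linear T" and TH: "T ` model B = E1"
    and LT: "\<And>y. y \<in> model B \<Longrightarrow> deriv_in E R x0 (T y) = y"
    and TL: "\<And>v. v \<in> E \<Longrightarrow> T (deriv_in E R x0 v) = proj E1 v"
    and dims: "dim E1 = dim (model B)" "dim {v \<in> E. proj E1 v = 0} = dim E - dim (model B)"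
    by (rule submersion_splitting[OF E DR_linear[OF x0] DR_surj[OF x0]]) blast
  have linT: "linear T" using bounded_linear.linear[OF bT] .
  \<comment> \<open>The coordinate form of the submersion, translated to vanish at \<open>x0\<close>
    and moved into \<open>E1\<close>. Its derivative at \<open>x0\<close> is the orthogonal
    projection, and \<open>T\<close> is injective on the values involved, so vertical vectors are
    unchanged.\<close>
  define Q where "Q u = T (R u - R x0)" for u
  have Qk: "C_k_on k E U Q" for k unfolding Q_def
    by (intro C_k_on_bounded_linear_comp[OF U_open bT] C_k_on_diff U_open R_k C_k_on_const)
  have DQ: "deriv_in E Q u v = T (deriv_in E R u v)" if u: "u \<in> U" and v: "v \<in> E" for u v
  proof (rule deriv_in_eq[OF E _ _ v])
    show "u \<in> E" using u U_E by blast
    have "((\<lambda>u. T (R u - R x0)) has_derivative (\<lambda>v. T (deriv_in E R u v - 0))) (at u within E)"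
      by (intro bounded_linear.has_derivative[OF bT] has_derivative_diff has_derivative_const C_k_on_SucD(1)[OF R_k u])
    then show "(Q has_derivative (\<lambda>v. T (deriv_in E R u v))) (at u within E)" by (simp add: Q_def[abs_def])
  qed
  have DR_in: "deriv_in E R u v \<in> model B" if "u \<in> U" "v \<in> E" for u v using DR_surj[OF that(1)] that(2) by blast
  have S: "coordinate_submersion E U G E1 Q"
  proof
    show "rel_open E U" "metric_on E U G" "subspace E1" "E1 \<subseteq> E" using U_open G_metric E1 by auto
    show "smooth_on E U Q" using Qk by (simp add: smooth_on_def)
    show "Q ` U \<subseteq> E1"
    proof
      fix y assume "y \<in> Q ` U"
      then obtain u where u: "u \<in> U" "y = Q u" by blast
      have "R u - R x0 \<in> model B" using R_in u(1) x0 by (intro subspace_diff[OF B_E]) auto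
      then show "y \<in> E1" using TH u(2) by (auto simp: Q_def)
    qed
    show "deriv_in E Q u ` E = E1" if u: "u \<in> U" for u
    proof -
      have "deriv_in E Q u ` E = T ` deriv_in E R u ` E" using DQ[OF u] by (auto simp: image_iff)
      then show ?thesis using DR_surj[OF u] TH by simp
    qed
  qed
  interpret S: coordinate_submersion E U G E1 Q by (rule S)
  have ker: "deriv_in E Q u v = 0 \<longleftrightarrow> deriv_in E R u v = 0" if u: "u \<in> U" and v: "v \<in> E" for u v
  proof
    assume "deriv_in E Q u v = 0"
    then have "deriv_in E R x0 (T (deriv_in E R u v)) = 0" using DQ[OF u v] linear_0[OF DR_linear[OF x0]] by simp
    then show "deriv_in E R u v = 0" using LT[OF DR_in[OF u v]] by simp
  qed (simp add: DQ[OF u v] linear_0[OF linT])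
  have tf: S.torsion_free by (rule integrable_torsion_free[OF S ker int])
  have Q0: "Q x0 = 0" by (simp add: Q_def linear_0[OF linT])
  have DQ0: "deriv_in E Q x0 v = proj E1 v" if "v \<in> E" for v using DQ[OF x0 that] TL[OF that] by simp
  obtain N0 \<Theta> \<Psi> where N0: "rel_open E N0" "0 \<in> N0" and \<Theta>0: "smooth_on E N0 \<Theta>" "\<Theta> ` N0 \<subseteq> U" "rel_open E (\<Theta> ` N0)"
    and \<Psi>0: "smooth_on E (\<Theta> ` N0) \<Psi>" "\<And>p. p \<in> N0 \<Longrightarrow> \<Psi> (\<Theta> p) = p" and \<Theta>_0: "\<Theta> 0 = x0"
    and Q\<Theta>0: "\<And>p a. p \<in> N0 \<Longrightarrow> a \<in> E1 \<Longrightarrow> deriv_in E \<Theta> p a \<in> S.hor (\<Theta> p)"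
    "\<And>p v. p \<in> N0 \<Longrightarrow> v \<in> E \<Longrightarrow> deriv_in E Q (\<Theta> p) (deriv_in E \<Theta> p v) = proj E1 v"
    "\<And>p v. p \<in> N0 \<Longrightarrow> v \<in> E \<Longrightarrow> deriv_in E \<Theta> p v = 0 \<Longrightarrow> v = 0"
  proof (rule S.straightening[OF tf x0 Q0 DQ0])
    fix N \<Theta> \<Psi>
    assume a: "rel_open E N" "0 \<in> N" "smooth_on E N \<Theta>" "\<Theta> ` N \<subseteq> U" "rel_open E (\<Theta> ` N)" "smooth_on E (\<Theta> ` N) \<Psi>"
      "\<And>p. p \<in> N \<Longrightarrow> \<Psi> (\<Theta> p) = p" "\<Theta> 0 = x0"
      and b: "\<And>p a. p \<in> N \<Longrightarrow> a \<in> E1 \<Longrightarrow> deriv_in E \<Theta> p a \<in> S.hor (\<Theta> p)"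
      "\<And>p v. p \<in> N \<Longrightarrow> v \<in> E \<Longrightarrow> deriv_in E Q (\<Theta> p) (deriv_in E \<Theta> p v) = proj E1 v"
      "\<And>p v. p \<in> N \<Longrightarrow> v \<in> E \<Longrightarrow> deriv_in E \<Theta> p v = 0 \<Longrightarrow> v = 0"
    show thesis by (rule that[OF a b])
  qed
  obtain e where e: "e > 0" "E \<inter> ball 0 e \<subseteq> N0" using rel_open_ball[OF N0] .
  \<comment> \<open>By the triangle inequality a point of the box has norm below
    \<open>2 * s\<close>.\<close>
  define s where "s = e / 2"
  have s: "s > 0" using e by (simp add: s_def)
  define N where "N = split_ball E E1 s"
  have N: "rel_open E N" unfolding N_def by (rule split_ball_open[OF E])
  have N_N0: "N \<subseteq> N0"
  proof
    fix p assume p: "p \<in> N"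
    have "norm p \<le> norm (proj E1 p) + norm (p - proj E1 p)" using norm_triangle_ineq[of "proj E1 p" "p - proj E1 p"] by simp
    also have "\<dots> < e" using p by (simp add: N_def split_ball_def s_def)
    finally show "p \<in> N0" using e p by (auto simp: N_def split_ball_def)
  qed
  have N_E: "N \<subseteq> E" using rel_open_subset[OF N] .
  have 0: "0 \<in> N" using s subspace_0[OF E] by (simp add: N_def split_ball_def linear_0[OF linear_proj])
  have \<Theta>k: "C_k_on k E N \<Theta>" for k using \<Theta>0(1) C_k_on_subset[OF _ N_N0] unfolding smooth_on_def by blast
  have \<Theta>U: "\<Theta> p \<in> U" if "p \<in> N" for p using that \<Theta>0(2) N_N0 by blast
  have \<Theta>N: "\<Theta> ` N \<subseteq> U" using \<Theta>U by blast
  have \<Theta>E: "\<Theta> ` N \<subseteq> E" using \<Theta>N U_E by blast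
  have \<Theta>N_open: "rel_open E (\<Theta> ` N)"
  proof -
    have "C_k_on 0 E (\<Theta> ` N0) \<Psi>" using \<Psi>0(1) unfolding smooth_on_def by blast
    then have "continuous_on (\<Theta> ` N0) \<Psi>" by simp
    moreover have "\<Psi> ` \<Theta> ` N0 \<subseteq> E" using \<Psi>0(2) rel_open_subset[OF N0(1)] by auto
    ultimately have "rel_open E {u \<in> \<Theta> ` N0. \<Psi> u \<in> N}" by (rule rel_open_vimage[OF \<Theta>0(3) N])
    moreover have "{u \<in> \<Theta> ` N0. \<Psi> u \<in> N} = \<Theta> ` N" using \<Psi>0(2) N_N0 by (auto simp: subset_iff)
    ultimately show ?thesis by simp
  qed
  define D where "D p v = deriv_in E \<Theta> p v" for p v
  have Dk: "C_k_on k E N (\<lambda>p. D p v)" if "v \<in> E" for v k unfolding D_def using C_k_on_SucD(2)[OF \<Theta>k that] .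
  have D_in: "D p v \<in> E" if "p \<in> N" "v \<in> E" for p v
    unfolding D_def using deriv_in_subspace[OF N that(1) \<Theta>E E \<Theta>k that(2)] .
  have D_lin: "linear (D p)" if "p \<in> N" for p
  proof -
    have "D p = deriv_in E \<Theta> p" by (auto simp: D_def)
    moreover have "\<Theta> differentiable (at p within E)" using C_k_on_SucD(1)[OF \<Theta>k that] by (rule differentiableI)
    ultimately show ?thesis using linear_deriv_in by simp
  qed
  have D_inj: "v = 0" if "p \<in> N" "v \<in> E" "D p v = 0" for p v using Q\<Theta>0(3) N_N0 that unfolding D_def by blast
  have D_surj: "deriv_in E \<Theta> p ` E = E" if p: "p \<in> N" for p
  proof (intro equalityI subsetI)
    show "y \<in> E" if "y \<in> deriv_in E \<Theta> p ` E" for y using that D_in[OF p] by (auto simp: D_def)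
    fix y assume y: "y \<in> E"
    have "\<exists>w\<in>E. D p w = y"
      by (rule linear_on_surj[OF linear_imp_linear_on[OF D_lin[OF p]] E _ _ y]) (use D_in[OF p] D_inj[OF p] in auto)
    then show "y \<in> deriv_in E \<Theta> p ` E" by (auto simp: D_def)
  qed
  define h where "h p v w = G (\<Theta> p) (D p v) (D p w)" for p v w
  have h: "metric_on E N h" unfolding metric_on_def smooth_on_def
  proof (intro conjI ballI allI impI)
    show "C_k_on k E N (\<lambda>p. h p v w)" if "v \<in> E" "w \<in> E" for v w k
      unfolding h_def
      by (rule C_k_on_bilinear_family[OF N U_open E E \<Theta>N _ _ metric_onD(2)[OF G_metric] metric_on_linear_right[OF G_metric E]
          metric_onD(1)[OF G_metric] \<Theta>k Dk[OF that(1)] Dk[OF that(2)]]) (use D_in that in auto)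
    fix p assume p: "p \<in> N"
    show "linear_on E (\<lambda>v. h p v w)" if "w \<in> E" for w
      using metric_onD(2)[OF G_metric \<Theta>U[OF p] D_in[OF p that]] D_in[OF p]
      unfolding linear_on_def h_def by (simp add: linear_add[OF D_lin[OF p]] linear_cmul[OF D_lin[OF p]])
    show "h p v w = h p w v" if "v \<in> E" "w \<in> E" for v w
      unfolding h_def using metric_onD(3)[OF G_metric \<Theta>U[OF p] D_in[OF p that(1)] D_in[OF p that(2)]] .
    show "0 < h p v v" if "v \<in> E" "v \<noteq> 0" for v
      unfolding h_def using metric_onD(4)[OF G_metric \<Theta>U[OF p] D_in[OF p that(1)]] D_inj[OF p that(1)] that(2) by blast
  qed
  \<comment> \<open>What the straightening achieves: \<open>D p\<close> maps the complement of
    \<open>E1\<close> to vertical vectors and \<open>E1\<close> to horizontal ones, which makes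
    \<open>h\<close> block diagonal.\<close>
  have vert: "deriv_in E R (\<Theta> p) (D p b) = 0" if "p \<in> N" "b \<in> E" "proj E1 b = 0" for p b
    using Q\<Theta>0(2)[of p b] ker[OF \<Theta>U D_in] that N_N0 by (auto simp: D_def)
  have hor: "G (\<Theta> p) (D p a) w = 0" if "p \<in> N" "a \<in> E1" "w \<in> E" "deriv_in E R (\<Theta> p) w = 0" for p a w
  proof -
    have "D p a \<in> S.hor (\<Theta> p)" using Q\<Theta>0(1)[of p a] that N_N0 by (auto simp: D_def)
    moreover have "w \<in> S.vert (\<Theta> p)" using that ker[OF \<Theta>U] by (auto simp: S.vert_def)
    ultimately show ?thesis by (auto simp: S.hor_def)
  qed
  define \<rho> where "\<rho> p = (r (param c (\<Theta> p)))\<^sup>2" for p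
  have rk: "C_k_on k E N (\<lambda>p. r (param c (\<Theta> p)))" for k
  proof -
    have 1: "\<Theta> ` N \<subseteq> snd c ` fst c" using \<Theta>N U_sub by blast
    show ?thesis using C_k_on_compose[OF N M.chart_rel_open[OF c] 1 \<Theta>k M.smooth_fun_k[OF r(1) c]] by simp
  qed
  have \<rho>_pos: "\<rho> p > 0" if "p \<in> N" for p
    using r(2)[OF patch_charts(4)[OF \<Theta>U[OF that]]] by (simp add: \<rho>_def)
  have K: "clairaut_metric E N E1 h \<rho>"
  proof
    show "rel_open E N" "subspace E1" "E1 \<subseteq> E" "metric_on E N h" using N E1 h by auto
    show "h p a b = 0" if "p \<in> N" "a \<in> E1" "b \<in> E" "proj E1 b = 0" for p a b
      unfolding h_def using hor[OF that(1,2) D_in[OF that(1,3)] vert[OF that(1,3,4)]] .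
    have "C_k_on k E N \<rho>" for k
      unfolding \<rho>_def power2_eq_square by (intro C_k_on_mult N rk)
    then show "smooth_on E N \<rho>" by (simp add: smooth_on_def)
    show "\<rho> p > 0" if "p \<in> N" for p using \<rho>_pos[OF that] .
    fix p v assume p: "p \<in> N" and v: "v \<in> E" "v \<noteq> 0"
    obtain \<epsilon> \<gamma> \<gamma>' \<gamma>'' where \<epsilon>: "\<epsilon> > 0" and g1: "geodesic_curve E N h {-1<..<1} \<gamma> \<gamma>' \<gamma>''" and \<gamma>0: "\<gamma> 0 = p" "\<gamma>' 0 = \<epsilon> *\<^sub>R v"
      and \<gamma>k: "\<And>k. C_k_on k UNIV {-1<..<1} \<gamma>"
      by (rule geodesic_exists[OF N h p v(1)]) blast
    have "(\<gamma>' has_vector_derivative \<gamma>'' 0) (at 0)" using g1 unfolding geodesic_curve_def by simp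
    then have "continuous (at 0) \<gamma>'" by (rule has_vector_derivative_continuous)
    moreover have "\<gamma>' 0 \<noteq> 0" using \<gamma>0 \<epsilon> v by simp
    ultimately obtain d0 where d0: "d0 > 0" "\<And>t. dist t 0 < d0 \<Longrightarrow> \<gamma>' t \<noteq> 0"
      using continuous_at_avoid[of 0 \<gamma>' 0] by (metis dist_commute)
    \<comment> \<open>The angle is meaningful for nonzero velocity only, so the interval is
      shortened until the velocity has no zeros.\<close>
    define dd where "dd = min d0 1"
    have dd: "dd > 0" "dd \<le> 1" "dd \<le> d0" using d0 by (auto simp: dd_def)
    let ?J = "{-dd<..<dd}"
    have JJ: "?J \<subseteq> {-1<..<1}" using dd by auto
    have g2: "geodesic_curve E N h ?J \<gamma> \<gamma>' \<gamma>''" using geodesic_curve_subset[OF g1 JJ] .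
    have \<gamma>N: "\<gamma> t \<in> N" "\<gamma>' t \<in> E" "\<gamma>' t \<noteq> 0" if "t \<in> ?J" for t
    proof -
      show "\<gamma> t \<in> N" "\<gamma>' t \<in> E" using g2 that unfolding geodesic_curve_def by blast+
      have "\<bar>t\<bar> < dd" using that by auto
      then show "\<gamma>' t \<noteq> 0" using d0(2)[of t] dd by (simp add: dist_real_def)
    qed
    have sm: "smooth_on E N \<Theta>" using \<Theta>k by (simp add: smooth_on_def)
    have pull: "h p v w = G (\<Theta> p) (deriv_in E \<Theta> p v) (deriv_in E \<Theta> p w)" for p v w by (simp add: h_def D_def)
    have g3: "geodesic_curve E U G ?J (\<lambda>t. \<Theta> (\<gamma> t)) (\<lambda>t. deriv_in E \<Theta> (\<gamma> t) (\<gamma>' t))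
       (\<lambda>t. deriv_in E (\<lambda>q. deriv_in E \<Theta> q (\<gamma>' t)) (\<gamma> t) (\<gamma>' t) + deriv_in E \<Theta> (\<gamma> t) (\<gamma>'' t))"
      by (rule geodesic_curve_image[OF _ N U_open G_metric sm \<Theta>N pull D_surj g2]) simp_all
    have g4: "geodesic_curve E (snd c ` fst c) (metric_coord M g c) ?J (\<lambda>t. \<Theta> (\<gamma> t)) (\<lambda>t. deriv_in E \<Theta> (\<gamma> t) (\<gamma>' t))
       (\<lambda>t. deriv_in E (\<lambda>q. deriv_in E \<Theta> q (\<gamma>' t)) (\<gamma> t) (\<gamma>' t) + deriv_in E \<Theta> (\<gamma> t) (\<gamma>'' t))"
      using g3 U_sub unfolding geodesic_curve_def G_def[symmetric] by blast
    have J2: "rel_open UNIV ?J" by (simp add: rel_open_def subspace_UNIV open_openin[symmetric])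
    have \<beta>k: "C_k_on k UNIV ?J (\<lambda>t. \<Theta> (\<gamma> t))" for k
      by (rule C_k_on_compose[OF J2 N _ C_k_on_subset[OF \<gamma>k JJ] \<Theta>k]) (use \<gamma>N in auto)
    have Jo: "open ?J" "is_interval ?J" by (auto simp: is_interval_convex_1)
    let ?\<alpha> = "\<lambda>t. param c (\<Theta> (\<gamma> t))"
    note geo = M.geodesic_from_chart[OF c Jo g4 \<beta>k]
    have vel: "velocity M ?\<alpha> t c = D (\<gamma> t) (\<gamma>' t)" if "t \<in> ?J" for t using geo(2)[OF that] by (simp add: D_def)
    have vel0: "velocity M ?\<alpha> t c \<noteq> 0" if "t \<in> ?J" for t using vel[OF that] D_inj[OF \<gamma>N(1,2)[OF that]] \<gamma>N(3)[OF that] by auto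
    then have "velocity M ?\<alpha> t \<noteq> (\<lambda>_. 0)" if "t \<in> ?J" for t using that by (metis (mono_tags, lifting))
    from clairaut[OF geo(1) this] obtain C where C: "\<And>t. t \<in> ?J \<Longrightarrow> r (?\<alpha> t) * sin (horizontal_angle M g B F (?\<alpha> t) (velocity M ?\<alpha> t)) = C"
      by blast
    \<comment> \<open>Multiplying the squared Clairaut relation by the squared speed clears the
      denominator hidden in the sine; the constant becomes the square of the Clairaut
      constant.\<close>
    have rel: "\<rho> (\<gamma> t) * h (\<gamma> t) (\<gamma>' t - proj E1 (\<gamma>' t)) (\<gamma>' t - proj E1 (\<gamma>' t)) = C\<^sup>2 * h (\<gamma> t) (\<gamma>' t) (\<gamma>' t)" if t: "t \<in> ?J" for t
    proof -
      note q = \<gamma>N[OF t]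
      let ?a = "proj E1 (\<gamma>' t)" and ?b = "\<gamma>' t - proj E1 (\<gamma>' t)"
      have aE1: "?a \<in> E1" "?a \<in> E" using proj_in[OF E1(1)] E1(2) by auto
      have bE: "?b \<in> E" "proj E1 ?b = 0" using q(2) aE1 E proj_id[OF E1(1) aE1(1)]
        by (auto simp: linear_diff[OF linear_proj] intro: subspace_diff)
      have split: "velocity M ?\<alpha> t c = D (\<gamma> t) ?a + D (\<gamma> t) ?b"
        using vel[OF t] by (simp add: linear_diff[OF D_lin[OF q(1)]])
      have "(sin (horizontal_angle M g B F (?\<alpha> t) (velocity M ?\<alpha> t)))\<^sup>2 * G (\<Theta> (\<gamma> t)) (velocity M ?\<alpha> t c) (velocity M ?\<alpha> t c)
         = G (\<Theta> (\<gamma> t)) (D (\<gamma> t) ?b) (D (\<gamma> t) ?b)"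
        by (rule sin_horizontal_angle[OF \<Theta>U[OF q(1)] geo(3)[OF t] vel0[OF t] split D_in[OF q(1) aE1(2)] hor[OF q(1) aE1(1)]
            D_in[OF q(1) bE(1)] vert[OF q(1) bE]])
      then have "(sin (horizontal_angle M g B F (?\<alpha> t) (velocity M ?\<alpha> t)))\<^sup>2 * h (\<gamma> t) (\<gamma>' t) (\<gamma>' t) = h (\<gamma> t) ?b ?b"
        by (simp add: h_def vel[OF t])
      then have "\<rho> (\<gamma> t) * h (\<gamma> t) ?b ?b = (r (?\<alpha> t) * sin (horizontal_angle M g B F (?\<alpha> t) (velocity M ?\<alpha> t)))\<^sup>2 * h (\<gamma> t) (\<gamma>' t) (\<gamma>' t)"
        by (simp add: \<rho>_def power_mult_distrib)
      then show ?thesis using C[OF t] by simp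
    qed
    show "\<exists>\<epsilon> \<gamma> \<gamma>' \<gamma>'' d C. 0 < \<epsilon> \<and> 0 < d \<and> geodesic_curve E N h {- d<..<d} \<gamma> \<gamma>' \<gamma>'' \<and> \<gamma> 0 = p \<and> \<gamma>' 0 = \<epsilon> *\<^sub>R v \<and>
        (\<forall>t\<in>{- d<..<d}. \<rho> (\<gamma> t) * h (\<gamma> t) (\<gamma>' t - proj E1 (\<gamma>' t)) (\<gamma>' t - proj E1 (\<gamma>' t)) = C * h (\<gamma> t) (\<gamma>' t) (\<gamma>' t))"
      using \<epsilon> dd(1) g2 \<gamma>0 rel by blast
  qed
  interpret K: clairaut_metric E N E1 h \<rho> by (rule K)
  show ?thesis
  proof (rule that[OF E1 dims s N_def N _ \<Theta>N \<Theta>N_open])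
    show "smooth_on E N \<Theta>" using \<Theta>k by (simp add: smooth_on_def)
    show "smooth_on E (\<Theta> ` N) \<Psi>" using \<Psi>0(1) C_k_on_subset[OF _ image_mono[OF N_N0]] unfolding smooth_on_def by blast
    show "\<Psi> (\<Theta> p) = p" if "p \<in> N" for p using \<Psi>0(2) N_N0 that by blast
    show "x0 \<in> \<Theta> ` N" using \<Theta>_0 0 by (metis image_eqI)
    show "metric_on E N h" by (rule h)
    show "h p v w = G (\<Theta> p) (deriv_in E \<Theta> p v) (deriv_in E \<Theta> p w)" for p v w by (simp add: h_def D_def)
    show "h p v w = h (proj E1 p) (proj E1 v) (proj E1 w) +
       (r (param c (\<Theta> (proj E1 p))))\<^sup>2 * (h (p - proj E1 p) (v - proj E1 v) (w - proj E1 w) / (r (param c (\<Theta> 0)))\<^sup>2)"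
      if "p \<in> N" "v \<in> E" "w \<in> E" for p v w
      using K.split_ball_warped(2)[of s p v w] that by (simp add: \<rho>_def N_def)
  qed
qed

end

section \<open>Assembling the warped product neighbourhood\<close>

context submersion_patch
begin

text \<open>Both factors are slices of the coordinate box embedded in \<open>M\<close> by
  \<open>\<iota>\<close>: the base \<open>\<iota>\<close>
  V1\<open>is horizontal and the other factor\<close>\<iota> \<open>V2\<close> lies in a fibre of
  \<open>F\<close>. The point with coordinates \<open>x + y\<close> corresponds to the pair of
  \<open>\<iota> x\<close> and \<open>\<iota> y\<close>.\<close>

theorem warped_neighbourhood:
  assumes x0: "x0 \<in> U" and r: "smooth_fun M r" "\<And>p. p \<in> points M \<Longrightarrow> r p > 0"
    and clairaut: "\<And>I \<alpha>. geodesic M g I \<alpha> \<Longrightarrow> (\<And>t. t \<in> I \<Longrightarrow> velocity M \<alpha> t \<noteq> (\<lambda>_. 0)) \<Longrightarrow>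
        \<exists>C. \<forall>t\<in>I. r (\<alpha> t) * sin (horizontal_angle M g B F (\<alpha> t) (velocity M \<alpha> t)) = C"
    and int: "integrable_distribution M (horizontal_space M g B F)"
  shows "\<exists>W. openin (mtop M) W \<and> param c x0 \<in> W \<and>
    is_warped_product (open_submanifold M W) (restrict_metric M g W) (dim (model B)) (dim E - dim (model B))"
proof -
  obtain E1 s N \<Theta> \<Psi> h where E1: "subspace E1" "E1 \<subseteq> E" and dims: "dim E1 = dim (model B)" "dim {v \<in> E. proj E1 v = 0} = dim E - dim (model B)"
    and s: "s > 0" and N_def: "N = split_ball E E1 s" and N: "rel_open E N" and \<Theta>: "smooth_on E N \<Theta>" "\<Theta> ` N \<subseteq> U" "rel_open E (\<Theta> ` N)"
    and \<Psi>: "smooth_on E (\<Theta> ` N) \<Psi>" "\<And>p. p \<in> N \<Longrightarrow> \<Psi> (\<Theta> p) = p" and x0N: "x0 \<in> \<Theta> ` N"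
    and h: "metric_on E N h" and h_eq: "\<And>p v w. p \<in> N \<Longrightarrow> v \<in> E \<Longrightarrow> w \<in> E \<Longrightarrow> h p v w = G (\<Theta> p) (deriv_in E \<Theta> p v) (deriv_in E \<Theta> p w)"
    and warped: "\<And>p v w. p \<in> N \<Longrightarrow> v \<in> E \<Longrightarrow> w \<in> E \<Longrightarrow> h p v w = h (proj E1 p) (proj E1 v) (proj E1 w) +
       (r (param c (\<Theta> (proj E1 p))))\<^sup>2 * (h (p - proj E1 p) (v - proj E1 v) (w - proj E1 w) / (r (param c (\<Theta> 0)))\<^sup>2)"
  proof (rule warped_coordinates[OF x0 r clairaut int])
    fix E1 s N \<Theta> \<Psi> h
    assume a: "subspace E1" "E1 \<subseteq> E" "dim E1 = dim (model B)" "dim {v \<in> E. proj E1 v = 0} = dim E - dim (model B)"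
      "s > 0" "N = split_ball E E1 s" "rel_open E N" "smooth_on E N \<Theta>" "\<Theta> ` N \<subseteq> U" "rel_open E (\<Theta> ` N)" "smooth_on E (\<Theta> ` N) \<Psi>"
      "\<And>p. p \<in> N \<Longrightarrow> \<Psi> (\<Theta> p) = p" "x0 \<in> \<Theta> ` N" "metric_on E N h"
      "\<And>p v w. p \<in> N \<Longrightarrow> v \<in> E \<Longrightarrow> w \<in> E \<Longrightarrow> h p v w = G (\<Theta> p) (deriv_in E \<Theta> p v) (deriv_in E \<Theta> p w)"
      and b: "\<And>p v w. p \<in> N \<Longrightarrow> v \<in> E \<Longrightarrow> w \<in> E \<Longrightarrow> h p v w = h (proj E1 p) (proj E1 v) (proj E1 w) +
       (r (param c (\<Theta> (proj E1 p))))\<^sup>2 * (h (p - proj E1 p) (v - proj E1 v) (w - proj E1 w) / (r (param c (\<Theta> 0)))\<^sup>2)"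
    show thesis by (rule that[OF a b])
  qed
  have E: "subspace E" using M.E .
  define P2 where "P2 p = p - proj E1 p" for p
  have bP2: "bounded_linear P2" unfolding P2_def by (intro bounded_linear_sub bounded_linear_ident bounded_linear_proj)
  have linP2: "linear P2" using bounded_linear.linear[OF bP2] .
  define E2 where "E2 = {v \<in> E. proj E1 v = 0}"
  have E2: "subspace E2" unfolding E2_def
    using E by (auto intro!: subspaceI simp: subspace_0 subspace_add subspace_scale linear_0[OF linear_proj] linear_add[OF linear_proj] linear_cmul[OF linear_proj])
  have proj_E: "proj E1 v \<in> E1" "proj E1 v \<in> E" for v using proj_in[OF E1(1)] E1(2) by auto
  have P2_E: "P2 v \<in> E2" if "v \<in> E" for v
    using that proj_E subspace_diff[OF E] proj_id[OF E1(1)] by (auto simp: P2_def E2_def linear_diff[OF linear_proj])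
  define V1 where "V1 = {x \<in> E1. norm x < s}"
  define V2 where "V2 = {y \<in> E2. norm y < s}"
  have ball_eq: "{x \<in> F. norm x < s} = F \<inter> ball 0 s" for F :: "'e set" by (auto simp: dist_norm)
  have V1: "rel_open E1 V1" unfolding V1_def ball_eq using rel_open_Int_open[OF rel_open_self[OF E1(1)]] by blast
  have V2: "rel_open E2 V2" unfolding V2_def ball_eq using rel_open_Int_open[OF rel_open_self[OF E2]] by blast
  have N_E: "N \<subseteq> E" using rel_open_subset[OF N] .
  have sum_N: "x + y \<in> N" "proj E1 (x + y) = x" "P2 (x + y) = y" if "x \<in> V1" "y \<in> V2" for x y
  proof -
    have x: "x \<in> E1" "norm x < s" and y: "y \<in> E" "proj E1 y = 0" "norm y < s" using that by (auto simp: V1_def V2_def E2_def)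
    show 1: "proj E1 (x + y) = x" using proj_id[OF E1(1) x(1)] y by (simp add: linear_add[OF linear_proj])
    then show "P2 (x + y) = y" by (simp add: P2_def)
    have "x + y \<in> E" using x y E1 E by (auto intro: subspace_add)
    then show "x + y \<in> N" using 1 x y by (simp add: N_def split_ball_def)
  qed
  have parts: "proj E1 p \<in> V1" "P2 p \<in> V2" "proj E1 p + P2 p = p" if p: "p \<in> N" for p
    using p proj_E P2_E[of p] N_E by (auto simp: N_def split_ball_def V1_def V2_def P2_def)
  have zeros: "0 \<in> V1" "0 \<in> V2" using s subspace_0[OF E1(1)] subspace_0[OF E2] by (auto simp: V1_def V2_def)
  have V1N: "V1 \<subseteq> N" and V2N: "V2 \<subseteq> N" using sum_N(1)[OF _ zeros(2)] sum_N(1)[OF zeros(1)] by auto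
  have 0: "0 \<in> N" using zeros V1N by auto
  have \<Theta>U: "\<Theta> p \<in> U" "\<Theta> p \<in> snd c ` fst c" if "p \<in> N" for p using that \<Theta>(2) U_sub by auto
  have \<Theta>k: "C_k_on k E N \<Theta>" for k using \<Theta>(1) by (simp add: smooth_on_def)
  have \<Psi>k: "C_k_on k E (\<Theta> ` N) \<Psi>" for k using \<Psi>(1) by (simp add: smooth_on_def)
  have \<Theta>\<Psi>: "\<Theta> (\<Psi> u) = u" "\<Psi> u \<in> N" if "u \<in> \<Theta> ` N" for u using that \<Psi>(2) by auto
  define \<iota> where "\<iota> p = param c (\<Theta> p)" for p
  have c\<iota>: "snd c (\<iota> p) = \<Theta> p" "\<iota> p \<in> fst c" if "p \<in> N" for p
    using M.chart_param[OF \<Theta>U(2)[OF that]] M.param_in[OF \<Theta>U(2)[OF that]] by (auto simp: \<iota>_def)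
  have inj\<iota>: "inj_on \<iota> N"
  proof (rule inj_onI)
    fix p q assume "p \<in> N" "q \<in> N" "\<iota> p = \<iota> q"
    then have "\<Theta> p = \<Theta> q" using c\<iota> by metis
    then show "p = q" using \<Psi>(2) \<open>p \<in> N\<close> \<open>q \<in> N\<close> by metis
  qed
  have inj1: "inj_on \<iota> V1" and inj2: "inj_on \<iota> V2" using inj_on_subset[OF inj\<iota>] V1N V2N by auto
  interpret CP: chart_product E1 V1 \<iota> E2 V2 \<iota> using V1 V2 inj1 inj2 by unfold_locales
  define W where "W = \<iota> ` N"
  have W_img: "W = param c ` (\<Theta> ` N)" by (auto simp: W_def \<iota>_def)
  have \<Theta>N_sub: "\<Theta> ` N \<subseteq> snd c ` fst c" using \<Theta>U by blast
  have W: "openin (mtop M) W" unfolding W_img by (rule M.openin_param_image[OF c \<Theta>(3) \<Theta>N_sub])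
  have Wc: "W \<subseteq> fst c" using c\<iota> by (auto simp: W_def)
  have WM: "W \<subseteq> points M" using openin_subset[OF W] .
  have cW_img: "snd c ` (fst c \<inter> W) = \<Theta> ` N" using c\<iota> by (force simp: W_def)
  let ?MW = "open_submanifold M W"
  interpret MW: manifold ?MW by unfold_locales (rule M.smooth_open_submanifold[OF W])
  interpret PP: manifold CP.P by unfold_locales (rule CP.P_manifold)
  have MW_points: "points ?MW = W" using WM by auto
  define cW where "cW = (fst c \<inter> W, snd c)"
  have cW: "cW \<in> atlas ?MW" using c by (auto simp: M.atlas_open_submanifold cW_def)
  have cW_at: "cW \<in> charts_at ?MW q" if "q \<in> W" for q using cW that Wc by (auto simp: charts_at_def cW_def)
  have param_cW: "param cW y = param c y" if "y \<in> \<Theta> ` N" for y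
    using M.restrict_param[OF c, of y W] that cW_img by (simp add: cW_def)
  define z where "z q = \<Psi> (snd c q)" for q
  have z\<iota>: "z (\<iota> p) = p" if "p \<in> N" for p using c\<iota>[OF that] \<Psi>(2)[OF that] by (simp add: z_def)
  have zW: "z q \<in> N" "\<iota> (z q) = q" if "q \<in> W" for q using that z\<iota> by (auto simp: W_def)
  define \<Phi> where "\<Phi> q = (\<iota> (proj E1 (z q)), \<iota> (P2 (z q)))" for q
  \<comment> \<open>The coordinates of the two slice points are added; the product shape of the box
    makes every such sum a point of \<open>N\<close>.\<close>
  define \<Phi>' where "\<Phi>' w = \<iota> (inv_into V1 \<iota> (fst w) + inv_into V2 \<iota> (snd w))" for w
  have inv1: "inv_into V1 \<iota> (\<iota> x) = x" if "x \<in> V1" for x using inj1 that by simp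
  have inv2: "inv_into V2 \<iota> (\<iota> y) = y" if "y \<in> V2" for y using inj2 that by simp

  have cont_c: "continuous_map (mtop ?MW) (top_of_set (\<Theta> ` N)) (snd c)"
  proof -
    have "continuous_map (subtopology (mtop M) (fst c)) euclidean (snd c)"
      using homeomorphic_imp_continuous_map[OF M.chart_homeo[OF c]] by (simp add: continuous_map_in_subtopology)
    then have "continuous_map (subtopology (mtop M) W) euclidean (snd c)"
      by (rule continuous_map_from_subtopology_mono[OF _ Wc])
    moreover have "snd c q \<in> \<Theta> ` N" if "q \<in> W" for q using that cW_img Wc by blast
    ultimately show ?thesis by (auto simp: continuous_map_in_subtopology)
  qed
  have cont_z: "continuous_map (mtop ?MW) (top_of_set N) z"
  proof -
    have "continuous_map (top_of_set (\<Theta> ` N)) (top_of_set N) \<Psi>"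
      using C_k_on_continuous[OF \<Theta>(3) \<Psi>k] \<Theta>\<Psi>(2) by auto
    from continuous_map_compose[OF cont_c this] show ?thesis by (simp add: o_def z_def[abs_def])
  qed
  have cont_\<Phi>: "continuous_map (mtop ?MW) (mtop CP.P) \<Phi>"
  proof -
    have 1: "continuous_map (top_of_set N) (top_of_set V1) (proj E1)"
      using linear_continuous_on[OF bounded_linear_proj] parts by auto
    have 2: "continuous_map (top_of_set N) (top_of_set V2) P2"
      using linear_continuous_on[OF bP2] parts by auto
    have "continuous_map (mtop ?MW) (top_of_set V1) (\<lambda>q. proj E1 (z q))" "continuous_map (mtop ?MW) (top_of_set V2) (\<lambda>q. P2 (z q))"
      using continuous_map_compose[OF cont_z 1] continuous_map_compose[OF cont_z 2] by (simp_all add: o_def)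
    from continuous_map_into_chart[OF this(1) inj1] continuous_map_into_chart[OF this(2) inj2]
    show ?thesis unfolding CP.P_simps \<Phi>_def[abs_def] by (intro continuous_map_pairedI)
  qed
  have \<Phi>_in: "\<Phi> q \<in> \<iota> ` V1 \<times> \<iota> ` V2" if "q \<in> W" for q using parts[OF zW(1)[OF that]] by (auto simp: \<Phi>_def)
  have rep_\<Phi>: "snd CP.c12 (\<Phi> q) = (proj E1 (z q), P2 (z q))" if "q \<in> W" for q
    using parts[OF zW(1)[OF that]] inv1 inv2 by (simp add: CP.c12_def \<Phi>_def)
  have smooth_\<Phi>: "smooth_map ?MW CP.P \<Phi>"
    unfolding smooth_map_def
  proof (intro conjI ballI cont_\<Phi>)
    fix e d assume e: "e \<in> atlas ?MW" and d: "d \<in> atlas CP.P"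
    then obtain e0 where e0: "e0 \<in> atlas M" "e = (fst e0 \<inter> W, snd e0)" by (auto simp: M.atlas_open_submanifold)
    have d: "d = CP.c12" using d by simp
    have dom: "fst e \<inter> \<Phi> -` fst d = fst e0 \<inter> (fst c \<inter> W)" using e0 \<Phi>_in Wc d by (auto simp: CP.c12_def)
    have U1: "rel_open E (snd e0 ` (fst e0 \<inter> (fst c \<inter> W)))"
      by (rule M.chart_image_rel_open[OF e0(1) openin_Int[OF M.chart_open[OF c] W]])
    \<comment> \<open>\<open>\<Phi>\<close> is explicit in the chart \<open>c\<close> only, so any
      other chart is first compared with \<open>c\<close> through a transition map.\<close>
    have tr: "C_k_on k E (snd e0 ` (fst e0 \<inter> (fst c \<inter> W))) (snd c \<circ> param e0)" for k
      by (rule C_k_on_subset[OF M.transition_k[OF e0(1) c]]) auto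
    have tr_img: "(snd c \<circ> param e0) ` (snd e0 ` (fst e0 \<inter> (fst c \<inter> W))) \<subseteq> \<Theta> ` N"
      using cW_img by (auto simp: M.param_chart[OF e0(1)])
    have k\<Psi>: "C_k_on k E (snd e0 ` (fst e0 \<inter> (fst c \<inter> W))) (\<lambda>y. \<Psi> ((snd c \<circ> param e0) y))" for k
      by (rule C_k_on_compose[OF U1 \<Theta>(3) tr_img tr \<Psi>k])
    show "smooth_on (model ?MW) (snd e ` (fst e \<inter> \<Phi> -` fst d)) (snd d \<circ> \<Phi> \<circ> param e)"
      unfolding smooth_on_def dom M.open_submanifold_simps
    proof
      fix k
      have "C_k_on k E (snd e0 ` (fst e0 \<inter> (fst c \<inter> W))) (\<lambda>y. (proj E1 (\<Psi> ((snd c \<circ> param e0) y)), P2 (\<Psi> ((snd c \<circ> param e0) y))))"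
        by (intro C_k_on_Pair U1 C_k_on_bounded_linear_comp[OF U1 bounded_linear_proj] C_k_on_bounded_linear_comp[OF U1 bP2] k\<Psi>)
      then have "C_k_on k E (snd e0 ` (fst e0 \<inter> (fst c \<inter> W))) (snd d \<circ> \<Phi> \<circ> param e)"
      proof (rule C_k_on_cong[OF U1, rotated])
        fix y assume "y \<in> snd e0 ` (fst e0 \<inter> (fst c \<inter> W))"
        then obtain q where q: "q \<in> fst e0" "q \<in> W" "y = snd e0 q" by blast
        then have "param e y = q" using M.restrict_param[OF e0(1), of y W] M.param_chart[OF e0(1)] e0(2) by auto
        then show "(proj E1 (\<Psi> ((snd c \<circ> param e0) y)), P2 (\<Psi> ((snd c \<circ> param e0) y))) = (snd d \<circ> \<Phi> \<circ> param e) y"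
          using rep_\<Phi>[OF q(2)] q M.param_chart[OF e0(1) q(1)] d by (simp add: z_def)
      qed
      then show "C_k_on k E (snd e ` (fst e0 \<inter> (fst c \<inter> W))) (snd d \<circ> \<Phi> \<circ> param e)" using e0(2) by simp
    qed
  qed
  have plus_k: "C_k_on k (E1 \<times> E2) (V1 \<times> V2) (\<lambda>w. fst w + snd w)" for k
    by (intro C_k_on_add CP.V12 C_k_on_bounded_linear bounded_linear_fst bounded_linear_snd)
  have plus_img: "(\<lambda>w. fst w + snd w) ` (V1 \<times> V2) \<subseteq> N" using sum_N by auto
  have \<Phi>'_in: "\<Phi>' w \<in> W" if "w \<in> \<iota> ` V1 \<times> \<iota> ` V2" for w
    using that sum_N(1) inv1 inv2 by (auto simp: \<Phi>'_def W_def)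
  have cont_\<Phi>': "continuous_map (mtop CP.P) (mtop ?MW) \<Phi>'"
  proof -
    have 1: "continuous_map (mtop CP.P) (top_of_set (V1 \<times> V2)) (map_prod (inv_into V1 \<iota>) (inv_into V2 \<iota>))"
      using CP.P_homeo by (simp add: homeomorphic_maps_def)
    have 2: "continuous_map (top_of_set (V1 \<times> V2)) (top_of_set N) (\<lambda>w. fst w + snd w)"
      using C_k_on_continuous[OF CP.V12 plus_k] plus_img by auto
    have 3: "continuous_map (top_of_set N) (top_of_set (snd c ` fst c)) \<Theta>"
      using C_k_on_continuous[OF N \<Theta>k] \<Theta>U(2) by auto
    have "continuous_map (mtop CP.P) (mtop M) (param c \<circ> (\<Theta> \<circ> ((\<lambda>w. fst w + snd w) \<circ> map_prod (inv_into V1 \<iota>) (inv_into V2 \<iota>))))"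
      by (intro continuous_map_compose[OF _ M.param_continuous[OF c]] continuous_map_compose[OF _ 3] continuous_map_compose[OF 1 2])
    moreover have "param c \<circ> (\<Theta> \<circ> ((\<lambda>w. fst w + snd w) \<circ> map_prod (inv_into V1 \<iota>) (inv_into V2 \<iota>))) = \<Phi>'"
      by (auto simp: \<Phi>'_def \<iota>_def fun_eq_iff)
    ultimately have "continuous_map (mtop CP.P) (mtop M) \<Phi>'" by simp
    moreover have "\<Phi>' ` topspace (mtop CP.P) \<subseteq> W" using \<Phi>'_in CP.P_simps(3) by blast
    ultimately show ?thesis by (auto simp: continuous_map_in_subtopology image_subset_iff)
  qed
  have smooth_\<Phi>': "smooth_map CP.P ?MW \<Phi>'"
    unfolding smooth_map_def
  proof (intro conjI ballI cont_\<Phi>')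
    fix d e assume d: "d \<in> atlas CP.P" and e: "e \<in> atlas ?MW"
    then obtain e0 where e0: "e0 \<in> atlas M" "e = (fst e0 \<inter> W, snd e0)" by (auto simp: M.atlas_open_submanifold)
    have d: "d = CP.c12" using d by simp
    let ?A = "snd c ` (fst c \<inter> fst e0)"
    \<comment> \<open>The coordinate domain of the inverse map in the charts \<open>d\<close> and
      \<open>e\<close>; it is open as a preimage of the overlap of \<open>c\<close> and
      \<open>e0\<close>.\<close>
    let ?D = "{w \<in> V1 \<times> V2. \<Theta> (fst w + snd w) \<in> ?A}"
    have dom: "snd d ` (fst d \<inter> \<Phi>' -` fst e) = ?D"
    proof -
      have pt: "\<Phi>' (\<iota> x, \<iota> y) = param c (\<Theta> (x + y))" if "x \<in> V1" "y \<in> V2" for x y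
        using that inv1 inv2 by (simp add: \<Phi>'_def \<iota>_def)
      have iff: "\<Phi>' (\<iota> x, \<iota> y) \<in> fst e \<longleftrightarrow> \<Theta> (x + y) \<in> ?A" if "x \<in> V1" "y \<in> V2" for x y
        using \<Phi>'_in[of "(\<iota> x, \<iota> y)"] that M.coord_in_iff[OF c, of "\<Theta> (x + y)" "fst e0"] pt[OF that] \<Theta>U(2)[OF sum_N(1)[OF that]] e0(2) by auto
      show ?thesis
      proof (intro equalityI subsetI)
        fix w assume "w \<in> snd d ` (fst d \<inter> \<Phi>' -` fst e)"
        then obtain x y where xy: "x \<in> V1" "y \<in> V2" "w = snd d (\<iota> x, \<iota> y)" "\<Phi>' (\<iota> x, \<iota> y) \<in> fst e"
          by (auto simp: d CP.c12_def)
        have "w = (x, y)" using xy inv1 inv2 by (simp add: d CP.c12_def)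
        then show "w \<in> ?D" using xy iff[OF xy(1,2)] by simp
      next
        fix w assume w: "w \<in> ?D"
        then obtain x y where xy: "x \<in> V1" "y \<in> V2" "w = (x, y)" by auto
        have "snd d (\<iota> x, \<iota> y) = w" "(\<iota> x, \<iota> y) \<in> fst d" using xy inv1 inv2 by (auto simp: d CP.c12_def)
        moreover have "\<Phi>' (\<iota> x, \<iota> y) \<in> fst e" using iff[OF xy(1,2)] w xy(3) by simp
        ultimately show "w \<in> snd d ` (fst d \<inter> \<Phi>' -` fst e)" by (metis IntI image_eqI vimageI)
      qed
    qed
    have A: "rel_open E ?A" using M.overlap_open[OF c e0(1)] .
    have \<Theta>plus: "C_k_on k (E1 \<times> E2) (V1 \<times> V2) (\<lambda>w. \<Theta> (fst w + snd w))" for k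
      by (rule C_k_on_compose[OF CP.V12 N plus_img plus_k \<Theta>k])
    have D_open: "rel_open (E1 \<times> E2) ?D"
      by (rule rel_open_vimage[OF CP.V12 A C_k_on_continuous[OF CP.V12 \<Theta>plus]])
        (use sum_N(1) \<Theta>U(1) rel_open_subset[OF U_open] in auto)
    show "smooth_on (model CP.P) (snd d ` (fst d \<inter> \<Phi>' -` fst e)) (snd e \<circ> \<Phi>' \<circ> param d)"
      unfolding smooth_on_def dom CP.P_simps
    proof
      fix k
      have "C_k_on k (E1 \<times> E2) ?D (\<lambda>w. (snd e0 \<circ> param c) (\<Theta> (fst w + snd w)))"
        by (rule C_k_on_compose[OF D_open A _ C_k_on_subset[OF \<Theta>plus] M.transition_k[OF c e0(1)]]) auto
      then show "C_k_on k (E1 \<times> E2) ?D (snd e \<circ> \<Phi>' \<circ> param d)"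
      proof (rule C_k_on_cong[OF D_open, rotated])
        fix w assume "w \<in> ?D"
        then obtain x y where xy: "x \<in> V1" "y \<in> V2" "w = (x, y)" by auto
        then show "(snd e0 \<circ> param c) (\<Theta> (fst w + snd w)) = (snd e \<circ> \<Phi>' \<circ> param d) w"
          using CP.param_c12[OF xy(1,2)] inv1 inv2 e0(2) by (simp add: d \<Phi>'_def \<iota>_def)
      qed
    qed
  qed
  have diffeo: "diffeomorphism ?MW CP.P \<Phi>"
    unfolding diffeomorphism_def
  proof (intro conjI exI[of _ \<Phi>'] ballI smooth_\<Phi> smooth_\<Phi>')
    show "\<Phi>' (\<Phi> q) = q" if "q \<in> points ?MW" for q
    proof -
      have q: "q \<in> W" using that MW_points by simp
      show ?thesis using parts[OF zW(1)[OF q]] inv1 inv2 zW(2)[OF q] by (simp add: \<Phi>_def \<Phi>'_def)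
    qed
    show "\<Phi> (\<Phi>' w) = w" if "w \<in> points CP.P" for w
    proof -
      have "w \<in> \<iota> ` V1 \<times> \<iota> ` V2" using that by simp
      then obtain x y where xy: "x \<in> V1" "y \<in> V2" "w = (\<iota> x, \<iota> y)" by auto
      then show ?thesis using inv1 inv2 z\<iota>[OF sum_N(1)[OF xy(1,2)]] sum_N(2,3)[OF xy(1,2)] by (simp add: \<Phi>_def \<Phi>'_def)
    qed
  qed

  \<comment> \<open>Dividing by the central value of \<open>r\<^sup>2\<close> allows the warping
    function to be \<open>r\<close> itself on the base slice.\<close>
  define k where "k y v w = h y v w / (r (\<iota> 0))\<^sup>2" for y v w
  have r0: "(r (\<iota> 0))\<^sup>2 > 0" using r(2)[OF patch_charts(4)[OF \<Theta>U(1)[OF 0]]] by (simp add: \<iota>_def)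
  have met1: "metric_on E1 V1 h" by (rule metric_on_subspace[OF h N V1 E1(2) V1N])
  have met2: "metric_on E2 V2 k" unfolding k_def
    by (rule metric_on_divide[OF metric_on_subspace[OF h N V2 _ V2N] V2 r0]) (auto simp: E2_def)
  let ?g1 = "chart_metric h V1 \<iota>" and ?g2 = "chart_metric k V2 \<iota>"
  have R1: "riemannian_manifold CP.M1 ?g1" by (rule riemannian_chart_manifold[OF V1 inj1 met1])
  have R2: "riemannian_manifold CP.M2 ?g2" by (rule riemannian_chart_manifold[OF V2 inj2 met2])
  have r\<iota>: "C_k_on k E N (\<lambda>p. r (\<iota> p))" for k
    using C_k_on_compose[OF N M.chart_rel_open[OF c] \<Theta>N_sub \<Theta>k M.smooth_fun_k[OF r(1) c]] by (simp add: \<iota>_def)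
  have sm_r: "smooth_fun CP.M1 r"
  proof (rule smooth_fun_chart_manifold[OF V1 inj1])
    show "C_k_on k E1 V1 (\<lambda>x. r (\<iota> x))" for k
      by (rule C_k_on_compose[OF V1 N _ C_k_on_id[OF V1] r\<iota>]) (use V1N in auto)
  qed
  have r_pos: "r q > 0" if "q \<in> points CP.M1" for q
    using that V1N WM r(2) by (auto simp: W_def)

  interpret Ph: manifold_map ?MW CP.P \<Phi> by unfold_locales (rule smooth_\<Phi>)
  interpret Inc: manifold_map ?MW M "\<lambda>p. p" by unfold_locales (rule M.smooth_inclusion[OF W])
  have metric: "restrict_metric M g W q v w = pullback_metric ?MW CP.P \<Phi> (warped_metric CP.M1 ?g1 CP.M2 ?g2 r) q v w"
    if q: "q \<in> W" and v: "v \<in> tangent_space ?MW q" and w: "w \<in> tangent_space ?MW q" for q v w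
  proof -
    let ?p = "z q"
    note p = zW[OF q]
    have sq: "snd c q = \<Theta> ?p" "snd cW q = \<Theta> ?p" using c\<iota>[OF p(1)] p(2) by (auto simp: cW_def)
    have u: "\<Theta> ?p \<in> \<Theta> ` N" using p by blast
    have c_at: "c \<in> charts_at M q" using c q Wc by (auto simp: charts_at_def)
    have qM: "q \<in> points M" using q WM by auto
    have c12_at: "CP.c12 \<in> charts_at CP.P (\<Phi> q)" using \<Phi>_in[OF q] by simp
    have vE: "v cW \<in> E" if "v \<in> tangent_space ?MW q" for v using MW.tangent_in[OF cW_at[OF q] that] by simp
    \<comment> \<open>In the chart \<open>c\<close> the inclusion is the identity, so the restricted
      metric has the same components as \<open>g\<close>.\<close>
    have inc_c: "differential ?MW M (\<lambda>p. p) q v c = v cW" "differential ?MW M (\<lambda>p. p) q v \<in> tangent_space M q"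
      if v: "v \<in> tangent_space ?MW q" for v
    proof -
      show "differential ?MW M (\<lambda>p. p) q v \<in> tangent_space M q"
        using Inc.differential_in[OF _ v] q qM by simp
      have "differential ?MW M (\<lambda>p. p) q v c = deriv_in E (snd c \<circ> (\<lambda>p. p) \<circ> param cW) (\<Theta> ?p) (v cW)"
        using Inc.differential_chart[OF cW_at[OF q] c_at v] sq by simp
      also have "\<dots> = v cW"
      proof (rule deriv_in_eq[OF E _ _ vE[OF v]])
        show "\<Theta> ?p \<in> E" using u rel_open_subset[OF \<Theta>(3)] by blast
        show "((snd c \<circ> (\<lambda>p. p) \<circ> param cW) has_derivative (\<lambda>v. v)) (at (\<Theta> ?p) within E)"
        proof (rule has_derivative_cong_rel[OF \<Theta>(3) u _ has_derivative_ident])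
          show "y = (snd c \<circ> (\<lambda>p. p) \<circ> param cW) y" if "y \<in> \<Theta> ` N" for y
            using param_cW[OF that] M.chart_param[of y c] \<Theta>N_sub that by auto
        qed
      qed
      finally show "differential ?MW M (\<lambda>p. p) q v c = v cW" .
    qed
    \<comment> \<open>The components of \<open>v\<close> in straightened coordinates. Everything is
      compared through them: \<open>\<Theta>\<close> sends them to the components in
      \<open>c\<close>, and \<open>\<Phi>\<close> splits them into their two projections.\<close>
    define Z where "Z v = deriv_in E \<Psi> (\<Theta> ?p) (v cW)" for v :: "('a, 'e) tvec"
    have \<Psi>N: "\<Psi> ` \<Theta> ` N \<subseteq> N" using \<Theta>\<Psi>(2) by blast
    have d\<Psi>: "(\<Psi> has_derivative deriv_in E \<Psi> (\<Theta> ?p)) (at (\<Theta> ?p) within E)" using C_k_on_SucD(1)[OF \<Psi>k u] .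
    have ZE: "Z v \<in> E" if "v \<in> tangent_space ?MW q" for v unfolding Z_def
      by (rule has_derivative_in_subspace[OF \<Theta>(3) u _ E d\<Psi> vE[OF that]]) (use \<Psi>N N_E in blast)
    have D\<Theta>Z: "deriv_in E \<Theta> ?p (Z v) = v cW" if v: "v \<in> tangent_space ?MW q" for v
    proof -
      have zz: "\<Psi> (\<Theta> ?p) = ?p" using \<Psi>(2)[OF p(1)] .
      have "deriv_in E (\<lambda>y. \<Theta> (\<Psi> y)) (\<Theta> ?p) (v cW) = deriv_in E \<Theta> (\<Psi> (\<Theta> ?p)) (deriv_in E \<Psi> (\<Theta> ?p) (v cW))"
        by (rule deriv_in_chain[OF \<Theta>(3) N \<Psi>N u differentiableI[OF d\<Psi>] _ vE[OF v]])
          (use C_k_on_SucD(1)[OF \<Theta>k p(1)] zz differentiableI in force)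
      moreover have "deriv_in E (\<lambda>y. \<Theta> (\<Psi> y)) (\<Theta> ?p) (v cW) = v cW"
      proof (rule deriv_in_eq[OF E _ _ vE[OF v]])
        show "\<Theta> ?p \<in> E" using u rel_open_subset[OF \<Theta>(3)] by blast
        show "((\<lambda>y. \<Theta> (\<Psi> y)) has_derivative (\<lambda>v. v)) (at (\<Theta> ?p) within E)"
          by (rule has_derivative_cong_rel[OF \<Theta>(3) u _ has_derivative_ident]) (use \<Theta>\<Psi>(1) in simp)
      qed
      ultimately show ?thesis using zz by (simp add: Z_def)
    qed
    have D\<Phi>: "differential ?MW CP.P \<Phi> q v CP.c12 = (proj E1 (Z v), P2 (Z v))" if v: "v \<in> tangent_space ?MW q" for v
    proof -
      have "differential ?MW CP.P \<Phi> q v CP.c12 = deriv_in E (snd CP.c12 \<circ> \<Phi> \<circ> param cW) (\<Theta> ?p) (v cW)"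
        using Ph.differential_chart[OF cW_at[OF q] c12_at v] sq by simp
      also have "\<dots> = (proj E1 (Z v), P2 (Z v))" unfolding Z_def
      proof (rule deriv_in_eq[OF E _ _ vE[OF v]])
        show "\<Theta> ?p \<in> E" using u rel_open_subset[OF \<Theta>(3)] by blast
        have "((\<lambda>y. (proj E1 (\<Psi> y), P2 (\<Psi> y))) has_derivative
          (\<lambda>v. (proj E1 (deriv_in E \<Psi> (\<Theta> ?p) v), P2 (deriv_in E \<Psi> (\<Theta> ?p) v)))) (at (\<Theta> ?p) within E)"
          by (intro has_derivative_Pair bounded_linear.has_derivative[OF bounded_linear_proj] bounded_linear.has_derivative[OF bP2] d\<Psi>)
        then show "((snd CP.c12 \<circ> \<Phi> \<circ> param cW) has_derivative
          (\<lambda>v. (proj E1 (deriv_in E \<Psi> (\<Theta> ?p) v), P2 (deriv_in E \<Psi> (\<Theta> ?p) v)))) (at (\<Theta> ?p) within E)"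
        proof (rule has_derivative_cong_rel[OF \<Theta>(3) u, rotated])
          fix y assume y: "y \<in> \<Theta> ` N"
          have pW: "param c y \<in> W" using y W_img by blast
          have "snd c (param c y) = y" using M.chart_param[of y c] \<Theta>N_sub y by blast
          then show "(proj E1 (\<Psi> y), P2 (\<Psi> y)) = (snd CP.c12 \<circ> \<Phi> \<circ> param cW) y"
            using rep_\<Phi>[OF pW] param_cW[OF y] by (simp add: z_def)
        qed
      qed
      finally show ?thesis .
    qed
    have inE12: "differential ?MW CP.P \<Phi> q v CP.c12 \<in> E1 \<times> E2" if v: "v \<in> tangent_space ?MW q" for v
      using D\<Phi>[OF v] proj_E P2_E[OF ZE[OF v]] by simp
    have \<Phi>P: "\<Phi> q \<in> points CP.P" using \<Phi>_in[OF q] by simp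
    have f1: "differential CP.P CP.M1 fst (\<Phi> q) (differential ?MW CP.P \<Phi> q v) CP.c1 = proj E1 (Z v)" if v: "v \<in> tangent_space ?MW q" for v
      using CP.differential_fst[where w="differential ?MW CP.P \<Phi> q v", OF \<Phi>P inE12[OF v]] D\<Phi>[OF v] by simp
    have f2: "differential CP.P CP.M2 snd (\<Phi> q) (differential ?MW CP.P \<Phi> q v) CP.c2 = P2 (Z v)" if v: "v \<in> tangent_space ?MW q" for v
      using CP.differential_snd[where w="differential ?MW CP.P \<Phi> q v", OF \<Phi>P inE12[OF v]] D\<Phi>[OF v] by simp
    have fs: "fst (\<Phi> q) = \<iota> (proj E1 ?p)" "snd (\<Phi> q) = \<iota> (P2 ?p)" by (auto simp: \<Phi>_def)
    have "restrict_metric M g W q v w = g q (differential ?MW M (\<lambda>p. p) q v) (differential ?MW M (\<lambda>p. p) q w)"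
      by (simp add: restrict_metric_def pullback_metric_def)
    also have "\<dots> = G (\<Theta> ?p) (v cW) (w cW)"
      using M.g_coord[OF c_at inc_c(2)[OF v] inc_c(2)[OF w]] inc_c(1)[OF v] inc_c(1)[OF w] sq by (simp add: G_def)
    also have "\<dots> = h ?p (Z v) (Z w)"
      using h_eq[OF p(1) ZE[OF v] ZE[OF w]] D\<Theta>Z[OF v] D\<Theta>Z[OF w] by simp
    also have "\<dots> = h (proj E1 ?p) (proj E1 (Z v)) (proj E1 (Z w)) + (r (\<iota> (proj E1 ?p)))\<^sup>2 * k (P2 ?p) (P2 (Z v)) (P2 (Z w))"
      using warped[OF p(1) ZE[OF v] ZE[OF w]] by (simp add: k_def P2_def \<iota>_def)
    also have "\<dots> = pullback_metric ?MW CP.P \<Phi> (warped_metric CP.M1 ?g1 CP.M2 ?g2 r) q v w"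
      using parts[OF p(1)] inv1 inv2
      by (simp add: pullback_metric_def warped_metric_def chart_metric_def f1[OF v] f1[OF w] f2[OF v] f2[OF w] fs)
    finally show ?thesis .
  qed
  have "is_warped_product ?MW (restrict_metric M g W) (dim (model B)) (dim E - dim (model B))"
    unfolding is_warped_product_def
  proof (intro exI conjI)
    show "riemannian_manifold CP.M1 ?g1" "riemannian_manifold CP.M2 ?g2" using R1 R2 by auto
    show "manifold_dim CP.M1 = dim (model B)" using dims by (simp add: manifold_dim_def)
    show "manifold_dim CP.M2 = dim E - dim (model B)" using dims by (simp add: manifold_dim_def E2_def)
    show "smooth_fun CP.M1 r" by (rule sm_r)
    show "\<forall>q\<in>points CP.M1. r q > 0" using r_pos by blast
    show "diffeomorphism ?MW CP.P \<Phi>" by (rule diffeo)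
    show "\<forall>p\<in>points ?MW. \<forall>v\<in>tangent_space ?MW p. \<forall>w\<in>tangent_space ?MW p.
       restrict_metric M g W p v w = pullback_metric ?MW CP.P \<Phi> (warped_metric CP.M1 ?g1 CP.M2 ?g2 r) p v w"
      using metric MW_points by blast
  qed
  moreover have "param c x0 \<in> W" using x0N W_img by blast
  ultimately show ?thesis using W by blast
qed

end

section \<open>From coordinate patches to the manifold\<close>

theorem proposition21:
  fixes M :: "('a, 'e::euclidean_space) manifold" and g :: "('a, 'e) metric_field"
    and B :: "('b, 'f::euclidean_space) manifold" and g' :: "('b, 'f) metric_field"
    and F :: "'a \<Rightarrow> 'b" and lam r f :: "'a \<Rightarrow> real" and m n :: nat
  assumes "riemannian_manifold M g" and "manifold_dim M = m"
    and "riemannian_manifold B g'" and "manifold_dim B = n"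
    and "clairaut_conformal_submersion M g B g' F lam r"
    and "\<forall>p\<in>points M. f p = ln (r p)"
    and "integrable_distribution M (horizontal_space M g B F)"
  shows "\<forall>p\<in>points M. \<exists>W. openin (mtop M) W \<and> p \<in> W \<and>
           is_warped_product (open_submanifold M W) (restrict_metric M g W) n (m - n)"
proof
  fix p assume p: "p \<in> points M"
  have M: "smooth_manifold M" and B: "smooth_manifold B" using assms(1,3) by (auto simp: riemannian_manifold_def)
  have sub: "submersion M B F" and r: "smooth_fun M r" "\<And>p. p \<in> points M \<Longrightarrow> r p > 0"
    and clairaut: "\<And>I \<alpha>. geodesic M g I \<alpha> \<Longrightarrow> (\<And>t. t \<in> I \<Longrightarrow> velocity M \<alpha> t \<noteq> (\<lambda>_. 0)) \<Longrightarrow>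
        \<exists>C. \<forall>t\<in>I. r (\<alpha> t) * sin (horizontal_angle M g B F (\<alpha> t) (velocity M \<alpha> t)) = C"
    using assms(5) by (auto simp: clairaut_conformal_submersion_def conformal_submersion_def)
  have "F p \<in> points B" using sub p by (auto simp: submersion_def smooth_map_def continuous_map_def)
  then obtain d where "d \<in> charts_at B (F p)" using manifold.chart_exists[of B "F p"] B unfolding manifold_def by blast
  then have dB: "d \<in> atlas B" "F p \<in> fst d" by (auto simp: charts_at_def)
  obtain c where "c \<in> charts_at M p" using manifold.chart_exists[of M p] M p unfolding manifold_def by blast
  then have cM: "c \<in> atlas M" "p \<in> fst c" by (auto simp: charts_at_def)
  interpret submersion_patch M g B F c d
    using assms(1) B sub cM dB by unfold_locales auto
  have x0: "snd c p \<in> U" using cM dB by (auto simp: U_def)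
  from warped_neighbourhood[OF x0 r clairaut assms(7)]
  show "\<exists>W. openin (mtop M) W \<and> p \<in> W \<and> is_warped_product (open_submanifold M W) (restrict_metric M g W) n (m - n)"
    using M.param_chart[OF cM] assms(2,4) by (simp add: manifold_dim_def)
qed

end
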